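(* Suppose that $\mathcal A$ is local. (1) For all $\lambda\in X$ there exists an up to isomorphism unique object $S_{\max}(\lambda)$ in $\mathcal X$ with the following properties: (a) $S_{\max}(\lambda)_\lambda$ is free of rank $1$, and $S_{\max}(\lambda)_\mu\neq\{0\}$ implies $\mu\le\lambda$; (b) $S_{\max}(\lambda)$ is indecomposable and maximal. Moreover, the objects $S_{\max}(\lambda)$ characterized in (1) have the following properties. (2) The endomorphism ring $\operatorname{End}_{\mathcal X}(S_{\max}(\lambda))$ is local for all $\lambda\in X$. (3) Let $S$ be a maximal object in $\mathcal X$. Then there is an index set $J$ and elements $\lambda_i\in X$ for $i\in J$ such that $S\cong\bigoplus_{i\in J}S_{\max}(\lambda_i)$.
   Context: Ground data. $\mathcal Z:=\mathbb Z[v,v^{-1}]$; for $n\in\mathbb Z$, $d>0$: $[n]_d:=\frac{v^{dn}-v^{-dn}}{v^d-v^{-d}}\in\mathcal Z$, $\left[{n\atop 0}\right]_d:=1$, $\left[{n\atop r}\right]_d:=\frac{[n]_d[n-1]_d\cdots[n-r+1]_d}{[1]_d\cdots[r]_d}\in\mathcal Z$ for $r\ge1$. $\mathcal A$ is a (commutative) unital $\mathcal Z$-algebra that is a Noetherian domain. $R$ is a finite (reduced, crystallographic) root system in a real vector space $V$ with simple roots $\Pi$, coroots $\alpha^\vee$, weight lattice $X=\{\lambda\in V\mid\langle\lambda,\alpha^\vee\rangle\in\mathbb Z\ \forall\alpha\in R\}$; $\mu\le\lambda$ iff $\lambda-\mu$ is a sum of elements of $\Pi$. $(d_\alpha)_{\alpha\in\Pi}$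 has entries in $\{1,2,3\}$, $(d_\alpha\langle\beta,\alpha^\vee\rangle)_{\alpha,\beta\in\Pi}$ is symmetric, and each irreducible component of $R$ contains a simple root $\alpha$ with $d_\alpha=1$. A subset $S\subset X$ is quasi-bounded if for every $\mu\in X$ the set $\{\lambda\in S\mid\mu\le\lambda\}$ is finite. The category $\mathcal X=\mathcal X_{\mathcal A}$. Objects are $X$-graded $\mathcal A$-modules $M=\bigoplus_{\mu\in X}M_\mu$ with $\mathcal A$-linear maps $E_{\mu,\alpha,n}\colon M_\mu\to M_{\mu+n\alpha}$, $F_{\mu,\alpha,n}\colon M_{\mu+n\alpha}\to M_\mu$ ($\mu\in X,\alpha\in\Pi,n>0$; the index $\mu$ is often dropped; $E_{\alpha,0}=F_{\alpha,0}=\mathrm{id}$) satisfying (a weight of $M$ is a $\mu$ with $M_\mu\ne0$): (X1) The set of weights is quasi-bounded and each $M_\mu$ is a finitely generated $\mathcal A$-module. (X2) For $\mu\in X$, $\alpha,\beta\in\Pi$, $m,n>0$, $x\in M_{\mu+n\beta}$: $E_{\alpha,m}F_{\beta,n}(x)=F_{\beta,n}E_{\alpha,m}(x)$ if $\alpha\neq\beta$, and $E_{\alpha,m}F_{\alpha,n}(x)=\sum_{r=0}^{\min(m,n)}\left[{\langle\mu,\alpha^\vee\rangle+m+n\atop r}\right]_{d_\alpha}F_{\alpha,n-r}E_{\alpha,m-r}(x)$ if $\alpha=\beta$. (X3) With $M_{\delta\mu}:=\bigoplus_{\alpha\in\Pi,n>0}M_{\mu+n\alpha}$, $E_\mu\colon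 M_\mu\to M_{\delta\mu}$ the column vector with entries $E_{\mu,\alpha,n}$, $F_\mu\colon M_{\delta\mu}\to M_\mu$ the row vector with entries $F_{\mu,\alpha,n}$, $M_{\{\mu\}}:=E_\mu(\operatorname{im}F_\mu)$, $M_{\langle\mu\rangle}:=E_\mu(M_\mu)$, for all $\mu$: (a) $E_\mu|_{\operatorname{im}F_\mu}$ is injective; (b) $M_{\langle\mu\rangle}/M_{\{\mu\}}$ is a torsion $\mathcal A$-module; (c) $M_\mu/\operatorname{im}F_\mu$ is a free $\mathcal A$-module. Morphisms are degree-preserving $\mathcal A$-linear maps commuting with all $E$- and $F$-maps. Put $M_{\{\mu\},\max}:=\{m\in M_{\delta\mu}\mid\xi m\in M_{\{\mu\}}\text{ for some }0\ne\xi\in\mathcal A\}$. An object $M$ is maximal if $M_{\langle\mu\rangle}=M_{\{\mu\},\max}$ for all $\mu\in X$. *)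

theory Defs
  imports Complex_Main "HOL-Library.Poly_Mapping" "HOL-Algebra.Algebra" "HOL-Algebra.Algebraic_Closure_Type"
begin

section \<open>Quantum integers and quantum binomials\<close>

text \<open>Laurent polynomials are finitely supported functions from exponents to integer
  coefficients, with the convolution product.\<close>

type_synonym laurent = "int \<Rightarrow>\<^sub>0 int"

definition vpow :: "int \<Rightarrow> laurent" where
  "vpow k = Poly_Mapping.single k 1"

text \<open>The two fractions are taken in the domain of Laurent polynomials itself; that the
  divisions are exact is the content of \<open>qint_eq\<close> and \<open>qbinom_eq\<close> below.\<close>

definition qint :: "nat \<Rightarrow> int \<Rightarrow> laurent" where
  "qint d n = (THE c. c * (vpow (int d) - vpow (- int d)) = vpow (int d * n) - vpow (- (int d * n)))"

definition qbinom :: "nat \<Rightarrow> int \<Rightarrow> nat \<Rightarrow> laurent" where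
  "qbinom d n r = (THE c. c * (\<Prod>i<r. qint d (int i + 1)) = (\<Prod>i<r. qint d (n - int i)))"

lemma vpow_mult: "vpow a * vpow b = vpow (a + b)"
  by (simp add: vpow_def mult_single)

lemma vpow_0 [simp]: "vpow 0 = 1"
  by (simp add: vpow_def)

lemma vpow_inject [simp]: "vpow a = vpow b \<longleftrightarrow> a = b"
  by (metis vpow_def lookup_single_eq lookup_single_not_eq zero_neq_one)

lemma exact_quotient:
  fixes a b :: laurent
  assumes "b \<noteq> 0" "b dvd a"
  shows "(THE c. c * b = a) * b = a"
proof -
  have "\<exists>!c. c * b = a"
    using assms by (auto simp: dvd_def mult.commute)
  then show ?thesis by (rule theI')
qed

lemma vdiff_ne_0: "k \<noteq> 0 \<Longrightarrow> vpow k - vpow (- k) \<noteq> 0"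
  by simp

lemma qint_dvd_nat: "vpow d - vpow (- d) dvd vpow (d * int n) - vpow (- (d * int n))"
proof (induction n)
  case (Suc n)
  have "vpow (d * int (Suc n)) - vpow (- (d * int (Suc n)))
      = vpow d * (vpow (d * int n) - vpow (- (d * int n)))
        + vpow (- (d * int n)) * (vpow d - vpow (- d))"
    by (simp add: algebra_simps vpow_mult)
  then show ?case using Suc by simp
qed simp

lemma qint_dvd: "vpow d - vpow (- d) dvd vpow (d * n) - vpow (- (d * n))"
proof (cases "n \<ge> 0")
  case True
  then show ?thesis using qint_dvd_nat[of d "nat n"] by simp
next
  case False
  then have "vpow d - vpow (- d) dvd vpow (- (d * n)) - vpow (d * n)"
    using qint_dvd_nat[of d "nat (- n)"] by simp
  then show ?thesis by (metis dvd_minus_iff minus_diff_eq)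
qed

lemma qint_eq:
  assumes "d > 0"
  shows "qint d n * (vpow (int d) - vpow (- int d)) = vpow (int d * n) - vpow (- (int d * n))"
  unfolding qint_def by (rule exact_quotient) (use assms qint_dvd in auto)

lemma qint_ne_0: "d > 0 \<Longrightarrow> n \<noteq> 0 \<Longrightarrow> qint d n \<noteq> 0"
  using qint_eq[of d n] vdiff_ne_0[of "int d * n"] by auto

lemma qint_0: "d > 0 \<Longrightarrow> qint d 0 = 0"
  using qint_eq[of d 0] vdiff_ne_0[of "int d"] by auto

lemma qint_rec:
  assumes d: "d > 0"
  shows "qint d (n + 1) = vpow (- (int d * (n - r))) * qint d (r + 1) + vpow (int d * (r + 1)) * qint d (n - r)"
proof -
  let ?b = "vpow (int d) - vpow (- int d)"
  have b: "?b \<noteq> 0" using d by simp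
  have "(vpow (- (int d * (n - r))) * qint d (r + 1) + vpow (int d * (r + 1)) * qint d (n - r)) * ?b
     = vpow (- (int d * (n - r))) * (qint d (r + 1) * ?b) + vpow (int d * (r + 1)) * (qint d (n - r) * ?b)"
    by (simp only: distrib_right mult.assoc)
  also have "\<dots> = qint d (n + 1) * ?b"
    unfolding qint_eq[OF d] by (simp add: right_diff_distrib vpow_mult) (simp add: algebra_simps)
  finally show ?thesis using b by simp
qed

lemma qbinom_dvd:
  assumes d: "d > 0"
  shows "(\<Prod>i<r. qint d (int i + 1)) dvd (\<Prod>i<r. qint d (n - int i))"
proof (induction r arbitrary: n)
  case (Suc r)
  let ?den = "\<lambda>r. \<Prod>i<r. qint d (int i + 1)" and ?num = "\<lambda>n r. \<Prod>i<r. qint d (n - int i)"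
  have step: "?num (n + 1) (Suc r) = vpow (- (int d * (n - int r))) * (?num n r * qint d (int r + 1))
      + vpow (int d * (int r + 1)) * ?num n (Suc r)" for n
  proof -
    have "?num (n + 1) (Suc r) = qint d (n + 1) * ?num n r"
      by (subst prod.lessThan_Suc_shift) (simp add: algebra_simps)
    then show ?thesis
      by (subst (asm) qint_rec[OF d, of n "int r"]) (simp add: algebra_simps)
  qed
  have first: "?den (Suc r) dvd ?num n r * qint d (int r + 1)" for n
    using Suc.IH[of n] by (simp add: mult_dvd_mono)
  have up: "?den (Suc r) dvd ?num (n + 1) (Suc r) \<longleftrightarrow> ?den (Suc r) dvd ?num n (Suc r)" for n
  proof -
    let ?u = "vpow (int d * (int r + 1))"
    have "?den (Suc r) dvd ?num (n + 1) (Suc r) \<longleftrightarrow> ?den (Suc r) dvd ?u * ?num n (Suc r)"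
      unfolding step using first[of n] by (meson dvd_add_right_iff dvd_mult)
    also have "\<dots> \<longleftrightarrow> ?den (Suc r) dvd ?num n (Suc r)"
    proof
      have "vpow (- (int d * (int r + 1))) * ?u = 1" by (simp add: vpow_mult)
      then have "vpow (- (int d * (int r + 1))) * (?u * ?num n (Suc r)) = ?num n (Suc r)"
        by (simp only: mult.assoc[symmetric] mult_1_left)
      then show "?den (Suc r) dvd ?u * ?num n (Suc r) \<Longrightarrow> ?den (Suc r) dvd ?num n (Suc r)"
        by (metis dvd_mult)
    qed (rule dvd_mult)
    finally show ?thesis .
  qed
  show ?case
  proof (induction n rule: int_induct[where k = 0])
    case base
    have "?num 0 (Suc r) = 0"
      by (subst prod.lessThan_Suc_shift) (simp add: qint_0[OF d])
    then show ?case by (simp only: dvd_0_right)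
  next
    case (step1 i) then show ?case using up[of i] by simp
  next
    case (step2 i) then show ?case using up[of "i - 1"] by simp
  qed
qed simp

lemma qbinom_eq:
  assumes d: "d > 0"
  shows "qbinom d n r * (\<Prod>i<r. qint d (int i + 1)) = (\<Prod>i<r. qint d (n - int i))"
  unfolding qbinom_def
  by (rule exact_quotient) (use qbinom_dvd[OF d] qint_ne_0[OF d] in auto)

section \<open>Root systems\<close>

text \<open>\<open>coroot D \<alpha> \<nu>\<close> is the pairing of \<open>\<nu>\<close> with the coroot of \<open>\<alpha>\<close>; it is meaningful for roots
  \<open>\<alpha>\<close> only. The ambient space \<open>V\<close> is the whole type.\<close>

record 'v root_data =
  roots :: "'v set"
  coroot :: "'v \<Rightarrow> 'v \<Rightarrow> real"
  simple :: "'v set"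
  dnum :: "'v \<Rightarrow> nat"

definition root_system :: "'v::real_vector root_data \<Rightarrow> bool" where
  "root_system D \<longleftrightarrow>
     finite (roots D) \<and> 0 \<notin> roots D \<and> span (roots D) = UNIV \<and>
     (\<forall>\<alpha>\<in>roots D. linear (coroot D \<alpha>) \<and> coroot D \<alpha> \<alpha> = 2 \<and>
        (\<lambda>x. x - coroot D \<alpha> x *\<^sub>R \<alpha>) ` roots D = roots D \<and>
        (\<forall>\<beta>\<in>roots D. coroot D \<alpha> \<beta> \<in> \<int>) \<and>
        (\<forall>c. c *\<^sub>R \<alpha> \<in> roots D \<longrightarrow> c = 1 \<or> c = - 1))"

definition simple_roots :: "'v::real_vector root_data \<Rightarrow> bool" where
  "simple_roots D \<longleftrightarrow>
     simple D \<subseteq> roots D \<and> independent (simple D) \<and>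
     (\<forall>\<beta>\<in>roots D. \<exists>c :: 'v \<Rightarrow> nat.
        \<beta> = (\<Sum>\<alpha>\<in>simple D. real (c \<alpha>) *\<^sub>R \<alpha>) \<or> \<beta> = - (\<Sum>\<alpha>\<in>simple D. real (c \<alpha>) *\<^sub>R \<alpha>))"

definition orthogonal_roots :: "'v::real_vector root_data \<Rightarrow> 'v set \<Rightarrow> 'v set \<Rightarrow> bool" where
  "orthogonal_roots D B C \<longleftrightarrow> (\<forall>\<beta>\<in>B. \<forall>\<gamma>\<in>C. coroot D \<beta> \<gamma> = 0 \<and> coroot D \<gamma> \<beta> = 0)"

definition irreducible_component :: "'v::real_vector root_data \<Rightarrow> 'v set \<Rightarrow> bool" where
  "irreducible_component D C \<longleftrightarrow>
     C \<subseteq> roots D \<and> C \<noteq> {} \<and> orthogonal_roots D C (roots D - C) \<and>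
     (\<forall>B\<subseteq>C. orthogonal_roots D B (C - B) \<longrightarrow> B = {} \<or> B = C)"

definition ground_data :: "'v::real_vector root_data \<Rightarrow> bool" where
  "ground_data D \<longleftrightarrow>
     root_system D \<and> simple_roots D \<and>
     (\<forall>\<alpha>\<in>simple D. dnum D \<alpha> \<in> {1, 2, 3}) \<and>
     (\<forall>\<alpha>\<in>simple D. \<forall>\<beta>\<in>simple D.
        real (dnum D \<alpha>) * coroot D \<alpha> \<beta> = real (dnum D \<beta>) * coroot D \<beta> \<alpha>) \<and>
     (\<forall>C. irreducible_component D C \<longrightarrow> (\<exists>\<alpha>\<in>simple D \<inter> C. dnum D \<alpha> = 1))"

definition weight_lattice :: "'v::real_vector root_data \<Rightarrow> 'v set" where
  "weight_lattice D = {\<nu>. \<forall>\<alpha>\<in>roots D. coroot D \<alpha> \<nu> \<in> \<int>}"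

definition weight_le :: "'v::real_vector root_data \<Rightarrow> 'v \<Rightarrow> 'v \<Rightarrow> bool" where
  "weight_le D \<mu> \<nu> \<longleftrightarrow> (\<exists>c :: 'v \<Rightarrow> nat. \<nu> - \<mu> = (\<Sum>\<alpha>\<in>simple D. real (c \<alpha>) *\<^sub>R \<alpha>))"

definition quasi_bounded :: "'v::real_vector root_data \<Rightarrow> 'v set \<Rightarrow> bool" where
  "quasi_bounded D S \<longleftrightarrow>
     S \<subseteq> weight_lattice D \<and> (\<forall>\<mu>\<in>weight_lattice D. finite {\<nu>\<in>S. weight_le D \<mu> \<nu>})"

section \<open>Local rings and modules\<close>

definition left_ideal :: "'r set \<Rightarrow> ('r, 'x) ring_scheme \<Rightarrow> bool" where
  "left_ideal I R \<longleftrightarrow>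
     additive_subgroup I R \<and> (\<forall>a\<in>carrier R. \<forall>x\<in>I. a \<otimes>\<^bsub>R\<^esub> x \<in> I)"

definition maximal_left_ideal :: "'r set \<Rightarrow> ('r, 'x) ring_scheme \<Rightarrow> bool" where
  "maximal_left_ideal I R \<longleftrightarrow>
     left_ideal I R \<and> I \<noteq> carrier R \<and>
     (\<forall>J. left_ideal J R \<longrightarrow> I \<subseteq> J \<longrightarrow> J = I \<or> J = carrier R)"

text \<open>The endomorphism rings below need not be commutative; for commutative rings a left ideal is
  an ideal.\<close>

definition local_ring :: "('r, 'x) ring_scheme \<Rightarrow> bool" where
  "local_ring R \<longleftrightarrow> ring R \<and> (\<exists>!I. maximal_left_ideal I R)"

definition mod_hom ::
  "('a, 'x) ring_scheme \<Rightarrow> ('a, 'm, 'y) module_scheme \<Rightarrow> ('a, 'n, 'z) module_scheme \<Rightarrow> ('m \<Rightarrow> 'n) set" where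
  "mod_hom R M N =
     {f \<in> carrier M \<rightarrow> carrier N.
        (\<forall>x\<in>carrier M. \<forall>y\<in>carrier M. f (x \<oplus>\<^bsub>M\<^esub> y) = f x \<oplus>\<^bsub>N\<^esub> f y) \<and>
        (\<forall>a\<in>carrier R. \<forall>x\<in>carrier M. f (a \<odot>\<^bsub>M\<^esub> x) = a \<odot>\<^bsub>N\<^esub> f x)}"

definition fin_gen_module :: "('a, 'x) ring_scheme \<Rightarrow> ('a, 'm, 'y) module_scheme \<Rightarrow> bool" where
  "fin_gen_module R M \<longleftrightarrow>
     (\<exists>G\<subseteq>carrier M. finite G \<and>
        (\<forall>x\<in>carrier M. \<exists>c\<in>G \<rightarrow> carrier R. x = (\<Oplus>\<^bsub>M\<^esub>g\<in>G. c g \<odot>\<^bsub>M\<^esub> g)))"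

definition torsion_module :: "('a, 'x) ring_scheme \<Rightarrow> ('a, 'm, 'y) module_scheme \<Rightarrow> bool" where
  "torsion_module R M \<longleftrightarrow>
     (\<forall>x\<in>carrier M. \<exists>\<xi>\<in>carrier R. \<xi> \<noteq> \<zero>\<^bsub>R\<^esub> \<and> \<xi> \<odot>\<^bsub>M\<^esub> x = \<zero>\<^bsub>M\<^esub>)"

definition module_basis :: "('a, 'x) ring_scheme \<Rightarrow> ('a, 'm, 'y) module_scheme \<Rightarrow> 'm set \<Rightarrow> bool" where
  "module_basis R M B \<longleftrightarrow>
     B \<subseteq> carrier M \<and>
     (\<forall>x\<in>carrier M. \<exists>!c. c \<in> (B \<rightarrow>\<^sub>E carrier R) \<and> finite {b\<in>B. c b \<noteq> \<zero>\<^bsub>R\<^esub>} \<and>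
        x = (\<Oplus>\<^bsub>M\<^esub>b\<in>{b\<in>B. c b \<noteq> \<zero>\<^bsub>R\<^esub>}. c b \<odot>\<^bsub>M\<^esub> b))"

definition free_module :: "('a, 'x) ring_scheme \<Rightarrow> ('a, 'm, 'y) module_scheme \<Rightarrow> bool" where
  "free_module R M \<longleftrightarrow> (\<exists>B. module_basis R M B)"

definition free_of_rank :: "('a, 'x) ring_scheme \<Rightarrow> ('a, 'm, 'y) module_scheme \<Rightarrow> nat \<Rightarrow> bool" where
  "free_of_rank R M n \<longleftrightarrow> (\<exists>B. module_basis R M B \<and> finite B \<and> card B = n)"

text \<open>A module record extends a ring record; the multiplicative fields play no role.\<close>

definition quot_module :: "('a, 'm) module \<Rightarrow> 'm set \<Rightarrow> ('a, 'm set) module" where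
  "quot_module M N =
     \<lparr>carrier = a_rcosets\<^bsub>M\<^esub> N, monoid.mult = undefined, one = undefined,
      ring.zero = N, ring.add = set_add M, module.smult = (\<lambda>a C. \<Union>x\<in>C. N +>\<^bsub>M\<^esub> (a \<odot>\<^bsub>M\<^esub> x))\<rparr>"

definition dsum_module :: "'i set \<Rightarrow> ('i \<Rightarrow> ('a, 'm) module) \<Rightarrow> ('a, 'i \<Rightarrow> 'm) module" where
  "dsum_module I M =
     \<lparr>carrier = {f \<in> (\<Pi>\<^sub>E i\<in>I. carrier (M i)). finite {i\<in>I. f i \<noteq> \<zero>\<^bsub>M i\<^esub>}},
      monoid.mult = undefined, one = undefined,
      ring.zero = (\<lambda>i\<in>I. \<zero>\<^bsub>M i\<^esub>),
      ring.add = (\<lambda>f g. \<lambda>i\<in>I. f i \<oplus>\<^bsub>M i\<^esub> g i),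
      module.smult = (\<lambda>a f. \<lambda>i\<in>I. a \<odot>\<^bsub>M i\<^esub> f i)\<rparr>"

section \<open>The category of graded modules with operators\<close>

text \<open>A graded module is the family of its weight spaces, of which only those at weights in the
  weight lattice matter. \<open>opE M \<mu> \<alpha> n\<close> maps the weight space at \<open>\<mu>\<close> to that at \<open>\<mu> + n\<alpha>\<close>, and
  \<open>opF M \<mu> \<alpha> n\<close> goes back. Only \<open>n > 0\<close> is significant in these fields: \<open>actE\<close> and \<open>actF\<close>
  implement the convention that the operators for \<open>n = 0\<close> are the identity.\<close>

record ('v, 'a, 'm) xobj =
  wt :: "'v \<Rightarrow> ('a, 'm) module"
  opE :: "'v \<Rightarrow> 'v \<Rightarrow> nat \<Rightarrow> 'm \<Rightarrow> 'm"
  opF :: "'v \<Rightarrow> 'v \<Rightarrow> nat \<Rightarrow> 'm \<Rightarrow> 'm"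

definition actE :: "('v, 'a, 'm) xobj \<Rightarrow> 'v \<Rightarrow> 'v \<Rightarrow> nat \<Rightarrow> 'm \<Rightarrow> 'm" where
  "actE M \<mu> \<alpha> n = (if n = 0 then id else opE M \<mu> \<alpha> n)"

definition actF :: "('v, 'a, 'm) xobj \<Rightarrow> 'v \<Rightarrow> 'v \<Rightarrow> nat \<Rightarrow> 'm \<Rightarrow> 'm" where
  "actF M \<mu> \<alpha> n = (if n = 0 then id else opF M \<mu> \<alpha> n)"

definition graded_with_ops ::
  "'a ring \<Rightarrow> 'v::real_vector root_data \<Rightarrow> ('v, 'a, 'm) xobj \<Rightarrow> bool" where
  "graded_with_ops A D M \<longleftrightarrow>
     (\<forall>\<mu>\<in>weight_lattice D. module A (wt M \<mu>) \<and>
        (\<forall>\<alpha>\<in>simple D. \<forall>n>0.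
           opE M \<mu> \<alpha> n \<in> mod_hom A (wt M \<mu>) (wt M (\<mu> + real n *\<^sub>R \<alpha>)) \<and>
           opF M \<mu> \<alpha> n \<in> mod_hom A (wt M (\<mu> + real n *\<^sub>R \<alpha>)) (wt M \<mu>)))"

definition weights :: "'v::real_vector root_data \<Rightarrow> ('v, 'a, 'm) xobj \<Rightarrow> 'v set" where
  "weights D M = {\<mu>\<in>weight_lattice D. carrier (wt M \<mu>) \<noteq> {\<zero>\<^bsub>wt M \<mu>\<^esub>}}"

definition axiom_X1 :: "'a ring \<Rightarrow> 'v::real_vector root_data \<Rightarrow> ('v, 'a, 'm) xobj \<Rightarrow> bool" where
  "axiom_X1 A D M \<longleftrightarrow>
     quasi_bounded D (weights D M) \<and> (\<forall>\<mu>\<in>weight_lattice D. fin_gen_module A (wt M \<mu>))"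

text \<open>The ring homomorphism \<open>\<phi>\<close> is the algebra structure on \<open>A\<close> over the Laurent polynomials.
  In the second formula \<open>x\<close> has weight \<open>\<mu> + n\<alpha>\<close>, so the operator \<open>E\<close> with exponent \<open>m - r\<close>
  leads to weight \<open>\<mu> + m\<alpha> + (n - r)\<alpha>\<close>, whence the base point \<open>\<mu> + m\<alpha>\<close> of \<open>F\<close>. The floor
  only turns the integral real number into an element of type \<open>int\<close>.\<close>

definition axiom_X2 ::
  "'a ring \<Rightarrow> (laurent \<Rightarrow> 'a) \<Rightarrow> 'v::real_vector root_data \<Rightarrow> ('v, 'a, 'm) xobj \<Rightarrow> bool" where
  "axiom_X2 A \<phi> D M \<longleftrightarrow>
     (\<forall>\<mu>\<in>weight_lattice D. \<forall>\<alpha>\<in>simple D. \<forall>\<beta>\<in>simple D. \<forall>m>0. \<forall>n>0.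
        \<forall>x\<in>carrier (wt M (\<mu> + real n *\<^sub>R \<beta>)).
          (\<alpha> \<noteq> \<beta> \<longrightarrow>
             actE M \<mu> \<alpha> m (actF M \<mu> \<beta> n x) =
             actF M (\<mu> + real m *\<^sub>R \<alpha>) \<beta> n (actE M (\<mu> + real n *\<^sub>R \<beta>) \<alpha> m x)) \<and>
          (\<alpha> = \<beta> \<longrightarrow>
             actE M \<mu> \<alpha> m (actF M \<mu> \<alpha> n x) =
             (\<Oplus>\<^bsub>wt M (\<mu> + real m *\<^sub>R \<alpha>)\<^esub>r\<in>{0..min m n}.
                \<phi> (qbinom (dnum D \<alpha>) (\<lfloor>coroot D \<alpha> \<mu>\<rfloor> + int m + int n) r)
                \<odot>\<^bsub>wt M (\<mu> + real m *\<^sub>R \<alpha>)\<^esub>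
                actF M (\<mu> + real m *\<^sub>R \<alpha>) \<alpha> (n - r)
                  (actE M (\<mu> + real n *\<^sub>R \<alpha>) \<alpha> (m - r) x))))"

definition delta_index :: "'v::real_vector root_data \<Rightarrow> ('v \<times> nat) set" where
  "delta_index D = simple D \<times> {n. n > 0}"

definition wt_delta ::
  "'v::real_vector root_data \<Rightarrow> ('v, 'a, 'm) xobj \<Rightarrow> 'v \<Rightarrow> ('a, 'v \<times> nat \<Rightarrow> 'm) module" where
  "wt_delta D M \<mu> = dsum_module (delta_index D) (\<lambda>(\<alpha>, n). wt M (\<mu> + real n *\<^sub>R \<alpha>))"

definition E_col ::
  "'v::real_vector root_data \<Rightarrow> ('v, 'a, 'm) xobj \<Rightarrow> 'v \<Rightarrow> 'm \<Rightarrow> ('v \<times> nat \<Rightarrow> 'm)" where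
  "E_col D M \<mu> x = (\<lambda>(\<alpha>, n)\<in>delta_index D. opE M \<mu> \<alpha> n x)"

definition F_row ::
  "'v::real_vector root_data \<Rightarrow> ('v, 'a, 'm) xobj \<Rightarrow> 'v \<Rightarrow> ('v \<times> nat \<Rightarrow> 'm) \<Rightarrow> 'm" where
  "F_row D M \<mu> f =
     finsum (wt M \<mu>) (\<lambda>(\<alpha>, n). opF M \<mu> \<alpha> n (f (\<alpha>, n)))
       {(\<alpha>, n)\<in>delta_index D. f (\<alpha>, n) \<noteq> \<zero>\<^bsub>wt M (\<mu> + real n *\<^sub>R \<alpha>)\<^esub>}"

definition im_F :: "'v::real_vector root_data \<Rightarrow> ('v, 'a, 'm) xobj \<Rightarrow> 'v \<Rightarrow> 'm set" where
  "im_F D M \<mu> = F_row D M \<mu> ` carrier (wt_delta D M \<mu>)"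

definition M_braces ::
  "'v::real_vector root_data \<Rightarrow> ('v, 'a, 'm) xobj \<Rightarrow> 'v \<Rightarrow> ('v \<times> nat \<Rightarrow> 'm) set" where
  "M_braces D M \<mu> = E_col D M \<mu> ` im_F D M \<mu>"

definition M_angle ::
  "'v::real_vector root_data \<Rightarrow> ('v, 'a, 'm) xobj \<Rightarrow> 'v \<Rightarrow> ('v \<times> nat \<Rightarrow> 'm) set" where
  "M_angle D M \<mu> = E_col D M \<mu> ` carrier (wt M \<mu>)"

definition M_braces_max ::
  "'a ring \<Rightarrow> 'v::real_vector root_data \<Rightarrow> ('v, 'a, 'm) xobj \<Rightarrow> 'v \<Rightarrow> ('v \<times> nat \<Rightarrow> 'm) set" where
  "M_braces_max A D M \<mu> =
     {m \<in> carrier (wt_delta D M \<mu>).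
        \<exists>\<xi>\<in>carrier A. \<xi> \<noteq> \<zero>\<^bsub>A\<^esub> \<and> \<xi> \<odot>\<^bsub>wt_delta D M \<mu>\<^esub> m \<in> M_braces D M \<mu>}"

definition axiom_X3 :: "'a ring \<Rightarrow> 'v::real_vector root_data \<Rightarrow> ('v, 'a, 'm) xobj \<Rightarrow> bool" where
  "axiom_X3 A D M \<longleftrightarrow>
     (\<forall>\<mu>\<in>weight_lattice D.
        inj_on (E_col D M \<mu>) (im_F D M \<mu>) \<and>
        torsion_module A
          (quot_module ((wt_delta D M \<mu>)\<lparr>carrier := M_angle D M \<mu>\<rparr>) (M_braces D M \<mu>)) \<and>
        free_module A (quot_module (wt M \<mu>) (im_F D M \<mu>)))"

definition X_object ::
  "'a ring \<Rightarrow> (laurent \<Rightarrow> 'a) \<Rightarrow> 'v::real_vector root_data \<Rightarrow> ('v, 'a, 'm) xobj \<Rightarrow> bool" where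
  "X_object A \<phi> D M \<longleftrightarrow>
     graded_with_ops A D M \<and> axiom_X1 A D M \<and> axiom_X2 A \<phi> D M \<and> axiom_X3 A D M"

definition maximal_object ::
  "'a ring \<Rightarrow> (laurent \<Rightarrow> 'a) \<Rightarrow> 'v::real_vector root_data \<Rightarrow> ('v, 'a, 'm) xobj \<Rightarrow> bool" where
  "maximal_object A \<phi> D M \<longleftrightarrow>
     X_object A \<phi> D M \<and> (\<forall>\<mu>\<in>weight_lattice D. M_angle D M \<mu> = M_braces_max A D M \<mu>)"

text \<open>Morphisms are extensional (undefined outside the weight lattice and outside the carriers),
  so that equality of functions is equality of morphisms.\<close>

definition X_hom ::
  "'a ring \<Rightarrow> 'v::real_vector root_data \<Rightarrow> ('v, 'a, 'm) xobj \<Rightarrow> ('v, 'a, 'n) xobj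
     \<Rightarrow> ('v \<Rightarrow> 'm \<Rightarrow> 'n) set" where
  "X_hom A D M N =
     {f \<in> (\<Pi>\<^sub>E \<mu>\<in>weight_lattice D. mod_hom A (wt M \<mu>) (wt N \<mu>) \<inter> extensional (carrier (wt M \<mu>))).
        \<forall>\<mu>\<in>weight_lattice D. \<forall>\<alpha>\<in>simple D. \<forall>n>0.
          (\<forall>x\<in>carrier (wt M \<mu>). f (\<mu> + real n *\<^sub>R \<alpha>) (opE M \<mu> \<alpha> n x) = opE N \<mu> \<alpha> n (f \<mu> x)) \<and>
          (\<forall>x\<in>carrier (wt M (\<mu> + real n *\<^sub>R \<alpha>)).
             f \<mu> (opF M \<mu> \<alpha> n x) = opF N \<mu> \<alpha> n (f (\<mu> + real n *\<^sub>R \<alpha>) x))}"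

definition X_comp ::
  "'v::real_vector root_data \<Rightarrow> ('v, 'a, 'm) xobj \<Rightarrow> ('v \<Rightarrow> 'n \<Rightarrow> 'k) \<Rightarrow> ('v \<Rightarrow> 'm \<Rightarrow> 'n)
     \<Rightarrow> ('v \<Rightarrow> 'm \<Rightarrow> 'k)" where
  "X_comp D M g f = (\<lambda>\<mu>\<in>weight_lattice D. compose (carrier (wt M \<mu>)) (g \<mu>) (f \<mu>))"

definition X_id :: "'v::real_vector root_data \<Rightarrow> ('v, 'a, 'm) xobj \<Rightarrow> 'v \<Rightarrow> 'm \<Rightarrow> 'm" where
  "X_id D M = (\<lambda>\<mu>\<in>weight_lattice D. \<lambda>x\<in>carrier (wt M \<mu>). x)"

definition X_iso ::
  "'a ring \<Rightarrow> 'v::real_vector root_data \<Rightarrow> ('v, 'a, 'm) xobj \<Rightarrow> ('v, 'a, 'n) xobj \<Rightarrow> bool" where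
  "X_iso A D M N \<longleftrightarrow>
     (\<exists>f\<in>X_hom A D M N. \<exists>g\<in>X_hom A D N M. X_comp D M g f = X_id D M \<and> X_comp D N f g = X_id D N)"

definition End_ring ::
  "'a ring \<Rightarrow> 'v::real_vector root_data \<Rightarrow> ('v, 'a, 'm) xobj \<Rightarrow> ('v \<Rightarrow> 'm \<Rightarrow> 'm) ring" where
  "End_ring A D M =
     \<lparr>carrier = X_hom A D M M,
      monoid.mult = X_comp D M,
      one = X_id D M,
      ring.zero = (\<lambda>\<mu>\<in>weight_lattice D. \<lambda>x\<in>carrier (wt M \<mu>). \<zero>\<^bsub>wt M \<mu>\<^esub>),
      ring.add = (\<lambda>f g. \<lambda>\<mu>\<in>weight_lattice D. \<lambda>x\<in>carrier (wt M \<mu>). f \<mu> x \<oplus>\<^bsub>wt M \<mu>\<^esub> g \<mu> x)\<rparr>"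

definition X_dsum :: "'i set \<Rightarrow> ('i \<Rightarrow> ('v, 'a, 'm) xobj) \<Rightarrow> ('v, 'a, 'i \<Rightarrow> 'm) xobj" where
  "X_dsum I M =
     \<lparr>wt = (\<lambda>\<mu>. dsum_module I (\<lambda>i. wt (M i) \<mu>)),
      opE = (\<lambda>\<mu> \<alpha> n f. \<lambda>i\<in>I. opE (M i) \<mu> \<alpha> n (f i)),
      opF = (\<lambda>\<mu> \<alpha> n f. \<lambda>i\<in>I. opF (M i) \<mu> \<alpha> n (f i))\<rparr>"

definition zero_object :: "'v::real_vector root_data \<Rightarrow> ('v, 'a, 'm) xobj \<Rightarrow> bool" where
  "zero_object D M \<longleftrightarrow> weights D M = {}"

text \<open>The summands range over objects with the same underlying type as \<open>M\<close>; this is no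
  restriction, since every direct summand of \<open>M\<close> is isomorphic to one inside \<open>M\<close>.\<close>

definition indecomposable ::
  "'a ring \<Rightarrow> (laurent \<Rightarrow> 'a) \<Rightarrow> 'v::real_vector root_data \<Rightarrow> ('v, 'a, 'm) xobj \<Rightarrow> bool" where
  "indecomposable A \<phi> D M \<longleftrightarrow>
     X_object A \<phi> D M \<and> \<not> zero_object D M \<and>
     (\<forall>N1 N2 :: ('v, 'a, 'm) xobj.
        X_object A \<phi> D N1 \<longrightarrow> X_object A \<phi> D N2 \<longrightarrow>
        X_iso A D M (X_dsum UNIV (\<lambda>b. if b then N1 else N2)) \<longrightarrow>
        zero_object D N1 \<or> zero_object D N2)"

definition Smax_property ::
  "'a ring \<Rightarrow> (laurent \<Rightarrow> 'a) \<Rightarrow> 'v::real_vector root_data \<Rightarrow> 'v \<Rightarrow> ('v, 'a, 'm) xobj \<Rightarrow> bool" where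
  "Smax_property A \<phi> D \<nu> S \<longleftrightarrow>
     X_object A \<phi> D S \<and>
     free_of_rank A (wt S \<nu>) 1 \<and> (\<forall>\<mu>\<in>weights D S. weight_le D \<mu> \<nu>) \<and>
     indecomposable A \<phi> D S \<and> maximal_object A \<phi> D S"

text \<open>A finitely generated module is isomorphic to a quotient of some \<open>A\<^sup>n\<close>, whose elements are
  cosets in \<open>nat \<Rightarrow> 'a\<close>. Hence every object is isomorphic to one with underlying type
  \<open>(nat \<Rightarrow> 'a) set\<close>, and it is harmless to choose the representative there.\<close>

definition S_max ::
  "'a ring \<Rightarrow> (laurent \<Rightarrow> 'a) \<Rightarrow> 'v::real_vector root_data \<Rightarrow> 'v \<Rightarrow> ('v, 'a, (nat \<Rightarrow> 'a) set) xobj" where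
  "S_max A \<phi> D \<nu> = (SOME S. Smax_property A \<phi> D \<nu> S)"

end

theory Submission
  imports Defs
begin

text \<open>
  Consider a maximal object \<open>M\<close> at a weight \<open>\<mu>\<close>. By the commutation axiom the product of the column
  \<open>E\<close> and the row \<open>F\<close> at \<open>\<mu>\<close> is a matrix \<open>\<Phi>\<close> that depends only on the part of \<open>M\<close> strictly above \<open>\<mu>\<close>
  (\<open>EF_map\<close>, \<open>X2_at_iff\<close>). So what \<open>M\<close> adds at \<open>\<mu>\<close> is a factorisation of \<open>\<Phi>\<close> through a finitely
  generated module \<open>M\<^sub>\<mu>\<close>, where \<open>E\<close> is injective on the image of \<open>F\<close>, the quotient of \<open>M\<^sub>\<mu>\<close> by that
  image is free, and the image of \<open>E\<close> is the torsion closure of the image of \<open>\<Phi>\<close>. Such a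
  factorisation is called a corner here.

  In a corner, \<open>E\<close> induces a surjection from a free module of finite rank onto a module known
  in advance, the torsion closure of the image of \<open>\<Phi>\<close> modulo this image. Over a local ring such a
  surjection is a projective cover plus a free module that is mapped to zero. The rank of the latter is the
  multiplicity of the corner. For given \<open>\<Phi>\<close>, corners of equal multiplicity are
  isomorphic (\<open>corner_extend\<close>, by Nakayama's lemma and the injectivity of surjective endomorphisms
  of Noetherian modules), and one of multiplicity zero exists (\<open>corner_exists\<close>).

  Since weights are quasi-bounded, objects can be treated by recursion from higher to lower
  weights. Hence a maximal object is determined up to isomorphism by its multiplicities at all
  weights (\<open>iso_exists\<close>), and for every \<open>\<kappa>\<close> there is one with multiplicity \<open>1\<close> at \<open>\<kappa>\<close> and \<open>0\<close>
  elsewhere (\<open>good_exists\<close>). Multiplicities are additive in direct sums (\<open>good_dsum\<close>), so sums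
  of these objects realise the multiplicities of any maximal object, which gives the decomposition
  theorem (\<open>generator_decomposition\<close>).

  It remains to identify these objects with the indecomposable ones. At a corner of multiplicity
  zero, a compatible endomorphism that is bijective above is bijective (\<open>corner_hom_bij\<close>).
  So an endomorphism of the object generated at \<open>\<kappa>\<close> is invertible as soon as it is so at \<open>\<kappa>\<close>,
  where it is a scalar (\<open>good_endo_bij\<close>). As the ring of scalars is local, so is the endomorphism ring, and the
  object is indecomposable. Conversely, an indecomposable maximal object with the required top weight
  space cannot have any further generator, since that could be split off (\<open>Smax_good\<close>).
\<close>

section \<open>Modules over a commutative ring\<close>

abbreviation trivial :: "('a, 'm, 'x) module_scheme => bool" where
  "trivial N \<equiv> carrier N = {\<zero>\<^bsub>N\<^esub>}"

locale ground_ring = cring A for A :: "'a ring" (structure)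
begin

abbreviation Hom :: "('a, 'm, 'y) module_scheme => ('a, 'n, 'z) module_scheme => ('m => 'n) set" where
  "Hom \<equiv> mod_hom A"

lemma mod_abelian_group: "module A M ==> abelian_group M"
  by (simp add: module_def)

lemma mod_zero_closed [simp]: "module A M ==> \<zero>\<^bsub>M\<^esub> \<in> carrier M"
  by (rule abelian_monoid.zero_closed[OF abelian_group.axioms(1)[OF mod_abelian_group]])

lemma mod_add_closed [simp]:
  "module A M ==> x \<in> carrier M ==> y \<in> carrier M ==> x \<oplus>\<^bsub>M\<^esub> y \<in> carrier M"
  by (rule abelian_monoid.a_closed[OF abelian_group.axioms(1)[OF mod_abelian_group]])

lemma mod_smult_closed [simp]:
  "module A M ==> a \<in> carrier A ==> x \<in> carrier M ==> a \<odot>\<^bsub>M\<^esub> x \<in> carrier M"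
  by (rule module.smult_closed)

lemma mod_neg_closed [simp]: "module A M ==> x \<in> carrier M ==> \<ominus>\<^bsub>M\<^esub> x \<in> carrier M"
  by (rule abelian_group.a_inv_closed[OF mod_abelian_group])

lemma mod_minus_closed [simp]:
  "module A M ==> x \<in> carrier M ==> y \<in> carrier M ==> x \<ominus>\<^bsub>M\<^esub> y \<in> carrier M"
  by (rule abelian_group.minus_closed[OF mod_abelian_group])

lemma mod_finsum_closed [simp]:
  "module A M ==> (\<And>i. i \<in> I ==> f i \<in> carrier M) ==> finsum M f I \<in> carrier M"
  by (rule abelian_monoid.finsum_closed[OF abelian_group.axioms(1)[OF mod_abelian_group]]) auto

lemma mod_zero_add [simp]: "module A M ==> x \<in> carrier M ==> \<zero>\<^bsub>M\<^esub> \<oplus>\<^bsub>M\<^esub> x = x"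
  by (rule abelian_monoid.l_zero[OF abelian_group.axioms(1)[OF mod_abelian_group]])

lemma mod_add_zero [simp]: "module A M ==> x \<in> carrier M ==> x \<oplus>\<^bsub>M\<^esub> \<zero>\<^bsub>M\<^esub> = x"
  by (rule abelian_monoid.r_zero[OF abelian_group.axioms(1)[OF mod_abelian_group]])

lemma mod_zero_smult [simp]: "module A M ==> x \<in> carrier M ==> \<zero> \<odot>\<^bsub>M\<^esub> x = \<zero>\<^bsub>M\<^esub>"
  by (rule module.smult_l_null)

lemma mod_smult_zero [simp]: "module A M ==> a \<in> carrier A ==> a \<odot>\<^bsub>M\<^esub> \<zero>\<^bsub>M\<^esub> = \<zero>\<^bsub>M\<^esub>"
  by (rule module.smult_r_null)

lemma mod_one_smult [simp]: "module A M ==> x \<in> carrier M ==> \<one> \<odot>\<^bsub>M\<^esub> x = x"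
  by (rule module.smult_one)

lemma mod_add_comm:
  "module A M ==> x \<in> carrier M ==> y \<in> carrier M ==> x \<oplus>\<^bsub>M\<^esub> y = y \<oplus>\<^bsub>M\<^esub> x"
  by (rule abelian_monoid.a_comm[OF abelian_group.axioms(1)[OF mod_abelian_group]])

lemma mod_add_assoc:
  "module A M ==> x \<in> carrier M ==> y \<in> carrier M ==> z \<in> carrier M
    ==> (x \<oplus>\<^bsub>M\<^esub> y) \<oplus>\<^bsub>M\<^esub> z = x \<oplus>\<^bsub>M\<^esub> (y \<oplus>\<^bsub>M\<^esub> z)"
  by (rule abelian_monoid.a_assoc[OF abelian_group.axioms(1)[OF mod_abelian_group]])

lemma mod_add_lcomm:
  "module A M ==> x \<in> carrier M ==> y \<in> carrier M ==> z \<in> carrier M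
    ==> x \<oplus>\<^bsub>M\<^esub> (y \<oplus>\<^bsub>M\<^esub> z) = y \<oplus>\<^bsub>M\<^esub> (x \<oplus>\<^bsub>M\<^esub> z)"
  by (rule abelian_monoid.a_lcomm[OF abelian_group.axioms(1)[OF mod_abelian_group]])

lemma mod_neg_add [simp]: "module A M ==> x \<in> carrier M ==> \<ominus>\<^bsub>M\<^esub> x \<oplus>\<^bsub>M\<^esub> x = \<zero>\<^bsub>M\<^esub>"
  by (rule abelian_group.l_neg[OF mod_abelian_group])

lemma mod_add_neg [simp]: "module A M ==> x \<in> carrier M ==> x \<oplus>\<^bsub>M\<^esub> \<ominus>\<^bsub>M\<^esub> x = \<zero>\<^bsub>M\<^esub>"
  by (rule abelian_group.r_neg[OF mod_abelian_group])

lemma mod_neg_neg [simp]: "module A M ==> x \<in> carrier M ==> \<ominus>\<^bsub>M\<^esub> (\<ominus>\<^bsub>M\<^esub> x) = x"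
  by (rule abelian_group.minus_minus[OF mod_abelian_group])

lemma mod_diff_self [simp]: "module A M ==> x \<in> carrier M ==> x \<ominus>\<^bsub>M\<^esub> x = \<zero>\<^bsub>M\<^esub>"
  by (simp add: a_minus_def)

lemma mod_diff_zero [simp]: "module A M ==> x \<in> carrier M ==> x \<ominus>\<^bsub>M\<^esub> \<zero>\<^bsub>M\<^esub> = x"
  by (metis a_minus_def mod_add_neg mod_add_zero mod_neg_closed mod_zero_add mod_zero_closed)

lemma mod_diff_add_cancel [simp]:
  "module A M ==> x \<in> carrier M ==> y \<in> carrier M ==> (x \<ominus>\<^bsub>M\<^esub> y) \<oplus>\<^bsub>M\<^esub> y = x"
  by (simp add: a_minus_def mod_add_assoc)

lemma mod_add_diff_cancel [simp]:
  "module A M ==> x \<in> carrier M ==> y \<in> carrier M ==> (x \<oplus>\<^bsub>M\<^esub> y) \<ominus>\<^bsub>M\<^esub> y = x"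
  by (simp add: a_minus_def mod_add_assoc)

lemma mod_diff_eq_zero_iff:
  "module A M ==> x \<in> carrier M ==> y \<in> carrier M ==> x \<ominus>\<^bsub>M\<^esub> y = \<zero>\<^bsub>M\<^esub> \<longleftrightarrow> x = y"
  by (metis mod_diff_add_cancel mod_diff_self mod_zero_add)

lemma mod_neg_eq_smult: "module A M ==> x \<in> carrier M ==> \<ominus>\<^bsub>M\<^esub> x = (\<ominus> \<one>) \<odot>\<^bsub>M\<^esub> x"
  by (simp add: module.smult_l_minus)

lemma mod_l_distr:
  "module A M ==> a \<in> carrier A ==> b \<in> carrier A ==> x \<in> carrier M
    ==> (a \<oplus> b) \<odot>\<^bsub>M\<^esub> x = a \<odot>\<^bsub>M\<^esub> x \<oplus>\<^bsub>M\<^esub> b \<odot>\<^bsub>M\<^esub> x"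
  by (rule module.smult_l_distr)

lemma mod_r_distr:
  "module A M ==> a \<in> carrier A ==> x \<in> carrier M ==> y \<in> carrier M
    ==> a \<odot>\<^bsub>M\<^esub> (x \<oplus>\<^bsub>M\<^esub> y) = a \<odot>\<^bsub>M\<^esub> x \<oplus>\<^bsub>M\<^esub> a \<odot>\<^bsub>M\<^esub> y"
  by (rule module.smult_r_distr)

lemma mod_smult_assoc:
  "module A M ==> a \<in> carrier A ==> b \<in> carrier A ==> x \<in> carrier M
    ==> (a \<otimes> b) \<odot>\<^bsub>M\<^esub> x = a \<odot>\<^bsub>M\<^esub> (b \<odot>\<^bsub>M\<^esub> x)"
  by (rule module.smult_assoc1)

lemma ground_moduleI:
  assumes add: "\<And>x y. x \<in> carrier M ==> y \<in> carrier M ==> x \<oplus>\<^bsub>M\<^esub> y \<in> carrier M"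
    and zero: "\<zero>\<^bsub>M\<^esub> \<in> carrier M"
    and smult: "\<And>a x. a \<in> carrier A ==> x \<in> carrier M ==> a \<odot>\<^bsub>M\<^esub> x \<in> carrier M"
    and assoc: "\<And>x y z. x \<in> carrier M ==> y \<in> carrier M ==> z \<in> carrier M
        ==> (x \<oplus>\<^bsub>M\<^esub> y) \<oplus>\<^bsub>M\<^esub> z = x \<oplus>\<^bsub>M\<^esub> (y \<oplus>\<^bsub>M\<^esub> z)"
    and comm: "\<And>x y. x \<in> carrier M ==> y \<in> carrier M ==> x \<oplus>\<^bsub>M\<^esub> y = y \<oplus>\<^bsub>M\<^esub> x"
    and l_zero: "\<And>x. x \<in> carrier M ==> \<zero>\<^bsub>M\<^esub> \<oplus>\<^bsub>M\<^esub> x = x"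
    and l_distr: "\<And>a b x. a \<in> carrier A ==> b \<in> carrier A ==> x \<in> carrier M
        ==> (a \<oplus> b) \<odot>\<^bsub>M\<^esub> x = a \<odot>\<^bsub>M\<^esub> x \<oplus>\<^bsub>M\<^esub> b \<odot>\<^bsub>M\<^esub> x"
    and r_distr: "\<And>a x y. a \<in> carrier A ==> x \<in> carrier M ==> y \<in> carrier M
        ==> a \<odot>\<^bsub>M\<^esub> (x \<oplus>\<^bsub>M\<^esub> y) = a \<odot>\<^bsub>M\<^esub> x \<oplus>\<^bsub>M\<^esub> a \<odot>\<^bsub>M\<^esub> y"
    and smult_assoc: "\<And>a b x. a \<in> carrier A ==> b \<in> carrier A ==> x \<in> carrier M
        ==> (a \<otimes> b) \<odot>\<^bsub>M\<^esub> x = a \<odot>\<^bsub>M\<^esub> (b \<odot>\<^bsub>M\<^esub> x)"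
    and one: "\<And>x. x \<in> carrier M ==> \<one> \<odot>\<^bsub>M\<^esub> x = x"
    and null: "\<And>x. x \<in> carrier M ==> \<zero> \<odot>\<^bsub>M\<^esub> x = \<zero>\<^bsub>M\<^esub>"
  shows "module A M"
proof (rule moduleI)
  show "abelian_group M"
  proof (rule abelian_groupI)
    fix x assume x: "x \<in> carrier M"
    have "(\<ominus> \<one>) \<odot>\<^bsub>M\<^esub> x \<oplus>\<^bsub>M\<^esub> \<one> \<odot>\<^bsub>M\<^esub> x = (\<ominus> \<one> \<oplus> \<one>) \<odot>\<^bsub>M\<^esub> x"
      using x by (intro l_distr[symmetric]) auto
    also have "\<dots> = \<zero>\<^bsub>M\<^esub>" using x by (simp add: l_neg null)
    finally show "\<exists>y\<in>carrier M. y \<oplus>\<^bsub>M\<^esub> x = \<zero>\<^bsub>M\<^esub>"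
      using x by (intro bexI[of _ "(\<ominus> \<one>) \<odot>\<^bsub>M\<^esub> x"]) (auto simp: one smult)
  qed (use assms in auto)
qed (use assms is_cring in auto)

subsection \<open>Homomorphisms\<close>

lemma mod_homI:
  assumes "\<And>x. x \<in> carrier M ==> f x \<in> carrier N"
    and "\<And>x y. x \<in> carrier M ==> y \<in> carrier M ==> f (x \<oplus>\<^bsub>M\<^esub> y) = f x \<oplus>\<^bsub>N\<^esub> f y"
    and "\<And>a x. a \<in> carrier A ==> x \<in> carrier M ==> f (a \<odot>\<^bsub>M\<^esub> x) = a \<odot>\<^bsub>N\<^esub> f x"
  shows "f \<in> Hom M N"
  using assms by (auto simp: mod_hom_def)

lemma hom_closed: "f \<in> Hom M N ==> x \<in> carrier M ==> f x \<in> carrier N"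
  by (auto simp: mod_hom_def)

lemma hom_add:
  "f \<in> Hom M N ==> x \<in> carrier M ==> y \<in> carrier M ==> f (x \<oplus>\<^bsub>M\<^esub> y) = f x \<oplus>\<^bsub>N\<^esub> f y"
  by (auto simp: mod_hom_def)

lemma hom_smult:
  "f \<in> Hom M N ==> a \<in> carrier A ==> x \<in> carrier M ==> f (a \<odot>\<^bsub>M\<^esub> x) = a \<odot>\<^bsub>N\<^esub> f x"
  by (auto simp: mod_hom_def)

lemma hom_zero:
  assumes "f \<in> Hom M N" "module A M" "module A N"
  shows "f \<zero>\<^bsub>M\<^esub> = \<zero>\<^bsub>N\<^esub>"
proof -
  have "f (\<zero> \<odot>\<^bsub>M\<^esub> \<zero>\<^bsub>M\<^esub>) = \<zero> \<odot>\<^bsub>N\<^esub> f \<zero>\<^bsub>M\<^esub>"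
    using assms by (intro hom_smult) auto
  then show ?thesis
    using assms by (simp add: hom_closed)
qed

lemma hom_neg:
  assumes "f \<in> Hom M N" "module A M" "module A N" "x \<in> carrier M"
  shows "f (\<ominus>\<^bsub>M\<^esub> x) = \<ominus>\<^bsub>N\<^esub> f x"
  using assms by (simp add: mod_neg_eq_smult hom_smult hom_closed)

lemma hom_diff:
  assumes "f \<in> Hom M N" "module A M" "module A N" "x \<in> carrier M" "y \<in> carrier M"
  shows "f (x \<ominus>\<^bsub>M\<^esub> y) = f x \<ominus>\<^bsub>N\<^esub> f y"
  using assms by (simp add: a_minus_def hom_add hom_neg)

lemma hom_finsum:
  assumes "f \<in> Hom M N" "module A M" "module A N" "\<And>i. i \<in> I ==> g i \<in> carrier M"
  shows "f (finsum M g I) = finsum N (\<lambda>i. f (g i)) I"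
proof -
  interpret M: abelian_group M using assms(2) by (rule mod_abelian_group)
  interpret N: abelian_group N using assms(3) by (rule mod_abelian_group)
  show ?thesis
    using assms(4)
  proof (induction I rule: infinite_finite_induct)
    case (infinite I)
    then show ?case using hom_zero[OF assms(1-3)] by (simp add: M.finsum_infinite N.finsum_infinite)
  next
    case empty
    then show ?case using hom_zero[OF assms(1-3)] by simp
  next
    case (insert i I)
    then show ?case
      using hom_closed[OF assms(1)] hom_add[OF assms(1)]
      by (subst M.finsum_insert, simp, simp, force, force, subst N.finsum_insert) (auto intro!: mod_finsum_closed assms)
  qed
qed

lemma hom_id: "(\<lambda>x. x) \<in> Hom M M"
  by (auto simp: mod_hom_def)

lemma hom_comp: "f \<in> Hom M N ==> g \<in> Hom N P ==> (\<lambda>x. g (f x)) \<in> Hom M P"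
  by (auto simp: mod_hom_def Pi_iff)

lemma hom_const_zero: "module A N ==> (\<lambda>x. \<zero>\<^bsub>N\<^esub>) \<in> Hom M N"
  by (auto simp: mod_hom_def)

lemma hom_plus:
  assumes "f \<in> Hom M N" "g \<in> Hom M N" "module A M" "module A N"
  shows "(\<lambda>x. f x \<oplus>\<^bsub>N\<^esub> g x) \<in> Hom M N"
proof (rule mod_homI)
  note [simp] = hom_closed[OF assms(1)] hom_closed[OF assms(2)] assms(3,4)
  fix x y assume [simp]: "x \<in> carrier M" "y \<in> carrier M"
  show "f (x \<oplus>\<^bsub>M\<^esub> y) \<oplus>\<^bsub>N\<^esub> g (x \<oplus>\<^bsub>M\<^esub> y) = (f x \<oplus>\<^bsub>N\<^esub> g x) \<oplus>\<^bsub>N\<^esub> (f y \<oplus>\<^bsub>N\<^esub> g y)"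
    by (simp add: hom_add[OF assms(1)] hom_add[OF assms(2)] mod_add_assoc mod_add_lcomm)
qed (use assms in \<open>auto simp: hom_closed hom_smult module.smult_r_distr\<close>)

lemma hom_scale:
  assumes "a \<in> carrier A" "f \<in> Hom M N" "module A M" "module A N"
  shows "(\<lambda>x. a \<odot>\<^bsub>N\<^esub> f x) \<in> Hom M N"
proof (rule mod_homI)
  fix b x assume "b \<in> carrier A" "x \<in> carrier M"
  then show "a \<odot>\<^bsub>N\<^esub> f (b \<odot>\<^bsub>M\<^esub> x) = b \<odot>\<^bsub>N\<^esub> (a \<odot>\<^bsub>N\<^esub> f x)"
    using assms by (simp add: hom_smult hom_closed module.smult_assoc1[symmetric] m_comm)
qed (use assms in \<open>auto simp: hom_closed hom_add module.smult_r_distr\<close>)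

lemma hom_minus:
  assumes "f \<in> Hom M N" "g \<in> Hom M N" "module A M" "module A N"
  shows "(\<lambda>x. f x \<ominus>\<^bsub>N\<^esub> g x) \<in> Hom M N"
proof (rule mod_homI)
  note [simp] = hom_closed[OF assms(1)] hom_closed[OF assms(2)] assms(3,4)
  note eq = a_minus_def mod_neg_eq_smult
  fix x y assume [simp]: "x \<in> carrier M" "y \<in> carrier M"
  show "f (x \<oplus>\<^bsub>M\<^esub> y) \<ominus>\<^bsub>N\<^esub> g (x \<oplus>\<^bsub>M\<^esub> y) = (f x \<ominus>\<^bsub>N\<^esub> g x) \<oplus>\<^bsub>N\<^esub> (f y \<ominus>\<^bsub>N\<^esub> g y)"
    using hom_add[OF hom_plus[OF assms(1) hom_scale[OF _ assms(2)]], of "\<ominus> \<one>" x y]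
    by (simp add: eq)
next
  note [simp] = hom_closed[OF assms(1)] hom_closed[OF assms(2)] assms(3,4)
  note eq = a_minus_def mod_neg_eq_smult
  fix a x assume [simp]: "x \<in> carrier M" "a \<in> carrier A"
  show "f (a \<odot>\<^bsub>M\<^esub> x) \<ominus>\<^bsub>N\<^esub> g (a \<odot>\<^bsub>M\<^esub> x) = a \<odot>\<^bsub>N\<^esub> (f x \<ominus>\<^bsub>N\<^esub> g x)"
    using hom_smult[OF hom_plus[OF assms(1) hom_scale[OF _ assms(2)]], of "\<ominus> \<one>" a x]
    by (simp add: eq)
qed (use assms in \<open>auto simp: hom_closed\<close>)

lemma hom_cong:
  assumes "f \<in> Hom M N" "\<And>x. x \<in> carrier M ==> g x = f x" "module A M"
  shows "g \<in> Hom M N"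
  using assms by (auto simp: mod_hom_def Pi_iff)

lemma hom_inv_into:
  assumes f: "f \<in> Hom M N" and b: "bij_betw f (carrier M) (carrier N)" and M: "module A M"
  shows "inv_into (carrier M) f \<in> Hom N M"
proof (rule mod_homI)
  have inv: "inv_into (carrier M) f y \<in> carrier M" "f (inv_into (carrier M) f y) = y" if "y \<in> carrier N" for y
    using b that by (auto simp: bij_betw_def inv_into_into f_inv_into_f)
  have eq: "inv_into (carrier M) f (f x) = x" if "x \<in> carrier M" for x
    using b that by (auto simp: bij_betw_def)
  show "inv_into (carrier M) f x \<in> carrier M" if "x \<in> carrier N" for x using inv that by auto
  show "inv_into (carrier M) f (x \<oplus>\<^bsub>N\<^esub> y) = inv_into (carrier M) f x \<oplus>\<^bsub>M\<^esub> inv_into (carrier M) f y"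
    if "x \<in> carrier N" "y \<in> carrier N" for x y
    using eq[of "inv_into (carrier M) f x \<oplus>\<^bsub>M\<^esub> inv_into (carrier M) f y"] inv that hom_add[OF f] M by simp
  show "inv_into (carrier M) f (a \<odot>\<^bsub>N\<^esub> x) = a \<odot>\<^bsub>M\<^esub> inv_into (carrier M) f x"
    if "a \<in> carrier A" "x \<in> carrier N" for a x
    using eq[of "a \<odot>\<^bsub>M\<^esub> inv_into (carrier M) f x"] inv that hom_smult[OF f] M by simp
qed

lemma hom_inj_onI:
  assumes "f \<in> Hom M N" "module A M" "module A N"
    and "\<And>x. x \<in> carrier M ==> f x = \<zero>\<^bsub>N\<^esub> ==> x = \<zero>\<^bsub>M\<^esub>"
  shows "inj_on f (carrier M)"
proof (rule inj_onI)
  fix x y assume xy: "x \<in> carrier M" "y \<in> carrier M" "f x = f y"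
  then have "f (x \<ominus>\<^bsub>M\<^esub> y) = \<zero>\<^bsub>N\<^esub>"
    using assms by (simp add: hom_diff hom_closed)
  then show "x = y" using assms(4)[of "x \<ominus>\<^bsub>M\<^esub> y"] xy assms(2) by (simp add: mod_diff_eq_zero_iff)
qed

subsection \<open>Submodules and generation\<close>

lemma submodI:
  assumes "module A M" "H \<subseteq> carrier M" "\<zero>\<^bsub>M\<^esub> \<in> H"
    and "\<And>x y. x \<in> H ==> y \<in> H ==> x \<oplus>\<^bsub>M\<^esub> y \<in> H"
    and smult: "\<And>a x. a \<in> carrier A ==> x \<in> H ==> a \<odot>\<^bsub>M\<^esub> x \<in> H"
  shows "submodule H A M"
proof (rule module.submoduleI[OF assms(1)])
  show "\<ominus>\<^bsub>M\<^esub> x \<in> H" if "x \<in> H" for x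
    using smult[of "\<ominus> \<one>" x] that mod_neg_eq_smult[OF assms(1), of x] assms(2) by fastforce
qed (use assms in blast)+

lemma submod_subset: "submodule H A M ==> module A M ==> x \<in> H ==> x \<in> carrier M"
  by (meson module.submoduleE(1) subsetD)

lemma submod_add: "submodule H A M ==> module A M ==> x \<in> H ==> y \<in> H ==> x \<oplus>\<^bsub>M\<^esub> y \<in> H"
  by (rule module.submoduleE(5))

lemma submod_smult: "submodule H A M ==> module A M ==> a \<in> carrier A ==> x \<in> H ==> a \<odot>\<^bsub>M\<^esub> x \<in> H"
  by (rule module.submoduleE(4))

lemma submod_zero: "submodule H A M ==> module A M ==> \<zero>\<^bsub>M\<^esub> \<in> H"
proof -
  assume *: "submodule H A M" "module A M"
  then obtain x where x: "x \<in> H" using module.submoduleE(2)[OF *(2,1)] by blast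
  then show "\<zero>\<^bsub>M\<^esub> \<in> H"
    using submod_smult[OF * zero_closed x] submod_subset[OF * x] *(2) by simp
qed

lemma submod_neg: "submodule H A M ==> module A M ==> x \<in> H ==> \<ominus>\<^bsub>M\<^esub> x \<in> H"
  by (rule module.submoduleE(3))

lemma submod_diff: "submodule H A M ==> module A M ==> x \<in> H ==> y \<in> H ==> x \<ominus>\<^bsub>M\<^esub> y \<in> H"
  by (simp add: a_minus_def submod_add submod_neg)

lemma submod_finsum:
  assumes "submodule H A M" "module A M" "\<And>i. i \<in> I ==> f i \<in> H"
  shows "finsum M f I \<in> H"
proof -
  interpret M: abelian_group M using assms(2) by (rule mod_abelian_group)
  show ?thesis using assms(3)
  proof (induction I rule: infinite_finite_induct)
    case (infinite I)
    then show ?case using submod_zero assms(1,2) by (simp add: M.finsum_infinite)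
  next
    case empty
    then show ?case using submod_zero assms(1,2) by simp
  next
    case (insert i I)
    then show ?case
      using submod_subset[OF assms(1,2)]
      by (subst M.finsum_insert) (auto intro: submod_add[OF assms(1,2)])
  qed
qed

lemma submod_carrier: "module A M ==> submodule (carrier M) A M"
  by (rule module.carrier_is_submodule)

lemma submod_image:
  assumes "f \<in> Hom M N" "module A M" "module A N" "submodule H A M"
  shows "submodule (f ` H) A N"
proof (rule submodI[OF assms(3)])
  note sub = submod_subset[OF assms(4,2)]
  show "f ` H \<subseteq> carrier N" using sub hom_closed[OF assms(1)] by auto
  show "\<zero>\<^bsub>N\<^esub> \<in> f ` H"
    using submod_zero[OF assms(4,2)] hom_zero[OF assms(1-3)] by (metis image_eqI)
  fix x y assume "x \<in> f ` H" "y \<in> f ` H"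
  then show "x \<oplus>\<^bsub>N\<^esub> y \<in> f ` H"
    using sub hom_add[OF assms(1)] submod_add[OF assms(4,2)] by (auto simp: image_iff) metis
next
  note sub = submod_subset[OF assms(4,2)]
  fix a x assume "a \<in> carrier A" "x \<in> f ` H"
  then show "a \<odot>\<^bsub>N\<^esub> x \<in> f ` H"
    using sub hom_smult[OF assms(1)] submod_smult[OF assms(4,2)] by (auto simp: image_iff) metis
qed

lemma submod_vimage:
  assumes "f \<in> Hom M N" "module A M" "module A N" "submodule H A N"
  shows "submodule {x \<in> carrier M. f x \<in> H} A M"
  using assms
  by (intro submodI) (auto simp: hom_zero submod_zero hom_add submod_add hom_smult submod_smult)

lemma submod_trivial: "module A M ==> submodule {\<zero>\<^bsub>M\<^esub>} A M"
  by (intro submodI) auto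

lemma submod_kernel:
  assumes "f \<in> Hom M N" "module A M" "module A N"
  shows "submodule {x \<in> carrier M. f x = \<zero>\<^bsub>N\<^esub>} A M"
  using submod_vimage[OF assms submod_trivial[OF assms(3)]] by simp

lemma submod_equalizer:
  assumes "f \<in> Hom M N" "g \<in> Hom M N" "module A M" "module A N"
  shows "submodule {x \<in> carrier M. f x = g x} A M"
  using assms
  by (intro submodI) (auto simp: hom_zero hom_add hom_smult)

lemma submod_Int:
  assumes "submodule H A M" "submodule K A M" "module A M"
  shows "submodule (H \<inter> K) A M"
  using assms by (intro submodI) (auto simp: submod_subset submod_zero submod_add submod_smult)

lemma submod_plus:
  assumes "submodule H A M" "submodule K A M" "module A M"
  shows "submodule {x \<in> carrier M. \<exists>k\<in>K. x \<ominus>\<^bsub>M\<^esub> k \<in> H} A M"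
proof (rule submodI[OF assms(3)], goal_cases)
  case 1 then show ?case by auto
next
  case 2 show ?case
    using assms by (auto intro!: bexI[OF _ submod_zero[OF assms(2,3)]] submod_zero)
next
  case (3 x y)
  then obtain k l where kl: "k \<in> K" "x \<ominus>\<^bsub>M\<^esub> k \<in> H" "l \<in> K" "y \<ominus>\<^bsub>M\<^esub> l \<in> H" "x \<in> carrier M" "y \<in> carrier M" by auto
  have c: "k \<in> carrier M" "l \<in> carrier M" using kl submod_subset[OF assms(2,3)] by auto
  have "(x \<oplus>\<^bsub>M\<^esub> y) \<ominus>\<^bsub>M\<^esub> (k \<oplus>\<^bsub>M\<^esub> l) = (x \<ominus>\<^bsub>M\<^esub> k) \<oplus>\<^bsub>M\<^esub> (y \<ominus>\<^bsub>M\<^esub> l)"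
    using kl c assms(3) by (simp add: a_minus_def mod_neg_eq_smult module.smult_r_distr mod_add_assoc mod_add_lcomm)
  then show ?case
    using kl c submod_add[OF assms(1,3) kl(2,4)] submod_add[OF assms(2,3) kl(1,3)] assms(3)
    by (auto intro!: bexI[of _ "k \<oplus>\<^bsub>M\<^esub> l"])
next
  case (4 a x)
  then obtain k where kl: "k \<in> K" "x \<ominus>\<^bsub>M\<^esub> k \<in> H" "x \<in> carrier M" by auto
  have c: "k \<in> carrier M" using kl submod_subset[OF assms(2,3)] by auto
  have "a \<odot>\<^bsub>M\<^esub> x \<ominus>\<^bsub>M\<^esub> a \<odot>\<^bsub>M\<^esub> k = a \<odot>\<^bsub>M\<^esub> (x \<ominus>\<^bsub>M\<^esub> k)"
    using kl c assms(3) 4 by (simp add: a_minus_def module.smult_r_distr module.smult_r_minus)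
  then show ?case
    using kl c 4 submod_smult[OF assms(1,3), of a "x \<ominus>\<^bsub>M\<^esub> k"] submod_smult[OF assms(2,3), of a k] assms(3)
    by (auto intro!: bexI[of _ "a \<odot>\<^bsub>M\<^esub> k"])
qed

definition mod_span :: "('a, 'm) module => 'm set => 'm set" where
  "mod_span M S = \<Inter>{H. submodule H A M \<and> S \<subseteq> H}"

lemma mod_span_least: "submodule H A M ==> S \<subseteq> H ==> mod_span M S \<subseteq> H"
  by (auto simp: mod_span_def)

lemma mod_span_superset: "S \<subseteq> mod_span M S"
  by (auto simp: mod_span_def)

lemma submod_mod_span:
  assumes "module A M" "S \<subseteq> carrier M"
  shows "submodule (mod_span M S) A M"
proof (rule submodI[OF assms(1)])
  show "mod_span M S \<subseteq> carrier M"
    using assms by (intro mod_span_least submod_carrier)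
qed (use assms in \<open>auto simp: mod_span_def submod_zero submod_add submod_smult\<close>)

lemma mod_span_mono: "S \<subseteq> T ==> mod_span M S \<subseteq> mod_span M T"
  by (auto simp: mod_span_def)

definition fin_gen :: "('a, 'm) module => 'm set => bool" where
  "fin_gen M H \<longleftrightarrow> (\<exists>G. finite G \<and> G \<subseteq> carrier M \<and> H = mod_span M G)"

lemma fin_gen_image:
  assumes f: "f \<in> Hom M N" and M: "module A M" and N: "module A N" and H: "fin_gen M H"
  shows "fin_gen N (f ` H)"
proof -
  obtain G where G: "finite G" "G \<subseteq> carrier M" "H = mod_span M G" using H by (auto simp: fin_gen_def)
  have "f ` H = mod_span N (f ` G)"
  proof
    have sub: "f ` G \<subseteq> carrier N" using G hom_closed[OF f] by auto
    have "H \<subseteq> {x \<in> carrier M. f x \<in> mod_span N (f ` G)}"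
      unfolding G(3) using G(2) sub mod_span_superset[of "f ` G" N]
      by (intro mod_span_least submod_vimage[OF f M N] submod_mod_span N) auto
    then show "f ` H \<subseteq> mod_span N (f ` G)" by auto
    show "mod_span N (f ` G) \<subseteq> f ` H"
      unfolding G(3) using G(2) mod_span_superset[of G M]
      by (intro mod_span_least submod_image[OF f M N] submod_mod_span M) auto
  qed
  moreover have "f ` G \<subseteq> carrier N" using G hom_closed[OF f] by auto
  ultimately show ?thesis using G(1) by (auto simp: fin_gen_def)
qed

lemma fin_gen_module_iff:
  assumes M: "module A M"
  shows "fin_gen_module A M \<longleftrightarrow> fin_gen M (carrier M)"
proof
  assume "fin_gen_module A M"
  then obtain G where G: "G \<subseteq> carrier M" "finite G"
    and c: "\<And>x. x \<in> carrier M ==> \<exists>c\<in>G \<rightarrow> carrier A. x = (\<Oplus>\<^bsub>M\<^esub>g\<in>G. c g \<odot>\<^bsub>M\<^esub> g)"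
    unfolding fin_gen_module_def by blast
  have S: "submodule (mod_span M G) A M" using M G(1) by (rule submod_mod_span)
  have "carrier M \<subseteq> mod_span M G"
  proof
    fix x assume "x \<in> carrier M"
    then obtain c where "c \<in> G \<rightarrow> carrier A" "x = (\<Oplus>\<^bsub>M\<^esub>g\<in>G. c g \<odot>\<^bsub>M\<^esub> g)" using c by blast
    then show "x \<in> mod_span M G"
      using mod_span_superset[of G M] by (auto intro!: submod_finsum[OF S M] submod_smult[OF S M] simp: Pi_iff subset_iff simp del: mod_finsum_closed)
  qed
  moreover have "mod_span M G \<subseteq> carrier M" using submod_subset[OF S M] by auto
  ultimately show "fin_gen M (carrier M)" using G by (auto simp: fin_gen_def)
next
  assume "fin_gen M (carrier M)"
  then obtain G where G: "finite G" "G \<subseteq> carrier M" "carrier M = mod_span M G" by (auto simp: fin_gen_def)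
  interpret M: abelian_group M using M by (rule mod_abelian_group)
  let ?H = "{x. \<exists>c\<in>G \<rightarrow> carrier A. x = (\<Oplus>\<^bsub>M\<^esub>g\<in>G. c g \<odot>\<^bsub>M\<^esub> g)}"
  have sub: "submodule ?H A M"
  proof (rule submodI[OF M], goal_cases)
    case 1 then show ?case using G(2) M by (auto intro!: mod_finsum_closed simp: Pi_iff subset_iff)
  next
    case 2
    have "(\<Oplus>\<^bsub>M\<^esub>g\<in>G. \<zero> \<odot>\<^bsub>M\<^esub> g) = \<zero>\<^bsub>M\<^esub>"
      using G(1,2) M by (intro M.add.finprod_one_eqI) (auto simp: subset_iff)
    then show ?case by (auto intro!: bexI[of _ "\<lambda>_. \<zero>"])
  next
    case (3 x y)
    then obtain c d where cd: "c \<in> G \<rightarrow> carrier A" "d \<in> G \<rightarrow> carrier A"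
      "x = (\<Oplus>\<^bsub>M\<^esub>g\<in>G. c g \<odot>\<^bsub>M\<^esub> g)" "y = (\<Oplus>\<^bsub>M\<^esub>g\<in>G. d g \<odot>\<^bsub>M\<^esub> g)" by auto
    have "(\<Oplus>\<^bsub>M\<^esub>g\<in>G. (c g \<oplus> d g) \<odot>\<^bsub>M\<^esub> g) = (\<Oplus>\<^bsub>M\<^esub>g\<in>G. c g \<odot>\<^bsub>M\<^esub> g \<oplus>\<^bsub>M\<^esub> d g \<odot>\<^bsub>M\<^esub> g)"
      using cd G(1,2) M by (intro M.finsum_cong') (auto simp: module.smult_l_distr Pi_iff subset_iff)
    also have "\<dots> = x \<oplus>\<^bsub>M\<^esub> y"
      unfolding cd(3,4) using cd G(1,2) M by (intro M.finsum_addf) (auto simp: Pi_iff subset_iff)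
    finally show ?case
      using cd by (intro CollectI bexI[of _ "\<lambda>g. c g \<oplus> d g"]) auto
  next
    case (4 a x)
    then obtain c where c: "c \<in> G \<rightarrow> carrier A" "x = (\<Oplus>\<^bsub>M\<^esub>g\<in>G. c g \<odot>\<^bsub>M\<^esub> g)" by auto
    have "a \<odot>\<^bsub>M\<^esub> x = (\<Oplus>\<^bsub>M\<^esub>g\<in>G. a \<odot>\<^bsub>M\<^esub> (c g \<odot>\<^bsub>M\<^esub> g))"
      unfolding c(2) using c G(1,2) M 4 by (intro module.finsum_smult_ldistr) (auto simp: Pi_iff subset_iff)
    also have "\<dots> = (\<Oplus>\<^bsub>M\<^esub>g\<in>G. (a \<otimes> c g) \<odot>\<^bsub>M\<^esub> g)"
      using c G(1,2) M 4 by (intro M.finsum_cong') (auto simp: module.smult_assoc1 Pi_iff subset_iff)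
    finally show ?case
      using c 4 by (intro CollectI bexI[of _ "\<lambda>g. a \<otimes> c g"]) auto
  qed
  have "g \<in> ?H" if g: "g \<in> G" for g
  proof -
    have "(\<Oplus>\<^bsub>M\<^esub>h\<in>G. (if h = g then \<one> else \<zero>) \<odot>\<^bsub>M\<^esub> h) = (\<Oplus>\<^bsub>M\<^esub>h\<in>G. if g = h then h else \<zero>\<^bsub>M\<^esub>)"
      using G(1,2) M by (intro M.finsum_cong') (auto simp: subset_iff)
    also have "\<dots> = g"
      using G(1,2) g M by (intro M.finsum_singleton) auto
    finally show ?thesis by (auto intro!: bexI[of _ "\<lambda>h. if h = g then \<one> else \<zero>"])
  qed
  then have "carrier M \<subseteq> ?H"
    unfolding G(3) by (intro mod_span_least[OF sub]) auto
  then show "fin_gen_module A M"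
    unfolding fin_gen_module_def using G(1,2) by (intro exI[of _ G]) auto
qed

end

section \<open>Direct sums and free modules\<close>

lemma dsum_simps:
  "carrier (dsum_module I M) = {f \<in> (\<Pi>\<^sub>E i\<in>I. carrier (M i)). finite {i\<in>I. f i \<noteq> \<zero>\<^bsub>M i\<^esub>}}"
  "\<zero>\<^bsub>dsum_module I M\<^esub> = (\<lambda>i\<in>I. \<zero>\<^bsub>M i\<^esub>)"
  "f \<oplus>\<^bsub>dsum_module I M\<^esub> g = (\<lambda>i\<in>I. f i \<oplus>\<^bsub>M i\<^esub> g i)"
  "a \<odot>\<^bsub>dsum_module I M\<^esub> f = (\<lambda>i\<in>I. a \<odot>\<^bsub>M i\<^esub> f i)"
  by (simp_all add: dsum_module_def)

lemma dsum_eqI: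
  assumes "f \<in> carrier (dsum_module I M)" "g \<in> carrier (dsum_module I M)" "\<And>i. i \<in> I ==> f i = g i"
  shows "f = g"
  using assms by (auto simp: dsum_simps intro: PiE_ext)

lemma dsum_component: "f \<in> carrier (dsum_module I M) ==> i \<in> I ==> f i \<in> carrier (M i)"
  by (auto simp: dsum_simps)

definition dsingle :: "('i => ('a, 'm) module) => 'i set => 'i => 'm => 'i => 'm" where
  "dsingle M I i x = (\<lambda>j\<in>I. if j = i then x else \<zero>\<^bsub>M j\<^esub>)"

text \<open>The map out of a direct sum given by a family of maps out of the summands. The sum runs over the
  support only, because \<open>finsum\<close> over an infinite set is meaningless.\<close>

definition dsum_elim ::
  "('i => ('a, 'm) module) => ('a, 'n) module => 'i set => ('i => 'm => 'n) => ('i => 'm) => 'n" where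
  "dsum_elim M N I g f = finsum N (\<lambda>i. g i (f i)) {i\<in>I. f i \<noteq> \<zero>\<^bsub>M i\<^esub>}"

definition dsum_map ::
  "'i set => ('i => 'm => 'n) => ('i => 'm) => 'i => 'n" where
  "dsum_map I g f = (\<lambda>i\<in>I. g i (f i))"

context ground_ring
begin

lemma module_dsum:
  assumes "\<And>i. i \<in> I ==> module A (M i)"
  shows "module A (dsum_module I M)"
proof (rule ground_moduleI, goal_cases)
  case (1 x y)
  have "{i \<in> I. x i \<oplus>\<^bsub>M i\<^esub> y i \<noteq> \<zero>\<^bsub>M i\<^esub>} \<subseteq> {i \<in> I. x i \<noteq> \<zero>\<^bsub>M i\<^esub>} \<union> {i \<in> I. y i \<noteq> \<zero>\<^bsub>M i\<^esub>}"
    using assms by auto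
  from finite_subset[OF this] 1 show ?case
    using assms by (auto simp: dsum_simps PiE_iff cong: conj_cong)
next
  case (3 a x)
  have "{i \<in> I. a \<odot>\<^bsub>M i\<^esub> x i \<noteq> \<zero>\<^bsub>M i\<^esub>} \<subseteq> {i \<in> I. x i \<noteq> \<zero>\<^bsub>M i\<^esub>}"
    using assms 3 by auto
  from finite_subset[OF this] 3 show ?case
    using assms by (auto simp: dsum_simps PiE_iff cong: conj_cong)
qed (use assms in \<open>auto simp: dsum_simps PiE_iff mod_add_assoc mod_add_comm mod_add_lcomm mod_l_distr mod_r_distr
      mod_smult_assoc extensional_def fun_eq_iff cong: conj_cong\<close>)

lemma dsingle_hom:
  assumes "\<And>i. i \<in> I ==> module A (M i)" "i \<in> I"
  shows "dsingle M I i \<in> Hom (M i) (dsum_module I M)"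
proof (rule mod_homI, goal_cases)
  case (1 x)
  have "{j \<in> I. (if j = i then x else \<zero>\<^bsub>M j\<^esub>) \<noteq> \<zero>\<^bsub>M j\<^esub>} \<subseteq> {i}" by auto
  from finite_subset[OF this] 1 assms show ?case
    by (auto simp: dsingle_def dsum_simps cong: conj_cong)
qed (use assms in \<open>auto simp: dsingle_def dsum_simps fun_eq_iff\<close>)

lemma dsingle_apply: "i \<in> I ==> j \<in> I ==> dsingle M I i x j = (if j = i then x else \<zero>\<^bsub>M j\<^esub>)"
  by (simp add: dsingle_def)

lemma dproj_hom: "i \<in> I ==> (\<lambda>f. f i) \<in> Hom (dsum_module I M) (M i)"
  by (auto simp: mod_hom_def dsum_simps)

lemma dsum_elim_support:
  assumes M: "\<And>i. i \<in> I ==> module A (M i)" and N: "module A N"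
    and g: "\<And>i. i \<in> I ==> g i \<in> Hom (M i) N"
    and f: "f \<in> carrier (dsum_module I M)"
    and K: "finite K" "K \<subseteq> I" "{i\<in>I. f i \<noteq> \<zero>\<^bsub>M i\<^esub>} \<subseteq> K"
  shows "dsum_elim M N I g f = finsum N (\<lambda>i. g i (f i)) K"
proof -
  interpret N: abelian_group N using N by (rule mod_abelian_group)
  show ?thesis
    unfolding dsum_elim_def
  proof (rule N.add.finprod_mono_neutral_cong_left)
    show "g i (f i) = \<zero>\<^bsub>N\<^esub>" if "i \<in> K - {i\<in>I. f i \<noteq> \<zero>\<^bsub>M i\<^esub>}" for i
      using that K hom_zero[OF g M N] by auto
    show "(\<lambda>i. g i (f i)) \<in> K \<rightarrow> carrier N"
      using K hom_closed[OF g dsum_component[OF f]] by blast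
  qed (use K in auto)
qed

lemma dsum_elim_hom:
  assumes M: "\<And>i. i \<in> I ==> module A (M i)" and N: "module A N"
    and g: "\<And>i. i \<in> I ==> g i \<in> Hom (M i) N"
  shows "dsum_elim M N I g \<in> Hom (dsum_module I M) N"
proof (rule mod_homI)
  interpret N: abelian_group N using N by (rule mod_abelian_group)
  note DM = module_dsum[of I M, OF M]
  have cl: "g i (f i) \<in> carrier N" if "f \<in> carrier (dsum_module I M)" "i \<in> I" for f i
    using hom_closed[OF g dsum_component[OF that(1)]] that(2) by blast
  show "dsum_elim M N I g x \<in> carrier N" if "x \<in> carrier (dsum_module I M)" for x
    unfolding dsum_elim_def using N cl[OF that] by simp
  show "dsum_elim M N I g (x \<oplus>\<^bsub>dsum_module I M\<^esub> y) = dsum_elim M N I g x \<oplus>\<^bsub>N\<^esub> dsum_elim M N I g y"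
    if xy: "x \<in> carrier (dsum_module I M)" "y \<in> carrier (dsum_module I M)" for x y
  proof -
    let ?K = "{i\<in>I. x i \<noteq> \<zero>\<^bsub>M i\<^esub>} \<union> {i\<in>I. y i \<noteq> \<zero>\<^bsub>M i\<^esub>}"
    have fin: "finite ?K" using xy by (auto simp: dsum_simps)
    have "dsum_elim M N I g (x \<oplus>\<^bsub>dsum_module I M\<^esub> y) = finsum N (\<lambda>i. g i ((x \<oplus>\<^bsub>dsum_module I M\<^esub> y) i)) ?K"
      using mod_add_closed[OF DM xy] by (intro dsum_elim_support M N g fin) (auto simp: dsum_simps(3) M)
    also have "\<dots> = finsum N (\<lambda>i. g i (x i) \<oplus>\<^bsub>N\<^esub> g i (y i)) ?K"
    proof (rule N.finsum_cong')
      show "(\<lambda>i. g i (x i) \<oplus>\<^bsub>N\<^esub> g i (y i)) \<in> ?K \<rightarrow> carrier N" using cl xy by auto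
      show "g i ((x \<oplus>\<^bsub>dsum_module I M\<^esub> y) i) = g i (x i) \<oplus>\<^bsub>N\<^esub> g i (y i)" if "i \<in> ?K" for i
        using that hom_add[OF g, of i "x i" "y i"] dsum_component[OF xy(1)] dsum_component[OF xy(2)]
        by (auto simp: dsum_simps(3))
    qed simp
    also have "\<dots> = finsum N (\<lambda>i. g i (x i)) ?K \<oplus>\<^bsub>N\<^esub> finsum N (\<lambda>i. g i (y i)) ?K"
      using cl xy by (intro N.finsum_addf) auto
    also have "\<dots> = dsum_elim M N I g x \<oplus>\<^bsub>N\<^esub> dsum_elim M N I g y"
      using dsum_elim_support[OF M N g xy(1) fin] dsum_elim_support[OF M N g xy(2) fin] by auto
    finally show ?thesis .
  qed
  show "dsum_elim M N I g (a \<odot>\<^bsub>dsum_module I M\<^esub> x) = a \<odot>\<^bsub>N\<^esub> dsum_elim M N I g x"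
    if a: "a \<in> carrier A" and x: "x \<in> carrier (dsum_module I M)" for a x
  proof -
    let ?K = "{i\<in>I. x i \<noteq> \<zero>\<^bsub>M i\<^esub>}"
    have fin: "finite ?K" using x by (auto simp: dsum_simps)
    have "dsum_elim M N I g (a \<odot>\<^bsub>dsum_module I M\<^esub> x) = finsum N (\<lambda>i. g i ((a \<odot>\<^bsub>dsum_module I M\<^esub> x) i)) ?K"
      using mod_smult_closed[OF DM a x] a by (intro dsum_elim_support M N g fin) (auto simp: dsum_simps(4) M)
    also have "\<dots> = finsum N (\<lambda>i. a \<odot>\<^bsub>N\<^esub> g i (x i)) ?K"
    proof (rule N.finsum_cong')
      show "(\<lambda>i. a \<odot>\<^bsub>N\<^esub> g i (x i)) \<in> ?K \<rightarrow> carrier N" using cl x a N by auto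
      show "g i ((a \<odot>\<^bsub>dsum_module I M\<^esub> x) i) = a \<odot>\<^bsub>N\<^esub> g i (x i)" if "i \<in> ?K" for i
        using that hom_smult[OF g a, of i "x i"] dsum_component[OF x]
        by (auto simp: dsum_simps(4))
    qed simp
    also have "\<dots> = a \<odot>\<^bsub>N\<^esub> dsum_elim M N I g x"
      unfolding dsum_elim_def using cl x a N fin by (intro module.finsum_smult_ldistr[symmetric]) auto
    finally show ?thesis .
  qed
qed

lemma dsum_elim_single:
  assumes M: "\<And>i. i \<in> I ==> module A (M i)" and N: "module A N"
    and g: "\<And>i. i \<in> I ==> g i \<in> Hom (M i) N"
    and i: "i \<in> I" and x: "x \<in> carrier (M i)"
  shows "dsum_elim M N I g (dsingle M I i x) = g i x"
proof -
  interpret N: abelian_group N using N by (rule mod_abelian_group)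
  have "dsum_elim M N I g (dsingle M I i x) = finsum N (\<lambda>j. g j (dsingle M I i x j)) {i}"
    using hom_closed[OF dsingle_hom[of I M, OF M i] x] i
    by (intro dsum_elim_support M N g) (auto simp: dsingle_def split: if_splits)
  also have "\<dots> = g i x"
    using hom_closed[OF g x] i by (subst N.finsum_insert) (auto simp: dsingle_def)
  finally show ?thesis .
qed

text \<open>Removing one entry from the support and adding it back as a single-entry element allows
  induction on the size of the support.\<close>

lemma dsum_generated:
  assumes M: "\<And>i. i \<in> I ==> module A (M i)"
    and H: "submodule H A (dsum_module I M)"
    and single: "\<And>i x. i \<in> I ==> x \<in> carrier (M i) ==> dsingle M I i x \<in> H"
    and f: "f \<in> carrier (dsum_module I M)"
  shows "f \<in> H"
proof -
  note DM = module_dsum[of I M, OF M]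
  have "f \<in> H" if "finite K" "{i\<in>I. f i \<noteq> \<zero>\<^bsub>M i\<^esub>} = K" "f \<in> carrier (dsum_module I M)" for K f
    using that
  proof (induction K arbitrary: f rule: finite_induct)
    case empty
    then have "f = \<zero>\<^bsub>dsum_module I M\<^esub>"
      using mod_zero_closed[OF DM] by (intro dsum_eqI[of f I M]) (auto simp: dsum_simps(2))
    then show ?case using submod_zero[OF H DM] by simp
  next
    case (insert k K)
    then have k: "k \<in> I" "f k \<noteq> \<zero>\<^bsub>M k\<^esub>" by auto
    let ?s = "dsingle M I k (f k)"
    have s: "?s \<in> carrier (dsum_module I M)"
      by (rule hom_closed[OF dsingle_hom[of I M, OF M k(1)] dsum_component[OF insert(5) k(1)]])
    define g where "g = (\<lambda>i\<in>I. if i = k then \<zero>\<^bsub>M i\<^esub> else f i)"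
    have supp: "{i\<in>I. g i \<noteq> \<zero>\<^bsub>M i\<^esub>} = K"
      using insert(4) insert(2) by (auto simp: g_def split: if_splits)
    have g: "g \<in> carrier (dsum_module I M)"
    proof -
      have "g \<in> (\<Pi>\<^sub>E i\<in>I. carrier (M i))"
        using dsum_component[OF insert(5)] M by (auto simp: g_def)
      then show ?thesis using supp insert(1) by (simp add: dsum_simps(1))
    qed
    have "g \<in> H" using insert.IH[OF supp g] .
    moreover have "?s \<in> H"
      by (rule single[OF k(1) dsum_component[OF insert(5) k(1)]])
    moreover have "f = ?s \<oplus>\<^bsub>dsum_module I M\<^esub> g"
    proof (rule dsum_eqI[OF insert(5)])
      show "f i = (?s \<oplus>\<^bsub>dsum_module I M\<^esub> g) i" if "i \<in> I" for i
        using that M dsum_component[OF insert(5)] k(1) by (simp add: dsum_simps(3) dsingle_def g_def)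
      show "?s \<oplus>\<^bsub>dsum_module I M\<^esub> g \<in> carrier (dsum_module I M)"
        by (rule mod_add_closed[OF DM s g])
    qed
    ultimately show ?case using submod_add[OF H DM] by metis
  qed
  from this[OF _ refl f] f show ?thesis by (simp add: dsum_simps(1))
qed

lemma dsum_hom_ext:
  assumes M: "\<And>i. i \<in> I ==> module A (M i)" and N: "module A N"
    and "g \<in> Hom (dsum_module I M) N" "h \<in> Hom (dsum_module I M) N"
    and eq: "\<And>i x. i \<in> I ==> x \<in> carrier (M i) ==> g (dsingle M I i x) = h (dsingle M I i x)"
    and f: "f \<in> carrier (dsum_module I M)"
  shows "g f = h f"
proof -
  note DM = module_dsum[of I M, OF M]
  let ?E = "{f \<in> carrier (dsum_module I M). g f = h f}"
  have S: "submodule ?E A (dsum_module I M)"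
    by (rule submod_equalizer[OF assms(3,4) DM N])
  have single: "dsingle M I i x \<in> ?E" if ix: "i \<in> I" "x \<in> carrier (M i)" for i x
  proof -
    have "dsingle M I i x \<in> carrier (dsum_module I M)"
      by (rule hom_closed[OF dsingle_hom[of I M, OF M ix(1)] ix(2)])
    then show ?thesis using eq[OF ix] by simp
  qed
  have "f \<in> ?E"
    by (rule dsum_generated[OF M S single f])
  then show ?thesis by simp
qed

lemma dsum_map_hom:
  assumes "\<And>i. i \<in> I ==> module A (M i)" "\<And>i. i \<in> I ==> module A (N i)"
    and g: "\<And>i. i \<in> I ==> g i \<in> Hom (M i) (N i)"
  shows "dsum_map I g \<in> Hom (dsum_module I M) (dsum_module I N)"
proof (rule mod_homI, goal_cases)
  case (1 x)
  have "{i \<in> I. g i (x i) \<noteq> \<zero>\<^bsub>N i\<^esub>} \<subseteq> {i \<in> I. x i \<noteq> \<zero>\<^bsub>M i\<^esub>}"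
    using hom_zero[OF g] assms by auto
  from finite_subset[OF this] 1 show ?case
    using hom_closed[OF g] by (auto simp: dsum_map_def dsum_simps PiE_iff cong: conj_cong)
next
  case (2 x y)
  then show ?case using hom_add[OF g] by (auto simp: dsum_map_def dsum_simps PiE_iff)
next
  case (3 a x)
  then show ?case using hom_smult[OF g] by (auto simp: dsum_map_def dsum_simps PiE_iff)
qed

lemma dsum_map_single:
  assumes "\<And>i. i \<in> I ==> module A (M i)" "\<And>i. i \<in> I ==> module A (N i)"
    and g: "\<And>i. i \<in> I ==> g i \<in> Hom (M i) (N i)" and i: "i \<in> I"
  shows "dsum_map I g (dsingle M I i x) = dsingle N I i (g i x)"
  using hom_zero[OF g] assms by (auto simp: dsum_map_def dsingle_def)

lemma dsum_map_bij:
  assumes M: "\<And>i. i \<in> I ==> module A (M i)" and N: "\<And>i. i \<in> I ==> module A (N i)"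
    and g: "\<And>i. i \<in> I ==> g i \<in> Hom (M i) (N i)"
    and b: "\<And>i. i \<in> I ==> bij_betw (g i) (carrier (M i)) (carrier (N i))"
  shows "bij_betw (dsum_map I g) (carrier (dsum_module I M)) (carrier (dsum_module I N))"
proof -
  let ?h = "\<lambda>i. inv_into (carrier (M i)) (g i)"
  have h: "?h i \<in> Hom (N i) (M i)" if "i \<in> I" for i
    using hom_inv_into[OF g b M] that by blast
  show ?thesis
  proof (rule bij_betw_byWitness[where f' = "dsum_map I ?h"])
    show "\<forall>x\<in>carrier (dsum_module I M). dsum_map I ?h (dsum_map I g x) = x"
    proof
      fix x assume x: "x \<in> carrier (dsum_module I M)"
      have c: "dsum_map I ?h (dsum_map I g x) \<in> carrier (dsum_module I M)"
        using hom_closed[OF dsum_map_hom[of I N M ?h, OF N M h]]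
          hom_closed[OF dsum_map_hom[of I M N g, OF M N g] x] by blast
      show "dsum_map I ?h (dsum_map I g x) = x"
      proof (rule dsum_eqI[OF c x])
        show "dsum_map I ?h (dsum_map I g x) i = x i" if "i \<in> I" for i
          using that bij_betw_inv_into_left[OF b dsum_component[OF x]] by (simp add: dsum_map_def)
      qed
    qed
    show "\<forall>x\<in>carrier (dsum_module I N). dsum_map I g (dsum_map I ?h x) = x"
    proof
      fix x assume x: "x \<in> carrier (dsum_module I N)"
      have c: "dsum_map I g (dsum_map I ?h x) \<in> carrier (dsum_module I N)"
        using hom_closed[OF dsum_map_hom[of I M N g, OF M N g]]
          hom_closed[OF dsum_map_hom[of I N M ?h, OF N M h] x] by blast
      show "dsum_map I g (dsum_map I ?h x) = x"
      proof (rule dsum_eqI[OF c x])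
        show "dsum_map I g (dsum_map I ?h x) i = x i" if "i \<in> I" for i
          using that bij_betw_inv_into_right[OF b dsum_component[OF x]] by (simp add: dsum_map_def)
      qed
    qed
    show "dsum_map I g ` carrier (dsum_module I M) \<subseteq> carrier (dsum_module I N)"
      using hom_closed[OF dsum_map_hom[of I M N g, OF M N g]] by auto
    show "dsum_map I ?h ` carrier (dsum_module I N) \<subseteq> carrier (dsum_module I M)"
      using hom_closed[OF dsum_map_hom[of I N M ?h, OF N M h]] by auto
  qed
qed

lemma fin_gen_dsum:
  assumes M: "\<And>i. i \<in> I ==> module A (M i)"
    and fin: "finite {i \<in> I. \<not> trivial (M i)}"
    and fg: "\<And>i. i \<in> I ==> fin_gen (M i) (carrier (M i))"
  shows "fin_gen (dsum_module I M) (carrier (dsum_module I M))"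
proof -
  let ?D = "dsum_module I M"
  note DM = module_dsum[of I M, OF M]
  let ?K = "{i \<in> I. \<not> trivial (M i)}"
  obtain G where G: "\<And>i. i \<in> I ==> finite (G i) \<and> G i \<subseteq> carrier (M i) \<and> carrier (M i) = mod_span (M i) (G i)"
    using fg unfolding fin_gen_def by metis
  define S where "S = (\<Union>i\<in>?K. dsingle M I i ` G i)"
  have S: "finite S" "S \<subseteq> carrier ?D"
    using fin G hom_closed[OF dsingle_hom[of I M, OF M]] unfolding S_def by (blast, blast)
  have sub: "submodule (mod_span ?D S) A ?D" using DM S(2) by (rule submod_mod_span)
  have "carrier ?D \<subseteq> mod_span ?D S"
  proof
    fix f assume f: "f \<in> carrier ?D"
    show "f \<in> mod_span ?D S"
    proof (rule dsum_generated[OF M sub _ f])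
      fix i x assume i: "i \<in> I" and x: "x \<in> carrier (M i)"
      note dh = dsingle_hom[of I M, OF M i]
      show "dsingle M I i x \<in> mod_span ?D S"
      proof (cases "i \<in> ?K")
        case True
        have "mod_span (M i) (G i) \<subseteq> {x \<in> carrier (M i). dsingle M I i x \<in> mod_span ?D S}"
        proof (rule mod_span_least[OF submod_vimage[OF dh M[OF i] DM sub]])
          have "dsingle M I i ` G i \<subseteq> mod_span ?D S"
            using mod_span_superset[of S ?D] True unfolding S_def by blast
          then show "G i \<subseteq> {x \<in> carrier (M i). dsingle M I i x \<in> mod_span ?D S}"
            using G[OF i] by blast
        qed
        then have "carrier (M i) \<subseteq> {x \<in> carrier (M i). dsingle M I i x \<in> mod_span ?D S}"
          using G[OF i] by metis
        then show ?thesis using x by auto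
      next
        case False
        then have "x = \<zero>\<^bsub>M i\<^esub>" using i x by auto
        then show ?thesis using hom_zero[OF dh M[OF i] DM] submod_zero[OF sub DM] by simp
      qed
    qed auto
  qed
  moreover have "mod_span ?D S \<subseteq> carrier ?D" using submod_subset[OF sub DM] by auto
  ultimately show ?thesis using S by (auto simp: fin_gen_def)
qed

subsection \<open>Free modules\<close>

definition ring_mod :: "('a, 'a) module" where
  "ring_mod = \<lparr>carrier = carrier A, monoid.mult = undefined, one = undefined,
     ring.zero = \<zero>, ring.add = (\<oplus>), module.smult = (\<otimes>)\<rparr>"

abbreviation free_mod :: "'i set => ('a, 'i => 'a) module" where
  "free_mod I \<equiv> dsum_module I (\<lambda>_. ring_mod)"

definition unit_vec :: "'i set => 'i => 'i => 'a" where
  "unit_vec I i = dsingle (\<lambda>_. ring_mod) I i \<one>"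

definition lincomb :: "('a, 'm) module => 'i set => ('i => 'm) => ('i => 'a) => 'm" where
  "lincomb M I b = dsum_elim (\<lambda>_. ring_mod) M I (\<lambda>i a. a \<odot>\<^bsub>M\<^esub> b i)"

lemma ring_mod_simps [simp]:
  "carrier ring_mod = carrier A" "\<zero>\<^bsub>ring_mod\<^esub> = \<zero>" "x \<oplus>\<^bsub>ring_mod\<^esub> y = x \<oplus> y" "a \<odot>\<^bsub>ring_mod\<^esub> x = a \<otimes> x"
  by (simp_all add: ring_mod_def)

lemma module_ring_mod [simp]: "module A ring_mod"
  by (rule ground_moduleI) (auto simp: a_assoc a_comm a_lcomm l_distr r_distr m_assoc)

lemma module_free_mod [simp]: "module A (free_mod I)"
  by (rule module_dsum) simp

lemma free_mod_carrier: "finite I ==> carrier (free_mod I) = (\<Pi>\<^sub>E i\<in>I. carrier A)"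
  by (auto simp: dsum_simps)

lemma unit_vec_closed: "i \<in> I ==> unit_vec I i \<in> carrier (free_mod I)"
  unfolding unit_vec_def by (rule hom_closed[OF dsingle_hom]) auto

lemma unit_vec_apply: "i \<in> I ==> j \<in> I ==> unit_vec I i j = (if j = i then \<one> else \<zero>)"
  by (simp add: unit_vec_def dsingle_def)

lemma dsingle_ring_mod:
  "i \<in> I ==> a \<in> carrier A ==> dsingle (\<lambda>_. ring_mod) I i a = a \<odot>\<^bsub>free_mod I\<^esub> unit_vec I i"
  by (auto simp: unit_vec_def dsingle_def dsum_simps fun_eq_iff)

lemma smult_const_hom:
  assumes "module A M" "b \<in> carrier M"
  shows "(\<lambda>a. a \<odot>\<^bsub>M\<^esub> b) \<in> Hom ring_mod M"
  using assms by (intro mod_homI) (auto simp: mod_l_distr mod_smult_assoc)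

lemma lincomb_hom:
  assumes "module A M" "\<And>i. i \<in> I ==> b i \<in> carrier M"
  shows "lincomb M I b \<in> Hom (free_mod I) M"
  unfolding lincomb_def using assms by (intro dsum_elim_hom smult_const_hom module_ring_mod)

lemma lincomb_unit:
  assumes "module A M" "\<And>i. i \<in> I ==> b i \<in> carrier M" "i \<in> I"
  shows "lincomb M I b (unit_vec I i) = b i"
proof -
  have "dsum_elim (\<lambda>_. ring_mod) M I (\<lambda>i a. a \<odot>\<^bsub>M\<^esub> b i) (dsingle (\<lambda>_. ring_mod) I i \<one>) = \<one> \<odot>\<^bsub>M\<^esub> b i"
    using assms by (intro dsum_elim_single smult_const_hom module_ring_mod) simp_all
  then show ?thesis using assms by (simp add: lincomb_def unit_vec_def)
qed

lemma free_generated: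
  assumes H: "submodule H A (free_mod I)"
    and "\<And>i. i \<in> I ==> unit_vec I i \<in> H"
    and f: "f \<in> carrier (free_mod I)"
  shows "f \<in> H"
proof (rule dsum_generated[OF _ H _ f])
  show "dsingle (\<lambda>_. ring_mod) I i a \<in> H" if "i \<in> I" "a \<in> carrier ring_mod" for i a
    using submod_smult[OF H module_free_mod, of a "unit_vec I i"] assms(2) that by (simp add: dsingle_ring_mod)
qed simp

lemma free_hom_ext:
  assumes N: "module A N" and g: "g \<in> Hom (free_mod I) N" and h: "h \<in> Hom (free_mod I) N"
    and eq: "\<And>i. i \<in> I ==> g (unit_vec I i) = h (unit_vec I i)"
    and f: "f \<in> carrier (free_mod I)"
  shows "g f = h f"
proof (rule dsum_hom_ext[OF _ N g h _ f])
  show "g (dsingle (\<lambda>_. ring_mod) I i a) = h (dsingle (\<lambda>_. ring_mod) I i a)"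
    if "i \<in> I" "a \<in> carrier ring_mod" for i a
    using that hom_smult[OF g, of a "unit_vec I i"] hom_smult[OF h, of a "unit_vec I i"] eq
    by (simp add: dsingle_ring_mod unit_vec_closed)
qed simp

lemma coordinates_lincomb:
  assumes N: "module A N" and p: "p \<in> Hom N (free_mod I)" and b: "\<And>i. i \<in> I ==> b i \<in> carrier N"
    and pb: "\<And>i. i \<in> I ==> p (b i) = unit_vec I i" and a: "a \<in> carrier (free_mod I)"
  shows "p (lincomb N I b a) = a"
proof (rule free_hom_ext[OF module_free_mod hom_comp[OF lincomb_hom[OF N b] p] hom_id _ a])
  show "p (lincomb N I b (unit_vec I i)) = unit_vec I i" if "i \<in> I" for i
    using lincomb_unit[where b = b and M = N, OF N b that] pb[OF that] by simp
qed

lemma lincomb_in_submod: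
  assumes M: "module A M" and H: "submodule H A M"
    and b: "\<And>i. i \<in> I ==> a i \<odot>\<^bsub>M\<^esub> b i \<in> H"
  shows "lincomb M I b a \<in> H"
  unfolding lincomb_def dsum_elim_def using b by (intro submod_finsum[OF H M]) auto

lemma lincomb_image_span:
  assumes M: "module A M" and b: "\<And>i. i \<in> I ==> b i \<in> carrier M"
  shows "lincomb M I b ` carrier (free_mod I) = mod_span M (b ` I)"
proof
  have sub: "b ` I \<subseteq> carrier M" using b by auto
  note S = submod_mod_span[OF M sub]
  show "lincomb M I b ` carrier (free_mod I) \<subseteq> mod_span M (b ` I)"
  proof (rule image_subsetI)
    fix a assume a: "a \<in> carrier (free_mod I)"
    have "a i \<odot>\<^bsub>M\<^esub> b i \<in> mod_span M (b ` I)" if "i \<in> I" for i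
      using dsum_component[OF a that] mod_span_superset[of "b ` I" M] that
      by (intro submod_smult[OF S M]) auto
    then show "lincomb M I b a \<in> mod_span M (b ` I)"
      by (rule lincomb_in_submod[OF M S])
  qed
  show "mod_span M (b ` I) \<subseteq> lincomb M I b ` carrier (free_mod I)"
  proof (rule mod_span_least[OF submod_image[OF lincomb_hom[OF M b] module_free_mod M submod_carrier]])
    show "b ` I \<subseteq> lincomb M I b ` carrier (free_mod I)"
    proof (rule image_subsetI)
      show "b i \<in> lincomb M I b ` carrier (free_mod I)" if "i \<in> I" for i
        using lincomb_unit[of M I b, OF M b that] unit_vec_closed[OF that] by force
    qed
  qed simp_all
qed

end

section \<open>Local Noetherian domains\<close>

locale local_noetherian_domain = ground_ring A + noetherian_domain A for A :: "'a ring" (structure) +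
  assumes local: "local_ring A"
begin

lemma left_ideal_iff_ideal: "left_ideal I A \<longleftrightarrow> ideal I A"
proof
  assume "left_ideal I A"
  then have a: "additive_subgroup I A" and l: "\<And>a x. a \<in> carrier A ==> x \<in> I ==> a \<otimes> x \<in> I"
    by (auto simp: left_ideal_def)
  have "x \<otimes> a \<in> I" if "a \<in> carrier A" "x \<in> I" for a x
    using l[OF that] m_comm[OF that(1), of x] additive_subgroup.a_Hcarr[OF a that(2)] by simp
  then show "ideal I A"
    using l by (intro ideal.intro a ideal_axioms.intro ring_axioms) auto
next
  assume "ideal I A"
  then interpret ideal I A .
  show "left_ideal I A"
    unfolding left_ideal_def using I_l_closed additive_subgroup_axioms by auto
qed

lemma nonunit_mult:
  assumes "x \<in> carrier A" "x \<notin> Units A" "a \<in> carrier A"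
  shows "a \<otimes> x \<notin> Units A"
proof
  assume u: "a \<otimes> x \<in> Units A"
  have "(inv (a \<otimes> x) \<otimes> a) \<otimes> x = \<one>"
    using Units_l_inv[OF u] assms u by (simp add: m_assoc)
  moreover from this have "x \<otimes> (inv (a \<otimes> x) \<otimes> a) = \<one>"
    using assms u m_comm[of x "inv (a \<otimes> x) \<otimes> a"] by simp
  ultimately have "x \<in> Units A"
    unfolding Units_def using assms u by (intro CollectI conjI bexI[of _ "inv (a \<otimes> x) \<otimes> a"]) auto
  with assms show False by simp
qed

lemma nonunit_in_maximal:
  assumes "x \<in> carrier A" "x \<notin> Units A"
  shows "\<exists>I. maximal_left_ideal I A \<and> x \<in> I"
proof -
  define S where "S = {I. ideal I A \<and> I \<noteq> carrier A \<and> x \<in> I}"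
  have px: "PIdl x \<in> S"
  proof -
    have "\<one> \<notin> PIdl x"
    proof
      assume "\<one> \<in> PIdl x"
      then obtain a where "a \<in> carrier A" "\<one> = a \<otimes> x" by (auto simp: cgenideal_def)
      then show False using nonunit_mult[OF assms, of a] Units_one_closed by metis
    qed
    then show ?thesis
      using cgenideal_ideal[OF assms(1)] cgenideal_self[OF assms(1)] by (auto simp: S_def)
  qed
  have bound: "\<exists>U\<in>S. \<forall>Y\<in>C. Y \<subseteq> U" if C: "subset.chain S C" for C
  proof (cases "C = {}")
    case True then show ?thesis using px by auto
  next
    case False
    have "subset.chain {I. ideal I A} C"
      using C by (auto simp: subset_chain_def S_def)
    from ideal_chain_is_trivial[OF False this] have "\<Union>C \<in> C" .
    moreover have "C \<subseteq> S" using C by (simp add: subset_chain_def)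
    ultimately show ?thesis by (intro bexI[of _ "\<Union>C"]) auto
  qed
  obtain I where I: "I \<in> S" "\<And>Y. Y \<in> S ==> I \<subseteq> Y ==> Y = I"
    using subset_Zorn[of S, OF bound] by blast
  have "maximal_left_ideal I A"
    unfolding maximal_left_ideal_def left_ideal_iff_ideal using I by (auto simp: S_def)
  then show ?thesis using I(1) by (auto simp: S_def)
qed

lemma maximal_nonunit: "maximal_left_ideal I A ==> x \<in> I ==> x \<notin> Units A"
proof
  assume I: "maximal_left_ideal I A" "x \<in> I" and x: "x \<in> Units A"
  then have id: "ideal I A" "I \<noteq> carrier A" by (auto simp: maximal_left_ideal_def left_ideal_iff_ideal)
  have "inv x \<otimes> x \<in> I" by (rule ideal.I_l_closed[OF id(1) I(2)]) (use x in simp)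
  then have "\<one> \<in> I" using x by simp
  then show False using id ideal.one_imp_carrier by blast
qed

text \<open>Two non-units lie in the unique maximal ideal, hence so does their sum.\<close>

lemma nonunit_add:
  assumes "x \<in> carrier A" "x \<notin> Units A" "y \<in> carrier A" "y \<notin> Units A"
  shows "x \<oplus> y \<notin> Units A"
proof -
  obtain I where I: "maximal_left_ideal I A" "x \<in> I" using nonunit_in_maximal[OF assms(1,2)] by blast
  obtain J where J: "maximal_left_ideal J A" "y \<in> J" using nonunit_in_maximal[OF assms(3,4)] by blast
  have "I = J" using I(1) J(1) local by (auto simp: local_ring_def)
  moreover have "additive_subgroup I A" using I(1) by (simp add: maximal_left_ideal_def left_ideal_def)
  ultimately have "x \<oplus> y \<in> I" using I(2) J(2) additive_subgroup.a_closed by fastforce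
  then show ?thesis using maximal_nonunit I(1) by blast
qed

lemma zero_nonunit [simp]: "\<zero> \<notin> Units A"
  by (metis Units_l_inv Units_inv_closed one_not_zero r_null)

lemma one_diff_nonunit:
  assumes "x \<in> carrier A" "x \<notin> Units A"
  shows "\<one> \<ominus> x \<in> Units A"
proof (rule ccontr)
  assume "\<one> \<ominus> x \<notin> Units A"
  then have "(\<one> \<ominus> x) \<oplus> x \<notin> Units A" using assms by (intro nonunit_add) auto
  moreover have "(\<one> \<ominus> x) \<oplus> x = \<one>" using assms by algebra
  ultimately show False by simp
qed

subsection \<open>Noetherian modules\<close>

lemma mod_neg_diff:
  assumes M: "module A M" and x: "x \<in> carrier M" and y: "y \<in> carrier M"
  shows "\<ominus>\<^bsub>M\<^esub> (x \<ominus>\<^bsub>M\<^esub> y) = y \<ominus>\<^bsub>M\<^esub> x"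
  using abelian_group.minus_add[OF mod_abelian_group[OF M], of x "\<ominus>\<^bsub>M\<^esub> y"] M x y
  by (simp add: a_minus_def mod_add_comm)

lemma mod_diff_split:
  assumes "module A M" "x \<in> carrier M" "y \<in> carrier M" "z \<in> carrier M"
  shows "x \<ominus>\<^bsub>M\<^esub> z = (x \<ominus>\<^bsub>M\<^esub> y) \<oplus>\<^bsub>M\<^esub> (y \<ominus>\<^bsub>M\<^esub> z)"
proof -
  have "(x \<ominus>\<^bsub>M\<^esub> y) \<oplus>\<^bsub>M\<^esub> (y \<oplus>\<^bsub>M\<^esub> \<ominus>\<^bsub>M\<^esub> z) = ((x \<ominus>\<^bsub>M\<^esub> y) \<oplus>\<^bsub>M\<^esub> y) \<oplus>\<^bsub>M\<^esub> \<ominus>\<^bsub>M\<^esub> z"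
    by (rule mod_add_assoc[symmetric]) (use assms in simp_all)
  then show ?thesis using assms by (simp add: a_minus_def[of M y z] a_minus_def[of M x z])
qed

lemma ideal_of_submod:
  assumes "submodule H A ring_mod" shows "ideal H A"
proof (rule idealI)
  have c: "H \<subseteq> carrier A" using submod_subset[OF assms module_ring_mod] by auto
  show "subgroup H (add_monoid A)"
  proof (rule group.subgroupI)
    show "group (add_monoid A)" by (rule a_group)
    show "H \<subseteq> carrier (add_monoid A)" using c by simp
    show "H \<noteq> {}" using submod_zero[OF assms module_ring_mod] by auto
    show "inv\<^bsub>add_monoid A\<^esub> a \<in> H" if "a \<in> H" for a
    proof -
      have "(\<ominus> \<one>) \<otimes> a \<in> H"
        using submod_smult[OF assms module_ring_mod, of "\<ominus> \<one>" a] that by simp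
      moreover have "(\<ominus> \<one>) \<otimes> a = \<ominus> a" using that c by (auto simp: l_minus)
      ultimately show ?thesis by (simp add: a_inv_def)
    qed
    show "a \<otimes>\<^bsub>add_monoid A\<^esub> b \<in> H" if "a \<in> H" "b \<in> H" for a b
      using submod_add[OF assms module_ring_mod that] by simp
  qed
  show "x \<otimes> a \<in> H" if "a \<in> H" "x \<in> carrier A" for a x
    using submod_smult[OF assms module_ring_mod that(2,1)] by simp
  then show "a \<otimes> x \<in> H" if "a \<in> H" "x \<in> carrier A" for a x
    using that c m_comm[of a x] by auto
qed (rule ring_axioms)

text \<open>The coefficients at one generator \<open>g\<close> of the elements of \<open>H\<close>, modulo the span of the other
  generators, form an ideal, which is finitely generated; the elements with coefficient \<open>0\<close> are
  handled by induction on the number of generators.\<close>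

lemma fin_gen_submod_aux:
  assumes M: "module A M" and "finite G" "G \<subseteq> carrier M" "submodule H A M" "H \<subseteq> mod_span M G"
  shows "fin_gen M H"
  using assms(2-5)
proof (induction G arbitrary: H rule: finite_induct)
  case empty
  then have "H = mod_span M {}" using mod_span_least[OF empty(2), of "{}"] by auto
  then show ?case by (auto simp: fin_gen_def)
next
  case (insert g G)
  note H = \<open>submodule H A M\<close>
  have g: "g \<in> carrier M" and G: "G \<subseteq> carrier M" using insert by auto
  note S = submod_mod_span[OF M G]
  note gh = smult_const_hom[OF M g]
  let ?S = "mod_span M G"
  \<comment> \<open>the ideal of leading coefficients of a submodule \<open>K\<close>, and its finite generation\<close>
  define lc where "lc K = {a \<in> carrier ring_mod. a \<odot>\<^bsub>M\<^esub> g \<in> {x \<in> carrier M. \<exists>k\<in>K. x \<ominus>\<^bsub>M\<^esub> k \<in> ?S}}" for K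
  have lc: "ideal (lc K) A" if "submodule K A M" for K
    unfolding lc_def by (intro ideal_of_submod submod_vimage[OF gh module_ring_mod M] submod_plus[OF S that M])
  have lcD: "\<exists>k\<in>K. a \<odot>\<^bsub>M\<^esub> g \<ominus>\<^bsub>M\<^esub> k \<in> ?S" if "a \<in> lc K" for a K using that by (auto simp: lc_def)
  have lcI: "a \<in> lc K" if "a \<in> carrier A" "k \<in> K" "a \<odot>\<^bsub>M\<^esub> g \<ominus>\<^bsub>M\<^esub> k \<in> ?S" for a k K
    using that M g by (auto simp: lc_def)
  obtain L where L: "L \<subseteq> carrier A" "finite L" "lc H = Idl L" using finetely_gen[OF lc[OF H]] by blast
  have "\<exists>h\<in>H. a \<odot>\<^bsub>M\<^esub> g \<ominus>\<^bsub>M\<^esub> h \<in> ?S" if "a \<in> L" for a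
    using lcD[of a H] L that genideal_self[OF L(1)] by auto
  then obtain h where h: "\<And>a. a \<in> L ==> h a \<in> H \<and> a \<odot>\<^bsub>M\<^esub> g \<ominus>\<^bsub>M\<^esub> h a \<in> ?S" by metis
  have "fin_gen M (H \<inter> ?S)"
    by (rule insert.IH[OF G submod_Int[OF H S M]]) auto
  then obtain G' where G': "finite G'" "G' \<subseteq> carrier M" "H \<inter> ?S = mod_span M G'" by (auto simp: fin_gen_def)
  let ?T = "G' \<union> h ` L"
  have T: "?T \<subseteq> H" "?T \<subseteq> carrier M"
    using mod_span_superset[of G' M] G'(3) h submod_subset[OF H M] by blast+
  note K = submod_mod_span[OF M T(2)]
  have "H = mod_span M ?T"
  proof
    show "mod_span M ?T \<subseteq> H" by (rule mod_span_least[OF H T(1)])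
    show "H \<subseteq> mod_span M ?T"
    proof
      fix x assume x: "x \<in> H"
      have xM: "x \<in> carrier M" using submod_subset[OF H M x] .
      let ?R = "(\<lambda>a. a \<odot>\<^bsub>M\<^esub> g) ` carrier ring_mod"
      have R: "submodule ?R A M" by (rule submod_image[OF gh module_ring_mod M submod_carrier[OF module_ring_mod]])
      have "insert g G \<subseteq> {x \<in> carrier M. \<exists>k\<in>?R. x \<ominus>\<^bsub>M\<^esub> k \<in> ?S}"
      proof
        fix y assume y: "y \<in> insert g G"
        have "\<exists>a\<in>carrier A. y \<ominus>\<^bsub>M\<^esub> a \<odot>\<^bsub>M\<^esub> g \<in> ?S"
        proof (cases "y = g")
          case True then show ?thesis using M g submod_zero[OF S M] by (intro bexI[of _ \<one>]) auto
        next
          case False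
          then have "y \<in> ?S" "y \<in> carrier M" using y G mod_span_superset[of G M] by auto
          then show ?thesis using M g by (intro bexI[of _ \<zero>]) auto
        qed
        then show "y \<in> {x \<in> carrier M. \<exists>k\<in>?R. x \<ominus>\<^bsub>M\<^esub> k \<in> ?S}" using y g G by auto
      qed
      from mod_span_least[OF submod_plus[OF S R M] this] x insert(6)
      obtain a where a: "a \<in> carrier A" "x \<ominus>\<^bsub>M\<^esub> a \<odot>\<^bsub>M\<^esub> g \<in> ?S" by auto
      have "a \<in> lc H"
      proof (rule lcI[OF a(1) x])
        have "a \<odot>\<^bsub>M\<^esub> g \<ominus>\<^bsub>M\<^esub> x = \<ominus>\<^bsub>M\<^esub> (x \<ominus>\<^bsub>M\<^esub> a \<odot>\<^bsub>M\<^esub> g)"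
          by (rule mod_neg_diff[OF M xM mod_smult_closed[OF M a(1) g], symmetric])
        then show "a \<odot>\<^bsub>M\<^esub> g \<ominus>\<^bsub>M\<^esub> x \<in> ?S" using submod_neg[OF S M a(2)] by simp
      qed
      moreover have "lc H \<subseteq> lc (mod_span M ?T)"
        unfolding L(3)
      proof (rule genideal_minimal[OF lc[OF K]], rule subsetI)
        fix b assume b: "b \<in> L"
        then have "h b \<in> mod_span M ?T" using mod_span_superset[of ?T M] by blast
        then show "b \<in> lc (mod_span M ?T)" using lcI[of b "h b"] h[OF b] L(1) b by blast
      qed
      ultimately obtain k where k: "k \<in> mod_span M ?T" "a \<odot>\<^bsub>M\<^esub> g \<ominus>\<^bsub>M\<^esub> k \<in> ?S" using lcD by blast
      have kM: "k \<in> carrier M" "k \<in> H"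
        using submod_subset[OF K M k(1)] mod_span_least[OF H T(1)] k(1) by auto
      have "x \<ominus>\<^bsub>M\<^esub> k = (x \<ominus>\<^bsub>M\<^esub> a \<odot>\<^bsub>M\<^esub> g) \<oplus>\<^bsub>M\<^esub> (a \<odot>\<^bsub>M\<^esub> g \<ominus>\<^bsub>M\<^esub> k)"
        by (rule mod_diff_split[OF M xM mod_smult_closed[OF M a(1) g] kM(1)])
      then have "x \<ominus>\<^bsub>M\<^esub> k \<in> H \<inter> ?S"
        using submod_add[OF S M a(2) k(2)] submod_diff[OF H M x kM(2)] by simp
      then have "x \<ominus>\<^bsub>M\<^esub> k \<in> mod_span M ?T"
        using G'(3) mod_span_mono[of G' ?T M] by blast
      from submod_add[OF K M this k(1)] show "x \<in> mod_span M ?T" using M xM kM by simp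
    qed
  qed
  then show ?case
    unfolding fin_gen_def using T(2) G'(1) L(2) by (intro exI[of _ ?T] conjI) auto
qed

lemma fin_gen_submod:
  assumes "module A M" "fin_gen M (carrier M)" "submodule H A M"
  shows "fin_gen M H"
proof -
  obtain G where "finite G" "G \<subseteq> carrier M" "carrier M = mod_span M G" using assms(2) by (auto simp: fin_gen_def)
  then show ?thesis
    using submod_subset[OF assms(3,1)] by (intro fin_gen_submod_aux[OF assms(1) _ _ assms(3)]) auto
qed

text \<open>The kernels of the powers of \<open>f\<close> form an ascending chain. Once it is stationary at \<open>N\<close>, an
  element of the kernel of \<open>f\<close> is \<open>f\<^sup>N\<close> of something in the kernel of \<open>f\<^sup>N\<^sup>+\<^sup>1\<close>, hence zero.\<close>

lemma surj_endo_inj: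
  assumes M: "module A M" and fg: "fin_gen M (carrier M)"
    and f: "f \<in> Hom M M" and surj: "f ` carrier M = carrier M"
  shows "inj_on f (carrier M)"
proof (rule hom_inj_onI[OF f M M])
  have pow: "(f ^^ n) \<in> Hom M M" for n
  proof (induction n)
    case 0 then show ?case using hom_id[of M] by (simp add: id_def)
  next
    case (Suc n) then show ?case using hom_comp[OF Suc f] by (simp add: comp_def)
  qed
  define K where "K n = {x \<in> carrier M. (f ^^ n) x = \<zero>\<^bsub>M\<^esub>}" for n
  have Ks: "submodule (K n) A M" for n
    unfolding K_def by (rule submod_kernel[OF pow M M])
  have Kstep: "K n \<subseteq> K (Suc n)" for n
    using hom_zero[OF f M M] by (auto simp: K_def)
  have Kmono: "K m \<subseteq> K n" if "m \<le> n" for m n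
    using lift_Suc_mono_le[of K, OF Kstep that] .
  have U: "submodule (\<Union>n. K n) A M"
  proof (rule submodI[OF M])
    show "(\<Union>n. K n) \<subseteq> carrier M" by (auto simp: K_def)
    show "\<zero>\<^bsub>M\<^esub> \<in> (\<Union>n. K n)" by (rule UN_I[of 0]) (rule UNIV_I, rule submod_zero[OF Ks M])
    show "x \<oplus>\<^bsub>M\<^esub> y \<in> (\<Union>n. K n)" if xy: "x \<in> (\<Union>n. K n)" "y \<in> (\<Union>n. K n)" for x y
    proof -
      obtain m n where mn: "x \<in> K m" "y \<in> K n" using xy by auto
      have "x \<oplus>\<^bsub>M\<^esub> y \<in> K (max m n)"
        by (rule submod_add[OF Ks M subsetD[OF Kmono mn(1)] subsetD[OF Kmono mn(2)]]) simp_all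
      then show ?thesis by (rule UN_I[of "max m n", rotated]) (rule UNIV_I)
    qed
    show "a \<odot>\<^bsub>M\<^esub> x \<in> (\<Union>n. K n)" if ax: "a \<in> carrier A" "x \<in> (\<Union>n. K n)" for a x
    proof -
      obtain n where n: "x \<in> K n" using ax(2) by auto
      show ?thesis by (rule UN_I[of n]) (rule UNIV_I, rule submod_smult[OF Ks M ax(1) n])
    qed
  qed
  obtain G where G: "finite G" "G \<subseteq> carrier M" "(\<Union>n. K n) = mod_span M G"
    using fin_gen_submod[OF M fg U] by (auto simp: fin_gen_def)
  have "\<exists>N. G \<subseteq> K N"
  proof -
    have "\<exists>n. g \<in> K n" if "g \<in> G" for g
      using subsetD[OF mod_span_superset that, of M] unfolding G(3)[symmetric] by (meson UN_E)
    then obtain n where n: "\<And>g. g \<in> G ==> g \<in> K (n g)" by metis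
    have "g \<in> K (Max (n ` G))" if "g \<in> G" for g
      by (rule subsetD[OF Kmono n[OF that]]) (use that G(1) in simp)
    then have "G \<subseteq> K (Max (n ` G))" by (rule subsetI)
    then show ?thesis by (rule exI)
  qed
  then obtain N where N: "G \<subseteq> K N" by blast
  have UN: "(\<Union>n. K n) \<subseteq> K N"
    unfolding G(3) by (rule mod_span_least[OF Ks N])
  fix x assume x: "x \<in> carrier M" "f x = \<zero>\<^bsub>M\<^esub>"
  have "(f ^^ n) ` carrier M = carrier M" for n
  proof (induction n)
    case (Suc n)
    have "(f ^^ Suc n) ` carrier M = f ` ((f ^^ n) ` carrier M)" by (simp add: image_image)
    then show ?case by (simp only: Suc surj)
  qed simp
  then have "x \<in> (f ^^ N) ` carrier M" using x(1) by simp
  then obtain y where y: "y \<in> carrier M" "x = (f ^^ N) y" by (rule imageE)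
  then have "y \<in> K (Suc N)" using x(2) by (simp add: K_def)
  then have "y \<in> K N" using UN by blast
  then show "x = \<zero>\<^bsub>M\<^esub>" using y by (simp add: K_def)
qed

subsection \<open>Nakayama's lemma for free modules\<close>

text \<open>If every unit vector is congruent to an element of \<open>H\<close> modulo the maximal ideal, the error
  terms can be removed one coordinate at a time: the coordinate \<open>j\<close> of the error is cleared by
  subtracting a multiple of the approximation of the \<open>j\<close>-th unit vector, whose \<open>j\<close>-th coordinate
  is a unit.\<close>

lemma nakayama_free:
  assumes fin: "finite I" and H: "submodule H A (free_mod I)"
    and approx: "\<And>i. i \<in> I ==> \<exists>h\<in>H. \<forall>j\<in>I. unit_vec I i j \<ominus> h j \<notin> Units A"
  shows "carrier (free_mod I) \<subseteq> H"
proof -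
  let ?F = "free_mod I"
  have HF: "h j \<in> carrier A" if "h \<in> H" "j \<in> I" for h j
    using dsum_component[OF submod_subset[OF H module_free_mod that(1)] that(2)] by simp
  have unit_cl: "unit_vec I i j \<in> carrier A" if "i \<in> I" "j \<in> I" for i j
    using that by (simp add: unit_vec_apply)
  have clear: "\<exists>h\<in>H. (\<forall>j\<in>I. unit_vec I i j \<ominus> h j \<notin> Units A) \<and> (\<forall>j\<in>I - J. unit_vec I i j \<ominus> h j = \<zero>)"
    if "finite K" "J = I - K" "K \<subseteq> I" "i \<in> I" for i J K
    using that
  proof (induction K arbitrary: i J rule: finite_induct)
    case empty then show ?case using approx by auto
  next
    case (insert k K)
    have k: "k \<in> I" using insert by auto
    have IH: "\<exists>h\<in>H. (\<forall>j\<in>I. unit_vec I i j \<ominus> h j \<notin> Units A) \<and> (\<forall>j\<in>K. unit_vec I i j \<ominus> h j = \<zero>)"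
      if "i \<in> I" for i
    proof -
      have "I - (I - K) = K" using insert by auto
      moreover have "K \<subseteq> I" using insert by auto
      ultimately show ?thesis using insert.IH[OF refl _ that] by simp
    qed
    obtain h where h: "h \<in> H" "\<And>j. j \<in> I ==> unit_vec I i j \<ominus> h j \<notin> Units A" "\<And>j. j \<in> K ==> unit_vec I i j \<ominus> h j = \<zero>"
      using IH[OF \<open>i \<in> I\<close>] by blast
    obtain e where e: "e \<in> H" "\<And>j. j \<in> I ==> unit_vec I k j \<ominus> e j \<notin> Units A" "\<And>j. j \<in> K ==> unit_vec I k j \<ominus> e j = \<zero>"
      using IH[OF k] by blast
    define c where "c = \<one> \<ominus> e k"
    define d where "d = unit_vec I i k \<ominus> h k"
    define u where "u = inv (e k)"
    have c: "c \<in> carrier A" "c \<notin> Units A"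
      using e(2)[OF k] HF[OF e(1) k] k by (auto simp: c_def unit_vec_apply)
    have "\<one> \<ominus> c = e k" unfolding c_def using HF[OF e(1) k]
      by (simp add: a_minus_def minus_add a_assoc[symmetric] r_neg)
    then have ek: "e k \<in> Units A" using one_diff_nonunit[OF c] by simp
    have u: "u \<in> carrier A" "u \<otimes> e k = \<one>" using ek by (auto simp: u_def)
    have d: "d \<in> carrier A" "d \<notin> Units A"
      using h(2)[OF k] HF[OF h(1) k] unit_cl[OF \<open>i \<in> I\<close> k] by (auto simp: d_def)
    define h' where "h' = h \<oplus>\<^bsub>?F\<^esub> (d \<otimes> u) \<odot>\<^bsub>?F\<^esub> e"
    have h'H: "h' \<in> H"
      unfolding h'_def using d u by (intro submod_add[OF H] submod_smult[OF H] h e module_free_mod) auto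
    have h'j: "h' j = h j \<oplus> (d \<otimes> u) \<otimes> e j" if "j \<in> I" for j
      using that by (simp add: h'_def dsum_simps)
    have at_k: "unit_vec I i k \<ominus> h' k = \<zero>"
    proof -
      have "unit_vec I i k \<ominus> h' k = d \<ominus> d \<otimes> (u \<otimes> e k)"
        unfolding h'j[OF k] d_def using unit_cl[OF \<open>i \<in> I\<close> k] HF[OF h(1) k] HF[OF e(1) k] u(1) d(1)
        by (simp add: a_minus_def minus_add a_assoc m_assoc)
      also have "\<dots> = \<zero>" unfolding u(2) using d by (simp add: r_right_minus_eq)
      finally show ?thesis .
    qed
    have other: "unit_vec I i j \<ominus> h' j = (unit_vec I i j \<ominus> h j) \<oplus> (d \<otimes> u) \<otimes> (unit_vec I k j \<ominus> e j)"
      if "j \<in> I" "j \<noteq> k" for j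
      unfolding h'j[OF that(1)]
    proof -
      have "unit_vec I k j = \<zero>" using that k by (simp add: unit_vec_apply)
      then show "unit_vec I i j \<ominus> (h j \<oplus> (d \<otimes> u) \<otimes> e j) = (unit_vec I i j \<ominus> h j) \<oplus> (d \<otimes> u) \<otimes> (unit_vec I k j \<ominus> e j)"
        using unit_cl[OF \<open>i \<in> I\<close> that(1)] HF[OF h(1) that(1)] HF[OF e(1) that(1)] d(1) u(1)
        by (simp add: a_minus_def minus_add a_assoc r_minus)
    qed
    have cl: "unit_vec I i j \<ominus> h j \<in> carrier A" "unit_vec I k j \<ominus> e j \<in> carrier A" if "j \<in> I" for j
      using that unit_cl k \<open>i \<in> I\<close> HF[OF h(1)] HF[OF e(1)] by auto
    have "unit_vec I i j \<ominus> h' j \<notin> Units A" if j: "j \<in> I" for j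
    proof (cases "j = k")
      case True then show ?thesis using at_k by simp
    next
      case False
      show ?thesis unfolding other[OF j False]
        using cl[OF j] h(2)[OF j] e(2)[OF j] d u by (intro nonunit_add nonunit_mult) auto
    qed
    moreover have "unit_vec I i j \<ominus> h' j = \<zero>" if j: "j \<in> I - J" for j
    proof (cases "j = k")
      case True then show ?thesis using at_k by simp
    next
      case False
      then have "j \<in> K" "j \<in> I" using j insert by auto
      then show ?thesis using other[of j] False h(3)[of j] e(3)[of j] d u by simp
    qed
    ultimately show ?case using h'H by blast
  qed
  have "unit_vec I i \<in> H" if i: "i \<in> I" for i
  proof -
    obtain h where h: "h \<in> H" "\<forall>j\<in>I. unit_vec I i j \<ominus> h j = \<zero>"
      using clear[OF fin _ order_refl i, of "{}"] by auto
    have "unit_vec I i = h"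
    proof (rule dsum_eqI[where M = "\<lambda>_. ring_mod" and I = I])
      show "unit_vec I i j = h j" if "j \<in> I" for j
        using h(2) that unit_cl[OF i that] HF[OF h(1) that] by (metis r_right_minus_eq)
    qed (use i h unit_vec_closed submod_subset[OF H module_free_mod] in auto)
    then show ?thesis using h by simp
  qed
  then show ?thesis using free_generated[OF H] by (meson subsetI)
qed

end

section \<open>Corners\<close>

context local_noetherian_domain
begin

lemma free_mod_eqI:
  "f \<in> carrier (free_mod I) ==> g \<in> carrier (free_mod I) ==> (\<And>i. i \<in> I ==> f i = g i) ==> f = g"
  by (rule dsum_eqI[where M = "\<lambda>_. ring_mod" and I = I])

lemma free_mod_eq_zero_iff:
  assumes "f \<in> carrier (free_mod I)"
  shows "f = \<zero>\<^bsub>free_mod I\<^esub> \<longleftrightarrow> (\<forall>i\<in>I. f i = \<zero>)"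
proof
  show "\<forall>i\<in>I. f i = \<zero>" if "f = \<zero>\<^bsub>free_mod I\<^esub>" using that by (simp add: dsum_simps(2))
  show "f = \<zero>\<^bsub>free_mod I\<^esub>" if f: "\<forall>i\<in>I. f i = \<zero>"
    by (rule free_mod_eqI[OF assms mod_zero_closed[OF module_free_mod]]) (use f in \<open>simp add: dsum_simps(2)\<close>)
qed

definition tors_closure :: "('a, 'd) module => 'd set => 'd set" where
  "tors_closure \<Delta> B = {m \<in> carrier \<Delta>. \<exists>\<xi>\<in>carrier A. \<xi> \<noteq> \<zero> \<and> \<xi> \<odot>\<^bsub>\<Delta>\<^esub> m \<in> B}"

text \<open>The map \<open>p\<close> gives coordinates on the free quotient \<open>N/U\<close>, and \<open>b\<close> lifts the basis to \<open>N\<close>. The basis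
  is adapted to \<open>K\<close>: its elements in \<open>C\<close> lie in \<open>K\<close>, while the remaining coordinates of elements of
  \<open>K\<close> lie in the maximal ideal. So \<open>C\<close> indexes a basis of the image of \<open>K\<close> in the vector space
  that \<open>N/U\<close> becomes over the residue field, and its cardinality is an invariant.\<close>

definition adapted_basis ::
  "('a, 'm) module => 'm set => 'm set => 'i set => 'i set => ('m => 'i => 'a) => ('i => 'm) => bool" where
  "adapted_basis N U K I C p b \<longleftrightarrow>
     finite I \<and> C \<subseteq> I \<and> p \<in> Hom N (free_mod I) \<and>
     (\<forall>x\<in>carrier N. p x = \<zero>\<^bsub>free_mod I\<^esub> \<longleftrightarrow> x \<in> U) \<and>
     (\<forall>i\<in>I. b i \<in> carrier N \<and> p (b i) = unit_vec I i) \<and>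
     (\<forall>i\<in>C. b i \<in> K) \<and>
     (\<forall>x\<in>K. \<forall>i\<in>I - C. p x i \<notin> Units A)"

definition has_adapted_basis :: "('a, 'm) module => 'm set => 'm set => nat => bool" where
  "has_adapted_basis N U K c \<longleftrightarrow>
     (\<exists>(I::nat set) C p b. adapted_basis N U K I C p b \<and> card C = c)"

definition mod_ker :: "('a, 'm) module => ('a, 'd) module => ('m => 'd) => 'm set" where
  "mod_ker N \<Delta> \<epsilon> = {x \<in> carrier N. \<epsilon> x = \<zero>\<^bsub>\<Delta>\<^esub>}"

text \<open>The situation at a weight \<open>\<mu>\<close> of a maximal object: \<open>N\<close> is the weight space, \<open>\<Delta>\<close> the sum of
  the weight spaces above, \<open>\<epsilon>\<close> the column of the operators \<open>E\<close> and \<open>\<theta>\<close> the row of the operators \<open>F\<close>. The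
  multiplicity \<open>c\<close> counts the elements of an adapted basis that lie in the kernel of \<open>\<epsilon>\<close>: the
  generators at \<open>\<mu>\<close> that nothing above \<open>\<mu>\<close> forces.\<close>

definition corner ::
  "('a, 'm) module => ('a, 'd) module => ('m => 'd) => ('d => 'm) => nat => bool" where
  "corner N \<Delta> \<epsilon> \<theta> c \<longleftrightarrow>
     module A N \<and> module A \<Delta> \<and> \<epsilon> \<in> Hom N \<Delta> \<and> \<theta> \<in> Hom \<Delta> N \<and>
     fin_gen N (carrier N) \<and>
     (\<forall>x\<in>carrier \<Delta>. \<epsilon> (\<theta> x) = \<zero>\<^bsub>\<Delta>\<^esub> --> \<theta> x = \<zero>\<^bsub>N\<^esub>) \<and>
     \<epsilon> ` carrier N = tors_closure \<Delta> (\<epsilon> ` \<theta> ` carrier \<Delta>) \<and>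
     has_adapted_basis N (\<theta> ` carrier \<Delta>) (mod_ker N \<Delta> \<epsilon>) c"

lemma cornerD:
  assumes "corner N \<Delta> \<epsilon> \<theta> c"
  shows "module A N" "module A \<Delta>" "\<epsilon> \<in> Hom N \<Delta>" "\<theta> \<in> Hom \<Delta> N" "fin_gen N (carrier N)"
    "\<And>x. x \<in> carrier \<Delta> ==> \<epsilon> (\<theta> x) = \<zero>\<^bsub>\<Delta>\<^esub> ==> \<theta> x = \<zero>\<^bsub>N\<^esub>"
    "\<epsilon> ` carrier N = tors_closure \<Delta> (\<epsilon> ` \<theta> ` carrier \<Delta>)"
    "has_adapted_basis N (\<theta> ` carrier \<Delta>) (mod_ker N \<Delta> \<epsilon>) c"
  using assms by (auto simp: corner_def)

lemma adapted_basisD: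
  assumes "adapted_basis N U K I C p b"
  shows "finite I" "C \<subseteq> I" "p \<in> Hom N (free_mod I)"
    "\<And>x. x \<in> carrier N ==> p x = \<zero>\<^bsub>free_mod I\<^esub> \<longleftrightarrow> x \<in> U"
    "\<And>i. i \<in> I ==> b i \<in> carrier N" "\<And>i. i \<in> I ==> p (b i) = unit_vec I i"
    "\<And>i. i \<in> C ==> b i \<in> K" "\<And>x i. x \<in> K ==> i \<in> I ==> i \<notin> C ==> p x i \<notin> Units A"
  using assms by (auto simp: adapted_basis_def)

text \<open>Natural numbers as indices keep the index type out of the notion of a corner.\<close>

lemma adapted_basis_reindex:
  assumes ab: "adapted_basis N U K I C p b"
  shows "has_adapted_basis N U K (card C)"
proof -
  note D = adapted_basisD[OF ab]
  obtain \<sigma> where \<sigma>: "bij_betw \<sigma> {..<card I} I" using ex_bij_betw_nat_finite[OF D(1)] by (auto simp: atLeast0LessThan)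
  define \<tau> where "\<tau> = inv_into {..<card I} \<sigma>"
  have st: "\<sigma> (\<tau> i) = i" "\<tau> i < card I" if "i \<in> I" for i
    using \<sigma> that bij_betw_inv_into_right[OF \<sigma> that] bij_betw_apply[OF bij_betw_inv_into[OF \<sigma>] that]
    by (auto simp: \<tau>_def)
  have ts: "\<tau> (\<sigma> n) = n" "\<sigma> n \<in> I" if "n < card I" for n
    using that bij_betw_inv_into_left[OF \<sigma>] bij_betw_apply[OF \<sigma>] by (auto simp: \<tau>_def)
  let ?J = "{..<card I}"
  define q where "q x = (\<lambda>n\<in>?J. p x (\<sigma> n))" for x
  have pF: "p x \<in> carrier (free_mod I)" if "x \<in> carrier N" for x using hom_closed[OF D(3) that] .
  have pFi: "p x i \<in> carrier A" if "x \<in> carrier N" "i \<in> I" for x i using dsum_component[OF pF[OF that(1)] that(2)] by simp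
  have q: "q \<in> Hom N (free_mod ?J)"
  proof (rule mod_homI)
    show "q x \<in> carrier (free_mod ?J)" if "x \<in> carrier N" for x
      using pFi[OF that] ts by (auto simp: q_def free_mod_carrier)
    show "q (x \<oplus>\<^bsub>N\<^esub> y) = q x \<oplus>\<^bsub>free_mod ?J\<^esub> q y" if "x \<in> carrier N" "y \<in> carrier N" for x y
      using hom_add[OF D(3) that] ts by (auto simp: q_def dsum_simps)
    show "q (a \<odot>\<^bsub>N\<^esub> x) = a \<odot>\<^bsub>free_mod ?J\<^esub> q x" if "a \<in> carrier A" "x \<in> carrier N" for a x
      using hom_smult[OF D(3) that] ts by (auto simp: q_def dsum_simps)
  qed
  have q0: "q x = \<zero>\<^bsub>free_mod ?J\<^esub> \<longleftrightarrow> p x = \<zero>\<^bsub>free_mod I\<^esub>" if x: "x \<in> carrier N" for x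
  proof
    assume *: "q x = \<zero>\<^bsub>free_mod ?J\<^esub>"
    show "p x = \<zero>\<^bsub>free_mod I\<^esub>"
    proof (rule dsum_eqI[where M = "\<lambda>_. ring_mod" and I = I])
      show "p x i = \<zero>\<^bsub>free_mod I\<^esub> i" if "i \<in> I" for i
        using fun_cong[OF *, of "\<tau> i"] st[OF that] that by (simp add: q_def dsum_simps)
    qed (use pF[OF x] in simp_all)
  next
    assume "p x = \<zero>\<^bsub>free_mod I\<^esub>"
    then show "q x = \<zero>\<^bsub>free_mod ?J\<^esub>" using ts by (auto simp: q_def dsum_simps)
  qed
  have "adapted_basis N U K ?J (\<tau> ` C) q (b \<circ> \<sigma>)"
    unfolding adapted_basis_def
  proof (intro conjI ballI)
    show "\<tau> ` C \<subseteq> ?J" using st D(2) by auto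
    show "q \<in> Hom N (free_mod ?J)" by (rule q)
    show "q x = \<zero>\<^bsub>free_mod ?J\<^esub> \<longleftrightarrow> x \<in> U" if "x \<in> carrier N" for x using q0[OF that] D(4)[OF that] by simp
    show "(b \<circ> \<sigma>) n \<in> carrier N" if "n \<in> ?J" for n using D(5) ts(2) that by simp
    show "q ((b \<circ> \<sigma>) n) = unit_vec ?J n" if n: "n \<in> ?J" for n
    proof (rule dsum_eqI[where M = "\<lambda>_. ring_mod" and I = ?J])
      have nI: "\<sigma> n \<in> I" using ts n by auto
      show "q ((b \<circ> \<sigma>) n) \<in> carrier (free_mod ?J)" using hom_closed[OF q] D(5)[OF nI] by simp
      show "unit_vec ?J n \<in> carrier (free_mod ?J)" using n by (rule unit_vec_closed)
      show "q ((b \<circ> \<sigma>) n) m = unit_vec ?J n m" if m: "m \<in> ?J" for m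
      proof -
        have mn: "m < card I" "n < card I" using m n by auto
        have inj: "\<sigma> m = \<sigma> n \<longleftrightarrow> m = n"
          using bij_betw_imp_inj_on[OF \<sigma>] m n by (rule inj_on_eq_iff)
        have "q ((b \<circ> \<sigma>) n) m = unit_vec I (\<sigma> n) (\<sigma> m)"
          using m D(6)[OF nI] by (simp add: q_def)
        also have "\<dots> = (if \<sigma> m = \<sigma> n then \<one> else \<zero>)" by (rule unit_vec_apply[OF nI ts(2)[OF mn(1)]])
        also have "\<dots> = (if m = n then \<one> else \<zero>)" by (simp only: inj)
        also have "\<dots> = unit_vec ?J n m" by (rule unit_vec_apply[OF n m, symmetric])
        finally show ?thesis .
      qed
    qed
    show "(b \<circ> \<sigma>) n \<in> K" if n: "n \<in> \<tau> ` C" for n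
    proof -
      obtain i where i: "i \<in> C" "n = \<tau> i" using n by (rule imageE) blast
      then show ?thesis using D(7)[OF i(1)] st(1)[OF subsetD[OF D(2) i(1)]] by simp
    qed
    show "q x n \<notin> Units A" if x: "x \<in> K" and n: "n \<in> ?J - \<tau> ` C" for x n
    proof -
      have "\<sigma> n \<notin> C"
      proof
        assume "\<sigma> n \<in> C"
        then have "\<tau> (\<sigma> n) \<in> \<tau> ` C" by (rule imageI)
        then show False using n ts by auto
      qed
      then show ?thesis using D(8)[OF x, of "\<sigma> n"] n ts by (simp add: q_def)
    qed
  qed simp
  moreover have "card (\<tau> ` C) = card C"
  proof (rule card_image, rule inj_onI)
    fix i j assume ij: "i \<in> C" "j \<in> C" "\<tau> i = \<tau> j"
    have "i = \<sigma> (\<tau> i)" using st(1)[OF subsetD[OF D(2) ij(1)]] by (rule sym)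
    also have "\<dots> = j" unfolding ij(3) by (rule st(1)[OF subsetD[OF D(2) ij(2)]])
    finally show "i = j" .
  qed
  ultimately show ?thesis unfolding has_adapted_basis_def by blast
qed

text \<open>Exchange argument: as long as some element of \<open>K\<close> has a unit coordinate outside \<open>C\<close>, it can
  replace the corresponding basis element, and its coordinate joins \<open>C\<close>. The new coordinate map is
  the old one followed by an elementary automorphism of the free module.\<close>

lemma adapted_basis_exists:
  assumes N: "module A N" and I: "finite I" and p: "p \<in> Hom N (free_mod I)"
    and pU: "\<And>x. x \<in> carrier N ==> p x = \<zero>\<^bsub>free_mod I\<^esub> \<longleftrightarrow> x \<in> U"
    and b: "\<And>i. i \<in> I ==> b i \<in> carrier N \<and> p (b i) = unit_vec I i"
    and K: "K \<subseteq> carrier N"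
  shows "\<exists>C p b. adapted_basis N U K I C p b"
proof -
  have "\<exists>C p b. adapted_basis N U K I C p b"
    if "C \<subseteq> I" "\<forall>i\<in>C. b i \<in> K" "p \<in> Hom N (free_mod I)"
      "\<And>x. x \<in> carrier N ==> p x = \<zero>\<^bsub>free_mod I\<^esub> \<longleftrightarrow> x \<in> U"
      "\<And>i. i \<in> I ==> b i \<in> carrier N \<and> p (b i) = unit_vec I i" for C p b
    using that
  proof (induction "card (I - C)" arbitrary: C p b rule: less_induct)
    case less
    note prems = less.prems
    show ?case
    proof (cases "\<forall>x\<in>K. \<forall>i\<in>I - C. p x i \<notin> Units A")
      case True
      then have "adapted_basis N U K I C p b" using prems I by (simp add: adapted_basis_def)
      then show ?thesis by blast
    next
      case False
      then obtain x j where xj: "x \<in> K" "j \<in> I" "j \<notin> C" "p x j \<in> Units A" by auto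
      have x: "x \<in> carrier N" using K xj by auto
      define u where "u = inv (p x j)"
      have u: "u \<in> carrier A" "u \<otimes> p x j = \<one>" using xj by (auto simp: u_def)
      have pcl: "p y i \<in> carrier A" if "y \<in> carrier N" "i \<in> I" for y i
        using dsum_component[OF hom_closed[OF prems(3) that(1)] that(2)] by simp
      \<comment> \<open>the elementary automorphism that sends \<open>p x\<close> to the \<open>j\<close>-th unit vector\<close>
      define q where "q y = (\<lambda>i\<in>I. if i = j then u \<otimes> p y j else p y i \<ominus> p x i \<otimes> (u \<otimes> p y j))" for y
      have q: "q \<in> Hom N (free_mod I)"
      proof (rule mod_homI)
        show "q y \<in> carrier (free_mod I)" if "y \<in> carrier N" for y
          using pcl[OF that] pcl[OF x] u xj by (auto simp: q_def free_mod_carrier I)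
        show "q (y \<oplus>\<^bsub>N\<^esub> z) = q y \<oplus>\<^bsub>free_mod I\<^esub> q z" if yz: "y \<in> carrier N" "z \<in> carrier N" for y z
        proof -
          have "(p y i \<oplus> p z i) \<ominus> p x i \<otimes> (u \<otimes> (p y j \<oplus> p z j))
              = (p y i \<ominus> p x i \<otimes> (u \<otimes> p y j)) \<oplus> (p z i \<ominus> p x i \<otimes> (u \<otimes> p z j))" if "i \<in> I" for i
            using pcl[OF \<open>y \<in> carrier N\<close>] pcl[OF \<open>z \<in> carrier N\<close>] pcl[OF x] u xj that
            by (simp add: a_minus_def r_distr minus_add a_assoc a_lcomm)
          then show ?thesis
            using pcl[OF yz(1) xj(2)] pcl[OF yz(2) xj(2)] u xj hom_add[OF prems(3) yz]
            by (auto simp: q_def dsum_simps r_distr)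
        qed
        show "q (a \<odot>\<^bsub>N\<^esub> y) = a \<odot>\<^bsub>free_mod I\<^esub> q y" if a: "a \<in> carrier A" and y: "y \<in> carrier N" for a y
        proof -
          have "a \<otimes> p y i \<ominus> p x i \<otimes> (u \<otimes> (a \<otimes> p y j)) = a \<otimes> (p y i \<ominus> p x i \<otimes> (u \<otimes> p y j))" if "i \<in> I" for i
            using pcl[OF y] pcl[OF x] u xj that a
            by (simp add: a_minus_def r_distr r_minus m_lcomm)
          then show ?thesis
            using pcl[OF y xj(2)] u xj hom_smult[OF prems(3) a y] a
            by (auto simp: q_def dsum_simps m_lcomm)
        qed
      qed
      have q0: "q y = \<zero>\<^bsub>free_mod I\<^esub> \<longleftrightarrow> y \<in> U" if y: "y \<in> carrier N" for y
      proof -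
        have "q y = \<zero>\<^bsub>free_mod I\<^esub> \<longleftrightarrow> p y = \<zero>\<^bsub>free_mod I\<^esub>"
        proof
          assume *: "q y = \<zero>\<^bsub>free_mod I\<^esub>"
          have qi: "q y i = \<zero>" if "i \<in> I" for i using fun_cong[OF *, of i] that by (simp add: dsum_simps)
          have up: "u \<otimes> p y j = \<zero>" using qi[OF xj(2)] xj by (simp add: q_def)
          have "p y i = \<zero>" if i: "i \<in> I" for i
          proof (cases "i = j")
            case True
            have "p y j = p x j \<otimes> (u \<otimes> p y j)"
              using u pcl[OF y xj(2)] pcl[OF x xj(2)] by (simp add: m_assoc[symmetric] m_comm[of "p x j" u])
            then show ?thesis using up True pcl[OF x xj(2)] by simp
          next
            case False
            then show ?thesis using qi[OF i] i up pcl[OF x i] pcl[OF y i] by (simp add: q_def a_minus_def)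
          qed
          then show "p y = \<zero>\<^bsub>free_mod I\<^esub>"
            using free_mod_eq_zero_iff[OF hom_closed[OF prems(3) y]] by simp
        next
          assume *: "p y = \<zero>\<^bsub>free_mod I\<^esub>"
          then have "p y i = \<zero>" if "i \<in> I" for i using that by (simp add: dsum_simps)
          then show "q y = \<zero>\<^bsub>free_mod I\<^esub>"
            using pcl[OF x] u xj by (auto simp: q_def dsum_simps(2) a_minus_def)
        qed
        then show ?thesis using prems(4)[OF y] by simp
      qed
      define b' where "b' = b(j := x)"
      have b': "b' i \<in> carrier N \<and> q (b' i) = unit_vec I i" if i: "i \<in> I" for i
      proof
        show bi: "b' i \<in> carrier N" using prems(5)[OF i] x by (simp add: b'_def)
        show "q (b' i) = unit_vec I i"
        proof (rule dsum_eqI[OF hom_closed[OF q bi] unit_vec_closed[OF i]])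
          fix k assume k: "k \<in> I"
          show "q (b' i) k = unit_vec I i k"
          proof (cases "i = j")
            case True
            have "p x k \<ominus> p x k \<otimes> (u \<otimes> p x j) = \<zero>" using u pcl[OF x k] by (simp add: r_right_minus_eq)
            then show ?thesis using True u k i by (simp add: b'_def q_def unit_vec_apply)
          next
            case False
            then have "p (b i) j = \<zero>" "p (b i) k = unit_vec I i k"
              using prems(5)[OF i] i xj(2) by (simp_all add: unit_vec_apply)
            then show ?thesis
              using False k i xj(2) u pcl[OF x k] by (auto simp: b'_def q_def unit_vec_apply a_minus_def)
          qed
        qed
      qed
      have "card (I - insert j C) < card (I - C)"
        using xj I by (intro psubset_card_mono) auto
      moreover have "insert j C \<subseteq> I" "\<forall>i\<in>insert j C. b' i \<in> K"
        using xj prems(1,2) by (auto simp: b'_def)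
      ultimately show ?thesis using less.hyps[OF _ _ _ q q0 b'] by blast
    qed
  qed
  from this[of "{}" b p] show ?thesis using p pU b by simp
qed

end

context local_noetherian_domain
begin

text \<open>The image of \<open>\<epsilon>\<close>, a torsion closure, is determined by \<open>\<epsilon> \<theta>\<close> alone, so a map that intertwines
  the products \<open>\<epsilon> \<theta>\<close> carries one image into the other.\<close>

lemma corner_angle_transfer:
  assumes c: "corner N \<Delta> \<epsilon> \<theta> c" and c': "corner N' \<Delta>' \<epsilon>' \<theta>' c'"
    and g: "g \<in> Hom \<Delta> \<Delta>'"
    and gc: "\<And>x. x \<in> carrier \<Delta> ==> g (\<epsilon> (\<theta> x)) = \<epsilon>' (\<theta>' (g x))"
    and x: "x \<in> carrier N"
  shows "\<exists>y\<in>carrier N'. \<epsilon>' y = g (\<epsilon> x)"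
proof -
  note D = cornerD[OF c] and D' = cornerD[OF c']
  have "\<epsilon> x \<in> tors_closure \<Delta> (\<epsilon> ` \<theta> ` carrier \<Delta>)" using D(7) x by blast
  then obtain \<xi> z where \<xi>: "\<xi> \<in> carrier A" "\<xi> \<noteq> \<zero>" and z: "z \<in> carrier \<Delta>" "\<xi> \<odot>\<^bsub>\<Delta>\<^esub> \<epsilon> x = \<epsilon> (\<theta> z)"
    by (auto simp: tors_closure_def)
  have ex: "\<epsilon> x \<in> carrier \<Delta>" using hom_closed[OF D(3) x] .
  have "\<xi> \<odot>\<^bsub>\<Delta>'\<^esub> g (\<epsilon> x) = \<epsilon>' (\<theta>' (g z))"
    using hom_smult[OF g \<xi>(1) ex] z gc[OF z(1)] by simp
  then have "g (\<epsilon> x) \<in> tors_closure \<Delta>' (\<epsilon>' ` \<theta>' ` carrier \<Delta>')"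
    using \<xi> hom_closed[OF g ex] hom_closed[OF g z(1)] unfolding tors_closure_def by blast
  then have "g (\<epsilon> x) \<in> \<epsilon>' ` carrier N'" using D'(7) by simp
  then obtain y where "g (\<epsilon> x) = \<epsilon>' y" "y \<in> carrier N'" by (rule imageE)
  then show ?thesis by (intro bexI[of _ y]) simp_all
qed

lemma mod_iso_inverse:
  assumes g: "g \<in> Hom M N" and b: "bij_betw g (carrier M) (carrier N)" and M: "module A M"
  shows "\<exists>h\<in>Hom N M. bij_betw h (carrier N) (carrier M) \<and>
    (\<forall>x\<in>carrier M. h (g x) = x) \<and> (\<forall>y\<in>carrier N. g (h y) = y)"
  using hom_inv_into[OF g b M] bij_betw_inv_into[OF b]
    bij_betw_inv_into_left[OF b] bij_betw_inv_into_right[OF b] by (intro bexI conjI ballI)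

lemma inverse_commutes:
  assumes c: "corner N \<Delta> \<epsilon> \<theta> c"
    and gc: "\<And>x. x \<in> carrier \<Delta> ==> g (\<epsilon> (\<theta> x)) = \<epsilon>' (\<theta>' (g x))"
    and h: "h \<in> Hom \<Delta>' \<Delta>" "\<And>x. x \<in> carrier \<Delta> ==> h (g x) = x" "\<And>y. y \<in> carrier \<Delta>' ==> g (h y) = y"
    and y: "y \<in> carrier \<Delta>'"
  shows "h (\<epsilon>' (\<theta>' y)) = \<epsilon> (\<theta> (h y))"
proof -
  note D = cornerD[OF c]
  have hy: "h y \<in> carrier \<Delta>" using hom_closed[OF h(1) y] .
  have "\<epsilon>' (\<theta>' y) = g (\<epsilon> (\<theta> (h y)))" using gc[OF hy] h(3)[OF y] by simp
  moreover have "\<epsilon> (\<theta> (h y)) \<in> carrier \<Delta>"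
    using hom_closed[OF D(3) hom_closed[OF D(4) hy]] .
  ultimately show ?thesis using h(2) by simp
qed

text \<open>The crucial use of locality. Every element of \<open>N'\<close> agrees with a value of \<open>f\<close> up to an element
  of the kernel of \<open>\<epsilon>'\<close>, whose coordinates outside \<open>C\<close> are non-units. If \<open>f\<close> also hits the basis
  elements in \<open>C\<close>, its image fills \<open>N'\<close> modulo the image of \<open>\<theta>'\<close> and the maximal ideal, and
  Nakayama's lemma applies; the image of \<open>\<theta>'\<close> is covered because \<open>g\<close> is onto.\<close>

lemma corner_hom_surj:
  assumes c: "corner N \<Delta> \<epsilon> \<theta> c" and c': "corner N' \<Delta>' \<epsilon>' \<theta>' c'"
    and g: "g \<in> Hom \<Delta> \<Delta>'" "bij_betw g (carrier \<Delta>) (carrier \<Delta>')"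
    and f: "f \<in> Hom N N'"
    and fe: "\<And>x. x \<in> carrier N ==> \<epsilon>' (f x) = g (\<epsilon> x)"
    and ft: "\<And>x. x \<in> carrier \<Delta> ==> f (\<theta> x) = \<theta>' (g x)"
    and ab: "adapted_basis N' (\<theta>' ` carrier \<Delta>') (mod_ker N' \<Delta>' \<epsilon>') I C p b"
    and bC: "\<And>i. i \<in> C ==> b i \<in> f ` carrier N"
  shows "f ` carrier N = carrier N'"
proof
  note D = cornerD[OF c] and D' = cornerD[OF c'] and B = adapted_basisD[OF ab]
  show "f ` carrier N \<subseteq> carrier N'" using hom_closed[OF f] by blast
  obtain h where h: "h \<in> Hom \<Delta>' \<Delta>" "bij_betw h (carrier \<Delta>') (carrier \<Delta>)"
    "\<And>x. x \<in> carrier \<Delta> ==> h (g x) = x" "\<And>y. y \<in> carrier \<Delta>' ==> g (h y) = y"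
    using mod_iso_inverse[OF g D(2)] by blast
  have gc: "g (\<epsilon> (\<theta> x)) = \<epsilon>' (\<theta>' (g x))" if "x \<in> carrier \<Delta>" for x
    using fe[OF hom_closed[OF D(4) that]] ft[OF that] by simp
  have hc: "h (\<epsilon>' (\<theta>' y)) = \<epsilon> (\<theta> (h y))" if "y \<in> carrier \<Delta>'" for y
    using inverse_commutes[where g = g and h = h and \<epsilon>' = \<epsilon>' and \<theta>' = \<theta>', OF c gc h(1,3,4) that] .
  note S = submod_image[OF f D(1) D'(1) submod_carrier[OF D(1)]]
  have U: "\<theta>' y \<in> f ` carrier N" if "y \<in> carrier \<Delta>'" for y
  proof -
    have "\<theta>' y = f (\<theta> (h y))" using ft[OF hom_closed[OF h(1) that]] h(4)[OF that] by simp
    then show ?thesis using hom_closed[OF D(4) hom_closed[OF h(1) that]] by blast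
  qed
  have lift: "\<exists>x\<in>carrier N. \<epsilon>' y = \<epsilon>' (f x)" if y: "y \<in> carrier N'" for y
  proof -
    obtain x where x: "x \<in> carrier N" "\<epsilon> x = h (\<epsilon>' y)"
      using corner_angle_transfer[OF c' c h(1) hc y] by blast
    have "\<epsilon>' (f x) = \<epsilon>' y" using fe[OF x(1)] x(2) h(4)[OF hom_closed[OF D'(3) y]] by simp
    then show ?thesis using x(1) by (intro bexI[of _ x]) simp_all
  qed
  let ?H = "p ` f ` carrier N"
  have H: "submodule ?H A (free_mod I)" by (rule submod_image[OF B(3) D'(1) module_free_mod S])
  have pcl: "p y j \<in> carrier A" if "y \<in> carrier N'" "j \<in> I" for y j
    using dsum_component[OF hom_closed[OF B(3) that(1)] that(2)] by simp
  have "\<exists>h\<in>?H. \<forall>j\<in>I. unit_vec I i j \<ominus> h j \<notin> Units A" if i: "i \<in> I" for i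
  proof (cases "i \<in> C")
    case True
    have "unit_vec I i \<in> ?H" using bC[OF True] B(6)[OF i] by (metis imageI)
    moreover have "unit_vec I i j \<ominus> unit_vec I i j \<notin> Units A" if "j \<in> I" for j
      using that i by (simp add: unit_vec_apply a_minus_def r_neg)
    ultimately show ?thesis by blast
  next
    case False
    have bi: "b i \<in> carrier N'" by (rule B(5)[OF i])
    obtain x where x: "x \<in> carrier N" "\<epsilon>' (b i) = \<epsilon>' (f x)" using lift[OF bi] by blast
    have fx: "f x \<in> carrier N'" by (rule hom_closed[OF f x(1)])
    define y where "y = b i \<ominus>\<^bsub>N'\<^esub> f x"
    have y: "y \<in> carrier N'" unfolding y_def by (rule mod_minus_closed[OF D'(1) bi fx])
    have yk: "y \<in> mod_ker N' \<Delta>' \<epsilon>'"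
      using y x hom_diff[OF D'(3,1,2) bi fx] hom_closed[OF D'(3) fx] D'(2)
      by (simp add: mod_ker_def y_def)
    \<comment> \<open>the coordinates of the error \<open>y\<close> at \<open>C\<close> may be units, but they can be corrected inside the image\<close>
    define r where "r = (\<lambda>j\<in>I. if j \<in> C then p y j else \<zero>)"
    have r: "r \<in> carrier (free_mod I)" using pcl[OF y] by (simp add: r_def free_mod_carrier[OF B(1)])
    define z where "z = lincomb N' I b r"
    have z: "z \<in> f ` carrier N"
      unfolding z_def
    proof (rule lincomb_in_submod[OF D'(1) S])
      fix j assume j: "j \<in> I"
      show "r j \<odot>\<^bsub>N'\<^esub> b j \<in> f ` carrier N"
      proof (cases "j \<in> C")
        case True
        then show ?thesis using submod_smult[OF S D'(1) pcl[OF y j] bC[OF True]] j by (simp add: r_def)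
      next
        case False
        then show ?thesis using submod_zero[OF S D'(1)] D'(1) B(5)[OF j] j by (simp add: r_def)
      qed
    qed
    have zN: "z \<in> carrier N'" by (rule submod_subset[OF S D'(1) z])
    have "p (lincomb N' I b r) = r" by (rule coordinates_lincomb[OF D'(1) B(3,5,6) r])
    then have pz: "p z = r" by (simp add: z_def)
    have fxz: "f x \<oplus>\<^bsub>N'\<^esub> z \<in> f ` carrier N"
      by (rule submod_add[OF S D'(1) imageI[OF x(1)] z])
    have diff: "unit_vec I i j \<ominus> p (f x \<oplus>\<^bsub>N'\<^esub> z) j = p y j \<ominus> r j" if j: "j \<in> I" for j
    proof -
      have "b i = y \<oplus>\<^bsub>N'\<^esub> f x" unfolding y_def using mod_diff_add_cancel[OF D'(1) bi fx] by simp
      then have "p (b i) = p y \<oplus>\<^bsub>free_mod I\<^esub> p (f x)" using hom_add[OF B(3) y fx] by simp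
      then have 1: "unit_vec I i j = p y j \<oplus> p (f x) j" using B(6)[OF i] j by (simp add: dsum_simps(3))
      have 2: "p (f x \<oplus>\<^bsub>N'\<^esub> z) j = p (f x) j \<oplus> r j"
        using hom_add[OF B(3) fx zN] pz j by (simp add: dsum_simps(3))
      have rj: "r j \<in> carrier A" using dsum_component[OF r j] by simp
      show ?thesis unfolding 1 2
        using pcl[OF y j] pcl[OF fx j] rj
        by (simp add: a_minus_def minus_add a_assoc[symmetric]) (simp add: a_assoc r_neg)
    qed
    have "unit_vec I i j \<ominus> p (f x \<oplus>\<^bsub>N'\<^esub> z) j \<notin> Units A" if j: "j \<in> I" for j
    proof (cases "j \<in> C")
      case True
      then show ?thesis unfolding diff[OF j] using j pcl[OF y j] by (simp add: r_def a_minus_def r_neg)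
    next
      case False
      then show ?thesis unfolding diff[OF j] using j pcl[OF y j] B(8)[OF yk j False]
        by (simp add: r_def a_minus_def)
    qed
    then show ?thesis using fxz by blast
  qed
  then have full: "carrier (free_mod I) \<subseteq> ?H" by (rule nakayama_free[OF B(1) H])
  show "carrier N' \<subseteq> f ` carrier N"
  proof
    fix y assume y: "y \<in> carrier N'"
    have "p y \<in> ?H" using full hom_closed[OF B(3) y] by blast
    then obtain x where x: "x \<in> carrier N" "p y = p (f x)" by blast
    have fx: "f x \<in> carrier N'" by (rule hom_closed[OF f x(1)])
    have "p (y \<ominus>\<^bsub>N'\<^esub> f x) = \<zero>\<^bsub>free_mod I\<^esub>"
      using hom_diff[OF B(3) D'(1) module_free_mod y fx] x hom_closed[OF B(3) fx] by simp
    then have "y \<ominus>\<^bsub>N'\<^esub> f x \<in> \<theta>' ` carrier \<Delta>'" using B(4)[OF mod_minus_closed[OF D'(1) y fx]] by simp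
    then obtain z where "z \<in> carrier \<Delta>'" "y \<ominus>\<^bsub>N'\<^esub> f x = \<theta>' z" by blast
    then have "y \<ominus>\<^bsub>N'\<^esub> f x \<in> f ` carrier N" using U by simp
    from submod_add[OF S D'(1) this imageI[OF x(1)]]
    show "y \<in> f ` carrier N" using mod_diff_add_cancel[OF D'(1) y fx] by simp
  qed
qed

text \<open>The module \<open>N\<close> is the direct sum of the image of \<open>\<theta>\<close> and the span of the lifted basis. On the first
  part the extension is forced, and well defined because \<open>\<epsilon>'\<close> is injective on the image of \<open>\<theta>'\<close>.
  A basis element may go to any element with the right image under \<open>\<epsilon>'\<close>; those in \<open>C\<close>, killed by
  \<open>\<epsilon>\<close>, are matched with those in \<open>C'\<close>, which are equally many, and this makes the extension onto.\<close>

lemma corner_extend_surj: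
  assumes c: "corner N \<Delta> \<epsilon> \<theta> c" and c': "corner N' \<Delta>' \<epsilon>' \<theta>' c"
    and g: "g \<in> Hom \<Delta> \<Delta>'" "bij_betw g (carrier \<Delta>) (carrier \<Delta>')"
    and gc: "\<And>x. x \<in> carrier \<Delta> ==> g (\<epsilon> (\<theta> x)) = \<epsilon>' (\<theta>' (g x))"
  shows "\<exists>f\<in>Hom N N'. (\<forall>x\<in>carrier N. \<epsilon>' (f x) = g (\<epsilon> x)) \<and>
     (\<forall>x\<in>carrier \<Delta>. f (\<theta> x) = \<theta>' (g x)) \<and> f ` carrier N = carrier N'"
proof -
  note D = cornerD[OF c] and D' = cornerD[OF c']
  obtain I C p b where ab: "adapted_basis N (\<theta> ` carrier \<Delta>) (mod_ker N \<Delta> \<epsilon>) (I::nat set) C p b" and C: "card C = c"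
    using D(8) by (auto simp: has_adapted_basis_def)
  obtain I' C' p' b' where ab': "adapted_basis N' (\<theta>' ` carrier \<Delta>') (mod_ker N' \<Delta>' \<epsilon>') (I'::nat set) C' p' b'" and C': "card C' = c"
    using D'(8) by (auto simp: has_adapted_basis_def)
  note B = adapted_basisD[OF ab] and B' = adapted_basisD[OF ab']
  have "finite C" "finite C'" using B(1,2) B'(1,2) finite_subset by auto
  then obtain \<sigma> where \<sigma>: "bij_betw \<sigma> C C'" using C C' finite_same_card_bij by metis
  have "\<exists>y\<in>carrier N'. \<epsilon>' y = g (\<epsilon> (b i)) \<and> (i \<in> C --> y = b' (\<sigma> i))" if i: "i \<in> I" for i
  proof (cases "i \<in> C")
    case True
    then have "\<sigma> i \<in> C'" using bij_betw_apply[OF \<sigma>] by blast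
    then have "b' (\<sigma> i) \<in> carrier N'" "\<epsilon>' (b' (\<sigma> i)) = \<zero>\<^bsub>\<Delta>'\<^esub>" using B'(7)[of "\<sigma> i"] by (auto simp: mod_ker_def)
    moreover have "g (\<epsilon> (b i)) = \<zero>\<^bsub>\<Delta>'\<^esub>"
      using B(7)[OF True] hom_zero[OF g(1) D(2) D'(2)] by (simp add: mod_ker_def)
    ultimately show ?thesis by (intro bexI[of _ "b' (\<sigma> i)"]) simp_all
  next
    case False
    then show ?thesis using corner_angle_transfer[OF c c' g(1) gc B(5)[OF i]] by blast
  qed
  then obtain n where n: "\<And>i. i \<in> I ==> n i \<in> carrier N'" "\<And>i. i \<in> I ==> \<epsilon>' (n i) = g (\<epsilon> (b i))"
    "\<And>i. i \<in> I ==> i \<in> C ==> n i = b' (\<sigma> i)" by metis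
  \<comment> \<open>the prescribed map on the image of \<open>\<theta>\<close>\<close>
  define \<psi> where "\<psi> u = \<theta>' (g (inv_into (carrier \<Delta>) \<theta> u))" for u
  have \<psi>: "\<psi> (\<theta> x) = \<theta>' (g x)" if x: "x \<in> carrier \<Delta>" for x
  proof -
    let ?w = "inv_into (carrier \<Delta>) \<theta> (\<theta> x)"
    have w: "?w \<in> carrier \<Delta>" "\<theta> ?w = \<theta> x" using inv_into_into[OF imageI[OF x]] f_inv_into_f[OF imageI[OF x]] by auto
    let ?d = "?w \<ominus>\<^bsub>\<Delta>\<^esub> x"
    have d: "?d \<in> carrier \<Delta>" by (rule mod_minus_closed[OF D(2) w(1) x])
    have "\<theta> ?d = \<zero>\<^bsub>N\<^esub>" using hom_diff[OF D(4,2,1) w(1) x] w(2) hom_closed[OF D(4) x] D(1) by simp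
    then have "\<epsilon>' (\<theta>' (g ?d)) = \<zero>\<^bsub>\<Delta>'\<^esub>"
      using gc[OF d] hom_zero[OF D(3,1,2)] hom_zero[OF g(1) D(2) D'(2)] by simp
    then have "\<theta>' (g ?d) = \<zero>\<^bsub>N'\<^esub>" by (rule D'(6)[OF hom_closed[OF g(1) d]])
    then have "\<theta>' (g ?w) \<ominus>\<^bsub>N'\<^esub> \<theta>' (g x) = \<zero>\<^bsub>N'\<^esub>"
      using hom_diff[OF g(1) D(2) D'(2) w(1) x]
        hom_diff[OF D'(4,2,1) hom_closed[OF g(1) w(1)] hom_closed[OF g(1) x]] by simp
    then show ?thesis
      using mod_diff_eq_zero_iff[OF D'(1) hom_closed[OF D'(4) hom_closed[OF g(1) w(1)]] hom_closed[OF D'(4) hom_closed[OF g(1) x]]]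
      by (simp add: \<psi>_def)
  qed
  note lb = lincomb_hom[where b = b and M = N, OF D(1) B(5)]
  note ln = lincomb_hom[where b = n and M = N', OF D'(1) n(1)]
  define r where "r x = x \<ominus>\<^bsub>N\<^esub> lincomb N I b (p x)" for x
  have r: "r \<in> Hom N N"
    unfolding r_def by (rule hom_minus[OF hom_id hom_comp[OF B(3) lb] D(1) D(1)])
  have plb: "p (lincomb N I b a) = a" if a: "a \<in> carrier (free_mod I)" for a
    by (rule coordinates_lincomb[OF D(1) B(3,5,6) a])
  have rU: "\<exists>s\<in>carrier \<Delta>. r x = \<theta> s" if x: "x \<in> carrier N" for x
  proof -
    have px: "p x \<in> carrier (free_mod I)" by (rule hom_closed[OF B(3) x])
    have "p (r x) = p x \<ominus>\<^bsub>free_mod I\<^esub> p (lincomb N I b (p x))"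
      unfolding r_def by (rule hom_diff[OF B(3) D(1) module_free_mod x hom_closed[OF lb px]])
    also have "\<dots> = \<zero>\<^bsub>free_mod I\<^esub>" using plb[OF px] px by simp
    finally have "r x \<in> \<theta> ` carrier \<Delta>" using B(4)[OF hom_closed[OF r x]] by simp
    then show ?thesis by blast
  qed
  have \<psi>r: "(\<lambda>x. \<psi> (r x)) \<in> Hom N N'"
  proof (rule mod_homI)
    fix x assume x: "x \<in> carrier N"
    obtain s where s: "s \<in> carrier \<Delta>" "r x = \<theta> s" using rU[OF x] by blast
    show "\<psi> (r x) \<in> carrier N'" using \<psi>[OF s(1)] s(2) hom_closed[OF D'(4) hom_closed[OF g(1) s(1)]] by simp
    show "\<psi> (r (a \<odot>\<^bsub>N\<^esub> x)) = a \<odot>\<^bsub>N'\<^esub> \<psi> (r x)" if a: "a \<in> carrier A" for a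
    proof -
      have "r (a \<odot>\<^bsub>N\<^esub> x) = \<theta> (a \<odot>\<^bsub>\<Delta>\<^esub> s)"
        using hom_smult[OF r a x] hom_smult[OF D(4) a s(1)] s(2) by simp
      then have "\<psi> (r (a \<odot>\<^bsub>N\<^esub> x)) = \<theta>' (g (a \<odot>\<^bsub>\<Delta>\<^esub> s))" using \<psi>[OF mod_smult_closed[OF D(2) a s(1)]] by simp
      also have "\<dots> = a \<odot>\<^bsub>N'\<^esub> \<theta>' (g s)"
        using hom_smult[OF g(1) a s(1)] hom_smult[OF D'(4) a hom_closed[OF g(1) s(1)]] by simp
      finally show ?thesis using \<psi>[OF s(1)] s(2) by simp
    qed
    fix y assume y: "y \<in> carrier N"
    obtain t where t: "t \<in> carrier \<Delta>" "r y = \<theta> t" using rU[OF y] by blast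
    have "r (x \<oplus>\<^bsub>N\<^esub> y) = \<theta> (s \<oplus>\<^bsub>\<Delta>\<^esub> t)"
      using hom_add[OF r x y] hom_add[OF D(4) s(1) t(1)] s(2) t(2) by simp
    then have "\<psi> (r (x \<oplus>\<^bsub>N\<^esub> y)) = \<theta>' (g (s \<oplus>\<^bsub>\<Delta>\<^esub> t))" using \<psi>[OF mod_add_closed[OF D(2) s(1) t(1)]] by simp
    also have "\<dots> = \<theta>' (g s) \<oplus>\<^bsub>N'\<^esub> \<theta>' (g t)"
      using hom_add[OF g(1) s(1) t(1)] hom_add[OF D'(4) hom_closed[OF g(1) s(1)] hom_closed[OF g(1) t(1)]] by simp
    finally show "\<psi> (r (x \<oplus>\<^bsub>N\<^esub> y)) = \<psi> (r x) \<oplus>\<^bsub>N'\<^esub> \<psi> (r y)" using \<psi>[OF s(1)] \<psi>[OF t(1)] s(2) t(2) by simp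
  qed
  define f where "f x = \<psi> (r x) \<oplus>\<^bsub>N'\<^esub> lincomb N' I n (p x)" for x
  have f: "f \<in> Hom N N'"
    unfolding f_def by (rule hom_plus[OF \<psi>r hom_comp[OF B(3) ln] D(1) D'(1)])
  have ft: "f (\<theta> x) = \<theta>' (g x)" if x: "x \<in> carrier \<Delta>" for x
  proof -
    have tx: "\<theta> x \<in> carrier N" by (rule hom_closed[OF D(4) x])
    have p0: "p (\<theta> x) = \<zero>\<^bsub>free_mod I\<^esub>" using B(4)[OF tx] x by blast
    have "r (\<theta> x) = \<theta> x"
      unfolding r_def p0 using hom_zero[OF lb module_free_mod D(1)] mod_diff_zero[OF D(1) tx] by simp
    then show ?thesis
      unfolding f_def p0 using hom_zero[OF ln module_free_mod D'(1)] \<psi>[OF x]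
        mod_add_zero[OF D'(1) hom_closed[OF D'(4) hom_closed[OF g(1) x]]] by simp
  qed
  have fe: "\<epsilon>' (f x) = g (\<epsilon> x)" if x: "x \<in> carrier N" for x
  proof -
    have px: "p x \<in> carrier (free_mod I)" by (rule hom_closed[OF B(3) x])
    have "\<epsilon>' (lincomb N' I n (p x)) = g (\<epsilon> (lincomb N I b (p x)))"
    proof (rule free_hom_ext[OF D'(2) hom_comp[OF ln D'(3)] hom_comp[OF hom_comp[OF lb D(3)] g(1)] _ px])
      show "\<epsilon>' (lincomb N' I n (unit_vec I i)) = g (\<epsilon> (lincomb N I b (unit_vec I i)))" if "i \<in> I" for i
        using lincomb_unit[where b = b and M = N, OF D(1) B(5) that] n(2)[OF that]
          lincomb_unit[where b = n and M = N', OF D'(1) n(1) that] by simp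
    qed
    moreover obtain s where s: "s \<in> carrier \<Delta>" "r x = \<theta> s" using rU[OF x] by blast
    then have "\<epsilon>' (\<psi> (r x)) = g (\<epsilon> (r x))" using \<psi>[OF s(1)] gc[OF s(1)] by simp
    moreover have "\<epsilon>' (f x) = \<epsilon>' (\<psi> (r x)) \<oplus>\<^bsub>\<Delta>'\<^esub> \<epsilon>' (lincomb N' I n (p x))"
      unfolding f_def by (rule hom_add[OF D'(3) hom_closed[OF \<psi>r x] hom_closed[OF ln px]])
    moreover have "g (\<epsilon> x) = g (\<epsilon> (r x)) \<oplus>\<^bsub>\<Delta>'\<^esub> g (\<epsilon> (lincomb N I b (p x)))"
    proof -
      have l: "lincomb N I b (p x) \<in> carrier N" by (rule hom_closed[OF lb px])
      have "x = r x \<oplus>\<^bsub>N\<^esub> lincomb N I b (p x)" unfolding r_def using mod_diff_add_cancel[OF D(1) x l] by simp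
      then show ?thesis using hom_add[OF hom_comp[OF D(3) g(1)] hom_closed[OF r x] l] by simp
    qed
    ultimately show ?thesis by simp
  qed
  have "b' j \<in> f ` carrier N" if j: "j \<in> C'" for j
  proof -
    obtain i where i: "i \<in> C" "j = \<sigma> i" using \<sigma> j by (auto simp: bij_betw_def)
    have iI: "i \<in> I" using B(2) i(1) by blast
    have "r (b i) = \<zero>\<^bsub>N\<^esub>"
      unfolding r_def B(6)[OF iI] using lincomb_unit[where b = b and M = N, OF D(1) B(5) iI] mod_diff_self[OF D(1) B(5)[OF iI]] by simp
    moreover have "\<psi> \<zero>\<^bsub>N\<^esub> = \<zero>\<^bsub>N'\<^esub>"
      using \<psi>[OF mod_zero_closed[OF D(2)]] hom_zero[OF D(4,2,1)] hom_zero[OF g(1) D(2) D'(2)] hom_zero[OF D'(4,2,1)] by simp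
    ultimately have "f (b i) = b' j"
      unfolding f_def B(6)[OF iI] using lincomb_unit[where b = n and M = N', OF D'(1) n(1) iI] n(3)[OF iI i(1)] i(2)
        mod_zero_add[OF D'(1) n(1)[OF iI]] by simp
    then show ?thesis using B(5)[OF iI] by (intro image_eqI[of _ _ "b i"]) simp_all
  qed
  from corner_hom_surj[OF c c' g f fe ft ab' this] have "f ` carrier N = carrier N'" by blast
  then show ?thesis using f fe ft by blast
qed

text \<open>Composed with a surjective extension of the inverse of \<open>g\<close>, the map \<open>f\<close> becomes a surjective
  endomorphism of a finitely generated module, hence injective.\<close>

lemma corner_surj_imp_bij:
  assumes c: "corner N \<Delta> \<epsilon> \<theta> c" and c': "corner N' \<Delta>' \<epsilon>' \<theta>' c"
    and g: "g \<in> Hom \<Delta> \<Delta>'" "bij_betw g (carrier \<Delta>) (carrier \<Delta>')"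
    and gc: "\<And>x. x \<in> carrier \<Delta> ==> g (\<epsilon> (\<theta> x)) = \<epsilon>' (\<theta>' (g x))"
    and f: "f \<in> Hom N N'" "f ` carrier N = carrier N'"
  shows "bij_betw f (carrier N) (carrier N')"
proof -
  note D = cornerD[OF c]
  obtain h where h: "h \<in> Hom \<Delta>' \<Delta>" "bij_betw h (carrier \<Delta>') (carrier \<Delta>)"
    "\<And>x. x \<in> carrier \<Delta> ==> h (g x) = x" "\<And>y. y \<in> carrier \<Delta>' ==> g (h y) = y"
    using mod_iso_inverse[OF g D(2)] by blast
  have hc: "h (\<epsilon>' (\<theta>' y)) = \<epsilon> (\<theta> (h y))" if "y \<in> carrier \<Delta>'" for y
    using inverse_commutes[where g = g and h = h and \<epsilon>' = \<epsilon>' and \<theta>' = \<theta>', OF c gc h(1,3,4) that] .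
  obtain k where k: "k \<in> Hom N' N" "k ` carrier N' = carrier N"
    using corner_extend_surj[OF c' c h(1,2) hc] by blast
  have "(\<lambda>x. k (f x)) ` carrier N = k ` f ` carrier N" by (simp add: image_image)
  also have "\<dots> = carrier N" using f(2) k(2) by simp
  finally have "inj_on (\<lambda>x. k (f x)) (carrier N)"
    by (rule surj_endo_inj[OF D(1,5) hom_comp[OF f(1) k(1)]])
  then have "inj_on f (carrier N)" by (auto simp: inj_on_def)
  then show ?thesis using f(2) by (simp add: bij_betw_def)
qed

text \<open>A corner is determined up to isomorphism by \<open>\<Delta>\<close>, the product \<open>\<epsilon> \<theta>\<close> and its multiplicity.\<close>

lemma corner_extend:
  assumes c: "corner N \<Delta> \<epsilon> \<theta> c" and c': "corner N' \<Delta>' \<epsilon>' \<theta>' c"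
    and g: "g \<in> Hom \<Delta> \<Delta>'" "bij_betw g (carrier \<Delta>) (carrier \<Delta>')"
    and gc: "\<And>x. x \<in> carrier \<Delta> ==> g (\<epsilon> (\<theta> x)) = \<epsilon>' (\<theta>' (g x))"
  shows "\<exists>f\<in>Hom N N'. bij_betw f (carrier N) (carrier N') \<and>
     (\<forall>x\<in>carrier N. \<epsilon>' (f x) = g (\<epsilon> x)) \<and> (\<forall>x\<in>carrier \<Delta>. f (\<theta> x) = \<theta>' (g x))"
proof -
  obtain f where f: "f \<in> Hom N N'" "\<forall>x\<in>carrier N. \<epsilon>' (f x) = g (\<epsilon> x)"
    "\<forall>x\<in>carrier \<Delta>. f (\<theta> x) = \<theta>' (g x)" "f ` carrier N = carrier N'"
    using corner_extend_surj[OF c c' g gc] by blast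
  have "bij_betw f (carrier N) (carrier N')" by (rule corner_surj_imp_bij[OF c c' g gc f(1,4)])
  with f show ?thesis by blast
qed

text \<open>In multiplicity zero there is nothing left to hit, so every compatible map is an isomorphism.
  This rigidity is the source of the local endomorphism rings.\<close>

lemma corner_hom_bij:
  assumes c: "corner N \<Delta> \<epsilon> \<theta> 0" and c': "corner N' \<Delta>' \<epsilon>' \<theta>' 0"
    and g: "g \<in> Hom \<Delta> \<Delta>'" "bij_betw g (carrier \<Delta>) (carrier \<Delta>')"
    and f: "f \<in> Hom N N'"
    and fe: "\<And>x. x \<in> carrier N ==> \<epsilon>' (f x) = g (\<epsilon> x)"
    and ft: "\<And>x. x \<in> carrier \<Delta> ==> f (\<theta> x) = \<theta>' (g x)"
  shows "bij_betw f (carrier N) (carrier N')"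
proof -
  note D = cornerD[OF c] and D' = cornerD[OF c']
  obtain I' C' p' b' where ab': "adapted_basis N' (\<theta>' ` carrier \<Delta>') (mod_ker N' \<Delta>' \<epsilon>') (I'::nat set) C' p' b'" and C': "card C' = 0"
    using D'(8) by (auto simp: has_adapted_basis_def)
  have "C' = {}" using C' adapted_basisD(1,2)[OF ab'] finite_subset by fastforce
  then have "f ` carrier N = carrier N'"
    by (intro corner_hom_surj[OF c c' g f fe ft ab']) simp_all
  moreover have "g (\<epsilon> (\<theta> x)) = \<epsilon>' (\<theta>' (g x))" if "x \<in> carrier \<Delta>" for x
    using fe[OF hom_closed[OF D(4) that]] ft[OF that] by simp
  ultimately show ?thesis using corner_surj_imp_bij[OF c c' g _ f] by blast
qed

end

context local_noetherian_domain
begin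

subsection \<open>Transport of corners\<close>

lemma corner_iso:
  assumes c: "corner N \<Delta> \<epsilon> \<theta> c" and N': "module A N'" and \<Delta>': "module A \<Delta>'"
    and e': "\<epsilon>' \<in> Hom N' \<Delta>'" and t': "\<theta>' \<in> Hom \<Delta>' N'"
    and h: "h \<in> Hom N N'" "bij_betw h (carrier N) (carrier N')"
    and k: "k \<in> Hom \<Delta> \<Delta>'" "bij_betw k (carrier \<Delta>) (carrier \<Delta>')"
    and he: "\<And>x. x \<in> carrier N ==> \<epsilon>' (h x) = k (\<epsilon> x)"
    and ht: "\<And>x. x \<in> carrier \<Delta> ==> \<theta>' (k x) = h (\<theta> x)"
  shows "corner N' \<Delta>' \<epsilon>' \<theta>' c"
proof -
  note D = cornerD[OF c]
  obtain h' where h': "h' \<in> Hom N' N" "bij_betw h' (carrier N') (carrier N)"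
    "\<And>x. x \<in> carrier N ==> h' (h x) = x" "\<And>y. y \<in> carrier N' ==> h (h' y) = y"
    using mod_iso_inverse[OF h D(1)] by blast
  have hN: "carrier N' = h ` carrier N" using h(2) by (simp add: bij_betw_def)
  have kD: "carrier \<Delta>' = k ` carrier \<Delta>" using k(2) by (simp add: bij_betw_def)
  have kinj: "k x = k y \<longleftrightarrow> x = y" if "x \<in> carrier \<Delta>" "y \<in> carrier \<Delta>" for x y
    using k(2) that by (auto simp: bij_betw_def inj_on_def)
  have h0: "h \<zero>\<^bsub>N\<^esub> = \<zero>\<^bsub>N'\<^esub>" by (rule hom_zero[OF h(1) D(1) N'])
  have k0: "k \<zero>\<^bsub>\<Delta>\<^esub> = \<zero>\<^bsub>\<Delta>'\<^esub>" by (rule hom_zero[OF k(1) D(2) \<Delta>'])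
  note ecl = hom_closed[OF D(3)] and tcl = hom_closed[OF D(4)]
  have im: "\<theta>' ` carrier \<Delta>' = h ` \<theta> ` carrier \<Delta>"
    unfolding kD image_image using ht by (intro image_cong) simp_all
  have im2: "\<epsilon>' ` \<theta>' ` carrier \<Delta>' = k ` \<epsilon> ` \<theta> ` carrier \<Delta>"
    unfolding im image_image using he tcl by (intro image_cong) simp_all
  have inj: "\<theta>' y = \<zero>\<^bsub>N'\<^esub>" if y: "y \<in> carrier \<Delta>'" and 0: "\<epsilon>' (\<theta>' y) = \<zero>\<^bsub>\<Delta>'\<^esub>" for y
  proof -
    obtain x where x: "x \<in> carrier \<Delta>" "y = k x" using y kD by blast
    have "k (\<epsilon> (\<theta> x)) = k \<zero>\<^bsub>\<Delta>\<^esub>" using 0 x(2) ht[OF x(1)] he[OF tcl[OF x(1)]] k0 by simp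
    then have "\<epsilon> (\<theta> x) = \<zero>\<^bsub>\<Delta>\<^esub>" using kinj[OF ecl[OF tcl[OF x(1)]] mod_zero_closed[OF D(2)]] by simp
    then have "\<theta> x = \<zero>\<^bsub>N\<^esub>" by (rule D(6)[OF x(1)])
    then show ?thesis using x(2) ht[OF x(1)] h0 by simp
  qed
  have tors: "\<epsilon>' ` carrier N' = tors_closure \<Delta>' (\<epsilon>' ` \<theta>' ` carrier \<Delta>')"
  proof -
    have "\<epsilon>' ` carrier N' = k ` \<epsilon> ` carrier N"
      unfolding hN image_image using he by (intro image_cong) simp_all
    also have "\<dots> = k ` tors_closure \<Delta> (\<epsilon> ` \<theta> ` carrier \<Delta>)" by (simp only: D(7))
    also have "\<dots> = tors_closure \<Delta>' (k ` \<epsilon> ` \<theta> ` carrier \<Delta>)"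
    proof
      show "k ` tors_closure \<Delta> (\<epsilon> ` \<theta> ` carrier \<Delta>) \<subseteq> tors_closure \<Delta>' (k ` \<epsilon> ` \<theta> ` carrier \<Delta>)"
      proof (rule image_subsetI)
        fix m assume "m \<in> tors_closure \<Delta> (\<epsilon> ` \<theta> ` carrier \<Delta>)"
        then obtain \<xi> where m: "m \<in> carrier \<Delta>" "\<xi> \<in> carrier A" "\<xi> \<noteq> \<zero>" "\<xi> \<odot>\<^bsub>\<Delta>\<^esub> m \<in> \<epsilon> ` \<theta> ` carrier \<Delta>"
          by (auto simp: tors_closure_def)
        have "\<xi> \<odot>\<^bsub>\<Delta>'\<^esub> k m = k (\<xi> \<odot>\<^bsub>\<Delta>\<^esub> m)" using hom_smult[OF k(1) m(2,1)] by simp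
        then have "\<xi> \<odot>\<^bsub>\<Delta>'\<^esub> k m \<in> k ` \<epsilon> ` \<theta> ` carrier \<Delta>" using m(4) by (metis imageI)
        then show "k m \<in> tors_closure \<Delta>' (k ` \<epsilon> ` \<theta> ` carrier \<Delta>)"
          using m(2,3) hom_closed[OF k(1) m(1)] unfolding tors_closure_def by blast
      qed
      show "tors_closure \<Delta>' (k ` \<epsilon> ` \<theta> ` carrier \<Delta>) \<subseteq> k ` tors_closure \<Delta> (\<epsilon> ` \<theta> ` carrier \<Delta>)"
      proof
        fix y assume "y \<in> tors_closure \<Delta>' (k ` \<epsilon> ` \<theta> ` carrier \<Delta>)"
        then obtain \<xi> z where y: "y \<in> carrier \<Delta>'" "\<xi> \<in> carrier A" "\<xi> \<noteq> \<zero>" "z \<in> carrier \<Delta>" "\<xi> \<odot>\<^bsub>\<Delta>'\<^esub> y = k (\<epsilon> (\<theta> z))"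
          by (auto simp: tors_closure_def)
        obtain m where m: "m \<in> carrier \<Delta>" "y = k m" using y(1) kD by blast
        have "k (\<xi> \<odot>\<^bsub>\<Delta>\<^esub> m) = k (\<epsilon> (\<theta> z))" using hom_smult[OF k(1) y(2) m(1)] y(5) m(2) by simp
        then have "\<xi> \<odot>\<^bsub>\<Delta>\<^esub> m = \<epsilon> (\<theta> z)"
          using kinj[OF mod_smult_closed[OF D(2) y(2) m(1)] ecl[OF tcl[OF y(4)]]] by simp
        then have "m \<in> tors_closure \<Delta> (\<epsilon> ` \<theta> ` carrier \<Delta>)"
          using y(2,3,4) m(1) unfolding tors_closure_def by blast
        then show "y \<in> k ` tors_closure \<Delta> (\<epsilon> ` \<theta> ` carrier \<Delta>)" using m(2) by blast
      qed
    qed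
    finally show ?thesis by (simp only: im2)
  qed
  obtain I C p b where ab: "adapted_basis N (\<theta> ` carrier \<Delta>) (mod_ker N \<Delta> \<epsilon>) (I::nat set) C p b" and C: "card C = c"
    using D(8) by (auto simp: has_adapted_basis_def)
  note B = adapted_basisD[OF ab]
  have "adapted_basis N' (\<theta>' ` carrier \<Delta>') (mod_ker N' \<Delta>' \<epsilon>') I C (\<lambda>y. p (h' y)) (\<lambda>i. h (b i))"
    unfolding adapted_basis_def
  proof (intro conjI ballI)
    show "finite I" "C \<subseteq> I" by (rule B(1), rule B(2))
    show "(\<lambda>y. p (h' y)) \<in> Hom N' (free_mod I)" by (rule hom_comp[OF h'(1) B(3)])
    fix y assume y: "y \<in> carrier N'"
    have "h' y \<in> \<theta> ` carrier \<Delta> \<longleftrightarrow> y \<in> \<theta>' ` carrier \<Delta>'"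
    proof
      assume "h' y \<in> \<theta> ` carrier \<Delta>"
      then have "h (h' y) \<in> h ` \<theta> ` carrier \<Delta>" by (rule imageI)
      then show "y \<in> \<theta>' ` carrier \<Delta>'" using h'(4)[OF y] im by simp
    next
      assume "y \<in> \<theta>' ` carrier \<Delta>'"
      then obtain x where "x \<in> carrier \<Delta>" "y = h (\<theta> x)" unfolding im by blast
      then show "h' y \<in> \<theta> ` carrier \<Delta>" using h'(3)[OF tcl] by simp
    qed
    then show "p (h' y) = \<zero>\<^bsub>free_mod I\<^esub> \<longleftrightarrow> y \<in> \<theta>' ` carrier \<Delta>'"
      using B(4)[OF hom_closed[OF h'(1) y]] by simp
  next
    fix i assume i: "i \<in> I"
    show "h (b i) \<in> carrier N'" by (rule hom_closed[OF h(1) B(5)[OF i]])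
    show "p (h' (h (b i))) = unit_vec I i" using h'(3)[OF B(5)[OF i]] B(6)[OF i] by simp
  next
    fix i assume i: "i \<in> C"
    have "b i \<in> carrier N" "\<epsilon> (b i) = \<zero>\<^bsub>\<Delta>\<^esub>" using B(7)[OF i] by (auto simp: mod_ker_def)
    then show "h (b i) \<in> mod_ker N' \<Delta>' \<epsilon>'"
      using he hom_closed[OF h(1)] k0 by (simp add: mod_ker_def)
  next
    fix y i assume y: "y \<in> mod_ker N' \<Delta>' \<epsilon>'" and i: "i \<in> I - C"
    have yN: "y \<in> carrier N'" and y0: "\<epsilon>' y = \<zero>\<^bsub>\<Delta>'\<^esub>" using y by (auto simp: mod_ker_def)
    have x: "h' y \<in> carrier N" by (rule hom_closed[OF h'(1) yN])
    have "k (\<epsilon> (h' y)) = k \<zero>\<^bsub>\<Delta>\<^esub>" using he[OF x] h'(4)[OF yN] y0 k0 by simp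
    then have "\<epsilon> (h' y) = \<zero>\<^bsub>\<Delta>\<^esub>" using kinj[OF ecl[OF x] mod_zero_closed[OF D(2)]] by simp
    then have "h' y \<in> mod_ker N \<Delta> \<epsilon>" using x by (simp add: mod_ker_def)
    then show "p (h' y) i \<notin> Units A" using B(8) i by blast
  qed
  then have "has_adapted_basis N' (\<theta>' ` carrier \<Delta>') (mod_ker N' \<Delta>' \<epsilon>') c"
    using C unfolding has_adapted_basis_def by blast
  moreover have "fin_gen N' (carrier N')"
    using fin_gen_image[OF h(1) D(1) N' D(5)] hN by simp
  ultimately show ?thesis
    unfolding corner_def using N' \<Delta>' e' t' inj tors by blast
qed

subsection \<open>Direct sums of corners\<close>

lemma submod_tors_closure:
  assumes D: "module A \<Delta>" and B: "submodule B A \<Delta>"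
  shows "submodule (tors_closure \<Delta> B) A \<Delta>"
proof (rule submodI[OF D])
  show "tors_closure \<Delta> B \<subseteq> carrier \<Delta>" by (auto simp: tors_closure_def)
  show "\<zero>\<^bsub>\<Delta>\<^esub> \<in> tors_closure \<Delta> B"
    using D submod_zero[OF B D] by (auto simp: tors_closure_def intro!: bexI[of _ \<one>])
next
  fix x y assume "x \<in> tors_closure \<Delta> B" "y \<in> tors_closure \<Delta> B"
  then obtain a b where a: "x \<in> carrier \<Delta>" "a \<in> carrier A" "a \<noteq> \<zero>" "a \<odot>\<^bsub>\<Delta>\<^esub> x \<in> B"
    and b: "y \<in> carrier \<Delta>" "b \<in> carrier A" "b \<noteq> \<zero>" "b \<odot>\<^bsub>\<Delta>\<^esub> y \<in> B" by (auto simp: tors_closure_def)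
  have "(a \<otimes> b) \<odot>\<^bsub>\<Delta>\<^esub> (x \<oplus>\<^bsub>\<Delta>\<^esub> y) = b \<odot>\<^bsub>\<Delta>\<^esub> (a \<odot>\<^bsub>\<Delta>\<^esub> x) \<oplus>\<^bsub>\<Delta>\<^esub> a \<odot>\<^bsub>\<Delta>\<^esub> (b \<odot>\<^bsub>\<Delta>\<^esub> y)"
    using a(1,2) b(1,2) D by (simp add: mod_r_distr mod_smult_assoc[symmetric] m_comm)
  moreover have "b \<odot>\<^bsub>\<Delta>\<^esub> (a \<odot>\<^bsub>\<Delta>\<^esub> x) \<oplus>\<^bsub>\<Delta>\<^esub> a \<odot>\<^bsub>\<Delta>\<^esub> (b \<odot>\<^bsub>\<Delta>\<^esub> y) \<in> B"
    by (rule submod_add[OF B D submod_smult[OF B D b(2) a(4)] submod_smult[OF B D a(2) b(4)]])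
  moreover have "a \<otimes> b \<noteq> \<zero>" using a b integral by blast
  ultimately show "x \<oplus>\<^bsub>\<Delta>\<^esub> y \<in> tors_closure \<Delta> B"
    using a(1,2) b(1,2) D by (auto simp: tors_closure_def intro!: bexI[of _ "a \<otimes> b"])
next
  fix c x assume c: "c \<in> carrier A" and "x \<in> tors_closure \<Delta> B"
  then obtain a where a: "x \<in> carrier \<Delta>" "a \<in> carrier A" "a \<noteq> \<zero>" "a \<odot>\<^bsub>\<Delta>\<^esub> x \<in> B" by (auto simp: tors_closure_def)
  have "a \<odot>\<^bsub>\<Delta>\<^esub> (c \<odot>\<^bsub>\<Delta>\<^esub> x) = c \<odot>\<^bsub>\<Delta>\<^esub> (a \<odot>\<^bsub>\<Delta>\<^esub> x)"
    using a(1,2) c D by (simp add: mod_smult_assoc[symmetric] m_comm)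
  then show "c \<odot>\<^bsub>\<Delta>\<^esub> x \<in> tors_closure \<Delta> B"
    using a c D submod_smult[OF B D c a(4)] by (auto simp: tors_closure_def intro!: bexI[of _ a])
qed

lemma tors_closure_hom:
  assumes k: "k \<in> Hom \<Delta> \<Delta>'" and B: "k ` B \<subseteq> B'" and m: "m \<in> tors_closure \<Delta> B"
  shows "k m \<in> tors_closure \<Delta>' B'"
proof -
  obtain a where a: "m \<in> carrier \<Delta>" "a \<in> carrier A" "a \<noteq> \<zero>" "a \<odot>\<^bsub>\<Delta>\<^esub> m \<in> B" using m by (auto simp: tors_closure_def)
  have "a \<odot>\<^bsub>\<Delta>'\<^esub> k m = k (a \<odot>\<^bsub>\<Delta>\<^esub> m)" using hom_smult[OF k a(2,1)] by simp
  then have "a \<odot>\<^bsub>\<Delta>'\<^esub> k m \<in> B'" using a(4) B by auto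
  then show ?thesis using a(2,3) hom_closed[OF k a(1)] unfolding tors_closure_def by blast
qed

text \<open>Multiplicities add up. All coordinates come from the finitely many nonzero modules \<open>N i\<close>, although
  infinitely many \<open>\<Delta> i\<close> may be nonzero.\<close>

lemma corner_dsum:
  assumes c: "\<And>i. i \<in> J ==> corner (N i) (\<Delta> i) (\<epsilon> i) (\<theta> i) (c i)"
    and K: "finite K" "K \<subseteq> J" "\<And>i. i \<in> J ==> i \<notin> K ==> trivial (N i)"
  shows "corner (dsum_module J N) (dsum_module J \<Delta>) (dsum_map J \<epsilon>) (dsum_map J \<theta>) (\<Sum>i\<in>K. c i)"
proof -
  note D = cornerD[OF c]
  let ?N = "dsum_module J N" and ?D = "dsum_module J \<Delta>" and ?e = "dsum_map J \<epsilon>" and ?t = "dsum_map J \<theta>"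
  have N: "module A ?N" by (rule module_dsum[OF D(1)])
  have DD: "module A ?D" by (rule module_dsum[OF D(2)])
  have e: "?e \<in> Hom ?N ?D" by (rule dsum_map_hom[OF D(1,2,3)])
  have t: "?t \<in> Hom ?D ?N" by (rule dsum_map_hom[OF D(2,1,4)])
  have ea: "?e x i = \<epsilon> i (x i)" if "i \<in> J" for x i using that by (simp add: dsum_map_def)
  have ta: "?t x i = \<theta> i (x i)" if "i \<in> J" for x i using that by (simp add: dsum_map_def)
  have comp: "f i \<in> carrier (N i)" if "f \<in> carrier ?N" "i \<in> J" for f i by (rule dsum_component[OF that])
  have compD: "f i \<in> carrier (\<Delta> i)" if "f \<in> carrier ?D" "i \<in> J" for f i by (rule dsum_component[OF that])
  have supp: "finite {i\<in>J. f i \<noteq> \<zero>\<^bsub>N i\<^esub>}" if f: "\<And>i. i \<in> J ==> f i \<in> carrier (N i)" for f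
    using K(3) f by (intro finite_subset[OF _ K(1)]) blast
  have mk: "(\<lambda>i\<in>J. f i) \<in> carrier ?N" if f: "\<And>i. i \<in> J ==> f i \<in> carrier (N i)" for f
    using supp[of "\<lambda>i\<in>J. f i"] f by (simp add: dsum_simps(1) PiE_iff)
  have inj: "?t x = \<zero>\<^bsub>?N\<^esub>" if x: "x \<in> carrier ?D" and 0: "?e (?t x) = \<zero>\<^bsub>?D\<^esub>" for x
  proof (rule dsum_eqI[OF hom_closed[OF t x] mod_zero_closed[OF N]])
    fix i assume i: "i \<in> J"
    have "\<epsilon> i (\<theta> i (x i)) = \<zero>\<^bsub>\<Delta> i\<^esub>" using fun_cong[OF 0, of i] i by (simp add: ea ta dsum_simps(2))
    then show "?t x i = \<zero>\<^bsub>?N\<^esub> i" using D(6)[OF i compD[OF x i]] i by (simp add: ta dsum_simps(2))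
  qed
  let ?B = "?e ` ?t ` carrier ?D"
  have Bs: "submodule ?B A ?D"
    by (rule submod_image[OF e N DD submod_image[OF t DD N submod_carrier[OF DD]]])
  have tors: "?e ` carrier ?N = tors_closure ?D ?B"
  proof
    show "?e ` carrier ?N \<subseteq> tors_closure ?D ?B"
    proof (rule image_subsetI)
      fix x assume x: "x \<in> carrier ?N"
      have "x \<in> {x \<in> carrier ?N. ?e x \<in> tors_closure ?D ?B}"
      proof (rule dsum_generated[OF D(1) submod_vimage[OF e N DD submod_tors_closure[OF DD Bs]] _ x])
        fix i y assume i: "i \<in> J" and y: "y \<in> carrier (N i)"
        note ds = dsingle_hom[where M = N and I = J, OF D(1) i] and dsD = dsingle_hom[where M = \<Delta> and I = J, OF D(2) i]
        have es: "?e (dsingle N J i z) = dsingle \<Delta> J i (\<epsilon> i z)" for z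
          by (rule dsum_map_single[OF D(1,2,3) i])
        have ts: "?t (dsingle \<Delta> J i z) = dsingle N J i (\<theta> i z)" for z
          by (rule dsum_map_single[OF D(2,1,4) i])
        have "dsingle \<Delta> J i (\<epsilon> i y) \<in> tors_closure ?D ?B"
        proof (rule tors_closure_hom[OF dsD])
          show "\<epsilon> i y \<in> tors_closure (\<Delta> i) (\<epsilon> i ` \<theta> i ` carrier (\<Delta> i))" using D(7)[OF i] y by blast
          show "dsingle \<Delta> J i ` \<epsilon> i ` \<theta> i ` carrier (\<Delta> i) \<subseteq> ?B"
          proof (rule image_subsetI)
            fix w assume "w \<in> \<epsilon> i ` \<theta> i ` carrier (\<Delta> i)"
            then obtain z where z: "z \<in> carrier (\<Delta> i)" "w = \<epsilon> i (\<theta> i z)" by blast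
            have "dsingle \<Delta> J i w = ?e (?t (dsingle \<Delta> J i z))" by (simp only: ts es z(2))
            then show "dsingle \<Delta> J i w \<in> ?B" using hom_closed[OF dsD z(1)] by blast
          qed
        qed
        then show "dsingle N J i y \<in> {x \<in> carrier ?N. ?e x \<in> tors_closure ?D ?B}"
          using hom_closed[OF ds y] by (simp add: es)
      qed
      then show "?e x \<in> tors_closure ?D ?B" by simp
    qed
    show "tors_closure ?D ?B \<subseteq> ?e ` carrier ?N"
    proof
      fix m assume m: "m \<in> tors_closure ?D ?B"
      have mD: "m \<in> carrier ?D" using m by (simp add: tors_closure_def)
      have "\<exists>y. y \<in> carrier (N i) \<and> \<epsilon> i y = m i" if i: "i \<in> J" for i
      proof -
        have "m i \<in> tors_closure (\<Delta> i) (\<epsilon> i ` \<theta> i ` carrier (\<Delta> i))"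
        proof (rule tors_closure_hom[OF dproj_hom[OF i] _ m])
          show "(\<lambda>f. f i) ` ?B \<subseteq> \<epsilon> i ` \<theta> i ` carrier (\<Delta> i)"
            using compD i by (auto simp: ea ta)
        qed
        then have "m i \<in> \<epsilon> i ` carrier (N i)" using D(7)[OF i] by simp
        then obtain y where "m i = \<epsilon> i y" "y \<in> carrier (N i)" by (rule imageE)
        then show ?thesis by (intro exI[of _ y]) simp
      qed
      then have "\<forall>i\<in>J. \<exists>y. y \<in> carrier (N i) \<and> \<epsilon> i y = m i" by (intro ballI)
      from bchoice[OF this] obtain y
        where y: "\<And>i. i \<in> J ==> y i \<in> carrier (N i)" "\<And>i. i \<in> J ==> \<epsilon> i (y i) = m i" by auto
      have yN: "(\<lambda>i\<in>J. y i) \<in> carrier ?N" by (rule mk[OF y(1)])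
      have "?e (\<lambda>i\<in>J. y i) = m"
        by (rule dsum_eqI[OF hom_closed[OF e yN] mD]) (simp add: ea y)
      then show "m \<in> ?e ` carrier ?N" using yN by blast
    qed
  qed
  have "\<exists>I C p b. adapted_basis (N i) (\<theta> i ` carrier (\<Delta> i)) (mod_ker (N i) (\<Delta> i) (\<epsilon> i)) (I::nat set) C p b \<and> card C = c i" if "i \<in> J" for i
    using D(8)[OF that] by (simp add: has_adapted_basis_def)
  then obtain I C p b where ab: "\<And>i. i \<in> J ==> adapted_basis (N i) (\<theta> i ` carrier (\<Delta> i)) (mod_ker (N i) (\<Delta> i) (\<epsilon> i)) (I i::nat set) (C i) (p i) (b i)"
    and C: "\<And>i. i \<in> J ==> card (C i) = c i" by metis
  note B = adapted_basisD[OF ab]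
  let ?I = "Sigma K I" and ?C = "Sigma K C"
  have KJ: "i \<in> J" if "i \<in> K" for i using that K(2) by blast
  have finI: "finite ?I" using K(1) B(1) KJ by (intro finite_SigmaI) blast+
  define q where "q f = (\<lambda>(i, n)\<in>?I. p i (f i) n)" for f
  have qa: "q f (i, n) = p i (f i) n" if "i \<in> K" "n \<in> I i" for f i n using that by (simp add: q_def)
  have pcl: "p i x n \<in> carrier A" if "i \<in> K" "x \<in> carrier (N i)" "n \<in> I i" for i x n
    using dsum_component[OF hom_closed[OF B(3)[OF KJ[OF that(1)]] that(2)] that(3)] by simp
  have q: "q \<in> Hom ?N (free_mod ?I)"
  proof (rule mod_homI)
    show qc: "q f \<in> carrier (free_mod ?I)" if f: "f \<in> carrier ?N" for f
      unfolding free_mod_carrier[OF finI] q_def using pcl comp[OF f] KJ by (intro restrict_PiE[THEN iffD2] Pi_I) auto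
    show "q (f \<oplus>\<^bsub>?N\<^esub> g) = q f \<oplus>\<^bsub>free_mod ?I\<^esub> q g" if f: "f \<in> carrier ?N" and g: "g \<in> carrier ?N" for f g
    proof (rule free_mod_eqI[OF qc[OF mod_add_closed[OF N f g]] mod_add_closed[OF module_free_mod qc[OF f] qc[OF g]]])
      fix k assume k: "k \<in> ?I"
      then obtain i n where k': "k = (i, n)" "i \<in> K" "n \<in> I i" by blast
      show "q (f \<oplus>\<^bsub>?N\<^esub> g) k = (q f \<oplus>\<^bsub>free_mod ?I\<^esub> q g) k"
        using k k' KJ[OF k'(2)] hom_add[OF B(3)[OF KJ[OF k'(2)]] comp[OF f KJ[OF k'(2)]] comp[OF g KJ[OF k'(2)]]]
        by (simp add: dsum_simps(3) qa)
    qed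
    show "q (a \<odot>\<^bsub>?N\<^esub> f) = a \<odot>\<^bsub>free_mod ?I\<^esub> q f" if a: "a \<in> carrier A" and f: "f \<in> carrier ?N" for a f
    proof (rule free_mod_eqI[OF qc[OF mod_smult_closed[OF N a f]] mod_smult_closed[OF module_free_mod a qc[OF f]]])
      fix k assume k: "k \<in> ?I"
      then obtain i n where k': "k = (i, n)" "i \<in> K" "n \<in> I i" by blast
      show "q (a \<odot>\<^bsub>?N\<^esub> f) k = (a \<odot>\<^bsub>free_mod ?I\<^esub> q f) k"
        using k k' KJ[OF k'(2)] hom_smult[OF B(3)[OF KJ[OF k'(2)]] a comp[OF f KJ[OF k'(2)]]]
        by (simp add: dsum_simps(4) qa)
    qed
  qed
  have "adapted_basis ?N (?t ` carrier ?D) (mod_ker ?N ?D ?e) ?I ?C q (\<lambda>(i, n). dsingle N J i (b i n))"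
    unfolding adapted_basis_def
  proof (intro conjI ballI)
    show "finite ?I" by (rule finI)
    show "?C \<subseteq> ?I" using B(2) KJ by blast
    show "q \<in> Hom ?N (free_mod ?I)" by (rule q)
  next
    fix f assume f: "f \<in> carrier ?N"
    have "q f = \<zero>\<^bsub>free_mod ?I\<^esub> \<longleftrightarrow> (\<forall>i\<in>K. \<forall>n\<in>I i. p i (f i) n = \<zero>)"
      using free_mod_eq_zero_iff[OF hom_closed[OF q f]] by (auto simp: qa)
    also have "\<dots> \<longleftrightarrow> (\<forall>i\<in>K. f i \<in> \<theta> i ` carrier (\<Delta> i))"
      using free_mod_eq_zero_iff[OF hom_closed[OF B(3)[OF KJ] comp[OF f KJ]]] B(4)[OF KJ comp[OF f KJ]] by simp
    also have "\<dots> \<longleftrightarrow> (\<forall>i\<in>J. f i \<in> \<theta> i ` carrier (\<Delta> i))"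
    proof -
      have "f i \<in> \<theta> i ` carrier (\<Delta> i)" if "i \<in> J" "i \<notin> K" for i
        using K(3)[OF that] comp[OF f that(1)] hom_zero[OF D(4)[OF that(1)] D(2)[OF that(1)] D(1)[OF that(1)]]
          mod_zero_closed[OF D(2)[OF that(1)]] by (metis image_eqI singletonD)
      then show ?thesis using KJ by blast
    qed
    also have "\<dots> \<longleftrightarrow> f \<in> ?t ` carrier ?D"
    proof
      assume a: "\<forall>i\<in>J. f i \<in> \<theta> i ` carrier (\<Delta> i)"
      have "\<exists>y. y \<in> carrier (\<Delta> i) \<and> \<theta> i y = f i \<and> (f i = \<zero>\<^bsub>N i\<^esub> --> y = \<zero>\<^bsub>\<Delta> i\<^esub>)" if i: "i \<in> J" for i
      proof (cases "f i = \<zero>\<^bsub>N i\<^esub>")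
        case True
        then show ?thesis using hom_zero[OF D(4)[OF i] D(2)[OF i] D(1)[OF i]] mod_zero_closed[OF D(2)[OF i]] by auto
      next
        case False
        from a i obtain z where "f i = \<theta> i z" "z \<in> carrier (\<Delta> i)" by blast
        then show ?thesis using False by (intro exI[of _ z]) simp
      qed
      then have "\<forall>i\<in>J. \<exists>y. y \<in> carrier (\<Delta> i) \<and> \<theta> i y = f i \<and> (f i = \<zero>\<^bsub>N i\<^esub> --> y = \<zero>\<^bsub>\<Delta> i\<^esub>)" by (intro ballI)
      from bchoice[OF this] obtain y where y: "\<And>i. i \<in> J ==> y i \<in> carrier (\<Delta> i)" "\<And>i. i \<in> J ==> \<theta> i (y i) = f i"
        "\<And>i. i \<in> J ==> f i = \<zero>\<^bsub>N i\<^esub> ==> y i = \<zero>\<^bsub>\<Delta> i\<^esub>" by auto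
      have fin: "finite {i\<in>J. f i \<noteq> \<zero>\<^bsub>N i\<^esub>}" using f by (simp add: dsum_simps(1))
      have "finite {i\<in>J. (\<lambda>i\<in>J. y i) i \<noteq> \<zero>\<^bsub>\<Delta> i\<^esub>}"
        by (rule finite_subset[OF _ fin]) (use y(3) in auto)
      then have yD: "(\<lambda>i\<in>J. y i) \<in> carrier ?D" using y(1) by (simp add: dsum_simps(1) PiE_iff)
      have "?t (\<lambda>i\<in>J. y i) = f"
        by (rule dsum_eqI[OF hom_closed[OF t yD] f]) (simp add: ta y)
      then show "f \<in> ?t ` carrier ?D" using yD by blast
    next
      assume "f \<in> ?t ` carrier ?D"
      then obtain y where y: "y \<in> carrier ?D" "f = ?t y" by blast
      show "\<forall>i\<in>J. f i \<in> \<theta> i ` carrier (\<Delta> i)" unfolding y(2) using compD[OF y(1)] ta by simp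
    qed
    finally show "q f = \<zero>\<^bsub>free_mod ?I\<^esub> \<longleftrightarrow> f \<in> ?t ` carrier ?D" .
  next
    fix k assume k: "k \<in> ?I"
    then obtain i n where k': "k = (i, n)" "i \<in> K" "n \<in> I i" by blast
    note i = KJ[OF k'(2)]
    have s: "dsingle N J i (b i n) \<in> carrier ?N"
      by (rule hom_closed[OF dsingle_hom[where M = N and I = J, OF D(1) i] B(5)[OF i k'(3)]])
    then show "(case k of (i, n) => dsingle N J i (b i n)) \<in> carrier ?N" by (simp add: k')
    have "q (dsingle N J i (b i n)) = unit_vec ?I k"
    proof (rule free_mod_eqI[OF hom_closed[OF q s] unit_vec_closed[OF k]])
      fix l assume l: "l \<in> ?I"
      then obtain j m where l': "l = (j, m)" "j \<in> K" "m \<in> I j" by blast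
      note j = KJ[OF l'(2)]
      show "q (dsingle N J i (b i n)) l = unit_vec ?I k l"
      proof (cases "j = i")
        case True
        then show ?thesis
          using l' k' B(6)[OF i k'(3)] i j unit_vec_apply[OF k l] unit_vec_apply[OF k'(3), of m] by (simp add: qa dsingle_apply)
      next
        case False
        have "p j \<zero>\<^bsub>N j\<^esub> = \<zero>\<^bsub>free_mod (I j)\<^esub>" by (rule hom_zero[OF B(3)[OF j] D(1)[OF j] module_free_mod])
        then show ?thesis
          using False l' k' i j unit_vec_apply[OF k l] by (simp add: qa dsingle_apply dsum_simps(2))
      qed
    qed
    then show "q (case k of (i, n) => dsingle N J i (b i n)) = unit_vec ?I k" by (simp add: k')
  next
    fix k assume "k \<in> ?C"
    then obtain i n where k': "k = (i, n)" "i \<in> K" "n \<in> C i" by blast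
    note i = KJ[OF k'(2)]
    have bn: "b i n \<in> carrier (N i)" "\<epsilon> i (b i n) = \<zero>\<^bsub>\<Delta> i\<^esub>" using B(7)[OF i k'(3)] by (auto simp: mod_ker_def)
    have "?e (dsingle N J i (b i n)) = dsingle \<Delta> J i (\<epsilon> i (b i n))" by (rule dsum_map_single[OF D(1,2,3) i])
    also have "\<dots> = \<zero>\<^bsub>?D\<^esub>" using bn(2) hom_zero[OF dsingle_hom[where M = \<Delta> and I = J, OF D(2) i] D(2)[OF i] DD] by simp
    finally show "(case k of (i, n) => dsingle N J i (b i n)) \<in> mod_ker ?N ?D ?e"
      using hom_closed[OF dsingle_hom[where M = N and I = J, OF D(1) i] bn(1)] by (simp add: mod_ker_def k')
  next
    fix f k assume f: "f \<in> mod_ker ?N ?D ?e" and k: "k \<in> ?I - ?C"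
    then obtain i n where k': "k = (i, n)" "i \<in> K" "n \<in> I i" "n \<notin> C i" by blast
    note i = KJ[OF k'(2)]
    have fN: "f \<in> carrier ?N" and f0: "?e f = \<zero>\<^bsub>?D\<^esub>" using f by (auto simp: mod_ker_def)
    have "\<epsilon> i (f i) = \<zero>\<^bsub>\<Delta> i\<^esub>" using fun_cong[OF f0, of i] i by (simp add: ea dsum_simps(2))
    then have "f i \<in> mod_ker (N i) (\<Delta> i) (\<epsilon> i)" using comp[OF fN i] by (simp add: mod_ker_def)
    then show "q f k \<notin> Units A" using B(8)[OF i _ k'(3,4)] k' by (simp add: qa)
  qed
  from adapted_basis_reindex[OF this]
  have "has_adapted_basis ?N (?t ` carrier ?D) (mod_ker ?N ?D ?e) (card ?C)" .
  moreover have "card ?C = (\<Sum>i\<in>K. c i)"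
    using C KJ K(1) finite_subset[OF B(2) B(1)] by (subst card_SigmaI) auto
  moreover have "fin_gen ?N (carrier ?N)"
    using K(3) by (intro fin_gen_dsum[OF D(1) _ D(5)] finite_subset[OF _ K(1)]) blast+
  ultimately show ?thesis
    unfolding corner_def using N DD e t inj tors by simp
qed

end

subsection \<open>Existence of corners\<close>

definition prod_module :: "('a, 'm) module => ('a, 'n) module => ('a, 'm \<times> 'n) module" where
  "prod_module M N =
     \<lparr>carrier = carrier M \<times> carrier N, monoid.mult = undefined, one = undefined,
      ring.zero = (\<zero>\<^bsub>M\<^esub>, \<zero>\<^bsub>N\<^esub>),
      ring.add = (\<lambda>x y. (fst x \<oplus>\<^bsub>M\<^esub> fst y, snd x \<oplus>\<^bsub>N\<^esub> snd y)),
      module.smult = (\<lambda>a x. (a \<odot>\<^bsub>M\<^esub> fst x, a \<odot>\<^bsub>N\<^esub> snd x))\<rparr>"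

lemma prod_module_simps:
  "carrier (prod_module M N) = carrier M \<times> carrier N" "\<zero>\<^bsub>prod_module M N\<^esub> = (\<zero>\<^bsub>M\<^esub>, \<zero>\<^bsub>N\<^esub>)"
  "x \<oplus>\<^bsub>prod_module M N\<^esub> y = (fst x \<oplus>\<^bsub>M\<^esub> fst y, snd x \<oplus>\<^bsub>N\<^esub> snd y)"
  "a \<odot>\<^bsub>prod_module M N\<^esub> x = (a \<odot>\<^bsub>M\<^esub> fst x, a \<odot>\<^bsub>N\<^esub> snd x)"
  by (simp_all add: prod_module_def)

context ground_ring
begin

lemma module_prod:
  assumes "module A M" "module A N"
  shows "module A (prod_module M N)"
  by (rule ground_moduleI)
    (use assms in \<open>auto simp: prod_module_simps mod_add_assoc mod_add_comm mod_add_lcomm mod_l_distr mod_r_distr mod_smult_assoc\<close>)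

lemma snd_hom: "snd \<in> Hom (prod_module M N) N"
  by (auto simp: mod_hom_def prod_module_simps)

lemma inl_hom: "module A M ==> module A N ==> (\<lambda>x. (x, \<zero>\<^bsub>N\<^esub>)) \<in> Hom M (prod_module M N)"
  and inr_hom: "module A M ==> module A N ==> (\<lambda>y. (\<zero>\<^bsub>M\<^esub>, y)) \<in> Hom N (prod_module M N)"
  by (auto simp: mod_hom_def prod_module_simps)

lemma prod_decomp:
  assumes "module A M" "module A N" "x \<in> carrier (prod_module M N)"
  shows "x = (fst x, \<zero>\<^bsub>N\<^esub>) \<oplus>\<^bsub>prod_module M N\<^esub> (\<zero>\<^bsub>M\<^esub>, snd x)"
  using assms by (auto simp: prod_module_simps)

lemma fin_gen_prod:
  assumes M: "module A M" and N: "module A N" and "fin_gen M (carrier M)" "fin_gen N (carrier N)"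
  shows "fin_gen (prod_module M N) (carrier (prod_module M N))"
proof -
  let ?P = "prod_module M N"
  obtain G where G: "finite G" "G \<subseteq> carrier M" "carrier M = mod_span M G" using assms(3) by (auto simp: fin_gen_def)
  obtain G' where G': "finite G'" "G' \<subseteq> carrier N" "carrier N = mod_span N G'" using assms(4) by (auto simp: fin_gen_def)
  note P = module_prod[OF M N] and l = inl_hom[OF M N] and r = inr_hom[OF M N]
  define S where "S = (\<lambda>x. (x, \<zero>\<^bsub>N\<^esub>)) ` G \<union> (\<lambda>y. (\<zero>\<^bsub>M\<^esub>, y)) ` G'"
  have S: "finite S" "S \<subseteq> carrier ?P"
    using G(1,2) G'(1,2) M N by (auto simp: S_def prod_module_simps)
  note Sp = submod_mod_span[OF P S(2)]
  have "mod_span M G \<subseteq> {x \<in> carrier M. (x, \<zero>\<^bsub>N\<^esub>) \<in> mod_span ?P S}"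
    using G(2) mod_span_superset[of S ?P] by (intro mod_span_least submod_vimage[OF l M P Sp]) (auto simp: S_def)
  then have 1: "(x, \<zero>\<^bsub>N\<^esub>) \<in> mod_span ?P S" if "x \<in> carrier M" for x using that G(3) by blast
  have "mod_span N G' \<subseteq> {y \<in> carrier N. (\<zero>\<^bsub>M\<^esub>, y) \<in> mod_span ?P S}"
    using G'(2) mod_span_superset[of S ?P] by (intro mod_span_least submod_vimage[OF r N P Sp]) (auto simp: S_def)
  then have 2: "(\<zero>\<^bsub>M\<^esub>, y) \<in> mod_span ?P S" if "y \<in> carrier N" for y using that G'(3) by blast
  have "carrier ?P \<subseteq> mod_span ?P S"
  proof
    fix x assume x: "x \<in> carrier ?P"
    have "fst x \<in> carrier M" "snd x \<in> carrier N" using x by (auto simp: prod_module_simps)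
    from submod_add[OF Sp P 1[OF this(1)] 2[OF this(2)]]
    show "x \<in> mod_span ?P S" by (simp only: prod_decomp[OF M N x, symmetric])
  qed
  moreover have "mod_span ?P S \<subseteq> carrier ?P" using submod_subset[OF Sp P] by blast
  ultimately show ?thesis using S by (auto simp: fin_gen_def)
qed

lemma fin_gen_free_mod: "finite I ==> fin_gen (free_mod I) (carrier (free_mod I))"
proof (rule fin_gen_dsum)
  assume "finite I"
  then show "finite {i \<in> I. \<not> trivial ring_mod}" by simp
  have S: "submodule (mod_span ring_mod {\<one>}) A ring_mod" by (rule submod_mod_span) simp_all
  have "a \<in> mod_span ring_mod {\<one>}" if "a \<in> carrier A" for a
    using submod_smult[OF S module_ring_mod that, of \<one>] mod_span_superset[of "{\<one>}" ring_mod] that by simp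
  moreover have "mod_span ring_mod {\<one>} \<subseteq> carrier A" using submod_subset[OF S module_ring_mod] by auto
  ultimately have "carrier ring_mod = mod_span ring_mod {\<one>}" by auto
  moreover have "{\<one>} \<subseteq> carrier ring_mod" by simp
  ultimately show "fin_gen ring_mod (carrier ring_mod)"
    unfolding fin_gen_def by blast
qed simp

text \<open>Structures have to be moved into prescribed types: sets of coefficient vectors for the chosen
  representatives, and the type of a given object for its summands.\<close>

lemma module_transport:
  fixes M :: "('a, 'm) module" and h :: "'m => 'n"
  assumes M: "module A M" and h: "inj_on h (carrier M)"
  shows "\<exists>N :: ('a, 'n) module. module A N \<and> h \<in> Hom M N \<and> bij_betw h (carrier M) (carrier N)"
proof -
  define k where "k = inv_into (carrier M) h"
  have k: "k (h x) = x" if "x \<in> carrier M" for x using h that by (simp add: k_def)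
  define N :: "('a, 'n) module" where "N = \<lparr>carrier = h ` carrier M, monoid.mult = undefined, one = undefined,
      ring.zero = h \<zero>\<^bsub>M\<^esub>, ring.add = (\<lambda>x y. h (k x \<oplus>\<^bsub>M\<^esub> k y)), module.smult = (\<lambda>a x. h (a \<odot>\<^bsub>M\<^esub> k x))\<rparr>"
  have "module A N"
    by (rule ground_moduleI)
      (use M in \<open>auto simp: N_def k mod_add_assoc mod_l_distr mod_r_distr mod_smult_assoc intro!: arg_cong[of _ _ h] mod_add_comm\<close>)
  moreover have "h \<in> Hom M N" by (rule mod_homI) (use M in \<open>auto simp: N_def k\<close>)
  moreover have "bij_betw h (carrier M) (carrier N)" using h by (simp add: bij_betw_def N_def)
  ultimately show ?thesis by blast
qed

text \<open>A finitely generated module embeds into sets of coefficient vectors: an element goes to the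
  set of all its representations as a combination of fixed generators.\<close>

lemma fin_gen_embeds:
  fixes M :: "('a, 'm) module"
  assumes M: "module A M" and fg: "fin_gen M (carrier M)"
  shows "\<exists>h :: 'm => (nat => 'a) set. inj_on h (carrier M)"
proof -
  obtain G where G: "finite G" "G \<subseteq> carrier M" "carrier M = mod_span M G" using fg by (auto simp: fin_gen_def)
  obtain g where g: "bij_betw g {..<card G} G" using ex_bij_betw_nat_finite[OF G(1)] by (auto simp: atLeast0LessThan)
  have gM: "g i \<in> carrier M" if "i \<in> {..<card G}" for i using bij_betw_apply[OF g that] G(2) by blast
  have gG: "g ` {..<card G} = G" using g by (simp add: bij_betw_def)
  let ?F = "carrier (free_mod {..<card G})"
  have im: "lincomb M {..<card G} g ` ?F = carrier M"
    using lincomb_image_span[where b = g, OF M gM] by (simp only: gG G(3)[symmetric])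
  define h where "h x = {a \<in> ?F. lincomb M {..<card G} g a = x}" for x
  have "inj_on h (carrier M)"
  proof (rule inj_onI)
    fix x y assume x: "x \<in> carrier M" and xy: "h x = h y"
    obtain a where "a \<in> ?F" "x = lincomb M {..<card G} g a" using x im by blast
    then have "a \<in> h x" by (simp add: h_def)
    then have "a \<in> h y" using xy by simp
    then show "x = y" using \<open>a \<in> h x\<close> by (simp add: h_def)
  qed
  then show ?thesis by blast
qed

end

context local_noetherian_domain
begin

text \<open>A set that generates \<open>M\<close> over \<open>B\<close> with the least number of elements: a unit coefficient in a
  relation would make one of them superfluous.\<close>

lemma minimal_generators:
  assumes D: "module A \<Delta>" and B: "submodule B A \<Delta>" and M: "submodule M A \<Delta>" and BM: "B \<subseteq> M" and fg: "fin_gen \<Delta> M"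
  shows "\<exists>G. finite G \<and> G \<subseteq> M \<and> M \<subseteq> mod_span \<Delta> (B \<union> G) \<and>
    (\<forall>g\<in>G. \<forall>a\<in>carrier A. a \<odot>\<^bsub>\<Delta>\<^esub> g \<in> mod_span \<Delta> (B \<union> (G - {g})) --> a \<notin> Units A)"
proof -
  let ?P = "\<lambda>n. \<exists>G. finite G \<and> card G = n \<and> G \<subseteq> M \<and> M \<subseteq> mod_span \<Delta> (B \<union> G)"
  have "\<exists>n. ?P n"
  proof -
    obtain G where G: "finite G" "M = mod_span \<Delta> G" using fg by (auto simp: fin_gen_def)
    have "G \<subseteq> M" unfolding G(2) by (rule mod_span_superset)
    moreover have "M \<subseteq> mod_span \<Delta> (B \<union> G)" unfolding G(2) by (rule mod_span_mono) simp
    ultimately show ?thesis using G(1) by blast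
  qed
  then have "?P (LEAST n. ?P n)" by (rule LeastI_ex)
  then obtain G where G: "finite G" "card G = (LEAST n. ?P n)" "G \<subseteq> M" "M \<subseteq> mod_span \<Delta> (B \<union> G)" by blast
  have "a \<notin> Units A" if g: "g \<in> G" and a: "a \<in> carrier A" "a \<odot>\<^bsub>\<Delta>\<^esub> g \<in> mod_span \<Delta> (B \<union> (G - {g}))" for g a
  proof
    assume u: "a \<in> Units A"
    let ?S = "mod_span \<Delta> (B \<union> (G - {g}))"
    have gD: "g \<in> carrier \<Delta>" using submod_subset[OF M D] G(3) g by blast
    have "B \<union> (G - {g}) \<subseteq> carrier \<Delta>" using submod_subset[OF M D] G(3) BM by blast
    note S = submod_mod_span[OF D this]
    have "inv a \<odot>\<^bsub>\<Delta>\<^esub> (a \<odot>\<^bsub>\<Delta>\<^esub> g) \<in> ?S" by (rule submod_smult[OF S D _ a(2)]) (use u in simp)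
    moreover have "inv a \<odot>\<^bsub>\<Delta>\<^esub> (a \<odot>\<^bsub>\<Delta>\<^esub> g) = g"
      using mod_smult_assoc[OF D Units_inv_closed[OF u] Units_closed[OF u] gD] u gD D by simp
    ultimately have "g \<in> ?S" by simp
    then have "B \<union> G \<subseteq> ?S" using mod_span_superset[of "B \<union> (G - {g})" \<Delta>] by blast
    from mod_span_least[OF S this] have "M \<subseteq> ?S" using G(4) by blast
    then have "?P (card (G - {g}))" using G(1,3) by (intro exI[of _ "G - {g}"]) auto
    then have "card G \<le> card (G - {g})" unfolding G(2) by (rule Least_le)
    then show False using card_Diff1_less[OF G(1) g] by simp
  qed
  then show ?thesis using G by blast
qed

text \<open>The extension is the direct sum of the image of \<open>\<Phi>\<close> and a free module on minimal generators
  of its torsion closure modulo the image, a projective cover. Minimality says exactly that kernel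
  elements have coordinates in the maximal ideal.\<close>

lemma corner_exists:
  fixes \<Delta> :: "('a, 'd) module"
  assumes D: "module A \<Delta>" and fg: "fin_gen \<Delta> (carrier \<Delta>)" and \<Phi>: "\<Phi> \<in> Hom \<Delta> \<Delta>"
  shows "\<exists>(N :: ('a, (nat => 'a) set) module) \<epsilon> \<theta>. corner N \<Delta> \<epsilon> \<theta> 0 \<and> (\<forall>x\<in>carrier \<Delta>. \<epsilon> (\<theta> x) = \<Phi> x)"
proof -
  let ?B = "\<Phi> ` carrier \<Delta>"
  let ?M = "tors_closure \<Delta> ?B"
  have B: "submodule ?B A \<Delta>" by (rule submod_image[OF \<Phi> D D submod_carrier[OF D]])
  have M: "submodule ?M A \<Delta>" by (rule submod_tors_closure[OF D B])
  have BD: "x \<in> carrier \<Delta>" if "x \<in> ?B" for x by (rule submod_subset[OF B D that])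
  have BM: "?B \<subseteq> ?M"
  proof
    fix x assume x: "x \<in> ?B"
    show "x \<in> ?M" unfolding tors_closure_def using BD[OF x] x D by (intro CollectI conjI bexI[of _ \<one>]) simp_all
  qed
  obtain G where G: "finite G" "G \<subseteq> ?M" "?M \<subseteq> mod_span \<Delta> (?B \<union> G)"
    and min: "\<And>g a. g \<in> G ==> a \<in> carrier A ==> a \<odot>\<^bsub>\<Delta>\<^esub> g \<in> mod_span \<Delta> (?B \<union> (G - {g})) ==> a \<notin> Units A"
    using minimal_generators[OF D B M BM fin_gen_submod[OF D fg M]] by blast
  have GD: "g \<in> carrier \<Delta>" if "g \<in> G" for g using submod_subset[OF M D] G(2) that by blast
  let ?Bm = "\<Delta>\<lparr>carrier := ?B\<rparr>"
  have Bm: "module A ?Bm" by (rule submodule.submodule_is_module[OF B D])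
  define P where "P = prod_module ?Bm (free_mod G)"
  have P: "module A P" unfolding P_def by (rule module_prod[OF Bm module_free_mod])
  have \<Phi>B: "\<Phi> \<in> Hom \<Delta> ?Bm"
    using hom_add[OF \<Phi>] hom_smult[OF \<Phi>] by (intro mod_homI) simp_all
  have fgP: "fin_gen P (carrier P)"
    unfolding P_def using fin_gen_image[OF \<Phi>B D Bm fg] by (intro fin_gen_prod Bm module_free_mod fin_gen_free_mod G(1)) simp
  define lc where "lc = lincomb \<Delta> G (\<lambda>g. g)"
  have lc: "lc \<in> Hom (free_mod G) \<Delta>" unfolding lc_def by (rule lincomb_hom[OF D GD])
  have lcu: "lc (unit_vec G g) = g" if "g \<in> G" for g
    unfolding lc_def using lincomb_unit[where b = "\<lambda>g. g", OF D GD that] .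
  define e where "e x = fst x \<oplus>\<^bsub>\<Delta>\<^esub> lc (snd x)" for x
  define t where "t x = (\<Phi> x, \<zero>\<^bsub>free_mod G\<^esub>)" for x
  have zP: "\<zero>\<^bsub>P\<^esub> = (\<zero>\<^bsub>\<Delta>\<^esub>, \<zero>\<^bsub>free_mod G\<^esub>)" by (simp add: P_def prod_module_simps)
  have cP: "x \<in> carrier P \<longleftrightarrow> fst x \<in> ?B \<and> snd x \<in> carrier (free_mod G)" for x
    by (cases x) (simp add: P_def prod_module_simps)
  have fst: "fst \<in> Hom P \<Delta>"
    by (rule mod_homI) (simp_all add: cP BD, simp_all add: P_def prod_module_simps)
  have snd: "snd \<in> Hom P (free_mod G)" unfolding P_def by (rule snd_hom)
  have e: "e \<in> Hom P \<Delta>"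
    unfolding e_def by (rule hom_plus[OF fst hom_comp[OF snd lc] P D])
  have t: "t \<in> Hom \<Delta> P"
    unfolding t_def P_def by (rule hom_comp[OF \<Phi>B inl_hom[OF Bm module_free_mod]])
  have lc0: "lc \<zero>\<^bsub>free_mod G\<^esub> = \<zero>\<^bsub>\<Delta>\<^esub>" by (rule hom_zero[OF lc module_free_mod D])
  have et: "e (t x) = \<Phi> x" if "x \<in> carrier \<Delta>" for x
    using hom_closed[OF \<Phi> that] D by (simp add: e_def t_def lc0)
  have etB: "e ` t ` carrier \<Delta> = ?B" unfolding image_image using et by (rule image_cong[OF refl])
  have tors: "e ` carrier P = tors_closure \<Delta> (e ` t ` carrier \<Delta>)"
    unfolding etB
  proof
    show "e ` carrier P \<subseteq> ?M"
    proof (rule image_subsetI)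
      fix x assume x: "x \<in> carrier P"
      have "lc (snd x) \<in> ?M" unfolding lc_def
      proof (rule lincomb_in_submod[OF D M])
        fix g assume g: "g \<in> G"
        have "snd x g \<in> carrier A" using dsum_component[OF _ g, of "snd x" "\<lambda>_. ring_mod"] x by (simp add: cP)
        then show "snd x g \<odot>\<^bsub>\<Delta>\<^esub> g \<in> ?M" using submod_smult[OF M D] G(2) g by blast
      qed
      moreover have "fst x \<in> ?M" using x BM unfolding cP by blast
      ultimately show "e x \<in> ?M" unfolding e_def by (intro submod_add[OF M D])
    qed
    have "?B \<union> G \<subseteq> e ` carrier P"
    proof
      fix x assume "x \<in> ?B \<union> G"
      then show "x \<in> e ` carrier P"
      proof
        assume x: "x \<in> ?B"
        have "e (x, \<zero>\<^bsub>free_mod G\<^esub>) = x" using BD[OF x] D by (simp add: e_def lc0)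
        moreover have "(x, \<zero>\<^bsub>free_mod G\<^esub>) \<in> carrier P" using x mod_zero_closed[OF module_free_mod] unfolding cP by simp
        ultimately show ?thesis by (metis imageI)
      next
        assume x: "x \<in> G"
        have "e (\<zero>\<^bsub>\<Delta>\<^esub>, unit_vec G x) = x" using GD[OF x] D by (simp add: e_def lcu[OF x])
        moreover have "(\<zero>\<^bsub>\<Delta>\<^esub>, unit_vec G x) \<in> carrier P" using submod_zero[OF B D] unit_vec_closed[OF x] unfolding cP by simp
        ultimately show ?thesis by (metis imageI)
      qed
    qed
    from mod_span_least[OF submod_image[OF e P D submod_carrier[OF P]] this] G(3)
    show "?M \<subseteq> e ` carrier P" by blast
  qed
  have "adapted_basis P (t ` carrier \<Delta>) (mod_ker P \<Delta> e) G {} snd (\<lambda>g. (\<zero>\<^bsub>\<Delta>\<^esub>, unit_vec G g))"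
    unfolding adapted_basis_def
  proof (intro conjI ballI)
    show "finite G" "{} \<subseteq> G" using G(1) by simp_all
    show "snd \<in> Hom P (free_mod G)" by (rule snd)
  next
    fix x assume x: "x \<in> carrier P"
    show "snd x = \<zero>\<^bsub>free_mod G\<^esub> \<longleftrightarrow> x \<in> t ` carrier \<Delta>"
    proof
      assume *: "snd x = \<zero>\<^bsub>free_mod G\<^esub>"
      obtain w where w: "w \<in> carrier \<Delta>" "fst x = \<Phi> w" using x unfolding cP by blast
      have "x = t w" using * w(2) by (cases x) (simp add: t_def)
      then show "x \<in> t ` carrier \<Delta>" using w(1) by simp
    next
      assume "x \<in> t ` carrier \<Delta>"
      then show "snd x = \<zero>\<^bsub>free_mod G\<^esub>" by (auto simp: t_def)
    qed
  next
    fix g assume g: "g \<in> G"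
    show "(\<zero>\<^bsub>\<Delta>\<^esub>, unit_vec G g) \<in> carrier P" using submod_zero[OF B D] unit_vec_closed[OF g] unfolding cP by simp
    show "snd (\<zero>\<^bsub>\<Delta>\<^esub>, unit_vec G g) = unit_vec G g" by simp
  next
    fix x g assume x: "x \<in> mod_ker P \<Delta> e" and g: "g \<in> G - {}"
    have xP: "fst x \<in> ?B" "snd x \<in> carrier (free_mod G)" and e0: "e x = \<zero>\<^bsub>\<Delta>\<^esub>"
      using x cP unfolding mod_ker_def by auto
    define a where "a = snd x"
    have gG: "g \<in> G" using g by simp
    have aF: "a \<in> carrier (free_mod G)" using xP by (simp add: a_def)
    have ag: "a j \<in> carrier A" if "j \<in> G" for j using dsum_component[OF aF that] by simp
    let ?S = "mod_span \<Delta> (?B \<union> (G - {g}))"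
    have "?B \<union> (G - {g}) \<subseteq> carrier \<Delta>" using BD GD by blast
    note S = submod_mod_span[OF D this] and sup = mod_span_superset[of "?B \<union> (G - {g})" \<Delta>]
    define r where "r = (\<lambda>j\<in>G. if j = g then \<zero> else a j)"
    have r: "r \<in> carrier (free_mod G)" using ag by (simp add: r_def free_mod_carrier[OF G(1)])
    have gu: "a g \<odot>\<^bsub>free_mod G\<^esub> unit_vec G g \<in> carrier (free_mod G)"
      by (rule mod_smult_closed[OF module_free_mod ag[OF gG] unit_vec_closed[OF gG]])
    have "a = r \<oplus>\<^bsub>free_mod G\<^esub> a g \<odot>\<^bsub>free_mod G\<^esub> unit_vec G g"
    proof (rule free_mod_eqI[OF aF mod_add_closed[OF module_free_mod r gu]])
      show "a j = (r \<oplus>\<^bsub>free_mod G\<^esub> a g \<odot>\<^bsub>free_mod G\<^esub> unit_vec G g) j" if "j \<in> G" for j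
        using that gG ag by (simp add: dsum_simps(3,4) r_def unit_vec_apply)
    qed
    then have "lc a = lc r \<oplus>\<^bsub>\<Delta>\<^esub> lc (a g \<odot>\<^bsub>free_mod G\<^esub> unit_vec G g)"
      using hom_add[OF lc r gu] by simp
    also have "lc (a g \<odot>\<^bsub>free_mod G\<^esub> unit_vec G g) = a g \<odot>\<^bsub>\<Delta>\<^esub> g"
      using hom_smult[OF lc ag[OF gG] unit_vec_closed[OF gG]] lcu[OF gG] by simp
    finally have dec: "lc a = lc r \<oplus>\<^bsub>\<Delta>\<^esub> a g \<odot>\<^bsub>\<Delta>\<^esub> g" .
    have agD: "a g \<odot>\<^bsub>\<Delta>\<^esub> g \<in> carrier \<Delta>" by (rule mod_smult_closed[OF D ag[OF gG] GD[OF gG]])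
    have lrD: "lc r \<in> carrier \<Delta>" by (rule hom_closed[OF lc r])
    have laD: "lc a \<in> carrier \<Delta>" by (rule hom_closed[OF lc aF])
    have lr: "lc r \<in> ?S" unfolding lc_def
    proof (rule lincomb_in_submod[OF D S])
      fix j assume j: "j \<in> G"
      show "r j \<odot>\<^bsub>\<Delta>\<^esub> j \<in> ?S"
      proof (cases "j = g")
        case True
        then show ?thesis using submod_zero[OF S D] GD[OF gG] gG D by (simp add: r_def)
      next
        case False
        then have "j \<in> ?S" using j sup by blast
        then show ?thesis using submod_smult[OF S D ag[OF j]] False j by (simp add: r_def)
      qed
    qed
    have "fst x \<in> ?S" using xP(1) sup by blast
    moreover have "lc a = \<ominus>\<^bsub>\<Delta>\<^esub> fst x"
    proof -
      have "fst x \<oplus>\<^bsub>\<Delta>\<^esub> lc a = \<zero>\<^bsub>\<Delta>\<^esub>" using e0 by (simp add: e_def a_def)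
      then show ?thesis
        using abelian_group.minus_equality[OF mod_abelian_group[OF D], of "lc a" "fst x"] laD BD[OF xP(1)]
        by (simp add: mod_add_comm[OF D])
    qed
    ultimately have la: "lc a \<in> ?S" using submod_neg[OF S D] by simp
    have "a g \<odot>\<^bsub>\<Delta>\<^esub> g = lc a \<ominus>\<^bsub>\<Delta>\<^esub> lc r"
      unfolding dec using mod_add_diff_cancel[OF D agD lrD] mod_add_comm[OF D lrD agD] by simp
    then have "a g \<odot>\<^bsub>\<Delta>\<^esub> g \<in> ?S" using submod_diff[OF S D la lr] by simp
    from min[OF gG ag[OF gG] this] show "snd x g \<notin> Units A" by (simp add: a_def)
  qed simp
  from adapted_basis_reindex[OF this]
  have ab: "has_adapted_basis P (t ` carrier \<Delta>) (mod_ker P \<Delta> e) 0" by simp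
  have inj: "t x = \<zero>\<^bsub>P\<^esub>" if "x \<in> carrier \<Delta>" "e (t x) = \<zero>\<^bsub>\<Delta>\<^esub>" for x
    using that et[OF that(1)] by (simp add: t_def zP)
  have cor: "corner P \<Delta> e t 0"
    unfolding corner_def using P D e t fgP inj tors ab by blast
  obtain h :: "'d \<times> ('d => 'a) => (nat => 'a) set" where h: "inj_on h (carrier P)"
    using fin_gen_embeds[OF P fgP] by blast
  obtain N :: "('a, (nat => 'a) set) module" where N: "module A N" "h \<in> Hom P N" "bij_betw h (carrier P) (carrier N)"
    using module_transport[OF P h] by blast
  obtain k where k: "k \<in> Hom N P" "bij_betw k (carrier N) (carrier P)"
    "\<And>x. x \<in> carrier P ==> k (h x) = x" "\<And>y. y \<in> carrier N ==> h (k y) = y"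
    using mod_iso_inverse[OF N(2,3) P] by blast
  have "corner N \<Delta> (\<lambda>y. e (k y)) (\<lambda>x. h (t x)) 0"
  proof (rule corner_iso[OF cor N(1) D hom_comp[OF k(1) e] hom_comp[OF t N(2)] N(2,3) hom_id])
    show "bij_betw (\<lambda>x. x) (carrier \<Delta>) (carrier \<Delta>)" using bij_betw_id[of "carrier \<Delta>"] by (simp add: id_def)
  qed (simp_all add: k(3))
  moreover have "e (k (h (t x))) = \<Phi> x" if "x \<in> carrier \<Delta>" for x
    using k(3)[OF hom_closed[OF t that]] et[OF that] by simp
  ultimately show ?thesis by blast
qed

end

section \<open>Quotients and free modules\<close>

context ground_ring
begin

lemma submod_abelian_subgroup:
  assumes "module A N" "submodule U A N"
  shows "abelian_subgroup U N"
proof (rule abelian_subgroupI3)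
  show "additive_subgroup U N"
    using submodule.axioms(1)[OF assms(2)] by (rule additive_subgroup.intro)
  show "abelian_group N" using assms(1) by (rule mod_abelian_group)
qed

lemma quot_simps:
  "carrier (quot_module N U) = a_rcosets\<^bsub>N\<^esub> U" "\<zero>\<^bsub>quot_module N U\<^esub> = U"
  "C \<oplus>\<^bsub>quot_module N U\<^esub> C' = C <+>\<^bsub>N\<^esub> C'" "a \<odot>\<^bsub>quot_module N U\<^esub> C = (\<Union>x\<in>C. U +>\<^bsub>N\<^esub> (a \<odot>\<^bsub>N\<^esub> x))"
  by (simp_all add: quot_module_def)

lemma coset_eq_iff:
  assumes N: "module A N" and U: "submodule U A N" and x: "x \<in> carrier N" and y: "y \<in> carrier N"
  shows "U +>\<^bsub>N\<^esub> x = U +>\<^bsub>N\<^esub> y \<longleftrightarrow> x \<ominus>\<^bsub>N\<^esub> y \<in> U"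
proof -
  note UN = submod_abelian_subgroup[OF N U]
  have Us: "U \<subseteq> carrier N" using submod_subset[OF U N] by blast
  show ?thesis
  proof
    assume "U +>\<^bsub>N\<^esub> x = U +>\<^bsub>N\<^esub> y"
    then have "x \<in> U +>\<^bsub>N\<^esub> y" using abelian_subgroup.a_rcos_self[OF UN x] by simp
    then obtain u where u: "u \<in> U" "x = u \<oplus>\<^bsub>N\<^esub> y" by (auto simp: a_r_coset_def')
    then have "x \<ominus>\<^bsub>N\<^esub> y = u" using mod_add_diff_cancel[OF N _ y] Us by blast
    then show "x \<ominus>\<^bsub>N\<^esub> y \<in> U" using u(1) by simp
  next
    assume d: "x \<ominus>\<^bsub>N\<^esub> y \<in> U"
    have "x = (x \<ominus>\<^bsub>N\<^esub> y) \<oplus>\<^bsub>N\<^esub> y" using mod_diff_add_cancel[OF N x y] by simp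
    then have "x \<in> U +>\<^bsub>N\<^esub> y" using d unfolding a_r_coset_def' by blast
    then show "U +>\<^bsub>N\<^esub> x = U +>\<^bsub>N\<^esub> y" using abelian_subgroup.a_repr_independence'[OF UN _ y] by metis
  qed
qed

lemma quot_carrier: "carrier (quot_module N U) = (\<lambda>x. U +>\<^bsub>N\<^esub> x) ` carrier N"
  by (auto simp: quot_simps A_RCOSETS_def')

lemma quot_ops:
  assumes N: "module A N" and U: "submodule U A N" and x: "x \<in> carrier N"
  shows "y \<in> carrier N ==> (U +>\<^bsub>N\<^esub> x) \<oplus>\<^bsub>quot_module N U\<^esub> (U +>\<^bsub>N\<^esub> y) = U +>\<^bsub>N\<^esub> (x \<oplus>\<^bsub>N\<^esub> y)"
    and "a \<in> carrier A ==> a \<odot>\<^bsub>quot_module N U\<^esub> (U +>\<^bsub>N\<^esub> x) = U +>\<^bsub>N\<^esub> (a \<odot>\<^bsub>N\<^esub> x)"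
    and "\<zero>\<^bsub>quot_module N U\<^esub> = U +>\<^bsub>N\<^esub> \<zero>\<^bsub>N\<^esub>"
proof -
  note UN = submod_abelian_subgroup[OF N U]
  have Us: "u \<in> carrier N" if "u \<in> U" for u using submod_subset[OF U N that] .
  show "(U +>\<^bsub>N\<^esub> x) \<oplus>\<^bsub>quot_module N U\<^esub> (U +>\<^bsub>N\<^esub> y) = U +>\<^bsub>N\<^esub> (x \<oplus>\<^bsub>N\<^esub> y)" if "y \<in> carrier N"
    unfolding quot_simps by (rule abelian_subgroup.a_rcos_sum[OF UN x that])
  show "a \<odot>\<^bsub>quot_module N U\<^esub> (U +>\<^bsub>N\<^esub> x) = U +>\<^bsub>N\<^esub> (a \<odot>\<^bsub>N\<^esub> x)" if a: "a \<in> carrier A"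
  proof -
    have eq: "U +>\<^bsub>N\<^esub> (a \<odot>\<^bsub>N\<^esub> z) = U +>\<^bsub>N\<^esub> (a \<odot>\<^bsub>N\<^esub> x)" if z: "z \<in> U +>\<^bsub>N\<^esub> x" for z
    proof -
      obtain u where u: "u \<in> U" "z = u \<oplus>\<^bsub>N\<^esub> x" using z by (auto simp: a_r_coset_def')
      have zN: "z \<in> carrier N" using u Us x N by simp
      have "a \<odot>\<^bsub>N\<^esub> z = a \<odot>\<^bsub>N\<^esub> u \<oplus>\<^bsub>N\<^esub> a \<odot>\<^bsub>N\<^esub> x" unfolding u(2) by (rule mod_r_distr[OF N a Us[OF u(1)] x])
      then have "a \<odot>\<^bsub>N\<^esub> z \<ominus>\<^bsub>N\<^esub> a \<odot>\<^bsub>N\<^esub> x = a \<odot>\<^bsub>N\<^esub> u"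
        using mod_add_diff_cancel[OF N mod_smult_closed[OF N a Us[OF u(1)]] mod_smult_closed[OF N a x]] by simp
      then have "a \<odot>\<^bsub>N\<^esub> z \<ominus>\<^bsub>N\<^esub> a \<odot>\<^bsub>N\<^esub> x \<in> U" using submod_smult[OF U N a u(1)] by simp
      then show ?thesis using coset_eq_iff[OF N U mod_smult_closed[OF N a zN] mod_smult_closed[OF N a x]] by simp
    qed
    show ?thesis unfolding quot_simps using eq abelian_subgroup.a_rcos_self[OF UN x] by blast
  qed
  have "U +>\<^bsub>N\<^esub> \<zero>\<^bsub>N\<^esub> = U" using Us N by (auto simp: a_r_coset_def')
  then show "\<zero>\<^bsub>quot_module N U\<^esub> = U +>\<^bsub>N\<^esub> \<zero>\<^bsub>N\<^esub>" by (simp add: quot_simps)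
qed

lemma module_quot:
  assumes N: "module A N" and U: "submodule U A N"
  shows "module A (quot_module N U)"
proof -
  note ops = quot_ops[OF N U] and z = quot_ops(3)[OF N U mod_zero_closed[OF N]]
  show ?thesis
    by (rule ground_moduleI)
      (use N in \<open>auto simp: quot_carrier ops(1,2) z mod_add_assoc mod_add_lcomm mod_add_comm
        mod_l_distr mod_r_distr mod_smult_assoc\<close>)
qed

lemma quot_map_hom:
  assumes N: "module A N" and U: "submodule U A N"
  shows "(\<lambda>x. U +>\<^bsub>N\<^esub> x) \<in> Hom N (quot_module N U)"
  using quot_ops(1,2)[OF N U] by (intro mod_homI) (auto simp: quot_carrier)

lemma quot_map_zero_iff:
  assumes N: "module A N" and U: "submodule U A N" and x: "x \<in> carrier N"
  shows "U +>\<^bsub>N\<^esub> x = \<zero>\<^bsub>quot_module N U\<^esub> \<longleftrightarrow> x \<in> U"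
  unfolding quot_ops(3)[OF N U x] coset_eq_iff[OF N U x mod_zero_closed[OF N]] mod_diff_zero[OF N x] ..

text \<open>Unique expansions say that the linear combination map is a bijection, which turns statements
  about bases into statements about homomorphisms.\<close>

lemma module_basis_iff:
  assumes Q: "module A Q"
  shows "module_basis A Q B \<longleftrightarrow>
    B \<subseteq> carrier Q \<and> bij_betw (lincomb Q B (\<lambda>b. b)) (carrier (free_mod B)) (carrier Q)"
proof (cases "B \<subseteq> carrier Q")
  case True
  have F: "c \<in> carrier (free_mod B) \<longleftrightarrow> c \<in> (B \<rightarrow>\<^sub>E carrier A) \<and> finite {b\<in>B. c b \<noteq> \<zero>}" for c
    by (simp add: dsum_simps(1))
  have L: "lincomb Q B (\<lambda>b. b) c = (\<Oplus>\<^bsub>Q\<^esub>b\<in>{b\<in>B. c b \<noteq> \<zero>}. c b \<odot>\<^bsub>Q\<^esub> b)" for c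
    by (simp add: lincomb_def dsum_elim_def)
  have hom: "lincomb Q B (\<lambda>b. b) \<in> Hom (free_mod B) Q"
    using True by (intro lincomb_hom[OF Q]) blast
  have "(\<forall>x\<in>carrier Q. \<exists>!c. c \<in> carrier (free_mod B) \<and> x = lincomb Q B (\<lambda>b. b) c)
      \<longleftrightarrow> bij_betw (lincomb Q B (\<lambda>b. b)) (carrier (free_mod B)) (carrier Q)" (is "?l \<longleftrightarrow> ?r")
  proof
    assume l: ?l
    have "inj_on (lincomb Q B (\<lambda>b. b)) (carrier (free_mod B))"
    proof (rule inj_onI)
      fix c d assume c: "c \<in> carrier (free_mod B)" "d \<in> carrier (free_mod B)" "lincomb Q B (\<lambda>b. b) c = lincomb Q B (\<lambda>b. b) d"
      have "lincomb Q B (\<lambda>b. b) c \<in> carrier Q" by (rule hom_closed[OF hom c(1)])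
      with l c show "c = d" by metis
    qed
    moreover have "carrier Q \<subseteq> lincomb Q B (\<lambda>b. b) ` carrier (free_mod B)"
      using l by (metis image_eqI subsetI)
    moreover have "lincomb Q B (\<lambda>b. b) ` carrier (free_mod B) \<subseteq> carrier Q" using hom_closed[OF hom] by blast
    ultimately show ?r unfolding bij_betw_def by blast
  next
    assume r: ?r
    show ?l
    proof
      fix x assume "x \<in> carrier Q"
      then obtain c where c: "c \<in> carrier (free_mod B)" "x = lincomb Q B (\<lambda>b. b) c" using r unfolding bij_betw_def by blast
      show "\<exists>!c. c \<in> carrier (free_mod B) \<and> x = lincomb Q B (\<lambda>b. b) c"
      proof (rule ex1I[of _ c])
        show "d = c" if "d \<in> carrier (free_mod B) \<and> x = lincomb Q B (\<lambda>b. b) d" for d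
          using that c bij_betw_imp_inj_on[OF r] by (auto simp: inj_on_def)
      qed (use c in simp)
    qed
  qed
  then show ?thesis unfolding module_basis_def F L using True by (simp add: conj_assoc)
qed (simp add: module_basis_def)

lemma hom_bij_comp:
  "f \<in> Hom M N ==> bij_betw f (carrier M) (carrier N) ==> g \<in> Hom N P ==> bij_betw g (carrier N) (carrier P)
    ==> bij_betw (\<lambda>x. g (f x)) (carrier M) (carrier P)"
  using bij_betw_trans[of f "carrier M" "carrier N" g "carrier P"] by (simp add: comp_def)

lemma free_of_rankI:
  fixes Q :: "('a, 'q) module" and I :: "'i set"
  assumes Q: "module A Q" and I: "finite I" and one: "\<one> \<noteq> \<zero>"
    and k: "k \<in> Hom (free_mod I) Q" "bij_betw k (carrier (free_mod I)) (carrier Q)"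
  shows "free_of_rank A Q (card I)"
proof -
  define \<tau> where "\<tau> i = k (unit_vec I i)" for i
  have inj: "inj_on \<tau> I"
  proof (rule inj_onI)
    fix i j assume ij: "i \<in> I" "j \<in> I" "\<tau> i = \<tau> j"
    then have "unit_vec I i = unit_vec I j"
      using inj_on_eq_iff[OF bij_betw_imp_inj_on[OF k(2)] unit_vec_closed[OF ij(1)] unit_vec_closed[OF ij(2)]]
      by (simp add: \<tau>_def)
    then show "i = j" using unit_vec_apply[OF ij(1) ij(1)] unit_vec_apply[OF ij(2) ij(1)] one by (auto split: if_splits)
  qed
  let ?B = "\<tau> ` I"
  have B: "?B \<subseteq> carrier Q" using hom_closed[OF k(1) unit_vec_closed] by (auto simp: \<tau>_def)
  have fB: "finite ?B" using I by simp
  define R where "R c = (\<lambda>i\<in>I. c (\<tau> i))" for c :: "'q => 'a"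
  have RF: "R c \<in> carrier (free_mod I)" if "c \<in> carrier (free_mod ?B)" for c
    using that unfolding free_mod_carrier[OF I] free_mod_carrier[OF fB] R_def by (intro restrict_PiE[THEN iffD2]) auto
  have Ri: "R c i = c (\<tau> i)" if "i \<in> I" for c i using that by (simp add: R_def)
  have R: "R \<in> Hom (free_mod ?B) (free_mod I)"
  proof (rule mod_homI)
    show "R c \<in> carrier (free_mod I)" if "c \<in> carrier (free_mod ?B)" for c by (rule RF[OF that])
    show "R (c \<oplus>\<^bsub>free_mod ?B\<^esub> d) = R c \<oplus>\<^bsub>free_mod I\<^esub> R d" for c d
      by (auto simp: R_def dsum_simps(3) restrict_def)
    show "R (a \<odot>\<^bsub>free_mod ?B\<^esub> c) = a \<odot>\<^bsub>free_mod I\<^esub> R c" for a c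
      by (auto simp: R_def dsum_simps(4) restrict_def)
  qed
  have Rb: "bij_betw R (carrier (free_mod ?B)) (carrier (free_mod I))"
    unfolding bij_betw_def
  proof
    show "inj_on R (carrier (free_mod ?B))"
    proof (rule inj_onI)
      fix c d assume c: "c \<in> carrier (free_mod ?B)" and d: "d \<in> carrier (free_mod ?B)" and cd: "R c = R d"
      show "c = d"
      proof (rule dsum_eqI[OF c d])
        fix b assume "b \<in> ?B"
        then obtain i where i: "i \<in> I" "b = \<tau> i" by blast
        show "c b = d b" using fun_cong[OF cd, of i] Ri[OF i(1)] i(2) by simp
      qed
    qed
    show "R ` carrier (free_mod ?B) = carrier (free_mod I)"
    proof
      show "R ` carrier (free_mod ?B) \<subseteq> carrier (free_mod I)" using RF by blast
      show "carrier (free_mod I) \<subseteq> R ` carrier (free_mod ?B)"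
      proof
        fix a assume a: "a \<in> carrier (free_mod I)"
        let ?c = "\<lambda>b\<in>?B. a (inv_into I \<tau> b)"
        have c: "?c \<in> carrier (free_mod ?B)"
          unfolding free_mod_carrier[OF fB]
        proof (rule restrict_PiE[THEN iffD2], rule Pi_I)
          fix b assume "b \<in> ?B"
          then have "inv_into I \<tau> b \<in> I" by (rule inv_into_into)
          from dsum_component[OF a this] show "a (inv_into I \<tau> b) \<in> carrier A" by simp
        qed
        have "R ?c = a"
        proof (rule dsum_eqI[OF RF[OF c] a])
          fix i assume i: "i \<in> I"
          show "R ?c i = a i" using i inv_into_f_f[OF inj i] by (simp add: Ri[OF i])
        qed
        then show "a \<in> R ` carrier (free_mod ?B)" using c by (metis imageI)
      qed
    qed
  qed
  have "lincomb Q ?B (\<lambda>b. b) c = k (R c)" if c: "c \<in> carrier (free_mod ?B)" for c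
  proof (rule free_hom_ext[OF Q lincomb_hom[OF Q] hom_comp[OF R k(1)] _ c])
    show "b \<in> carrier Q" if "b \<in> ?B" for b using that B by blast
    fix b assume b: "b \<in> ?B"
    then obtain i where i: "i \<in> I" "b = \<tau> i" by blast
    have "R (unit_vec ?B b) = unit_vec I i"
    proof (rule dsum_eqI[OF RF[OF unit_vec_closed[OF b]] unit_vec_closed[OF i(1)]])
      fix j assume j: "j \<in> I"
      have "\<tau> j = b \<longleftrightarrow> j = i" unfolding i(2) by (rule inj_on_eq_iff[OF inj j i(1)])
      then show "R (unit_vec ?B b) j = unit_vec I i j"
        using unit_vec_apply[OF b imageI[OF j]] unit_vec_apply[OF i(1) j] by (simp add: Ri[OF j])
    qed
    then show "lincomb Q ?B (\<lambda>b. b) (unit_vec ?B b) = k (R (unit_vec ?B b))"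
      using lincomb_unit[where b = "\<lambda>b. b" and I = ?B, OF Q subsetD[OF B] b] i(2) by (simp add: \<tau>_def)
  qed
  then have "bij_betw (lincomb Q ?B (\<lambda>b. b)) (carrier (free_mod ?B)) (carrier Q)"
    using bij_betw_cong[THEN iffD2, OF _ hom_bij_comp[OF R Rb k]] by blast
  then have "module_basis A Q ?B" using module_basis_iff[OF Q] B by blast
  moreover have "card ?B = card I" by (rule card_image[OF inj])
  ultimately show ?thesis unfolding free_of_rank_def using fB by blast
qed

text \<open>Finitely many generators involve only finitely many coordinates.\<close>

lemma fin_gen_free_imp_finite:
  assumes fg: "fin_gen (free_mod B) (carrier (free_mod B))" and one: "\<one> \<noteq> \<zero>"
  shows "finite B"
proof -
  obtain G where G: "finite G" "G \<subseteq> carrier (free_mod B)" "carrier (free_mod B) = mod_span (free_mod B) G"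
    using fg by (auto simp: fin_gen_def)
  define S where "S = (\<Union>g\<in>G. {b\<in>B. g b \<noteq> \<zero>})"
  have S: "finite S" using G(1,2) by (auto simp: S_def dsum_simps(1))
  let ?H = "{f \<in> carrier (free_mod B). \<forall>b\<in>B - S. f b = \<zero>}"
  have "submodule ?H A (free_mod B)"
    by (rule submodI) (auto simp: dsum_simps(2-4) intro: mod_zero_closed[OF module_free_mod, unfolded dsum_simps(2), simplified]
      mod_add_closed[OF module_free_mod, unfolded dsum_simps(3), simplified] mod_smult_closed[OF module_free_mod, unfolded dsum_simps(4), simplified])
  moreover have "G \<subseteq> ?H" using G(2) by (auto simp: S_def)
  ultimately have "mod_span (free_mod B) G \<subseteq> ?H" by (rule mod_span_least)
  then have "unit_vec B b \<in> ?H" if "b \<in> B" for b using unit_vec_closed[OF that] G(3) by blast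
  then have "b \<in> S" if "b \<in> B" for b
    using unit_vec_apply[OF that that] one that by (metis (mono_tags, lifting) Diff_iff mem_Collect_eq)
  then have "B \<subseteq> S" by (rule subsetI)
  then show ?thesis using S by (rule finite_subset)
qed

text \<open>A basis of the quotient is used as its own index set, whence the type of \<open>I\<close>.\<close>

lemma free_quotient_coordinates:
  fixes N :: "('a, 'm) module"
  assumes N: "module A N" and U: "submodule U A N" and fg: "fin_gen N (carrier N)" and one: "\<one> \<noteq> \<zero>"
    and free: "free_module A (quot_module N U)"
  shows "\<exists>(I :: 'm set set) p b. finite I \<and> p \<in> Hom N (free_mod I) \<and>
    (\<forall>x\<in>carrier N. p x = \<zero>\<^bsub>free_mod I\<^esub> \<longleftrightarrow> x \<in> U) \<and> (\<forall>i\<in>I. b i \<in> carrier N \<and> p (b i) = unit_vec I i)"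
proof -
  let ?Q = "quot_module N U" and ?\<pi> = "\<lambda>x. U +>\<^bsub>N\<^esub> x"
  note Q = module_quot[OF N U] and \<pi> = quot_map_hom[OF N U]
  obtain B where B: "B \<subseteq> carrier ?Q" "bij_betw (lincomb ?Q B (\<lambda>b. b)) (carrier (free_mod B)) (carrier ?Q)"
    using free unfolding free_module_def module_basis_iff[OF Q] by blast
  have hom: "lincomb ?Q B (\<lambda>b. b) \<in> Hom (free_mod B) ?Q"
    using B(1) by (intro lincomb_hom[OF Q]) blast
  let ?k = "inv_into (carrier (free_mod B)) (lincomb ?Q B (\<lambda>b. b))"
  note k = hom_inv_into[OF hom B(2) module_free_mod] and kb = bij_betw_inv_into[OF B(2)]
  have "fin_gen ?Q (carrier ?Q)" using fin_gen_image[OF \<pi> N Q fg] by (simp add: quot_carrier)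
  from fin_gen_image[OF k Q module_free_mod this]
  have "fin_gen (free_mod B) (carrier (free_mod B))" using kb by (simp add: bij_betw_def)
  then have fin: "finite B" using one by (rule fin_gen_free_imp_finite)
  have "\<exists>x. x \<in> carrier N \<and> ?\<pi> x = b" if "b \<in> B" for b
    using that B(1) unfolding quot_carrier by blast
  then have "\<forall>b\<in>B. \<exists>x. x \<in> carrier N \<and> ?\<pi> x = b" by blast
  from bchoice[OF this] obtain s where s: "\<And>b. b \<in> B ==> s b \<in> carrier N" "\<And>b. b \<in> B ==> ?\<pi> (s b) = b" by blast
  have "(\<lambda>x. ?k (?\<pi> x)) \<in> Hom N (free_mod B)" by (rule hom_comp[OF \<pi> k])
  moreover have "?k (?\<pi> x) = \<zero>\<^bsub>free_mod B\<^esub> \<longleftrightarrow> x \<in> U" if x: "x \<in> carrier N" for x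
  proof -
    have "?k (?\<pi> x) = ?k \<zero>\<^bsub>?Q\<^esub> \<longleftrightarrow> ?\<pi> x = \<zero>\<^bsub>?Q\<^esub>"
      using inj_on_eq_iff[OF bij_betw_imp_inj_on[OF kb] hom_closed[OF \<pi> x] mod_zero_closed[OF Q]] .
    then show ?thesis using hom_zero[OF k Q module_free_mod] quot_map_zero_iff[OF N U x] by simp
  qed
  moreover have "?k (?\<pi> (s b)) = unit_vec B b" if b: "b \<in> B" for b
  proof -
    have "lincomb ?Q B (\<lambda>b. b) (unit_vec B b) = b"
      using B(1) by (intro lincomb_unit[OF Q _ b]) blast
    then show ?thesis using bij_betw_inv_into_left[OF B(2) unit_vec_closed[OF b]] s(2)[OF b] by simp
  qed
  ultimately show ?thesis using fin s(1)
    by (intro exI[of _ B] exI[of _ "\<lambda>x. ?k (?\<pi> x)"] exI[of _ s] conjI ballI) simp_all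
qed

lemma coordinates_imp_free_quotient:
  assumes N: "module A N" and U: "submodule U A N" and I: "finite I" and one: "\<one> \<noteq> \<zero>"
    and p: "p \<in> Hom N (free_mod I)" "\<And>x. x \<in> carrier N ==> p x = \<zero>\<^bsub>free_mod I\<^esub> \<longleftrightarrow> x \<in> U"
    and b: "\<And>i. i \<in> I ==> b i \<in> carrier N" "\<And>i. i \<in> I ==> p (b i) = unit_vec I i"
  shows "free_module A (quot_module N U)"
proof -
  let ?Q = "quot_module N U" and ?\<pi> = "\<lambda>x. U +>\<^bsub>N\<^esub> x"
  note Q = module_quot[OF N U] and \<pi> = quot_map_hom[OF N U] and lb = lincomb_hom[where b = b, OF N b(1)]
  have plb: "p (lincomb N I b a) = a" if a: "a \<in> carrier (free_mod I)" for a
    by (rule coordinates_lincomb[OF N p(1) b a])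
  let ?k = "\<lambda>a. ?\<pi> (lincomb N I b a)"
  have k: "?k \<in> Hom (free_mod I) ?Q" by (rule hom_comp[OF lb \<pi>])
  have "bij_betw ?k (carrier (free_mod I)) (carrier ?Q)"
    unfolding bij_betw_def
  proof
    show "inj_on ?k (carrier (free_mod I))"
    proof (rule hom_inj_onI[OF k module_free_mod Q])
      fix a assume a: "a \<in> carrier (free_mod I)" "?k a = \<zero>\<^bsub>?Q\<^esub>"
      have l: "lincomb N I b a \<in> carrier N" by (rule hom_closed[OF lb a(1)])
      have "lincomb N I b a \<in> U" using a(2) quot_map_zero_iff[OF N U l] by simp
      then have "p (lincomb N I b a) = \<zero>\<^bsub>free_mod I\<^esub>" using p(2)[OF l] by simp
      then show "a = \<zero>\<^bsub>free_mod I\<^esub>" using plb[OF a(1)] by simp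
    qed
    show "?k ` carrier (free_mod I) = carrier ?Q"
    proof
      show "?k ` carrier (free_mod I) \<subseteq> carrier ?Q" using hom_closed[OF k] by blast
      show "carrier ?Q \<subseteq> ?k ` carrier (free_mod I)"
        unfolding quot_carrier
      proof (rule image_subsetI)
        fix x assume x: "x \<in> carrier N"
        have px: "p x \<in> carrier (free_mod I)" by (rule hom_closed[OF p(1) x])
        have l: "lincomb N I b (p x) \<in> carrier N" by (rule hom_closed[OF lb px])
        have "p (x \<ominus>\<^bsub>N\<^esub> lincomb N I b (p x)) = p x \<ominus>\<^bsub>free_mod I\<^esub> p x"
          using hom_diff[OF p(1) N module_free_mod x l] plb[OF px] by simp
        also have "\<dots> = \<zero>\<^bsub>free_mod I\<^esub>" by (rule mod_diff_self[OF module_free_mod px])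
        finally have "x \<ominus>\<^bsub>N\<^esub> lincomb N I b (p x) \<in> U" using p(2)[OF mod_minus_closed[OF N x l]] by simp
        then have "?\<pi> x = ?k (p x)" using coset_eq_iff[OF N U x l] by simp
        then show "?\<pi> x \<in> ?k ` carrier (free_mod I)" using px by blast
      qed
    qed
  qed
  from free_of_rankI[OF Q I one k this] show ?thesis by (auto simp: free_of_rank_def free_module_def)
qed

lemma torsion_quotient:
  assumes D: "module A \<Delta>" and H: "submodule H A \<Delta>" and B: "submodule B A \<Delta>" and BH: "B \<subseteq> H"
    and tors: "\<And>m. m \<in> H ==> \<exists>\<xi>\<in>carrier A. \<xi> \<noteq> \<zero> \<and> \<xi> \<odot>\<^bsub>\<Delta>\<^esub> m \<in> B"
  shows "torsion_module A (quot_module (\<Delta>\<lparr>carrier := H\<rparr>) B)"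
proof -
  let ?N = "\<Delta>\<lparr>carrier := H\<rparr>"
  have N: "module A ?N" by (rule submodule.submodule_is_module[OF H D])
  have B': "submodule B A ?N"
    by (rule submodI[OF N]) (use BH submod_zero[OF B D] submod_add[OF B D] submod_smult[OF B D] in auto)
  show ?thesis
    unfolding torsion_module_def quot_carrier
  proof (rule ballI)
    fix C assume "C \<in> (\<lambda>x. B +>\<^bsub>?N\<^esub> x) ` carrier ?N"
    then obtain m where m: "m \<in> carrier ?N" "C = B +>\<^bsub>?N\<^esub> m" by blast
    obtain \<xi> where \<xi>: "\<xi> \<in> carrier A" "\<xi> \<noteq> \<zero>" "\<xi> \<odot>\<^bsub>\<Delta>\<^esub> m \<in> B" using tors[of m] m(1) by auto
    have "\<xi> \<odot>\<^bsub>quot_module ?N B\<^esub> C = B +>\<^bsub>?N\<^esub> (\<xi> \<odot>\<^bsub>?N\<^esub> m)" unfolding m(2) by (rule quot_ops(2)[OF N B' m(1) \<xi>(1)])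
    also have "\<dots> = \<zero>\<^bsub>quot_module ?N B\<^esub>"
      using quot_map_zero_iff[OF N B' mod_smult_closed[OF N \<xi>(1) m(1)]] \<xi>(3) by simp
    finally show "\<exists>\<xi>\<in>carrier A. \<xi> \<noteq> \<zero> \<and> \<xi> \<odot>\<^bsub>quot_module ?N B\<^esub> C = \<zero>\<^bsub>quot_module ?N B\<^esub>"
      using \<xi>(1,2) by blast
  qed
qed

end

section \<open>Weights\<close>

lemma ex_height:
  fixes D :: "'v::real_vector root_data"
  assumes "ground_data D"
  shows "\<exists>f::'v => real. linear f \<and> (\<forall>\<alpha>\<in>simple D. f \<alpha> = 1)"
proof -
  have "independent (simple D)" using assms by (simp add: ground_data_def simple_roots_def)
  from linear_independent_extend[OF this, of "\<lambda>_. 1::real"] show ?thesis .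
qed

abbreviation shift :: "'v::real_vector => 'v => nat => 'v" where
  "shift \<mu> \<alpha> n \<equiv> \<mu> + real n *\<^sub>R \<alpha>"

locale graded_category = local_noetherian_domain A for A :: "'a ring" (structure) +
  fixes \<phi> :: "laurent => 'a" and D :: "'v::real_vector root_data"
  assumes ground: "ground_data D" and \<phi>: "\<phi> \<in> ring_hom ring_of_type_algebra A"
begin

abbreviation wl :: "'v set" where "wl \<equiv> weight_lattice D"

definition weight_lt :: "'v => 'v => bool" where
  "weight_lt \<mu> \<nu> \<longleftrightarrow> weight_le D \<mu> \<nu> \<and> \<mu> \<noteq> \<nu>"

lemma \<phi>_closed: "\<phi> q \<in> carrier A"
  using \<phi> by (auto simp: ring_hom_def ring_of_type_algebra_def)

lemma finite_simple: "finite (simple D)" and simple_roots_subset: "simple D \<subseteq> root_data.roots D"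
  using ground finite_subset by (auto simp: ground_data_def root_system_def simple_roots_def)

lemma wl_shift: 
  assumes "\<mu> \<in> wl" "\<alpha> \<in> simple D" shows "shift \<mu> \<alpha> n \<in> wl"
  unfolding weight_lattice_def
proof (intro CollectI ballI)
  fix \<beta> assume \<beta>: "\<beta> \<in> root_data.roots D"
  have lin: "linear (coroot D \<beta>)" and int: "coroot D \<beta> \<alpha> \<in> \<int>"
    using ground \<beta> assms(2) simple_roots_subset by (auto simp: ground_data_def root_system_def)
  have "coroot D \<beta> (shift \<mu> \<alpha> n) = coroot D \<beta> \<mu> + real n * coroot D \<beta> \<alpha>"
    using lin by (simp add: linear_add linear_scale)
  then show "coroot D \<beta> (shift \<mu> \<alpha> n) \<in> \<int>"
    using assms(1) \<beta> int by (auto simp: weight_lattice_def)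
qed

text \<open>A linear functional that is \<open>1\<close> on simple roots; the difference of heights is the measure for
  inductions from higher to lower weights.\<close>

definition height :: "'v => real" where
  "height = (SOME f. linear f \<and> (\<forall>\<alpha>\<in>simple D. f \<alpha> = 1))"

lemma height: "linear height" "\<And>\<alpha>. \<alpha> \<in> simple D ==> height \<alpha> = 1"
proof -
  have "linear height \<and> (\<forall>\<alpha>\<in>simple D. height \<alpha> = 1)" unfolding height_def by (rule someI_ex[OF ex_height[OF ground]])
  then show "linear height" "\<And>\<alpha>. \<alpha> \<in> simple D ==> height \<alpha> = 1" by blast+
qed

lemma height_shift: "\<alpha> \<in> simple D ==> height (shift \<mu> \<alpha> n) = height \<mu> + real n"
  using height by (simp add: linear_add linear_scale)

lemma weight_le_height:
  assumes "weight_le D \<mu> \<nu>"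
  shows "\<exists>k::nat. height \<nu> = height \<mu> + real k \<and> (k = 0 --> \<nu> = \<mu>)"
proof -
  obtain c :: "'v => nat" where c: "\<nu> - \<mu> = (\<Sum>\<alpha>\<in>simple D. real (c \<alpha>) *\<^sub>R \<alpha>)"
    using assms by (auto simp: weight_le_def)
  have "height (\<nu> - \<mu>) = (\<Sum>\<alpha>\<in>simple D. real (c \<alpha>) * height \<alpha>)"
    unfolding c using height(1) by (simp add: linear_sum linear_scale)
  also have "\<dots> = real (\<Sum>\<alpha>\<in>simple D. c \<alpha>)" using height(2) by simp
  finally have "height \<nu> = height \<mu> + real (\<Sum>\<alpha>\<in>simple D. c \<alpha>)" using height(1) by (simp add: linear_diff)
  moreover have "\<nu> = \<mu>" if "(\<Sum>\<alpha>\<in>simple D. c \<alpha>) = 0"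
  proof -
    have "\<forall>\<alpha>\<in>simple D. c \<alpha> = 0" using that finite_simple by simp
    then have "\<nu> - \<mu> = 0" unfolding c by (intro sum.neutral) simp
    then show ?thesis by simp
  qed
  ultimately show ?thesis by (intro exI[of _ "\<Sum>\<alpha>\<in>simple D. c \<alpha>"]) simp
qed

lemma weight_lt_height: "weight_lt \<mu> \<nu> ==> height \<mu> + 1 \<le> height \<nu>"
proof -
  assume *: "weight_lt \<mu> \<nu>"
  then obtain k :: nat where "height \<nu> = height \<mu> + real k" "k = 0 --> \<nu> = \<mu>"
    using weight_le_height[of \<mu> \<nu>] unfolding weight_lt_def by blast
  then show ?thesis using * by (cases k) (auto simp: weight_lt_def)
qed

lemma weight_le_refl [simp]: "weight_le D \<mu> \<mu>"
  unfolding weight_le_def by (rule exI[of _ "\<lambda>_. 0"]) simp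

lemma weight_le_trans:
  assumes "weight_le D \<mu> \<nu>" "weight_le D \<nu> \<kappa>" shows "weight_le D \<mu> \<kappa>"
proof -
  obtain c d :: "'v => nat" where "\<nu> - \<mu> = (\<Sum>\<alpha>\<in>simple D. real (c \<alpha>) *\<^sub>R \<alpha>)" "\<kappa> - \<nu> = (\<Sum>\<alpha>\<in>simple D. real (d \<alpha>) *\<^sub>R \<alpha>)"
    using assms by (auto simp: weight_le_def)
  moreover have "\<kappa> - \<mu> = (\<nu> - \<mu>) + (\<kappa> - \<nu>)" by simp
  ultimately have "\<kappa> - \<mu> = (\<Sum>\<alpha>\<in>simple D. real (c \<alpha> + d \<alpha>) *\<^sub>R \<alpha>)"
    by (simp only: of_nat_add scaleR_add_left sum.distrib)
  then show ?thesis unfolding weight_le_def by (rule exI[of _ "\<lambda>\<alpha>. c \<alpha> + d \<alpha>"])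
qed

lemma weight_le_shift:
  assumes "\<alpha> \<in> simple D" shows "weight_le D \<mu> (shift \<mu> \<alpha> n)"
  unfolding weight_le_def
proof (rule exI[of _ "\<lambda>\<beta>. if \<beta> = \<alpha> then n else 0"])
  have "(\<Sum>\<beta>\<in>simple D. real (if \<beta> = \<alpha> then n else 0) *\<^sub>R \<beta>) = (\<Sum>\<beta>\<in>simple D. if \<beta> = \<alpha> then real n *\<^sub>R \<beta> else 0)"
    by (rule sum.cong) auto
  then show "shift \<mu> \<alpha> n - \<mu> = (\<Sum>\<beta>\<in>simple D. real (if \<beta> = \<alpha> then n else 0) *\<^sub>R \<beta>)"
    using assms finite_simple by simp
qed

lemma weight_lt_shift: "\<alpha> \<in> simple D ==> n > 0 ==> weight_lt \<mu> (shift \<mu> \<alpha> n)"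
  using weight_le_shift height_shift[of \<alpha> \<mu> n] by (auto simp: weight_lt_def)

lemma weight_lt_le_trans: "weight_lt \<mu> \<nu> ==> weight_le D \<nu> \<kappa> ==> weight_lt \<mu> \<kappa>"
proof -
  assume *: "weight_lt \<mu> \<nu>" "weight_le D \<nu> \<kappa>"
  obtain k :: nat where "height \<kappa> = height \<nu> + real k" using weight_le_height[OF *(2)] by blast
  then have "\<mu> \<noteq> \<kappa>" using weight_lt_height[OF *(1)] by auto
  then show ?thesis using * weight_le_trans[of \<mu> \<nu> \<kappa>] by (simp add: weight_lt_def)
qed

lemma finite_shifts:
  assumes S: "quasi_bounded D S" and \<mu>: "\<mu> \<in> wl"
  shows "finite {(\<alpha>, n) \<in> delta_index D. shift \<mu> \<alpha> n \<in> S}"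
proof (rule finite_subset)
  let ?T = "{\<nu>\<in>S. weight_le D \<mu> \<nu>}"
  show "finite (simple D \<times> (\<lambda>\<nu>. nat \<lfloor>height \<nu> - height \<mu>\<rfloor>) ` ?T)"
    using finite_simple S \<mu> by (auto simp: quasi_bounded_def)
  show "{(\<alpha>, n) \<in> delta_index D. shift \<mu> \<alpha> n \<in> S} \<subseteq> simple D \<times> (\<lambda>\<nu>. nat \<lfloor>height \<nu> - height \<mu>\<rfloor>) ` ?T"
  proof (clarsimp simp: delta_index_def)
    fix \<alpha> and n :: nat assume "\<alpha> \<in> simple D" "shift \<mu> \<alpha> n \<in> S"
    then show "n \<in> (\<lambda>\<nu>. nat \<lfloor>height \<nu> - height \<mu>\<rfloor>) ` ?T"
      using weight_le_shift[of \<alpha> \<mu> n] height_shift[of \<alpha> \<mu> n]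
      by (intro image_eqI[of _ _ "shift \<mu> \<alpha> n"]) auto
  qed
qed

section \<open>Objects as families of corners\<close>

text \<open>Objects are compared and constructed one weight at a time, from above. All conditions are
  therefore stated at a weight \<open>\<mu>\<close>, and refer to the weight spaces at \<open>\<mu>\<close> and above only.\<close>

definition ops_at :: "('v, 'a, 'm) xobj => 'v => bool" where
  "ops_at M \<mu> \<longleftrightarrow> module A (wt M \<mu>) \<and>
     (\<forall>\<alpha>\<in>simple D. \<forall>n>0.
        opE M \<mu> \<alpha> n \<in> Hom (wt M \<mu>) (wt M (shift \<mu> \<alpha> n)) \<and>
        opF M \<mu> \<alpha> n \<in> Hom (wt M (shift \<mu> \<alpha> n)) (wt M \<mu>))"

lemma ops_atD:
  assumes "ops_at M \<mu>"
  shows "module A (wt M \<mu>)"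
    "\<And>\<alpha> n. \<alpha> \<in> simple D ==> n > 0 ==> opE M \<mu> \<alpha> n \<in> Hom (wt M \<mu>) (wt M (shift \<mu> \<alpha> n))"
    "\<And>\<alpha> n. \<alpha> \<in> simple D ==> n > 0 ==> opF M \<mu> \<alpha> n \<in> Hom (wt M (shift \<mu> \<alpha> n)) (wt M \<mu>)"
  using assms by (auto simp: ops_at_def)

definition ops_above :: "('v, 'a, 'm) xobj => 'v => bool" where
  "ops_above M \<mu> \<longleftrightarrow> (\<forall>\<nu>\<in>wl. weight_lt \<mu> \<nu> --> ops_at M \<nu>)"

definition finite_above :: "('v, 'a, 'm) xobj => 'v => bool" where
  "finite_above M \<mu> \<longleftrightarrow>
     finite {(\<alpha>, n) \<in> delta_index D. \<not> trivial (wt M (shift \<mu> \<alpha> n))}"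

definition delta_wt :: "('v, 'a, 'm) xobj => 'v => 'v \<times> nat => ('a, 'm) module" where
  "delta_wt M \<mu> = (\<lambda>(\<alpha>, n). wt M (shift \<mu> \<alpha> n))"

lemma wt_delta_eq: "wt_delta D M \<mu> = dsum_module (delta_index D) (delta_wt M \<mu>)"
  by (simp add: wt_delta_def delta_wt_def)

lemma delta_wt_simp [simp]: "delta_wt M \<mu> (\<alpha>, n) = wt M (shift \<mu> \<alpha> n)"
  by (simp add: delta_wt_def)

lemma delta_index_iff [simp]: "(\<alpha>, n) \<in> delta_index D \<longleftrightarrow> \<alpha> \<in> simple D \<and> n > 0"
  by (simp add: delta_index_def)

lemma ops_aboveD:
  "ops_above M \<mu> ==> \<mu> \<in> wl ==> \<alpha> \<in> simple D ==> n > 0 ==> ops_at M (shift \<mu> \<alpha> n)"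
  using wl_shift weight_lt_shift by (auto simp: ops_above_def)

lemma delta_wt_module:
  "ops_above M \<mu> ==> \<mu> \<in> wl ==> i \<in> delta_index D ==> module A (delta_wt M \<mu> i)"
  using ops_aboveD by (cases i) (auto simp: ops_at_def)

lemma module_wt_delta: "ops_above M \<mu> ==> \<mu> \<in> wl ==> module A (wt_delta D M \<mu>)"
  unfolding wt_delta_eq by (rule module_dsum) (rule delta_wt_module)

lemma F_row_eq:
  "F_row D M \<mu> = dsum_elim (delta_wt M \<mu>) (wt M \<mu>) (delta_index D) (\<lambda>(\<alpha>, n). opF M \<mu> \<alpha> n)"
proof
  fix f
  have *: "{(\<alpha>, n) \<in> delta_index D. f (\<alpha>, n) \<noteq> \<zero>\<^bsub>wt M (shift \<mu> \<alpha> n)\<^esub>} = {i \<in> delta_index D. f i \<noteq> \<zero>\<^bsub>delta_wt M \<mu> i\<^esub>}"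
    by (auto simp: delta_wt_def)
  have **: "(\<lambda>(\<alpha>, n). opF M \<mu> \<alpha> n (f (\<alpha>, n))) = (\<lambda>i. (case i of (\<alpha>, n) => opF M \<mu> \<alpha> n) (f i))"
    by auto
  show "F_row D M \<mu> f = dsum_elim (delta_wt M \<mu>) (wt M \<mu>) (delta_index D) (\<lambda>(\<alpha>, n). opF M \<mu> \<alpha> n) f"
    unfolding F_row_def dsum_elim_def * ** ..
qed

lemma F_row_hom:
  assumes "ops_at M \<mu>" "ops_above M \<mu>" "\<mu> \<in> wl"
  shows "F_row D M \<mu> \<in> Hom (wt_delta D M \<mu>) (wt M \<mu>)"
  unfolding F_row_eq wt_delta_eq
  by (rule dsum_elim_hom) (use assms delta_wt_module in \<open>auto simp: ops_at_def\<close>)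

lemma F_row_single:
  assumes "ops_at M \<mu>" "ops_above M \<mu>" "\<mu> \<in> wl" "\<alpha> \<in> simple D" "n > 0" "x \<in> carrier (wt M (shift \<mu> \<alpha> n))"
  shows "F_row D M \<mu> (dsingle (delta_wt M \<mu>) (delta_index D) (\<alpha>, n) x) = opF M \<mu> \<alpha> n x"
proof -
  have "dsum_elim (delta_wt M \<mu>) (wt M \<mu>) (delta_index D) (\<lambda>(\<alpha>, n). opF M \<mu> \<alpha> n)
      (dsingle (delta_wt M \<mu>) (delta_index D) (\<alpha>, n) x) = (\<lambda>(\<alpha>, n). opF M \<mu> \<alpha> n) (\<alpha>, n) x"
    by (rule dsum_elim_single) (use assms delta_wt_module in \<open>auto simp: ops_at_def\<close>)
  then show ?thesis by (simp add: F_row_eq)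
qed

lemma wt_delta_carrierI:
  assumes fin: "finite_above M \<mu>" and f: "\<And>\<alpha> n. \<alpha> \<in> simple D ==> n > 0 ==> f (\<alpha>, n) \<in> carrier (wt M (shift \<mu> \<alpha> n))"
    and e: "f \<in> extensional (delta_index D)"
  shows "f \<in> carrier (wt_delta D M \<mu>)"
  unfolding wt_delta_eq dsum_simps(1)
proof (intro CollectI conjI)
  show "f \<in> (\<Pi>\<^sub>E i\<in>delta_index D. carrier (delta_wt M \<mu> i))"
    using f e by (auto simp: PiE_iff)
  show "finite {i \<in> delta_index D. f i \<noteq> \<zero>\<^bsub>delta_wt M \<mu> i\<^esub>}"
  proof (rule finite_subset)
    show "finite {(\<alpha>, n) \<in> delta_index D. \<not> trivial (wt M (shift \<mu> \<alpha> n))}"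
      using fin by (simp add: finite_above_def)
    show "{i \<in> delta_index D. f i \<noteq> \<zero>\<^bsub>delta_wt M \<mu> i\<^esub>}
        \<subseteq> {(\<alpha>, n) \<in> delta_index D. \<not> trivial (wt M (shift \<mu> \<alpha> n))}"
      using f by auto
  qed
qed

lemma E_col_hom:
  assumes "ops_at M \<mu>" "finite_above M \<mu>"
  shows "E_col D M \<mu> \<in> Hom (wt M \<mu>) (wt_delta D M \<mu>)"
proof (rule mod_homI)
  have E: "opE M \<mu> \<alpha> n \<in> Hom (wt M \<mu>) (wt M (shift \<mu> \<alpha> n))" if "\<alpha> \<in> simple D" "n > 0" for \<alpha> n
    using assms(1) that by (simp add: ops_at_def)
  show "E_col D M \<mu> x \<in> carrier (wt_delta D M \<mu>)" if "x \<in> carrier (wt M \<mu>)" for x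
    by (rule wt_delta_carrierI[OF assms(2)]) (use hom_closed[OF E that] in \<open>auto simp: E_col_def\<close>)
  show "E_col D M \<mu> (x \<oplus>\<^bsub>wt M \<mu>\<^esub> y) = E_col D M \<mu> x \<oplus>\<^bsub>wt_delta D M \<mu>\<^esub> E_col D M \<mu> y"
    if "x \<in> carrier (wt M \<mu>)" "y \<in> carrier (wt M \<mu>)" for x y
    using hom_add[OF E that] by (auto simp: E_col_def wt_delta_eq dsum_simps(3) fun_eq_iff)
  show "E_col D M \<mu> (a \<odot>\<^bsub>wt M \<mu>\<^esub> x) = a \<odot>\<^bsub>wt_delta D M \<mu>\<^esub> E_col D M \<mu> x"
    if "a \<in> carrier A" "x \<in> carrier (wt M \<mu>)" for a x
    using hom_smult[OF E that] by (auto simp: E_col_def wt_delta_eq dsum_simps(4) fun_eq_iff)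
qed

lemma E_col_apply: "\<alpha> \<in> simple D ==> n > 0 ==> E_col D M \<mu> x (\<alpha>, n) = opE M \<mu> \<alpha> n x"
  by (simp add: E_col_def)

definition EF_entry :: "('v, 'a, 'm) xobj => 'v => 'v => nat => 'v => nat => 'm => 'm" where
  "EF_entry M \<mu> \<alpha> m \<beta> n x =
     (if \<alpha> \<noteq> \<beta> then actF M (shift \<mu> \<alpha> m) \<beta> n (actE M (shift \<mu> \<beta> n) \<alpha> m x)
      else (\<Oplus>\<^bsub>wt M (shift \<mu> \<alpha> m)\<^esub>r\<in>{0..min m n}.
                \<phi> (qbinom (dnum D \<alpha>) (\<lfloor>coroot D \<alpha> \<mu>\<rfloor> + int m + int n) r)
                \<odot>\<^bsub>wt M (shift \<mu> \<alpha> m)\<^esub>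
                actF M (shift \<mu> \<alpha> m) \<alpha> (n - r)
                  (actE M (shift \<mu> \<alpha> n) \<alpha> (m - r) x)))"

definition X2_at :: "('v, 'a, 'm) xobj => 'v => bool" where
  "X2_at M \<mu> \<longleftrightarrow> (\<forall>\<alpha>\<in>simple D. \<forall>\<beta>\<in>simple D. \<forall>m>0. \<forall>n>0. \<forall>x\<in>carrier (wt M (shift \<mu> \<beta> n)).
     opE M \<mu> \<alpha> m (opF M \<mu> \<beta> n x) = EF_entry M \<mu> \<alpha> m \<beta> n x)"

lemma axiom_X2_iff: "axiom_X2 A \<phi> D M \<longleftrightarrow> (\<forall>\<mu>\<in>wl. X2_at M \<mu>)"
  unfolding axiom_X2_def X2_at_def EF_entry_def
  by (intro ball_cong refl all_cong) (auto simp: actE_def actF_def)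

text \<open>The matrix of all products \<open>E F\<close> at \<open>\<mu>\<close> as prescribed by the commutation axiom. It uses the
  operators strictly above \<open>\<mu>\<close> only, so it is known before the weight space at \<open>\<mu>\<close> is.\<close>

definition EF_map :: "('v, 'a, 'm) xobj => 'v => ('v \<times> nat => 'm) => 'v \<times> nat => 'm" where
  "EF_map M \<mu> = dsum_elim (delta_wt M \<mu>) (wt_delta D M \<mu>) (delta_index D)
     (\<lambda>(\<beta>, n) x. \<lambda>(\<alpha>, m)\<in>delta_index D. EF_entry M \<mu> \<alpha> m \<beta> n x)"

lemma actE_hom: "ops_at M \<nu> ==> \<alpha> \<in> simple D ==> actE M \<nu> \<alpha> k \<in> Hom (wt M \<nu>) (wt M (shift \<nu> \<alpha> k))"
  and actF_hom: "ops_at M \<nu> ==> \<alpha> \<in> simple D ==> actF M \<nu> \<alpha> k \<in> Hom (wt M (shift \<nu> \<alpha> k)) (wt M \<nu>)"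
  by (auto simp: actE_def actF_def ops_at_def mod_hom_def)

lemma hom_sum:
  assumes "module A M" "module A N" "\<And>r. r \<in> K ==> f r \<in> Hom M N"
  shows "(\<lambda>x. finsum N (\<lambda>r. f r x) K) \<in> Hom M N"
proof -
  interpret N: abelian_monoid N using mod_abelian_group[OF assms(2)] by (rule abelian_group.axioms)
  show ?thesis
    using assms(3)
  proof (induction K rule: infinite_finite_induct)
    case (infinite K)
    then show ?case using hom_const_zero[OF assms(2)] by (simp add: N.finsum_infinite)
  next
    case empty
    then show ?case using hom_const_zero[OF assms(2)] by simp
  next
    case (insert r K)
    have IH: "(\<lambda>x. finsum N (\<lambda>r. f r x) K) \<in> Hom M N" using insert by simp
    have "(\<lambda>x. f r x \<oplus>\<^bsub>N\<^esub> finsum N (\<lambda>r. f r x) K) \<in> Hom M N"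
      by (rule hom_plus[OF insert.prems[OF insertI1] IH assms(1,2)])
    then show ?case
    proof (rule hom_cong[OF _ _ assms(1)])
      fix x assume x: "x \<in> carrier M"
      have "f s x \<in> carrier N" if "s \<in> insert r K" for s using hom_closed[OF insert.prems[OF that] x] .
      then show "finsum N (\<lambda>r. f r x) (insert r K) = f r x \<oplus>\<^bsub>N\<^esub> finsum N (\<lambda>r. f r x) K"
        using insert(1,2) by (subst N.finsum_insert) auto
    qed
  qed
qed

lemma EF_summand_hom:
  assumes "ops_above M \<mu>" "\<mu> \<in> wl" "\<alpha> \<in> simple D" "\<beta> \<in> simple D" "m > 0" "n > 0"
    and "shift \<mu> \<beta> n + real m' *\<^sub>R \<alpha> = shift \<mu> \<alpha> m + real n' *\<^sub>R \<beta>"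
  shows "(\<lambda>x. actF M (shift \<mu> \<alpha> m) \<beta> n' (actE M (shift \<mu> \<beta> n) \<alpha> m' x))
    \<in> Hom (wt M (shift \<mu> \<beta> n)) (wt M (shift \<mu> \<alpha> m))"
  using hom_comp[OF actE_hom[OF ops_aboveD[OF assms(1,2,4,6)] assms(3), of m']]
    actF_hom[OF ops_aboveD[OF assms(1,2,3,5)] assms(4), of n'] assms(7) by simp

lemma EF_entry_hom:
  assumes ab: "ops_above M \<mu>" "\<mu> \<in> wl" and \<alpha>: "\<alpha> \<in> simple D" and \<beta>: "\<beta> \<in> simple D" and mn: "m > 0" "n > 0"
  shows "EF_entry M \<mu> \<alpha> m \<beta> n \<in> Hom (wt M (shift \<mu> \<beta> n)) (wt M (shift \<mu> \<alpha> m))"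
proof (cases "\<alpha> = \<beta>")
  case False
  have "(\<lambda>x. actF M (shift \<mu> \<alpha> m) \<beta> n (actE M (shift \<mu> \<beta> n) \<alpha> m x))
    \<in> Hom (wt M (shift \<mu> \<beta> n)) (wt M (shift \<mu> \<alpha> m))"
    by (rule EF_summand_hom[OF ab \<alpha> \<beta> mn]) simp
  then show ?thesis using False by (simp add: EF_entry_def[abs_def])
next
  case True
  have mods: "module A (wt M (shift \<mu> \<alpha> n))" "module A (wt M (shift \<mu> \<alpha> m))"
    using ops_aboveD[OF ab \<alpha>] mn by (simp_all add: ops_at_def)
  have "(\<lambda>x. \<phi> (qbinom (dnum D \<alpha>) (\<lfloor>coroot D \<alpha> \<mu>\<rfloor> + int m + int n) r) \<odot>\<^bsub>wt M (shift \<mu> \<alpha> m)\<^esub>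
          actF M (shift \<mu> \<alpha> m) \<alpha> (n - r) (actE M (shift \<mu> \<alpha> n) \<alpha> (m - r) x))
      \<in> Hom (wt M (shift \<mu> \<alpha> n)) (wt M (shift \<mu> \<alpha> m))" if r: "r \<in> {0..min m n}" for r
  proof (rule hom_scale[OF \<phi>_closed _ mods])
    have "shift \<mu> \<alpha> n + real (m - r) *\<^sub>R \<alpha> = shift \<mu> \<alpha> m + real (n - r) *\<^sub>R \<alpha>"
      using r by (simp add: scaleR_add_left[symmetric] add.assoc of_nat_diff del: scaleR_left_distrib)
    then show "(\<lambda>x. actF M (shift \<mu> \<alpha> m) \<alpha> (n - r) (actE M (shift \<mu> \<alpha> n) \<alpha> (m - r) x))
        \<in> Hom (wt M (shift \<mu> \<alpha> n)) (wt M (shift \<mu> \<alpha> m))"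
      by (rule EF_summand_hom[OF ab \<alpha> \<alpha> mn])
  qed
  from hom_sum[where K = "{0..min m n}", OF mods this]
  show ?thesis unfolding EF_entry_def[abs_def] True[symmetric] by simp
qed

lemma EF_column_hom:
  assumes ab: "ops_above M \<mu>" "\<mu> \<in> wl" and fin: "finite_above M \<mu>" and \<beta>: "\<beta> \<in> simple D" "n > 0"
  shows "(\<lambda>x. \<lambda>(\<alpha>, m)\<in>delta_index D. EF_entry M \<mu> \<alpha> m \<beta> n x) \<in> Hom (wt M (shift \<mu> \<beta> n)) (wt_delta D M \<mu>)"
proof (rule mod_homI)
  note E = EF_entry_hom[OF ab _ \<beta>(1) _ \<beta>(2)]
  show "(\<lambda>(\<alpha>, m)\<in>delta_index D. EF_entry M \<mu> \<alpha> m \<beta> n x) \<in> carrier (wt_delta D M \<mu>)"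
    if "x \<in> carrier (wt M (shift \<mu> \<beta> n))" for x
    by (rule wt_delta_carrierI[OF fin]) (use hom_closed[OF E that] in auto)
qed (use hom_add[OF EF_entry_hom[OF ab _ \<beta>(1) _ \<beta>(2)]] hom_smult[OF EF_entry_hom[OF ab _ \<beta>(1) _ \<beta>(2)]]
   in \<open>auto simp: wt_delta_eq dsum_simps(3,4) fun_eq_iff\<close>)

lemma EF_map_hom:
  assumes "ops_above M \<mu>" "\<mu> \<in> wl" "finite_above M \<mu>"
  shows "EF_map M \<mu> \<in> Hom (wt_delta D M \<mu>) (wt_delta D M \<mu>)"
  unfolding EF_map_def wt_delta_eq[of M \<mu>]
proof (rule dsum_elim_hom)
  show "module A (delta_wt M \<mu> i)" if "i \<in> delta_index D" for i by (rule delta_wt_module[OF assms(1,2) that])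
  show "module A (dsum_module (delta_index D) (delta_wt M \<mu>))" using module_wt_delta[OF assms(1,2)] by (simp add: wt_delta_eq)
  show "(\<lambda>(\<beta>, n) x. \<lambda>(\<alpha>, m)\<in>delta_index D. EF_entry M \<mu> \<alpha> m \<beta> n x) i \<in> Hom (delta_wt M \<mu> i) (dsum_module (delta_index D) (delta_wt M \<mu>))"
    if "i \<in> delta_index D" for i
    using EF_column_hom[OF assms] that by (cases i) (simp add: wt_delta_eq)
qed

lemma EF_map_single:
  assumes "ops_above M \<mu>" "\<mu> \<in> wl" "finite_above M \<mu>" "\<beta> \<in> simple D" "n > 0" "x \<in> carrier (wt M (shift \<mu> \<beta> n))"
  shows "EF_map M \<mu> (dsingle (delta_wt M \<mu>) (delta_index D) (\<beta>, n) x) = (\<lambda>(\<alpha>, m)\<in>delta_index D. EF_entry M \<mu> \<alpha> m \<beta> n x)"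
proof -
  have "EF_map M \<mu> (dsingle (delta_wt M \<mu>) (delta_index D) (\<beta>, n) x)
      = (\<lambda>(\<beta>, n) x. \<lambda>(\<alpha>, m)\<in>delta_index D. EF_entry M \<mu> \<alpha> m \<beta> n x) (\<beta>, n) x"
    unfolding EF_map_def
  proof (rule dsum_elim_single)
    show "module A (delta_wt M \<mu> i)" if "i \<in> delta_index D" for i by (rule delta_wt_module[OF assms(1,2) that])
    show "module A (wt_delta D M \<mu>)" by (rule module_wt_delta[OF assms(1,2)])
    show "(\<lambda>(\<beta>, n) x. \<lambda>(\<alpha>, m)\<in>delta_index D. EF_entry M \<mu> \<alpha> m \<beta> n x) i \<in> Hom (delta_wt M \<mu> i) (wt_delta D M \<mu>)"
      if "i \<in> delta_index D" for i
      using EF_column_hom[OF assms(1-3)] that by (cases i) simp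
  qed (use assms in simp_all)
  then show ?thesis by simp
qed

text \<open>The commutation axiom at \<open>\<mu>\<close> becomes one equation: the column \<open>E\<close> and the row \<open>F\<close> factor the known
  matrix.\<close>

lemma X2_at_iff:
  assumes "ops_at M \<mu>" "ops_above M \<mu>" "\<mu> \<in> wl" "finite_above M \<mu>"
  shows "X2_at M \<mu> \<longleftrightarrow> (\<forall>x\<in>carrier (wt_delta D M \<mu>). E_col D M \<mu> (F_row D M \<mu> x) = EF_map M \<mu> x)"
proof
  let ?s = "dsingle (delta_wt M \<mu>) (delta_index D)"
  assume X: "X2_at M \<mu>"
  show "\<forall>x\<in>carrier (wt_delta D M \<mu>). E_col D M \<mu> (F_row D M \<mu> x) = EF_map M \<mu> x"
  proof
    fix f assume f: "f \<in> carrier (wt_delta D M \<mu>)"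
    show "E_col D M \<mu> (F_row D M \<mu> f) = EF_map M \<mu> f"
    proof (rule dsum_hom_ext[where I = "delta_index D" and M = "delta_wt M \<mu>" and N = "wt_delta D M \<mu>"
          and g = "\<lambda>x. E_col D M \<mu> (F_row D M \<mu> x)" and h = "EF_map M \<mu>" and f = f])
      show "module A (delta_wt M \<mu> i)" if "i \<in> delta_index D" for i by (rule delta_wt_module[OF assms(2,3) that])
      show "module A (wt_delta D M \<mu>)" by (rule module_wt_delta[OF assms(2,3)])
      show "(\<lambda>x. E_col D M \<mu> (F_row D M \<mu> x)) \<in> Hom (dsum_module (delta_index D) (delta_wt M \<mu>)) (wt_delta D M \<mu>)"
        using hom_comp[OF F_row_hom[OF assms(1-3)] E_col_hom[OF assms(1,4)]] by (simp add: wt_delta_eq)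
      show "EF_map M \<mu> \<in> Hom (dsum_module (delta_index D) (delta_wt M \<mu>)) (wt_delta D M \<mu>)"
        using EF_map_hom[OF assms(2-4)] by (simp add: wt_delta_eq)
      show "f \<in> carrier (dsum_module (delta_index D) (delta_wt M \<mu>))" using f by (simp add: wt_delta_eq)
      fix i x assume i: "i \<in> delta_index D" and x: "x \<in> carrier (delta_wt M \<mu> i)"
      obtain \<beta> n where bn: "i = (\<beta>, n)" "\<beta> \<in> simple D" "n > 0" using i by (cases i) auto
      have x': "x \<in> carrier (wt M (shift \<mu> \<beta> n))" using x bn by simp
      have "E_col D M \<mu> (opF M \<mu> \<beta> n x) = (\<lambda>(\<alpha>, m)\<in>delta_index D. EF_entry M \<mu> \<alpha> m \<beta> n x)"
        using X bn x' unfolding E_col_def X2_at_def by (auto simp: fun_eq_iff)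
      then show "E_col D M \<mu> (F_row D M \<mu> (?s i x)) = EF_map M \<mu> (?s i x)"
        unfolding bn(1) F_row_single[OF assms(1-3) bn(2,3) x'] EF_map_single[OF assms(2-4) bn(2,3) x'] .
    qed
  qed
next
  let ?s = "dsingle (delta_wt M \<mu>) (delta_index D)"
  assume E: "\<forall>x\<in>carrier (wt_delta D M \<mu>). E_col D M \<mu> (F_row D M \<mu> x) = EF_map M \<mu> x"
  show "X2_at M \<mu>"
    unfolding X2_at_def
  proof (intro ballI allI impI)
    fix \<alpha> \<beta> x and m n :: nat
    assume a: "\<alpha> \<in> simple D" "\<beta> \<in> simple D" "0 < m" "0 < n" "x \<in> carrier (wt M (shift \<mu> \<beta> n))"
    have "dsingle (delta_wt M \<mu>) (delta_index D) (\<beta>, n) \<in> Hom (delta_wt M \<mu> (\<beta>, n)) (dsum_module (delta_index D) (delta_wt M \<mu>))"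
      by (rule dsingle_hom) (use a delta_wt_module[OF assms(2,3)] in auto)
    from hom_closed[OF this, of x] have "?s (\<beta>, n) x \<in> carrier (wt_delta D M \<mu>)" using a by (simp add: wt_delta_eq)
    from bspec[OF E this] have "E_col D M \<mu> (opF M \<mu> \<beta> n x) = (\<lambda>(\<alpha>, m)\<in>delta_index D. EF_entry M \<mu> \<alpha> m \<beta> n x)"
      by (simp only: F_row_single[OF assms(1-3) a(2,4,5)] EF_map_single[OF assms(2-4) a(2,4,5)])
    from fun_cong[OF this, of "(\<alpha>, m)"]
    show "opE M \<mu> \<alpha> m (opF M \<mu> \<beta> n x) = EF_entry M \<mu> \<alpha> m \<beta> n x"
      using a by (simp add: E_col_def)
  qed
qed

end

context graded_category
begin

text \<open>The local form of maximality at \<open>\<mu>\<close>, together with the multiplicity.\<close>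

definition good_at :: "('v, 'a, 'm) xobj => 'v => nat => bool" where
  "good_at M \<mu> c \<longleftrightarrow> ops_at M \<mu> \<and> finite_above M \<mu> \<and> X2_at M \<mu> \<and>
     corner (wt M \<mu>) (wt_delta D M \<mu>) (E_col D M \<mu>) (F_row D M \<mu>) c"

lemma graded_with_ops_iff: "graded_with_ops A D M \<longleftrightarrow> (\<forall>\<mu>\<in>wl. ops_at M \<mu>)"
  by (simp add: graded_with_ops_def ops_at_def)

lemma weights_iff: "\<mu> \<in> weights D M \<longleftrightarrow> \<mu> \<in> wl \<and> \<not> trivial (wt M \<mu>)"
  by (simp add: weights_def)

lemma quasi_bounded_finite_above:
  assumes "quasi_bounded D (weights D M)" "\<mu> \<in> wl"
  shows "finite_above M \<mu>"
proof -
  have "{(\<alpha>, n) \<in> delta_index D. \<not> trivial (wt M (shift \<mu> \<alpha> n))}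
      = {(\<alpha>, n) \<in> delta_index D. shift \<mu> \<alpha> n \<in> weights D M}"
    using wl_shift[OF assms(2)] by (auto simp: weights_iff)
  then show ?thesis using finite_shifts[OF assms] by (simp add: finite_above_def)
qed

lemma im_F_eq: "im_F D M \<mu> = F_row D M \<mu> ` carrier (wt_delta D M \<mu>)"
  by (simp add: im_F_def)

lemma M_braces_max_eq:
  "M_braces_max A D M \<mu> = tors_closure (wt_delta D M \<mu>) (E_col D M \<mu> ` F_row D M \<mu> ` carrier (wt_delta D M \<mu>))"
  by (simp add: M_braces_max_def M_braces_def im_F_def tors_closure_def)

text \<open>Freeness of \<open>M\<^sub>\<mu> / im F\<close> provides a basis, which can be adapted to the kernel of \<open>E\<close>; the other
  conditions are those of a corner.\<close>

lemma maximal_object_imp_good: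
  assumes M: "maximal_object A \<phi> D M" and \<mu>: "\<mu> \<in> wl"
  shows "\<exists>c. good_at M \<mu> c"
proof -
  have X: "X_object A \<phi> D M" and ang: "M_angle D M \<mu> = M_braces_max A D M \<mu>"
    using M \<mu> by (auto simp: maximal_object_def)
  have ops: "ops_at M \<nu>" if "\<nu> \<in> wl" for \<nu> using X that by (simp add: X_object_def graded_with_ops_iff)
  have above: "ops_above M \<mu>" using ops by (simp add: ops_above_def)
  have qb: "quasi_bounded D (weights D M)" and fg: "fin_gen_module A (wt M \<mu>)"
    using X \<mu> by (auto simp: X_object_def axiom_X1_def)
  have fin: "finite_above M \<mu>" by (rule quasi_bounded_finite_above[OF qb \<mu>])
  have X2: "X2_at M \<mu>" using X \<mu> by (simp add: X_object_def axiom_X2_iff)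
  have inj: "inj_on (E_col D M \<mu>) (im_F D M \<mu>)" and free: "free_module A (quot_module (wt M \<mu>) (im_F D M \<mu>))"
    using X \<mu> by (auto simp: X_object_def axiom_X3_def)
  note N = ops_atD(1)[OF ops[OF \<mu>]]
  note \<Delta> = module_wt_delta[OF above \<mu>] and E = E_col_hom[OF ops[OF \<mu>] fin] and F = F_row_hom[OF ops[OF \<mu>] above \<mu>]
  have fgN: "fin_gen (wt M \<mu>) (carrier (wt M \<mu>))" using fg fin_gen_module_iff[OF N] by simp
  have U: "submodule (im_F D M \<mu>) A (wt M \<mu>)"
    unfolding im_F_eq by (rule submod_image[OF F \<Delta> N submod_carrier[OF \<Delta>]])
  have 1: "F_row D M \<mu> x = \<zero>\<^bsub>wt M \<mu>\<^esub>" if x: "x \<in> carrier (wt_delta D M \<mu>)" and 0: "E_col D M \<mu> (F_row D M \<mu> x) = \<zero>\<^bsub>wt_delta D M \<mu>\<^esub>" for x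
  proof (rule inj_onD[OF inj])
    show "E_col D M \<mu> (F_row D M \<mu> x) = E_col D M \<mu> \<zero>\<^bsub>wt M \<mu>\<^esub>" using 0 hom_zero[OF E N \<Delta>] by simp
    show "F_row D M \<mu> x \<in> im_F D M \<mu>" using x by (simp add: im_F_eq)
    show "\<zero>\<^bsub>wt M \<mu>\<^esub> \<in> im_F D M \<mu>" by (rule submod_zero[OF U N])
  qed
  obtain I p b where "finite I" "p \<in> Hom (wt M \<mu>) (free_mod (I :: 'b set set))"
    "\<And>x. x \<in> carrier (wt M \<mu>) ==> p x = \<zero>\<^bsub>free_mod I\<^esub> \<longleftrightarrow> x \<in> im_F D M \<mu>"
    "\<And>i. i \<in> I ==> b i \<in> carrier (wt M \<mu>) \<and> p (b i) = unit_vec I i"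
    using free_quotient_coordinates[OF N U fgN one_not_zero free] by blast
  from adapted_basis_exists[OF N this, of "mod_ker (wt M \<mu>) (wt_delta D M \<mu>) (E_col D M \<mu>)"]
  obtain C p b where "adapted_basis (wt M \<mu>) (im_F D M \<mu>) (mod_ker (wt M \<mu>) (wt_delta D M \<mu>) (E_col D M \<mu>)) I C p b"
    by (auto simp: mod_ker_def)
  from adapted_basis_reindex[OF this]
  have "corner (wt M \<mu>) (wt_delta D M \<mu>) (E_col D M \<mu>) (F_row D M \<mu>) (card C)"
    unfolding corner_def im_F_eq using N \<Delta> E F fgN 1 ang by (simp add: M_angle_def M_braces_max_eq)
  then show ?thesis unfolding good_at_def using ops[OF \<mu>] fin X2 by blast
qed

lemma good_imp_maximal_object:
  assumes qb: "quasi_bounded D (weights D M)" and good: "\<And>\<mu>. \<mu> \<in> wl ==> \<exists>c. good_at M \<mu> c"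
  shows "maximal_object A \<phi> D M"
proof -
  have ops: "ops_at M \<nu>" if "\<nu> \<in> wl" for \<nu> using good[OF that] by (auto simp: good_at_def)
  have X3: "inj_on (E_col D M \<mu>) (im_F D M \<mu>) \<and>
        torsion_module A (quot_module ((wt_delta D M \<mu>)\<lparr>carrier := M_angle D M \<mu>\<rparr>) (M_braces D M \<mu>)) \<and>
        free_module A (quot_module (wt M \<mu>) (im_F D M \<mu>)) \<and> fin_gen_module A (wt M \<mu>) \<and>
        M_angle D M \<mu> = M_braces_max A D M \<mu> \<and> X2_at M \<mu>" if \<mu>: "\<mu> \<in> wl" for \<mu>
  proof -
    obtain c where g: "good_at M \<mu> c" using good[OF \<mu>] by blast
    have cor: "corner (wt M \<mu>) (wt_delta D M \<mu>) (E_col D M \<mu>) (F_row D M \<mu>) c" and X2: "X2_at M \<mu>"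
      using g by (auto simp: good_at_def)
    note C = cornerD[OF cor]
    have U: "submodule (im_F D M \<mu>) A (wt M \<mu>)"
      unfolding im_F_eq by (rule submod_image[OF C(4,2,1) submod_carrier[OF C(2)]])
    have ang: "M_angle D M \<mu> = M_braces_max A D M \<mu>" using C(7) by (simp add: M_angle_def M_braces_max_eq)
    have inj: "inj_on (E_col D M \<mu>) (im_F D M \<mu>)"
    proof (rule inj_onI)
      fix x y assume xy: "x \<in> im_F D M \<mu>" "y \<in> im_F D M \<mu>" "E_col D M \<mu> x = E_col D M \<mu> y"
      obtain v w where vw: "v \<in> carrier (wt_delta D M \<mu>)" "x = F_row D M \<mu> v" "w \<in> carrier (wt_delta D M \<mu>)" "y = F_row D M \<mu> w"
        using xy(1,2) by (auto simp: im_F_eq)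
      let ?d = "v \<ominus>\<^bsub>wt_delta D M \<mu>\<^esub> w"
      have xyN: "x \<in> carrier (wt M \<mu>)" "y \<in> carrier (wt M \<mu>)" using vw hom_closed[OF C(4)] by auto
      have d: "?d \<in> carrier (wt_delta D M \<mu>)" by (rule mod_minus_closed[OF C(2) vw(1,3)])
      have Fd: "F_row D M \<mu> ?d = x \<ominus>\<^bsub>wt M \<mu>\<^esub> y" unfolding vw(2,4) by (rule hom_diff[OF C(4,2,1) vw(1,3)])
      have "E_col D M \<mu> (F_row D M \<mu> ?d) = \<zero>\<^bsub>wt_delta D M \<mu>\<^esub>"
        unfolding Fd using hom_diff[OF C(3,1,2) xyN] xy(3) hom_closed[OF C(3) xyN(2)] C(2) by simp
      from C(6)[OF d this] show "x = y" unfolding Fd using mod_diff_eq_zero_iff[OF C(1) xyN] by simp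
    qed
    have H: "submodule (M_angle D M \<mu>) A (wt_delta D M \<mu>)"
      unfolding M_angle_def by (rule submod_image[OF C(3,1,2) submod_carrier[OF C(1)]])
    have B: "submodule (M_braces D M \<mu>) A (wt_delta D M \<mu>)"
      unfolding M_braces_def by (rule submod_image[OF C(3,1,2) U])
    have BH: "M_braces D M \<mu> \<subseteq> M_angle D M \<mu>"
      unfolding M_braces_def M_angle_def using submod_subset[OF U C(1)] by blast
    have tors: "torsion_module A (quot_module ((wt_delta D M \<mu>)\<lparr>carrier := M_angle D M \<mu>\<rparr>) (M_braces D M \<mu>))"
    proof (rule torsion_quotient[OF C(2) H B BH])
      fix m assume "m \<in> M_angle D M \<mu>"
      then show "\<exists>\<xi>\<in>carrier A. \<xi> \<noteq> \<zero> \<and> \<xi> \<odot>\<^bsub>wt_delta D M \<mu>\<^esub> m \<in> M_braces D M \<mu>"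
        unfolding ang M_braces_max_def by blast
    qed
    obtain I C' p b where ab: "adapted_basis (wt M \<mu>) (im_F D M \<mu>) (mod_ker (wt M \<mu>) (wt_delta D M \<mu>) (E_col D M \<mu>)) (I::nat set) C' p b"
      using C(8) by (auto simp: has_adapted_basis_def im_F_eq)
    note AB = adapted_basisD[OF ab]
    have "free_module A (quot_module (wt M \<mu>) (im_F D M \<mu>))"
      by (rule coordinates_imp_free_quotient[OF C(1) U AB(1) one_not_zero AB(3,4,5,6)])
    moreover have "fin_gen_module A (wt M \<mu>)" using C(5) fin_gen_module_iff[OF C(1)] by simp
    ultimately show ?thesis using inj tors ang X2 by blast
  qed
  have "X_object A \<phi> D M"
    unfolding X_object_def graded_with_ops_iff axiom_X1_def axiom_X2_iff axiom_X3_def using ops qb X3 by blast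
  then show ?thesis unfolding maximal_object_def using X3 by blast
qed

subsection \<open>Isomorphisms\<close>

definition compat_at :: "('v => 'm => 'n) => ('v, 'a, 'm) xobj => ('v, 'a, 'n) xobj => 'v => bool" where
  "compat_at f M N \<mu> \<longleftrightarrow> (\<forall>\<alpha>\<in>simple D. \<forall>n>0.
      (\<forall>x\<in>carrier (wt M \<mu>). f (shift \<mu> \<alpha> n) (opE M \<mu> \<alpha> n x) = opE N \<mu> \<alpha> n (f \<mu> x)) \<and>
      (\<forall>x\<in>carrier (wt M (shift \<mu> \<alpha> n)). f \<mu> (opF M \<mu> \<alpha> n x) = opF N \<mu> \<alpha> n (f (shift \<mu> \<alpha> n) x)))"

definition iso_at :: "('v => 'm => 'n) => ('v, 'a, 'm) xobj => ('v, 'a, 'n) xobj => 'v => bool" where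
  "iso_at f M N \<mu> \<longleftrightarrow> f \<mu> \<in> Hom (wt M \<mu>) (wt N \<mu>) \<and>
     bij_betw (f \<mu>) (carrier (wt M \<mu>)) (carrier (wt N \<mu>)) \<and> compat_at f M N \<mu>"

lemma X_homD:
  assumes "f \<in> X_hom A D M N" "\<mu> \<in> wl"
  shows "f \<mu> \<in> Hom (wt M \<mu>) (wt N \<mu>)" "compat_at f M N \<mu>"
  using assms by (auto simp: X_hom_def compat_at_def PiE_iff)

lemma X_homI:
  assumes ops: "\<And>\<mu>. \<mu> \<in> wl ==> ops_at M \<mu>"
    and f: "\<And>\<mu>. \<mu> \<in> wl ==> f \<mu> \<in> Hom (wt M \<mu>) (wt N \<mu>)" "\<And>\<mu>. \<mu> \<in> wl ==> compat_at f M N \<mu>"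
  shows "(\<lambda>\<mu>\<in>wl. \<lambda>x\<in>carrier (wt M \<mu>). f \<mu> x) \<in> X_hom A D M N"
  unfolding X_hom_def
proof (intro CollectI conjI ballI allI impI)
  let ?f = "\<lambda>\<mu>\<in>wl. \<lambda>x\<in>carrier (wt M \<mu>). f \<mu> x"
  note mods = ops_atD(1)[OF ops]
  show "?f \<in> (\<Pi>\<^sub>E \<mu>\<in>wl. Hom (wt M \<mu>) (wt N \<mu>) \<inter> extensional (carrier (wt M \<mu>)))"
  proof (rule restrict_PiE[THEN iffD2], rule Pi_I, rule IntI)
    fix \<mu> assume \<mu>: "\<mu> \<in> wl"
    show "restrict (f \<mu>) (carrier (wt M \<mu>)) \<in> Hom (wt M \<mu>) (wt N \<mu>)"
      by (rule hom_cong[OF f(1)[OF \<mu>] _ mods[OF \<mu>]]) simp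
  qed simp
  fix \<mu> \<alpha> and n :: nat assume a: "\<mu> \<in> wl" "\<alpha> \<in> simple D" "0 < n"
  note s = wl_shift[OF a(1,2), of n]
  note E = ops_atD(2)[OF ops[OF a(1)] a(2,3)] and F = ops_atD(3)[OF ops[OF a(1)] a(2,3)]
  show "?f (shift \<mu> \<alpha> n) (opE M \<mu> \<alpha> n x) = opE N \<mu> \<alpha> n (?f \<mu> x)" if "x \<in> carrier (wt M \<mu>)" for x
    using that a s hom_closed[OF E that] f(2)[OF a(1)] by (simp add: compat_at_def)
  show "?f \<mu> (opF M \<mu> \<alpha> n x) = opF N \<mu> \<alpha> n (?f (shift \<mu> \<alpha> n) x)" if "x \<in> carrier (wt M (shift \<mu> \<alpha> n))" for x
    using that a s hom_closed[OF F that] f(2)[OF a(1)] by (simp add: compat_at_def)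
qed

lemma X_hom_inverse:
  assumes M: "\<And>\<mu>. \<mu> \<in> wl ==> ops_at M \<mu>" and N: "\<And>\<mu>. \<mu> \<in> wl ==> ops_at N \<mu>"
    and f: "\<And>\<mu>. \<mu> \<in> wl ==> iso_at f M N \<mu>"
  shows "\<exists>f'\<in>X_hom A D M N. \<exists>g\<in>X_hom A D N M. (\<forall>\<mu>\<in>wl. \<forall>x\<in>carrier (wt M \<mu>). f' \<mu> x = f \<mu> x) \<and>
    X_comp D M g f' = X_id D M \<and> X_comp D N f' g = X_id D N"
proof -
  define g where "g \<mu> = inv_into (carrier (wt M \<mu>)) (f \<mu>)" for \<mu>
  have hom: "f \<mu> \<in> Hom (wt M \<mu>) (wt N \<mu>)" and bij: "bij_betw (f \<mu>) (carrier (wt M \<mu>)) (carrier (wt N \<mu>))"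
    and com: "compat_at f M N \<mu>" if "\<mu> \<in> wl" for \<mu> using f[OF that] by (auto simp: iso_at_def)
  note mods = ops_atD(1)[OF M]
  have g: "g \<mu> \<in> Hom (wt N \<mu>) (wt M \<mu>)" if "\<mu> \<in> wl" for \<mu>
    unfolding g_def by (rule hom_inv_into[OF hom[OF that] bij[OF that] mods[OF that]])
  have gf: "g \<mu> (f \<mu> x) = x" if "\<mu> \<in> wl" "x \<in> carrier (wt M \<mu>)" for \<mu> x
    unfolding g_def by (rule bij_betw_inv_into_left[OF bij[OF that(1)] that(2)])
  have fg: "f \<mu> (g \<mu> y) = y" if "\<mu> \<in> wl" "y \<in> carrier (wt N \<mu>)" for \<mu> y
    unfolding g_def by (rule bij_betw_inv_into_right[OF bij[OF that(1)] that(2)])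
  have cg: "compat_at g N M \<mu>" if \<mu>: "\<mu> \<in> wl" for \<mu>
    unfolding compat_at_def
  proof (intro ballI allI impI conjI)
    fix \<alpha> and n :: nat assume a: "\<alpha> \<in> simple D" "0 < n"
    note s = wl_shift[OF \<mu> a(1), of n]
    note E = ops_atD(2)[OF M[OF \<mu>] a] and F = ops_atD(3)[OF M[OF \<mu>] a]
    show "g (shift \<mu> \<alpha> n) (opE N \<mu> \<alpha> n y) = opE M \<mu> \<alpha> n (g \<mu> y)" if y: "y \<in> carrier (wt N \<mu>)" for y
    proof -
      have gy: "g \<mu> y \<in> carrier (wt M \<mu>)" by (rule hom_closed[OF g[OF \<mu>] y])
      have "f (shift \<mu> \<alpha> n) (opE M \<mu> \<alpha> n (g \<mu> y)) = opE N \<mu> \<alpha> n y"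
        using com[OF \<mu>] a gy fg[OF \<mu> y] by (simp add: compat_at_def)
      then show ?thesis using gf[OF s hom_closed[OF E gy]] by simp
    qed
    show "g \<mu> (opF N \<mu> \<alpha> n y) = opF M \<mu> \<alpha> n (g (shift \<mu> \<alpha> n) y)" if y: "y \<in> carrier (wt N (shift \<mu> \<alpha> n))" for y
    proof -
      have gy: "g (shift \<mu> \<alpha> n) y \<in> carrier (wt M (shift \<mu> \<alpha> n))" by (rule hom_closed[OF g[OF s] y])
      have "f \<mu> (opF M \<mu> \<alpha> n (g (shift \<mu> \<alpha> n) y)) = opF N \<mu> \<alpha> n y"
        using com[OF \<mu>] a gy fg[OF s y] by (simp add: compat_at_def)
      then show ?thesis using gf[OF \<mu> hom_closed[OF F gy]] by simp
    qed
  qed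
  let ?f = "\<lambda>\<mu>\<in>wl. \<lambda>x\<in>carrier (wt M \<mu>). f \<mu> x" and ?g = "\<lambda>\<mu>\<in>wl. \<lambda>x\<in>carrier (wt N \<mu>). g \<mu> x"
  show ?thesis
  proof (intro bexI conjI)
    show "?f \<in> X_hom A D M N" by (rule X_homI[OF M hom com])
    show "?g \<in> X_hom A D N M" by (rule X_homI[OF N g cg])
    show "\<forall>\<mu>\<in>wl. \<forall>x\<in>carrier (wt M \<mu>). ?f \<mu> x = f \<mu> x" by simp
    show "X_comp D M ?g ?f = X_id D M"
      unfolding X_comp_def X_id_def using gf hom_closed[OF hom]
      by (intro restrict_ext) (simp add: compose_def restrict_def fun_eq_iff)
    show "X_comp D N ?f ?g = X_id D N"
      unfolding X_comp_def X_id_def using fg hom_closed[OF g]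
      by (intro restrict_ext) (simp add: compose_def restrict_def fun_eq_iff)
  qed
qed

lemma X_isoI:
  assumes "\<And>\<mu>. \<mu> \<in> wl ==> ops_at M \<mu>" "\<And>\<mu>. \<mu> \<in> wl ==> ops_at N \<mu>" "\<And>\<mu>. \<mu> \<in> wl ==> iso_at f M N \<mu>"
  shows "X_iso A D M N"
  using X_hom_inverse[OF assms] unfolding X_iso_def by blast

lemma X_isoD:
  assumes "X_iso A D M N"
  shows "\<exists>f g. f \<in> X_hom A D M N \<and> g \<in> X_hom A D N M \<and> (\<forall>\<mu>\<in>wl. iso_at f M N \<mu>) \<and>
     (\<forall>\<mu>\<in>wl. \<forall>x\<in>carrier (wt M \<mu>). g \<mu> (f \<mu> x) = x) \<and> (\<forall>\<mu>\<in>wl. \<forall>y\<in>carrier (wt N \<mu>). f \<mu> (g \<mu> y) = y)"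
proof -
  obtain f g where f: "f \<in> X_hom A D M N" and g: "g \<in> X_hom A D N M"
    and gf: "X_comp D M g f = X_id D M" and fg: "X_comp D N f g = X_id D N"
    using assms by (auto simp: X_iso_def)
  have 1: "g \<mu> (f \<mu> x) = x" if "\<mu> \<in> wl" "x \<in> carrier (wt M \<mu>)" for \<mu> x
    using fun_cong[OF fun_cong[OF gf, of \<mu>], of x] that by (simp add: X_comp_def X_id_def compose_def)
  have 2: "f \<mu> (g \<mu> y) = y" if "\<mu> \<in> wl" "y \<in> carrier (wt N \<mu>)" for \<mu> y
    using fun_cong[OF fun_cong[OF fg, of \<mu>], of y] that by (simp add: X_comp_def X_id_def compose_def)
  have "iso_at f M N \<mu>" if \<mu>: "\<mu> \<in> wl" for \<mu>
    unfolding iso_at_def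
  proof (intro conjI)
    show "bij_betw (f \<mu>) (carrier (wt M \<mu>)) (carrier (wt N \<mu>))"
      by (rule bij_betw_byWitness[where f' = "g \<mu>"])
        (use 1[OF \<mu>] 2[OF \<mu>] hom_closed[OF X_homD(1)[OF f \<mu>]] hom_closed[OF X_homD(1)[OF g \<mu>]] in auto)
  qed (rule X_homD[OF f \<mu>])+
  then show ?thesis using f g 1 2 by blast
qed

definition delta_map :: "('v => 'm => 'n) => 'v => ('v \<times> nat => 'm) => 'v \<times> nat => 'n" where
  "delta_map f \<mu> = dsum_map (delta_index D) (\<lambda>(\<alpha>, n). f (shift \<mu> \<alpha> n))"

definition hom_above :: "('v => 'm => 'n) => ('v, 'a, 'm) xobj => ('v, 'a, 'n) xobj => 'v => bool" where
  "hom_above f M N \<mu> \<longleftrightarrow> (\<forall>\<nu>\<in>wl. weight_lt \<mu> \<nu> --> f \<nu> \<in> Hom (wt M \<nu>) (wt N \<nu>) \<and> compat_at f M N \<nu>)"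

lemma hom_aboveD:
  assumes "hom_above f M N \<mu>" "\<mu> \<in> wl" "\<alpha> \<in> simple D" "n > 0"
  shows "f (shift \<mu> \<alpha> n) \<in> Hom (wt M (shift \<mu> \<alpha> n)) (wt N (shift \<mu> \<alpha> n))"
    "compat_at f M N (shift \<mu> \<alpha> n)"
  using assms wl_shift weight_lt_shift by (auto simp: hom_above_def)

lemma delta_map_apply: "\<alpha> \<in> simple D ==> n > 0 ==> delta_map f \<mu> x (\<alpha>, n) = f (shift \<mu> \<alpha> n) (x (\<alpha>, n))"
  by (simp add: delta_map_def dsum_map_def)

lemma delta_map_hom:
  assumes "ops_above M \<mu>" "ops_above N \<mu>" "\<mu> \<in> wl" "hom_above f M N \<mu>"
  shows "delta_map f \<mu> \<in> Hom (wt_delta D M \<mu>) (wt_delta D N \<mu>)"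
  unfolding delta_map_def wt_delta_eq
  by (rule dsum_map_hom) (use delta_wt_module[OF assms(1,3)] delta_wt_module[OF assms(2,3)] hom_aboveD[OF assms(4,3)] in auto)

lemma delta_map_single:
  assumes "ops_above M \<mu>" "ops_above N \<mu>" "\<mu> \<in> wl" "hom_above f M N \<mu>" "\<alpha> \<in> simple D" "n > 0"
  shows "delta_map f \<mu> (dsingle (delta_wt M \<mu>) (delta_index D) (\<alpha>, n) x)
    = dsingle (delta_wt N \<mu>) (delta_index D) (\<alpha>, n) (f (shift \<mu> \<alpha> n) x)"
proof -
  have "dsum_map (delta_index D) (\<lambda>(\<alpha>, n). f (shift \<mu> \<alpha> n)) (dsingle (delta_wt M \<mu>) (delta_index D) (\<alpha>, n) x)
    = dsingle (delta_wt N \<mu>) (delta_index D) (\<alpha>, n) ((\<lambda>(\<alpha>, n). f (shift \<mu> \<alpha> n)) (\<alpha>, n) x)"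
    by (rule dsum_map_single) (use delta_wt_module[OF assms(1,3)] delta_wt_module[OF assms(2,3)] hom_aboveD[OF assms(4,3)] assms(5,6) in auto)
  then show ?thesis by (simp add: delta_map_def)
qed

lemma delta_map_bij:
  assumes "ops_above M \<mu>" "ops_above N \<mu>" "\<mu> \<in> wl" "hom_above f M N \<mu>"
    and b: "\<And>\<nu>. \<nu> \<in> wl ==> weight_lt \<mu> \<nu> ==> bij_betw (f \<nu>) (carrier (wt M \<nu>)) (carrier (wt N \<nu>))"
  shows "bij_betw (delta_map f \<mu>) (carrier (wt_delta D M \<mu>)) (carrier (wt_delta D N \<mu>))"
  unfolding delta_map_def wt_delta_eq
  by (rule dsum_map_bij) (use delta_wt_module[OF assms(1,3)] delta_wt_module[OF assms(2,3)] hom_aboveD[OF assms(4,3)]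
      b[OF wl_shift[OF assms(3)] weight_lt_shift] in auto)

lemma actE_nat:
  "compat_at f M N \<nu> ==> \<alpha> \<in> simple D ==> x \<in> carrier (wt M \<nu>) ==> f (shift \<nu> \<alpha> k) (actE M \<nu> \<alpha> k x) = actE N \<nu> \<alpha> k (f \<nu> x)"
  and actF_nat:
  "compat_at f M N \<nu> ==> \<alpha> \<in> simple D ==> y \<in> carrier (wt M (shift \<nu> \<alpha> k)) ==> f \<nu> (actF M \<nu> \<alpha> k y) = actF N \<nu> \<alpha> k (f (shift \<nu> \<alpha> k) y)"
  by (auto simp: actE_def actF_def compat_at_def)

lemma EF_summand_nat:
  assumes M: "ops_above M \<mu>" and \<mu>: "\<mu> \<in> wl" and f: "hom_above f M N \<mu>"
    and a: "\<alpha> \<in> simple D" "\<beta> \<in> simple D" "m > 0" "n > 0"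
    and eq: "shift \<mu> \<beta> n + real m' *\<^sub>R \<alpha> = shift \<mu> \<alpha> m + real n' *\<^sub>R \<beta>"
    and x: "x \<in> carrier (wt M (shift \<mu> \<beta> n))"
  shows "f (shift \<mu> \<alpha> m) (actF M (shift \<mu> \<alpha> m) \<beta> n' (actE M (shift \<mu> \<beta> n) \<alpha> m' x))
    = actF N (shift \<mu> \<alpha> m) \<beta> n' (actE N (shift \<mu> \<beta> n) \<alpha> m' (f (shift \<mu> \<beta> n) x))"
proof -
  let ?y = "actE M (shift \<mu> \<beta> n) \<alpha> m' x"
  have "?y \<in> carrier (wt M (shift \<mu> \<beta> n + real m' *\<^sub>R \<alpha>))"
    by (rule hom_closed[OF actE_hom[OF ops_aboveD[OF M \<mu> a(2,4)] a(1)] x])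
  then have "f (shift \<mu> \<alpha> m) (actF M (shift \<mu> \<alpha> m) \<beta> n' ?y)
      = actF N (shift \<mu> \<alpha> m) \<beta> n' (f (shift \<mu> \<alpha> m + real n' *\<^sub>R \<beta>) ?y)"
    unfolding eq by (rule actF_nat[OF hom_aboveD(2)[OF f \<mu> a(1,3)] a(2)])
  also have "f (shift \<mu> \<alpha> m + real n' *\<^sub>R \<beta>) ?y = actE N (shift \<mu> \<beta> n) \<alpha> m' (f (shift \<mu> \<beta> n) x)"
    unfolding eq[symmetric] by (rule actE_nat[OF hom_aboveD(2)[OF f \<mu> a(2,4)] a(1) x])
  finally show ?thesis .
qed

lemma EF_entry_nat:
  assumes M: "ops_above M \<mu>" and N: "ops_above N \<mu>" and \<mu>: "\<mu> \<in> wl" and f: "hom_above f M N \<mu>"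
    and a: "\<alpha> \<in> simple D" "\<beta> \<in> simple D" "m > 0" "n > 0"
    and x: "x \<in> carrier (wt M (shift \<mu> \<beta> n))"
  shows "f (shift \<mu> \<alpha> m) (EF_entry M \<mu> \<alpha> m \<beta> n x) = EF_entry N \<mu> \<alpha> m \<beta> n (f (shift \<mu> \<beta> n) x)"
proof (cases "\<alpha> = \<beta>")
  case False
  then show ?thesis
    using EF_summand_nat[OF M \<mu> f a, of m n x] x by (simp add: EF_entry_def algebra_simps)
next
  case True
  let ?s = "shift \<mu> \<alpha> m" and ?q = "\<lambda>r. \<phi> (qbinom (dnum D \<alpha>) (\<lfloor>coroot D \<alpha> \<mu>\<rfloor> + int m + int n) r)"
  let ?t = "\<lambda>M r x. actF M ?s \<alpha> (n - r) (actE M (shift \<mu> \<alpha> n) \<alpha> (m - r) x)"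
  have x': "x \<in> carrier (wt M (shift \<mu> \<alpha> n))" using x True by simp
  have mM: "module A (wt M ?s)" and mN: "module A (wt N ?s)"
    using ops_aboveD[OF M \<mu> a(1,3)] ops_aboveD[OF N \<mu> a(1,3)] by (simp_all add: ops_at_def)
  have eq: "shift \<mu> \<alpha> n + real (m - r) *\<^sub>R \<alpha> = ?s + real (n - r) *\<^sub>R \<alpha>" if "r \<in> {0..min m n}" for r
    using that by (simp add: scaleR_add_left[symmetric] add.assoc of_nat_diff del: scaleR_left_distrib)
  have tM: "?t M r x \<in> carrier (wt M ?s)" if r: "r \<in> {0..min m n}" for r
    by (rule hom_closed[OF EF_summand_hom[OF M \<mu> a(1,1,3,4) eq[OF r]] x'])
  note fs = hom_aboveD(1)[OF f \<mu> a(1,3)]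
  have fx: "f (shift \<mu> \<alpha> n) x \<in> carrier (wt N (shift \<mu> \<alpha> n))"
    by (rule hom_closed[OF hom_aboveD(1)[OF f \<mu> a(1,4)] x'])
  have tN: "?t N r (f (shift \<mu> \<alpha> n) x) \<in> carrier (wt N ?s)" if r: "r \<in> {0..min m n}" for r
    by (rule hom_closed[OF EF_summand_hom[OF N \<mu> a(1,1,3,4) eq[OF r]] fx])
  interpret N: abelian_monoid "wt N ?s" using mod_abelian_group[OF mN] by (rule abelian_group.axioms)
  have "f ?s (finsum (wt M ?s) (\<lambda>r. ?q r \<odot>\<^bsub>wt M ?s\<^esub> ?t M r x) {0..min m n})
      = finsum (wt N ?s) (\<lambda>r. f ?s (?q r \<odot>\<^bsub>wt M ?s\<^esub> ?t M r x)) {0..min m n}"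
    by (rule hom_finsum[OF fs mM mN]) (use tM mM \<phi>_closed in simp)
  also have "\<dots> = finsum (wt N ?s) (\<lambda>r. ?q r \<odot>\<^bsub>wt N ?s\<^esub> ?t N r (f (shift \<mu> \<alpha> n) x)) {0..min m n}"
  proof (rule N.finsum_cong')
    show "(\<lambda>r. ?q r \<odot>\<^bsub>wt N ?s\<^esub> ?t N r (f (shift \<mu> \<alpha> n) x)) \<in> {0..min m n} \<rightarrow> carrier (wt N ?s)"
      using tN mN \<phi>_closed by (intro Pi_I) simp
    show "f ?s (?q r \<odot>\<^bsub>wt M ?s\<^esub> ?t M r x) = ?q r \<odot>\<^bsub>wt N ?s\<^esub> ?t N r (f (shift \<mu> \<alpha> n) x)" if r: "r \<in> {0..min m n}" for r
      using hom_smult[OF fs \<phi>_closed tM[OF r]] EF_summand_nat[OF M \<mu> f a(1,1,3,4) eq[OF r] x'] by simp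
  qed simp
  finally show ?thesis unfolding EF_entry_def True[symmetric] by simp
qed

text \<open>The matrix is natural, being built from the operators above \<open>\<mu>\<close>.\<close>

lemma EF_map_nat:
  assumes M: "ops_above M \<mu>" "finite_above M \<mu>" and N: "ops_above N \<mu>" "finite_above N \<mu>" and \<mu>: "\<mu> \<in> wl" and f: "hom_above f M N \<mu>"
    and y: "y \<in> carrier (wt_delta D M \<mu>)"
  shows "delta_map f \<mu> (EF_map M \<mu> y) = EF_map N \<mu> (delta_map f \<mu> y)"
proof -
  note d = delta_map_hom[OF M(1) N(1) \<mu> f] and EM = EF_map_hom[OF M(1) \<mu> M(2)] and EN = EF_map_hom[OF N(1) \<mu> N(2)]
  show ?thesis
  proof (rule dsum_hom_ext[where I = "delta_index D" and M = "delta_wt M \<mu>" and N = "wt_delta D N \<mu>"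
        and g = "\<lambda>y. delta_map f \<mu> (EF_map M \<mu> y)" and h = "\<lambda>y. EF_map N \<mu> (delta_map f \<mu> y)" and f = y])
    show "module A (delta_wt M \<mu> i)" if "i \<in> delta_index D" for i by (rule delta_wt_module[OF M(1) \<mu> that])
    show "module A (wt_delta D N \<mu>)" by (rule module_wt_delta[OF N(1) \<mu>])
    show "(\<lambda>y. delta_map f \<mu> (EF_map M \<mu> y)) \<in> Hom (dsum_module (delta_index D) (delta_wt M \<mu>)) (wt_delta D N \<mu>)"
      using hom_comp[OF EM d] by (simp only: wt_delta_eq[of M])
    show "(\<lambda>y. EF_map N \<mu> (delta_map f \<mu> y)) \<in> Hom (dsum_module (delta_index D) (delta_wt M \<mu>)) (wt_delta D N \<mu>)"
      using hom_comp[OF d EN] by (simp only: wt_delta_eq[of M])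
    show "y \<in> carrier (dsum_module (delta_index D) (delta_wt M \<mu>))" using y by (simp only: wt_delta_eq)
    fix i x assume i: "i \<in> delta_index D" and x: "x \<in> carrier (delta_wt M \<mu> i)"
    obtain \<beta> n where bn: "i = (\<beta>, n)" "\<beta> \<in> simple D" "n > 0" using i by (cases i) auto
    have x': "x \<in> carrier (wt M (shift \<mu> \<beta> n))" using x bn by simp
    have fx: "f (shift \<mu> \<beta> n) x \<in> carrier (wt N (shift \<mu> \<beta> n))"
      by (rule hom_closed[OF hom_aboveD(1)[OF f \<mu> bn(2,3)] x'])
    show "delta_map f \<mu> (EF_map M \<mu> (dsingle (delta_wt M \<mu>) (delta_index D) i x))
        = EF_map N \<mu> (delta_map f \<mu> (dsingle (delta_wt M \<mu>) (delta_index D) i x))"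
      unfolding bn(1) delta_map_single[OF M(1) N(1) \<mu> f bn(2,3)] EF_map_single[OF M(1) \<mu> M(2) bn(2,3) x'] EF_map_single[OF N(1) \<mu> N(2) bn(2,3) fx]
      unfolding delta_map_def dsum_map_def
      by (rule restrict_ext) (use EF_entry_nat[OF M(1) N(1) \<mu> f _ bn(2) _ bn(3) x'] in auto)
  qed
qed

end

context graded_category
begin

lemma compat_at_E_col:
  assumes M: "ops_at M \<mu>" "finite_above M \<mu>" and f: "compat_at f M N \<mu>" and x: "x \<in> carrier (wt M \<mu>)"
  shows "E_col D N \<mu> (f \<mu> x) = delta_map f \<mu> (E_col D M \<mu> x)"
  unfolding delta_map_def dsum_map_def E_col_def
  by (rule restrict_ext) (use f x in \<open>auto simp: compat_at_def\<close>)

lemma compat_at_F_row: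
  assumes M: "ops_at M \<mu>" "ops_above M \<mu>" and N: "ops_at N \<mu>" "ops_above N \<mu>" and \<mu>: "\<mu> \<in> wl"
    and fh: "f \<mu> \<in> Hom (wt M \<mu>) (wt N \<mu>)" and fa: "hom_above f M N \<mu>" and f: "compat_at f M N \<mu>"
    and y: "y \<in> carrier (wt_delta D M \<mu>)"
  shows "f \<mu> (F_row D M \<mu> y) = F_row D N \<mu> (delta_map f \<mu> y)"
proof (rule dsum_hom_ext[where I = "delta_index D" and M = "delta_wt M \<mu>" and N = "wt N \<mu>"
      and g = "\<lambda>y. f \<mu> (F_row D M \<mu> y)" and h = "\<lambda>y. F_row D N \<mu> (delta_map f \<mu> y)" and f = y])
  show "module A (delta_wt M \<mu> i)" if "i \<in> delta_index D" for i by (rule delta_wt_module[OF M(2) \<mu> that])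
  show "module A (wt N \<mu>)" using N(1) by (simp add: ops_at_def)
  show "(\<lambda>y. f \<mu> (F_row D M \<mu> y)) \<in> Hom (dsum_module (delta_index D) (delta_wt M \<mu>)) (wt N \<mu>)"
    using hom_comp[OF F_row_hom[OF M \<mu>] fh] by (simp only: wt_delta_eq[of M])
  show "(\<lambda>y. F_row D N \<mu> (delta_map f \<mu> y)) \<in> Hom (dsum_module (delta_index D) (delta_wt M \<mu>)) (wt N \<mu>)"
    using hom_comp[OF delta_map_hom[OF M(2) N(2) \<mu> fa] F_row_hom[OF N \<mu>]] by (simp only: wt_delta_eq[of M])
  show "y \<in> carrier (dsum_module (delta_index D) (delta_wt M \<mu>))" using y by (simp only: wt_delta_eq)
  fix i x assume i: "i \<in> delta_index D" and x: "x \<in> carrier (delta_wt M \<mu> i)"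
  obtain \<beta> n where bn: "i = (\<beta>, n)" "\<beta> \<in> simple D" "n > 0" using i by (cases i) auto
  have x': "x \<in> carrier (wt M (shift \<mu> \<beta> n))" using x bn by simp
  have fx: "f (shift \<mu> \<beta> n) x \<in> carrier (wt N (shift \<mu> \<beta> n))"
    by (rule hom_closed[OF hom_aboveD(1)[OF fa \<mu> bn(2,3)] x'])
  show "f \<mu> (F_row D M \<mu> (dsingle (delta_wt M \<mu>) (delta_index D) i x))
      = F_row D N \<mu> (delta_map f \<mu> (dsingle (delta_wt M \<mu>) (delta_index D) i x))"
    unfolding bn(1) delta_map_single[OF M(2) N(2) \<mu> fa bn(2,3)] F_row_single[OF M \<mu> bn(2,3) x'] F_row_single[OF N \<mu> bn(2,3) fx]
    using f bn x' by (simp add: compat_at_def)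
qed

lemma compat_atI:
  assumes M: "ops_at M \<mu>" "ops_above M \<mu>" and N: "ops_at N \<mu>" "ops_above N \<mu>" and \<mu>: "\<mu> \<in> wl"
    and fa: "hom_above f M N \<mu>"
    and e: "\<And>x. x \<in> carrier (wt M \<mu>) ==> E_col D N \<mu> (g x) = delta_map f \<mu> (E_col D M \<mu> x)"
    and t: "\<And>y. y \<in> carrier (wt_delta D M \<mu>) ==> g (F_row D M \<mu> y) = F_row D N \<mu> (delta_map f \<mu> y)"
  shows "compat_at (f(\<mu> := g)) M N \<mu>"
  unfolding compat_at_def
proof (intro ballI allI impI conjI)
  fix \<alpha> and n :: nat assume a: "\<alpha> \<in> simple D" "0 < n"
  have ne: "shift \<mu> \<alpha> n \<noteq> \<mu>" using weight_lt_shift[OF a, of \<mu>] by (auto simp: weight_lt_def)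
  show "(f(\<mu> := g)) (shift \<mu> \<alpha> n) (opE M \<mu> \<alpha> n x) = opE N \<mu> \<alpha> n ((f(\<mu> := g)) \<mu> x)" if x: "x \<in> carrier (wt M \<mu>)" for x
    using fun_cong[OF e[OF x], of "(\<alpha>, n)"] ne a by (simp add: E_col_apply delta_map_apply)
  show "(f(\<mu> := g)) \<mu> (opF M \<mu> \<alpha> n x) = opF N \<mu> \<alpha> n ((f(\<mu> := g)) (shift \<mu> \<alpha> n) x)" if x: "x \<in> carrier (wt M (shift \<mu> \<alpha> n))" for x
  proof -
    let ?s = "dsingle (delta_wt M \<mu>) (delta_index D) (\<alpha>, n)"
    have "?s \<in> Hom (delta_wt M \<mu> (\<alpha>, n)) (dsum_module (delta_index D) (delta_wt M \<mu>))"
      by (rule dsingle_hom) (use a delta_wt_module[OF M(2) \<mu>] in auto)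
    from hom_closed[OF this, of x] have s: "?s x \<in> carrier (wt_delta D M \<mu>)" using x by (simp add: wt_delta_eq)
    have fx: "f (shift \<mu> \<alpha> n) x \<in> carrier (wt N (shift \<mu> \<alpha> n))"
      by (rule hom_closed[OF hom_aboveD(1)[OF fa \<mu> a] x])
    have "g (opF M \<mu> \<alpha> n x) = opF N \<mu> \<alpha> n (f (shift \<mu> \<alpha> n) x)"
      using t[OF s] unfolding delta_map_single[OF M(2) N(2) \<mu> fa a] F_row_single[OF M \<mu> a x] F_row_single[OF N \<mu> a fx] .
    then show ?thesis using ne by simp
  qed
qed

lemma good_atD:
  assumes "good_at M \<mu> c"
  shows "ops_at M \<mu>" "finite_above M \<mu>" "X2_at M \<mu>" "corner (wt M \<mu>) (wt_delta D M \<mu>) (E_col D M \<mu>) (F_row D M \<mu>) c"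
  using assms by (auto simp: good_at_def)

lemma good_EF:
  assumes g: "good_at M \<mu> c" and above: "ops_above M \<mu>" and \<mu>: "\<mu> \<in> wl" and y: "y \<in> carrier (wt_delta D M \<mu>)"
  shows "E_col D M \<mu> (F_row D M \<mu> y) = EF_map M \<mu> y"
  using X2_at_iff[OF good_atD(1)[OF g] above \<mu> good_atD(2)[OF g]] good_atD(3)[OF g] y by blast

text \<open>This is the hypothesis under which corners can be compared, and it holds for free: both
  products \<open>E F\<close> are given by the same formula above \<open>\<mu>\<close>.\<close>

lemma delta_map_intertwines:
  assumes gM: "good_at M \<mu> c" and gN: "good_at N \<mu> c'" and M: "ops_above M \<mu>" and N: "ops_above N \<mu>" and \<mu>: "\<mu> \<in> wl"
    and fa: "hom_above f M N \<mu>" and y: "y \<in> carrier (wt_delta D M \<mu>)"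
  shows "delta_map f \<mu> (E_col D M \<mu> (F_row D M \<mu> y)) = E_col D N \<mu> (F_row D N \<mu> (delta_map f \<mu> y))"
  unfolding good_EF[OF gM M \<mu> y] good_EF[OF gN N \<mu> hom_closed[OF delta_map_hom[OF M N \<mu> fa] y]]
  by (rule EF_map_nat[OF M good_atD(2)[OF gM] N good_atD(2)[OF gN] \<mu> fa y])

lemma iso_at_zero_iff:
  assumes M: "ops_at M \<nu>" and N: "ops_at N \<nu>" and f: "iso_at f M N \<nu>"
  shows "trivial (wt M \<nu>) \<longleftrightarrow> trivial (wt N \<nu>)"
proof -
  have mods: "module A (wt M \<nu>)" "module A (wt N \<nu>)" using M N by (auto simp: ops_at_def)
  have fh: "f \<nu> \<in> Hom (wt M \<nu>) (wt N \<nu>)" and fb: "bij_betw (f \<nu>) (carrier (wt M \<nu>)) (carrier (wt N \<nu>))"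
    using f by (auto simp: iso_at_def)
  have im: "f \<nu> ` carrier (wt M \<nu>) = carrier (wt N \<nu>)" and inj: "inj_on (f \<nu>) (carrier (wt M \<nu>))"
    using fb by (auto simp: bij_betw_def)
  have 0: "f \<nu> \<zero>\<^bsub>wt M \<nu>\<^esub> = \<zero>\<^bsub>wt N \<nu>\<^esub>" by (rule hom_zero[OF fh mods])
  show ?thesis
  proof
    assume "trivial (wt M \<nu>)"
    then show "trivial (wt N \<nu>)" using im 0 by simp
  next
    assume z: "trivial (wt N \<nu>)"
    have "x = \<zero>\<^bsub>wt M \<nu>\<^esub>" if x: "x \<in> carrier (wt M \<nu>)" for x
    proof (rule inj_onD[OF inj _ x mod_zero_closed[OF mods(1)]])
      have "f \<nu> x \<in> carrier (wt N \<nu>)" by (rule hom_closed[OF fh x])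
      then show "f \<nu> x = f \<nu> \<zero>\<^bsub>wt M \<nu>\<^esub>" using z 0 by simp
    qed
    then show "trivial (wt M \<nu>)" using mod_zero_closed[OF mods(1)] by blast
  qed
qed

lemma good_iso:
  assumes gM: "\<And>\<mu>. \<mu> \<in> wl ==> good_at M \<mu> (k \<mu>)" and N: "\<And>\<mu>. \<mu> \<in> wl ==> ops_at N \<mu>"
    and f: "\<And>\<mu>. \<mu> \<in> wl ==> iso_at f M N \<mu>" and \<mu>: "\<mu> \<in> wl"
  shows "good_at N \<mu> (k \<mu>)"
proof -
  have M: "ops_at M \<nu>" if "\<nu> \<in> wl" for \<nu> using good_atD(1)[OF gM[OF that]] .
  have aM: "ops_above M \<mu>" and aN: "ops_above N \<mu>" using M N by (simp_all add: ops_above_def)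
  have fa: "hom_above f M N \<mu>" using f by (simp add: hom_above_def iso_at_def)
  have fh: "f \<nu> \<in> Hom (wt M \<nu>) (wt N \<nu>)" and fb: "bij_betw (f \<nu>) (carrier (wt M \<nu>)) (carrier (wt N \<nu>))"
    and fc: "compat_at f M N \<nu>" if "\<nu> \<in> wl" for \<nu> using f[OF that] by (auto simp: iso_at_def)
  have db: "bij_betw (delta_map f \<mu>) (carrier (wt_delta D M \<mu>)) (carrier (wt_delta D N \<mu>))"
    by (rule delta_map_bij[OF aM aN \<mu> fa]) (rule fb)
  note dh = delta_map_hom[OF aM aN \<mu> fa]
  note C = good_atD[OF gM[OF \<mu>]]
  have mods: "module A (wt M \<nu>)" "module A (wt N \<nu>)" if "\<nu> \<in> wl" for \<nu> using M[OF that] N[OF that] by (auto simp: ops_at_def)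
  have zero: "trivial (wt M \<nu>) \<longleftrightarrow> trivial (wt N \<nu>)" if \<nu>: "\<nu> \<in> wl" for \<nu>
    by (rule iso_at_zero_iff[OF M[OF \<nu>] N[OF \<nu>] f[OF \<nu>]])
  have fin: "finite_above N \<mu>"
  proof -
    have "{(\<alpha>, n) \<in> delta_index D. \<not> trivial (wt N (shift \<mu> \<alpha> n))}
      = {(\<alpha>, n) \<in> delta_index D. \<not> trivial (wt M (shift \<mu> \<alpha> n))}"
      using zero[OF wl_shift[OF \<mu>]] by auto
    then show ?thesis using C(2) by (simp add: finite_above_def)
  qed
  note e = compat_at_E_col[OF C(1,2) fc[OF \<mu>]]
  note t = compat_at_F_row[OF C(1) aM N[OF \<mu>] aN \<mu> fh[OF \<mu>] fa fc[OF \<mu>]]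
  note EN = E_col_hom[OF N[OF \<mu>] fin] and FN = F_row_hom[OF N[OF \<mu>] aN \<mu>]
  have cor: "corner (wt N \<mu>) (wt_delta D N \<mu>) (E_col D N \<mu>) (F_row D N \<mu>) (k \<mu>)"
    by (rule corner_iso[where h = "f \<mu>" and k = "delta_map f \<mu>" and \<epsilon>' = "E_col D N \<mu>" and \<theta>' = "F_row D N \<mu>" and \<epsilon> = "E_col D M \<mu>" and \<theta> = "F_row D M \<mu>",
        OF C(4) mods(2)[OF \<mu>] module_wt_delta[OF aN \<mu>] EN FN fh[OF \<mu>] fb[OF \<mu>] dh db e t[symmetric]])
  have "X2_at N \<mu>"
    unfolding X2_at_iff[OF N[OF \<mu>] aN \<mu> fin]
  proof
    fix z assume "z \<in> carrier (wt_delta D N \<mu>)"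
    then have "z \<in> delta_map f \<mu> ` carrier (wt_delta D M \<mu>)" using db by (simp add: bij_betw_def)
    then obtain y where y: "y \<in> carrier (wt_delta D M \<mu>)" "z = delta_map f \<mu> y" by blast
    have Fy: "F_row D M \<mu> y \<in> carrier (wt M \<mu>)" by (rule hom_closed[OF cornerD(4)[OF C(4)] y(1)])
    have "E_col D N \<mu> (F_row D N \<mu> z) = delta_map f \<mu> (E_col D M \<mu> (F_row D M \<mu> y))"
      unfolding y(2) t[OF y(1), symmetric] e[OF Fy] ..
    also have "\<dots> = EF_map N \<mu> z"
      unfolding good_EF[OF gM[OF \<mu>] aM \<mu> y(1)] y(2) by (rule EF_map_nat[OF aM C(2) aN fin \<mu> fa y(1)])
    finally show "E_col D N \<mu> (F_row D N \<mu> z) = EF_map N \<mu> z" .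
  qed
  then show ?thesis unfolding good_at_def using N[OF \<mu>] fin cor by blast
qed

text \<open>All structure is carried along the injections into the new type.\<close>

lemma good_transport:
  fixes M :: "('v, 'a, 'm) xobj" and h :: "'v => 'm => 'n"
  assumes gM: "\<And>\<mu>. \<mu> \<in> wl ==> good_at M \<mu> (k \<mu>)" and h: "\<And>\<mu>. \<mu> \<in> wl ==> inj_on (h \<mu>) (carrier (wt M \<mu>))"
  shows "\<exists>N :: ('v, 'a, 'n) xobj. (\<forall>\<mu>\<in>wl. good_at N \<mu> (k \<mu>)) \<and> weights D N = weights D M"
proof -
  have M: "ops_at M \<nu>" if "\<nu> \<in> wl" for \<nu> using good_atD(1)[OF gM[OF that]] .
  note mods = ops_atD(1)[OF M]
  have "\<forall>\<mu>\<in>wl. \<exists>Q :: ('a, 'n) module. module A Q \<and> h \<mu> \<in> Hom (wt M \<mu>) Q \<and> bij_betw (h \<mu>) (carrier (wt M \<mu>)) (carrier Q)"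
    using module_transport[OF mods h] by blast
  from bchoice[OF this] obtain Q :: "'v => ('a, 'n) module" where Q: "\<And>\<mu>. \<mu> \<in> wl ==> module A (Q \<mu>)"
    "\<And>\<mu>. \<mu> \<in> wl ==> h \<mu> \<in> Hom (wt M \<mu>) (Q \<mu>)"
    "\<And>\<mu>. \<mu> \<in> wl ==> bij_betw (h \<mu>) (carrier (wt M \<mu>)) (carrier (Q \<mu>))" by blast
  define j where "j \<mu> = inv_into (carrier (wt M \<mu>)) (h \<mu>)" for \<mu>
  have j: "j \<mu> \<in> Hom (Q \<mu>) (wt M \<mu>)" if "\<mu> \<in> wl" for \<mu>
    unfolding j_def by (rule hom_inv_into[OF Q(2,3)[OF that] mods[OF that]])
  have jh: "j \<mu> (h \<mu> x) = x" if "\<mu> \<in> wl" "x \<in> carrier (wt M \<mu>)" for \<mu> x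
    unfolding j_def by (rule bij_betw_inv_into_left[OF Q(3)[OF that(1)] that(2)])
  define N where "N = \<lparr>wt = Q, opE = (\<lambda>\<mu> \<alpha> n y. h (shift \<mu> \<alpha> n) (opE M \<mu> \<alpha> n (j \<mu> y))),
     opF = (\<lambda>\<mu> \<alpha> n y. h \<mu> (opF M \<mu> \<alpha> n (j (shift \<mu> \<alpha> n) y)))\<rparr>"
  have N: "ops_at N \<mu>" if \<mu>: "\<mu> \<in> wl" for \<mu>
    unfolding ops_at_def
  proof (intro conjI ballI allI impI)
    show "module A (wt N \<mu>)" using Q(1)[OF \<mu>] by (simp add: N_def)
    fix \<alpha> and n :: nat assume a: "\<alpha> \<in> simple D" "0 < n"
    note s = wl_shift[OF \<mu> a(1), of n]
    note E = ops_atD(2)[OF M[OF \<mu>] a] and F = ops_atD(3)[OF M[OF \<mu>] a]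
    show "opE N \<mu> \<alpha> n \<in> Hom (wt N \<mu>) (wt N (shift \<mu> \<alpha> n))"
      using hom_comp[OF hom_comp[OF j[OF \<mu>] E] Q(2)[OF s]] by (simp add: N_def)
    show "opF N \<mu> \<alpha> n \<in> Hom (wt N (shift \<mu> \<alpha> n)) (wt N \<mu>)"
      using hom_comp[OF hom_comp[OF j[OF s] F] Q(2)[OF \<mu>]] by (simp add: N_def)
  qed
  have iso: "iso_at h M N \<mu>" if \<mu>: "\<mu> \<in> wl" for \<mu>
    unfolding iso_at_def compat_at_def
    using Q(2,3)[OF \<mu>] jh[OF \<mu>] jh[OF wl_shift[OF \<mu>]] by (simp add: N_def)
  have "good_at N \<mu> (k \<mu>)" if "\<mu> \<in> wl" for \<mu> by (rule good_iso[OF gM N iso that])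
  moreover have "\<mu> \<in> weights D N \<longleftrightarrow> \<mu> \<in> weights D M" for \<mu>
    unfolding weights_iff using iso_at_zero_iff[OF M N iso, of \<mu>] by blast
  then have "weights D N = weights D M" by blast
  ultimately show ?thesis by blast
qed

subsection \<open>Uniqueness of objects with given multiplicities\<close>

definition downset :: "'v set => 'v set" where
  "downset W = {\<mu>\<in>wl. \<exists>\<kappa>\<in>W. weight_le D \<mu> \<kappa>}"

text \<open>Below a fixed weight, the greatest height difference to the finitely many weights in \<open>W\<close> above it
  decreases strictly when going up.\<close>

lemma wf_downset:
  assumes W: "quasi_bounded D W"
  shows "wf {(\<nu>, \<mu>). \<mu> \<in> wl \<and> weight_lt \<mu> \<nu> \<and> \<nu> \<in> downset W}"
proof -
  define T where "T \<mu> = (\<lambda>\<kappa>. nat \<lfloor>height \<kappa> - height \<mu>\<rfloor>) ` {\<kappa>\<in>W. weight_le D \<mu> \<kappa>}" for \<mu>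
  have fin: "finite (T \<mu>)" if "\<mu> \<in> wl" for \<mu> using W that by (simp add: T_def quasi_bounded_def)
  have "{(\<nu>, \<mu>). \<mu> \<in> wl \<and> weight_lt \<mu> \<nu> \<and> \<nu> \<in> downset W} \<subseteq> measure (\<lambda>\<mu>. Max (T \<mu>))"
  proof clarify
    fix \<nu> \<mu> assume \<mu>: "\<mu> \<in> wl" and lt: "weight_lt \<mu> \<nu>" and \<nu>: "\<nu> \<in> downset W"
    have \<nu>w: "\<nu> \<in> wl" and ne: "T \<nu> \<noteq> {}" using \<nu> by (auto simp: downset_def T_def)
    have "Max (T \<nu>) \<in> T \<nu>" by (rule Max_in[OF fin[OF \<nu>w] ne])
    then obtain \<kappa> where \<kappa>: "\<kappa> \<in> W" "weight_le D \<nu> \<kappa>" "Max (T \<nu>) = nat \<lfloor>height \<kappa> - height \<nu>\<rfloor>" by (auto simp: T_def)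
    have "weight_le D \<mu> \<kappa>" using weight_lt_le_trans[OF lt \<kappa>(2)] by (simp add: weight_lt_def)
    then have "nat \<lfloor>height \<kappa> - height \<mu>\<rfloor> \<in> T \<mu>" using \<kappa>(1) by (auto simp: T_def)
    then have 1: "nat \<lfloor>height \<kappa> - height \<mu>\<rfloor> \<le> Max (T \<mu>)" by (rule Max_ge[OF fin[OF \<mu>]])
    obtain k :: nat where "height \<kappa> = height \<nu> + real k" using weight_le_height[OF \<kappa>(2)] by blast
    then have "nat \<lfloor>height \<kappa> - height \<nu>\<rfloor> < nat \<lfloor>height \<kappa> - height \<mu>\<rfloor>"
      using weight_lt_height[OF lt] by linarith
    from this 1 have "nat \<lfloor>height \<kappa> - height \<nu>\<rfloor> < Max (T \<mu>)" by (rule less_le_trans)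
    then show "(\<nu>, \<mu>) \<in> measure (\<lambda>\<mu>. Max (T \<mu>))" by (simp only: in_measure \<kappa>(3))
  qed
  then show ?thesis by (rule wf_subset[OF wf_measure])
qed

lemma downset_weights:
  "W \<subseteq> wl ==> \<mu> \<in> W ==> \<mu> \<in> downset W"
  by (auto simp: downset_def intro!: bexI[of _ \<mu>])

lemma downset_mono: "\<mu> \<in> wl ==> weight_le D \<mu> \<nu> ==> \<nu> \<in> downset W ==> \<mu> \<in> downset W"
  using weight_le_trans by (auto simp: downset_def)

text \<open>Isomorphisms at all weights above \<open>\<mu>\<close> induce one of the sums \<open>M\<^sub>\<delta>\<^sub>\<mu>\<close> that intertwines the
  products \<open>E F\<close>, and equality of the multiplicities at \<open>\<mu>\<close> allows it to be extended to \<open>\<mu>\<close>. So the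
  isomorphism is built by well-founded recursion from above.\<close>

lemma iso_exists:
  fixes M :: "('v, 'a, 'm) xobj" and N :: "('v, 'a, 'n) xobj"
  assumes qM: "quasi_bounded D (weights D M)" and qN: "quasi_bounded D (weights D N)"
    and gM: "\<And>\<mu>. \<mu> \<in> wl ==> good_at M \<mu> (k \<mu>)" and gN: "\<And>\<mu>. \<mu> \<in> wl ==> good_at N \<mu> (k \<mu>)"
  shows "X_iso A D M N"
proof -
  let ?W = "weights D M \<union> weights D N"
  let ?d = "downset ?W"
  have "{\<nu> \<in> ?W. weight_le D \<mu> \<nu>} = {\<nu> \<in> weights D M. weight_le D \<mu> \<nu>} \<union> {\<nu> \<in> weights D N. weight_le D \<mu> \<nu>}" for \<mu>
    by blast
  then have qb: "quasi_bounded D ?W" using qM qN by (simp add: quasi_bounded_def)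
  have Wwl: "?W \<subseteq> wl" by (auto simp: weights_def)
  have oM: "ops_at M \<mu>" and oN: "ops_at N \<mu>" if "\<mu> \<in> wl" for \<mu>
    using good_atD(1)[OF gM[OF that]] good_atD(1)[OF gN[OF that]] .
  have aM: "ops_above M \<mu>" and aN: "ops_above N \<mu>" for \<mu> using oM oN by (simp_all add: ops_above_def)
  have zM: "trivial (wt M \<mu>)" and zN: "trivial (wt N \<mu>)" if "\<mu> \<in> wl" "\<mu> \<notin> ?d" for \<mu>
    using downset_weights[OF Wwl, of \<mu>] that by (auto simp: weights_iff)
  define R where "R = {(\<nu>, \<mu>). \<mu> \<in> wl \<and> weight_lt \<mu> \<nu> \<and> \<nu> \<in> ?d}"
  \<comment> \<open>outside the downset both objects vanish, and the zero map is an isomorphism there\<close>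
  define z where "z f = (\<lambda>\<nu>. if \<nu> \<in> ?d then f \<nu> else (\<lambda>x. \<zero>\<^bsub>wt N \<nu>\<^esub>))" for f :: "'v => 'm => 'n"
  define P where "P f \<mu> g \<longleftrightarrow> (\<mu> \<in> ?d --> iso_at ((z f)(\<mu> := g)) M N \<mu>)" for f \<mu> g
  have d_wl: "\<mu> \<in> wl" if "\<mu> \<in> ?d" for \<mu> using that by (simp add: downset_def)
  have upd: "(z f)(\<mu> := f \<mu>) = z f" if "\<mu> \<in> ?d" for f \<mu> using that by (auto simp: z_def)
  have trivial: "iso_at (z f) M N \<mu>" if \<mu>: "\<mu> \<in> wl" "\<mu> \<notin> ?d" for f \<mu>
    unfolding iso_at_def compat_at_def
  proof (intro conjI ballI allI impI)
    note mN = ops_atD(1)[OF oN[OF \<mu>(1)]]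
    have z\<mu>: "z f \<mu> = (\<lambda>x. \<zero>\<^bsub>wt N \<mu>\<^esub>)" using \<mu>(2) by (simp add: z_def)
    show "z f \<mu> \<in> Hom (wt M \<mu>) (wt N \<mu>)" unfolding z\<mu> by (rule hom_const_zero[OF mN])
    show "bij_betw (z f \<mu>) (carrier (wt M \<mu>)) (carrier (wt N \<mu>))"
      unfolding z\<mu> zM[OF \<mu>] zN[OF \<mu>] by (simp add: bij_betw_def)
    fix \<alpha> and n :: nat assume a: "\<alpha> \<in> simple D" "0 < n"
    note s = wl_shift[OF \<mu>(1) a(1), of n]
    have s': "shift \<mu> \<alpha> n \<notin> ?d" using downset_mono[OF \<mu>(1) weight_le_shift[OF a(1)]] \<mu>(2) by blast
    note mNs = ops_atD(1)[OF oN[OF s]]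
    have zs: "z f (shift \<mu> \<alpha> n) = (\<lambda>x. \<zero>\<^bsub>wt N (shift \<mu> \<alpha> n)\<^esub>)" using s' by (simp add: z_def)
    note E = ops_atD(2)[OF oN[OF \<mu>(1)] a] and F = ops_atD(3)[OF oN[OF \<mu>(1)] a]
    show "z f (shift \<mu> \<alpha> n) (opE M \<mu> \<alpha> n x) = opE N \<mu> \<alpha> n (z f \<mu> x)" for x
      unfolding zs z\<mu> using hom_zero[OF E mN mNs] by simp
    show "z f \<mu> (opF M \<mu> \<alpha> n x) = opF N \<mu> \<alpha> n (z f (shift \<mu> \<alpha> n) x)" for x
      unfolding zs z\<mu> using hom_zero[OF F mNs mN] by simp
  qed
  have "\<exists>f. \<forall>\<mu>. P f \<mu> (f \<mu>)"
  proof (rule dependent_wf_choice)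
    show "wf R" unfolding R_def by (rule wf_downset[OF qb])
  next
    fix f g :: "'v => 'm => 'n" and \<mu> r assume fg: "\<And>\<nu>. (\<nu>, \<mu>) \<in> R ==> f \<nu> = g \<nu>"
    show "P f \<mu> r = P g \<mu> r"
    proof (cases "\<mu> \<in> ?d")
      case True
      have "((z f)(\<mu> := r)) (shift \<mu> \<alpha> n) = ((z g)(\<mu> := r)) (shift \<mu> \<alpha> n)" if "\<alpha> \<in> simple D" "n > 0" for \<alpha> n
        using fg[of "shift \<mu> \<alpha> n"] weight_lt_shift[OF that] d_wl[OF True] by (simp add: z_def R_def)
      then show ?thesis by (simp add: P_def iso_at_def compat_at_def)
    qed (simp add: P_def)
  next
    fix \<mu> and f :: "'v => 'm => 'n" assume IH: "\<And>\<nu>. (\<nu>, \<mu>) \<in> R ==> P f \<nu> (f \<nu>)"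
    show "\<exists>r. P f \<mu> r"
    proof (cases "\<mu> \<in> ?d")
      case False
      then show ?thesis by (simp add: P_def)
    next
      case True
      note \<mu> = d_wl[OF True]
      have iso: "iso_at (z f) M N \<nu>" if \<nu>: "\<nu> \<in> wl" "weight_lt \<mu> \<nu>" for \<nu>
      proof (cases "\<nu> \<in> ?d")
        case True
        then have "(\<nu>, \<mu>) \<in> R" using \<mu> \<nu> by (simp add: R_def)
        from IH[OF this] show ?thesis using True upd[OF True] by (simp add: P_def)
      qed (rule trivial[OF \<nu>(1)])
      have fa: "hom_above (z f) M N \<mu>" using iso by (simp add: hom_above_def iso_at_def)
      have fb: "bij_betw (z f \<nu>) (carrier (wt M \<nu>)) (carrier (wt N \<nu>))" if "\<nu> \<in> wl" "weight_lt \<mu> \<nu>" for \<nu>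
        using iso[OF that] by (simp add: iso_at_def)
      have db: "bij_betw (delta_map (z f) \<mu>) (carrier (wt_delta D M \<mu>)) (carrier (wt_delta D N \<mu>))"
        by (rule delta_map_bij[OF aM aN \<mu> fa]) (rule fb)
      obtain g where g: "g \<in> Hom (wt M \<mu>) (wt N \<mu>)" "bij_betw g (carrier (wt M \<mu>)) (carrier (wt N \<mu>))"
        "\<And>x. x \<in> carrier (wt M \<mu>) ==> E_col D N \<mu> (g x) = delta_map (z f) \<mu> (E_col D M \<mu> x)"
        "\<And>y. y \<in> carrier (wt_delta D M \<mu>) ==> g (F_row D M \<mu> y) = F_row D N \<mu> (delta_map (z f) \<mu> y)"
        using corner_extend[where g = "delta_map (z f) \<mu>" and \<epsilon>' = "E_col D N \<mu>" and \<theta>' = "F_row D N \<mu>" and \<epsilon> = "E_col D M \<mu>" and \<theta> = "F_row D M \<mu>",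
          OF good_atD(4)[OF gM[OF \<mu>]] good_atD(4)[OF gN[OF \<mu>]] delta_map_hom[OF aM aN \<mu> fa] db
          delta_map_intertwines[OF gM[OF \<mu>] gN[OF \<mu>] aM aN \<mu> fa]] by blast
      have "compat_at ((z f)(\<mu> := g)) M N \<mu>"
        by (rule compat_atI[OF oM[OF \<mu>] aM oN[OF \<mu>] aN \<mu> fa g(3,4)])
      then show ?thesis using g(1,2) by (intro exI[of _ g]) (simp add: P_def iso_at_def)
    qed
  qed
  then obtain f where f: "\<And>\<mu>. P f \<mu> (f \<mu>)" by blast
  have "iso_at (z f) M N \<mu>" if "\<mu> \<in> wl" for \<mu>
  proof (cases "\<mu> \<in> ?d")
    case True
    then show ?thesis using f[of \<mu>] upd[OF True] by (simp add: P_def)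
  qed (rule trivial[OF that])
  from X_isoI[OF oM oN this] show ?thesis .
qed

end

section \<open>Existence of objects with a single generator\<close>

definition zero_mod :: "('a, 'm) module" where
  "zero_mod = \<lparr>carrier = {undefined}, monoid.mult = undefined, one = undefined,
     ring.zero = undefined, ring.add = (\<lambda>_ _. undefined), module.smult = (\<lambda>_ _. undefined)\<rparr>"

lemma dsum_module_cong: "(\<And>i. i \<in> I ==> M i = N i) ==> dsum_module I M = dsum_module I N"
  unfolding dsum_module_def by (auto simp: fun_eq_iff restrict_def PiE_iff cong: conj_cong)

context graded_category
begin

lemma zero_mod_simps [simp]: "carrier zero_mod = {undefined}" "\<zero>\<^bsub>zero_mod\<^esub> = undefined"
  by (simp_all add: zero_mod_def)

lemma module_zero_mod: "module A zero_mod"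
  by (rule ground_moduleI) (auto simp: zero_mod_def)

lemma fin_gen_zero_mod: "fin_gen (zero_mod :: ('a, 'm) module) (carrier zero_mod)"
proof -
  let ?Z = "zero_mod :: ('a, 'm) module"
  have S: "submodule (mod_span ?Z {}) A ?Z" by (rule submod_mod_span[OF module_zero_mod]) simp
  have "undefined \<in> mod_span ?Z {}" using submod_zero[OF S module_zero_mod] by simp
  moreover have "x = undefined" if "x \<in> mod_span ?Z {}" for x using submod_subset[OF S module_zero_mod that] by simp
  ultimately have "carrier ?Z = mod_span ?Z {}" by auto
  then show ?thesis unfolding fin_gen_def by (intro exI[of _ "{}"] conjI) simp_all
qed

lemma finite_interval: "finite {\<nu>. weight_le D \<mu> \<nu> \<and> weight_le D \<nu> \<kappa>}"
proof (cases "weight_le D \<mu> \<kappa>")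
  case True
  obtain N :: nat where N: "height \<kappa> = height \<mu> + real N" using weight_le_height[OF True] by blast
  define g where "g c = \<mu> + (\<Sum>\<alpha>\<in>simple D. real (c \<alpha>) *\<^sub>R \<alpha>)" for c :: "'v => nat"
  have "{\<nu>. weight_le D \<mu> \<nu> \<and> weight_le D \<nu> \<kappa>} \<subseteq> g ` (\<Pi>\<^sub>E \<alpha>\<in>simple D. {..N})"
  proof clarify
    fix \<nu> assume \<nu>: "weight_le D \<mu> \<nu>" "weight_le D \<nu> \<kappa>"
    obtain c :: "'v => nat" where c: "\<nu> - \<mu> = (\<Sum>\<alpha>\<in>simple D. real (c \<alpha>) *\<^sub>R \<alpha>)"
      using \<nu>(1) by (auto simp: weight_le_def)
    have "height (\<nu> - \<mu>) = (\<Sum>\<alpha>\<in>simple D. real (c \<alpha>) * height \<alpha>)"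
      unfolding c using height(1) by (simp add: linear_sum linear_scale)
    also have "\<dots> = real (\<Sum>\<alpha>\<in>simple D. c \<alpha>)" using height(2) by simp
    finally have h: "height \<nu> = height \<mu> + real (\<Sum>\<alpha>\<in>simple D. c \<alpha>)" using height(1) by (simp add: linear_diff)
    obtain k :: nat where "height \<kappa> = height \<nu> + real k" using weight_le_height[OF \<nu>(2)] by blast
    then have "real (\<Sum>\<alpha>\<in>simple D. c \<alpha>) \<le> real N" using h N by linarith
    then have le: "(\<Sum>\<alpha>\<in>simple D. c \<alpha>) \<le> N" by (simp only: of_nat_le_iff)
    have "c \<alpha> \<le> N" if "\<alpha> \<in> simple D" for \<alpha>
      using member_le_sum[OF that, of c] finite_simple le by simp
    then have "restrict c (simple D) \<in> (\<Pi>\<^sub>E \<alpha>\<in>simple D. {..N})" by auto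
    moreover have "\<nu> = g (restrict c (simple D))"
    proof -
      have "(\<Sum>\<alpha>\<in>simple D. real (restrict c (simple D) \<alpha>) *\<^sub>R \<alpha>) = \<nu> - \<mu>"
        unfolding c by (rule sum.cong) simp_all
      then show ?thesis by (simp add: g_def)
    qed
    ultimately show "\<nu> \<in> g ` (\<Pi>\<^sub>E \<alpha>\<in>simple D. {..N})" by blast
  qed
  moreover have "finite (g ` (\<Pi>\<^sub>E \<alpha>\<in>simple D. {..N}))"
    using finite_simple by (intro finite_imageI finite_PiE) simp_all
  ultimately show ?thesis by (rule finite_subset)
next
  case False
  then have e: "{\<nu>. weight_le D \<mu> \<nu> \<and> weight_le D \<nu> \<kappa>} = {}" using weight_le_trans by blast
  show ?thesis unfolding e by (rule finite.emptyI)
qed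

lemma weight_lt_irrefl: "weight_lt \<mu> \<nu> ==> \<not> weight_le D \<nu> \<mu>"
proof
  assume *: "weight_lt \<mu> \<nu>" "weight_le D \<nu> \<mu>"
  obtain k :: nat where "height \<mu> = height \<nu> + real k" using weight_le_height[OF *(2)] by blast
  then show False using weight_lt_height[OF *(1)] by simp
qed

definition agree_at :: "('v, 'a, 'm) xobj => ('v, 'a, 'm) xobj => 'v => bool" where
  "agree_at M N \<nu> \<longleftrightarrow> wt M \<nu> = wt N \<nu> \<and> opE M \<nu> = opE N \<nu> \<and> opF M \<nu> = opF N \<nu>"

lemma ops_at_cong:
  assumes "agree_at M N \<mu>" "\<And>\<alpha> n. \<alpha> \<in> simple D ==> n > 0 ==> wt M (shift \<mu> \<alpha> n) = wt N (shift \<mu> \<alpha> n)"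
  shows "ops_at M \<mu> = ops_at N \<mu>"
  unfolding ops_at_def using assms by (simp add: agree_at_def)

text \<open>Goodness at \<open>\<mu>\<close> does not see the weights that are not above \<open>\<mu>\<close>; hence later steps of a recursion
  from above do not destroy earlier ones.\<close>

lemma good_at_cong:
  assumes agree: "\<And>\<nu>. weight_le D \<mu> \<nu> ==> agree_at M N \<nu>"
  shows "good_at M \<mu> c = good_at N \<mu> c"
proof -
  have a: "agree_at M N \<mu>" using agree by simp
  have s: "wt M (shift \<mu> \<alpha> n) = wt N (shift \<mu> \<alpha> n)" "opE M (shift \<mu> \<alpha> n) = opE N (shift \<mu> \<alpha> n)"
    "opF M (shift \<mu> \<alpha> n) = opF N (shift \<mu> \<alpha> n)" if "\<alpha> \<in> simple D" for \<alpha> n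
    using agree[OF weight_le_shift[OF that]] by (auto simp: agree_at_def)
  have 1: "ops_at M \<mu> = ops_at N \<mu>" by (rule ops_at_cong[OF a s(1)])
  have 2: "finite_above M \<mu> = finite_above N \<mu>"
    unfolding finite_above_def by (rule arg_cong[of _ _ finite]) (auto simp: s)
  have "EF_entry M \<mu> \<alpha> m \<beta> n x = EF_entry N \<mu> \<alpha> m \<beta> n x" if "\<alpha> \<in> simple D" "\<beta> \<in> simple D" for \<alpha> \<beta> m n x
  proof -
    have sE: "actE M (shift \<mu> \<alpha> n) = actE N (shift \<mu> \<alpha> n)" and sF: "actF M (shift \<mu> \<alpha> n) = actF N (shift \<mu> \<alpha> n)"
      if "\<alpha> \<in> simple D" for \<alpha> n
      by (simp_all only: actE_def[abs_def] actF_def[abs_def] s[OF that])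
    show ?thesis unfolding EF_entry_def sE[OF that(1)] sE[OF that(2)] sF[OF that(1)] s(1)[OF that(1)] ..
  qed
  then have 3: "X2_at M \<mu> = X2_at N \<mu>"
    unfolding X2_at_def using a s by (simp add: agree_at_def)
  have 4: "wt_delta D M \<mu> = wt_delta D N \<mu>"
    unfolding wt_delta_eq by (rule dsum_module_cong) (auto simp: delta_wt_def delta_index_def s)
  have 5: "E_col D M \<mu> = E_col D N \<mu>" using a by (simp add: E_col_def agree_at_def fun_eq_iff)
  have "{(\<alpha>, n) \<in> delta_index D. f (\<alpha>, n) \<noteq> \<zero>\<^bsub>wt M (shift \<mu> \<alpha> n)\<^esub>} = {(\<alpha>, n) \<in> delta_index D. f (\<alpha>, n) \<noteq> \<zero>\<^bsub>wt N (shift \<mu> \<alpha> n)\<^esub>}" for f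
    by (auto simp: s)
  then have 6: "F_row D M \<mu> = F_row D N \<mu>" using a by (simp add: F_row_def agree_at_def fun_eq_iff)
  show ?thesis unfolding good_at_def 1 2 3 4 5 6 using a by (simp add: agree_at_def)
qed

lemma corner_top:
  assumes N: "module A N" and \<Delta>: "module A \<Delta>" "trivial \<Delta>"
    and e: "\<epsilon> \<in> Hom N \<Delta>" and t: "\<theta> \<in> Hom \<Delta> N" and I: "finite I"
    and k: "k \<in> Hom (free_mod I) N" "bij_betw k (carrier (free_mod I)) (carrier N)"
  shows "corner N \<Delta> \<epsilon> \<theta> (card I)"
proof -
  obtain p where p: "p \<in> Hom N (free_mod I)" "bij_betw p (carrier N) (carrier (free_mod I))"
    "\<And>x. x \<in> carrier (free_mod I) ==> p (k x) = x" "\<And>y. y \<in> carrier N ==> k (p y) = y"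
    using mod_iso_inverse[OF k module_free_mod] by blast
  have t0: "\<theta> \<zero>\<^bsub>\<Delta>\<^esub> = \<zero>\<^bsub>N\<^esub>" by (rule hom_zero[OF t \<Delta>(1) N])
  have e0: "\<epsilon> x = \<zero>\<^bsub>\<Delta>\<^esub>" if "x \<in> carrier N" for x using hom_closed[OF e that] \<Delta>(2) by simp
  have im: "\<theta> ` carrier \<Delta> = {\<zero>\<^bsub>N\<^esub>}" using t0 by (simp add: \<Delta>(2))
  have ab: "adapted_basis N (\<theta> ` carrier \<Delta>) (mod_ker N \<Delta> \<epsilon>) I I p (\<lambda>i. k (unit_vec I i))"
    unfolding adapted_basis_def
  proof (intro conjI ballI)
    show "finite I" "I \<subseteq> I" "p \<in> Hom N (free_mod I)" using I p(1) by simp_all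
    fix x assume x: "x \<in> carrier N"
    have "p x = p \<zero>\<^bsub>N\<^esub> \<longleftrightarrow> x = \<zero>\<^bsub>N\<^esub>"
      using inj_on_eq_iff[OF bij_betw_imp_inj_on[OF p(2)] x mod_zero_closed[OF N]] .
    then show "p x = \<zero>\<^bsub>free_mod I\<^esub> \<longleftrightarrow> x \<in> \<theta> ` carrier \<Delta>"
      unfolding im using hom_zero[OF p(1) N module_free_mod] by simp
  next
    fix i assume i: "i \<in> I"
    show ki: "k (unit_vec I i) \<in> carrier N" by (rule hom_closed[OF k(1) unit_vec_closed[OF i]])
    show "p (k (unit_vec I i)) = unit_vec I i" by (rule p(3)[OF unit_vec_closed[OF i]])
    show "k (unit_vec I i) \<in> mod_ker N \<Delta> \<epsilon>" using ki e0[OF ki] by (simp add: mod_ker_def)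
  qed simp
  have "\<epsilon> ` carrier N = {\<zero>\<^bsub>\<Delta>\<^esub>}" using e0 mod_zero_closed[OF N] by (auto intro!: image_eqI)
  moreover have "tors_closure \<Delta> (\<epsilon> ` \<theta> ` carrier \<Delta>) = {\<zero>\<^bsub>\<Delta>\<^esub>}"
  proof -
    have "\<epsilon> ` \<theta> ` carrier \<Delta> = {\<zero>\<^bsub>\<Delta>\<^esub>}" unfolding im using e0[OF mod_zero_closed[OF N]] by simp
    moreover have "\<one> \<odot>\<^bsub>\<Delta>\<^esub> \<zero>\<^bsub>\<Delta>\<^esub> = \<zero>\<^bsub>\<Delta>\<^esub>" using \<Delta>(1) by simp
    ultimately show ?thesis unfolding tors_closure_def \<Delta>(2) using one_closed one_not_zero by blast
  qed
  moreover have "k ` carrier (free_mod I) = carrier N" using k(2) by (simp add: bij_betw_def)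
  then have "fin_gen N (carrier N)" using fin_gen_image[OF k(1) module_free_mod N fin_gen_free_mod[OF I]] by simp
  ultimately show ?thesis
    unfolding corner_def using N \<Delta> e t t0 adapted_basis_reindex[OF ab] by simp
qed

lemma wt_delta_zero:
  assumes M: "ops_above M \<mu>" and \<mu>: "\<mu> \<in> wl" and z: "\<And>\<alpha> n. \<alpha> \<in> simple D ==> n > 0 ==> trivial (wt M (shift \<mu> \<alpha> n))"
  shows "trivial (wt_delta D M \<mu>)"
proof -
  note \<Delta> = module_wt_delta[OF M \<mu>]
  have D0: "x = \<zero>\<^bsub>wt_delta D M \<mu>\<^esub>" if x: "x \<in> carrier (wt_delta D M \<mu>)" for x
    unfolding wt_delta_eq
  proof (rule dsum_eqI)
    show "x \<in> carrier (dsum_module (delta_index D) (delta_wt M \<mu>))" using x by (simp only: wt_delta_eq)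
    show "\<zero>\<^bsub>dsum_module (delta_index D) (delta_wt M \<mu>)\<^esub> \<in> carrier (dsum_module (delta_index D) (delta_wt M \<mu>))"
      using mod_zero_closed[OF \<Delta>] by (simp only: wt_delta_eq)
    fix i assume i: "i \<in> delta_index D"
    have "x i \<in> carrier (delta_wt M \<mu> i)" using dsum_component[OF _ i] x by (simp only: wt_delta_eq)
    moreover have "trivial (delta_wt M \<mu> i)" using i z by (cases i) simp
    ultimately show "x i = \<zero>\<^bsub>dsum_module (delta_index D) (delta_wt M \<mu>)\<^esub> i" using i by (simp add: dsum_simps(2))
  qed
  then show ?thesis using mod_zero_closed[OF \<Delta>] by blast
qed

text \<open>At a weight with nothing above it, a corner is just a free module, its rank being the
  multiplicity.\<close>

lemma good_top:
  assumes \<mu>: "\<mu> \<in> wl" and M: "ops_at M \<mu>" "ops_above M \<mu>"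
    and z: "\<And>\<alpha> n. \<alpha> \<in> simple D ==> n > 0 ==> trivial (wt M (shift \<mu> \<alpha> n))"
    and I: "finite I" and k: "k \<in> Hom (free_mod I) (wt M \<mu>)" "bij_betw k (carrier (free_mod I)) (carrier (wt M \<mu>))"
  shows "good_at M \<mu> (card I)"
proof -
  have "{(\<alpha>, n) \<in> delta_index D. \<not> trivial (wt M (shift \<mu> \<alpha> n))} = {}"
    using z by auto
  then have fin: "finite_above M \<mu>" unfolding finite_above_def by (simp only: finite.emptyI)
  note N = ops_atD(1)[OF M(1)]
  note \<Delta> = module_wt_delta[OF M(2) \<mu>]
  have Dz: "trivial (wt_delta D M \<mu>)" by (rule wt_delta_zero[OF M(2) \<mu> z])
  note E = E_col_hom[OF M(1) fin] and F = F_row_hom[OF M \<mu>] and EF = EF_map_hom[OF M(2) \<mu> fin]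
  have "X2_at M \<mu>"
    unfolding X2_at_iff[OF M \<mu> fin] Dz
    using hom_zero[OF EF \<Delta> \<Delta>] hom_zero[OF F \<Delta> N] hom_zero[OF E N \<Delta>] by simp
  then show ?thesis
    unfolding good_at_def using M(1) fin corner_top[OF N \<Delta> Dz E F I k] by blast
qed

text \<open>The matrix of products at \<open>\<mu>\<close> is factored through a corner of multiplicity zero, and the entries of
  the two factors are the operators to be added.\<close>

lemma good_extend:
  fixes M :: "('v, 'a, (nat => 'a) set) xobj"
  assumes \<mu>: "\<mu> \<in> wl" and M: "ops_above M \<mu>" and fin: "finite_above M \<mu>"
    and fg: "\<And>\<nu>. \<nu> \<in> wl ==> weight_lt \<mu> \<nu> ==> fin_gen (wt M \<nu>) (carrier (wt M \<nu>))"
  shows "\<exists>Q e f. good_at (M\<lparr>wt := (wt M)(\<mu> := Q), opE := (opE M)(\<mu> := e), opF := (opF M)(\<mu> := f)\<rparr>) \<mu> 0"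
proof -
  let ?\<Delta> = "wt_delta D M \<mu>" and ?I = "delta_index D"
  note \<Delta> = module_wt_delta[OF M \<mu>] and \<Phi> = EF_map_hom[OF M \<mu> fin]
  have shift_ne: "shift \<mu> \<alpha> n \<noteq> \<mu>" if "\<alpha> \<in> simple D" "n > 0" for \<alpha> n
    using weight_lt_shift[OF that, of \<mu>] by (auto simp: weight_lt_def)
  have fg\<Delta>: "fin_gen ?\<Delta> (carrier ?\<Delta>)"
    unfolding wt_delta_eq
  proof (rule fin_gen_dsum)
    show "module A (delta_wt M \<mu> i)" if "i \<in> ?I" for i by (rule delta_wt_module[OF M \<mu> that])
    have "{i \<in> ?I. \<not> trivial (delta_wt M \<mu> i)}
      = {(\<alpha>, n) \<in> ?I. \<not> trivial (wt M (shift \<mu> \<alpha> n))}" by auto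
    then show "finite {i \<in> ?I. \<not> trivial (delta_wt M \<mu> i)}" using fin by (simp only: finite_above_def)
    show "fin_gen (delta_wt M \<mu> i) (carrier (delta_wt M \<mu> i))" if "i \<in> ?I" for i
      using fg[OF wl_shift[OF \<mu>] weight_lt_shift] that by (cases i) simp
  qed
  obtain Q :: "('a, (nat => 'a) set) module" and \<epsilon> \<theta> where cor: "corner Q ?\<Delta> \<epsilon> \<theta> 0" and et: "\<And>x. x \<in> carrier ?\<Delta> ==> \<epsilon> (\<theta> x) = EF_map M \<mu> x"
    using corner_exists[OF \<Delta> fg\<Delta> \<Phi>] by blast
  note C = cornerD[OF cor]
  define e where "e \<alpha> n x = \<epsilon> x (\<alpha>, n)" for \<alpha> and n :: nat and x
  define f where "f \<alpha> n y = \<theta> (dsingle (delta_wt M \<mu>) ?I (\<alpha>, n) y)" for \<alpha> and n :: nat and y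
  define M' where "M' = M\<lparr>wt := (wt M)(\<mu> := Q), opE := (opE M)(\<mu> := e), opF := (opF M)(\<mu> := f)\<rparr>"
  have at: "wt M' \<mu> = Q" "opE M' \<mu> = e" "opF M' \<mu> = f" by (simp_all add: M'_def)
  have ag: "agree_at M' M \<nu>" if "weight_lt \<mu> \<nu>" for \<nu> using that by (auto simp: M'_def agree_at_def weight_lt_def)
  have ws: "wt M' (shift \<mu> \<alpha> n) = wt M (shift \<mu> \<alpha> n)" if "\<alpha> \<in> simple D" "n > 0" for \<alpha> n
    using shift_ne[OF that] by (simp add: M'_def)
  have dw: "delta_wt M' \<mu> i = delta_wt M \<mu> i" if "i \<in> ?I" for i using that ws by (cases i) simp
  have D': "wt_delta D M' \<mu> = ?\<Delta>" unfolding wt_delta_eq by (rule dsum_module_cong[OF dw])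
  have ds: "dsingle (delta_wt M' \<mu>) ?I i = dsingle (delta_wt M \<mu>) ?I i" for i
    unfolding dsingle_def using dw by (auto simp: restrict_def fun_eq_iff)
  have M'_above: "ops_above M' \<mu>"
    unfolding ops_above_def
  proof (intro ballI impI)
    fix \<nu> assume \<nu>: "\<nu> \<in> wl" "weight_lt \<mu> \<nu>"
    have "ops_at M' \<nu> = ops_at M \<nu>"
    proof (rule ops_at_cong[OF ag[OF \<nu>(2)]])
      show "wt M' (shift \<nu> \<alpha> n) = wt M (shift \<nu> \<alpha> n)" if "\<alpha> \<in> simple D" for \<alpha> n
        using ag[OF weight_lt_le_trans[OF \<nu>(2) weight_le_shift[OF that]]] by (simp add: agree_at_def)
    qed
    then show "ops_at M' \<nu>" using M \<nu> by (simp add: ops_above_def)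
  qed
  have M'_fin: "finite_above M' \<mu>"
  proof -
    have "{(\<alpha>, n) \<in> ?I. \<not> trivial (wt M' (shift \<mu> \<alpha> n))}
      = {(\<alpha>, n) \<in> ?I. \<not> trivial (wt M (shift \<mu> \<alpha> n))}" using ws by auto
    then show ?thesis using fin by (simp only: finite_above_def)
  qed
  have M'_ops: "ops_at M' \<mu>"
    unfolding ops_at_def at
  proof (intro conjI ballI allI impI)
    show "module A Q" by (rule C(1))
    fix \<alpha> and n :: nat assume a: "\<alpha> \<in> simple D" "0 < n"
    have i: "(\<alpha>, n) \<in> ?I" using a by simp
    have "(\<lambda>g. g (\<alpha>, n)) \<in> Hom ?\<Delta> (delta_wt M \<mu> (\<alpha>, n))" unfolding wt_delta_eq by (rule dproj_hom[OF i])
    from hom_comp[OF C(3) this] show "e \<alpha> n \<in> Hom Q (wt M' (shift \<mu> \<alpha> n))"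
      unfolding e_def[abs_def] ws[OF a] by simp
    have "dsingle (delta_wt M \<mu>) ?I (\<alpha>, n) \<in> Hom (delta_wt M \<mu> (\<alpha>, n)) ?\<Delta>"
      unfolding wt_delta_eq by (rule dsingle_hom[OF delta_wt_module[OF M \<mu>] i])
    from hom_comp[OF this C(4)] show "f \<alpha> n \<in> Hom (wt M' (shift \<mu> \<alpha> n)) Q"
      unfolding f_def[abs_def] ws[OF a] by simp
  qed
  note E = E_col_hom[OF M'_ops M'_fin] and F = F_row_hom[OF M'_ops M'_above \<mu>]
  have Eeq: "E_col D M' \<mu> x = \<epsilon> x" if x: "x \<in> carrier Q" for x
  proof (rule dsum_eqI[where I = ?I and M = "delta_wt M \<mu>"])
    show "E_col D M' \<mu> x \<in> carrier (dsum_module ?I (delta_wt M \<mu>))" using hom_closed[OF E, of x] x at D' by (simp add: wt_delta_eq)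
    show "\<epsilon> x \<in> carrier (dsum_module ?I (delta_wt M \<mu>))" using hom_closed[OF C(3) x] by (simp add: wt_delta_eq)
    show "E_col D M' \<mu> x i = \<epsilon> x i" if "i \<in> ?I" for i using that by (cases i) (simp add: E_col_apply at e_def)
  qed
  have Feq: "F_row D M' \<mu> y = \<theta> y" if y: "y \<in> carrier ?\<Delta>" for y
  proof (rule dsum_hom_ext[where I = ?I and M = "delta_wt M \<mu>" and N = Q and g = "F_row D M' \<mu>" and h = \<theta> and f = y])
    show "module A (delta_wt M \<mu> i)" if "i \<in> ?I" for i by (rule delta_wt_module[OF M \<mu> that])
    show "module A Q" by (rule C(1))
    show "F_row D M' \<mu> \<in> Hom (dsum_module ?I (delta_wt M \<mu>)) Q" using F unfolding D' at by (simp only: wt_delta_eq)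
    show "\<theta> \<in> Hom (dsum_module ?I (delta_wt M \<mu>)) Q" using C(4) unfolding wt_delta_eq .
    show "y \<in> carrier (dsum_module ?I (delta_wt M \<mu>))" using y unfolding wt_delta_eq .
    fix i x assume i: "i \<in> ?I" and x: "x \<in> carrier (delta_wt M \<mu> i)"
    obtain \<beta> n where bn: "i = (\<beta>, n)" "\<beta> \<in> simple D" "n > 0" using i by (cases i) auto
    have "x \<in> carrier (wt M' (shift \<mu> \<beta> n))" using x bn ws by simp
    from F_row_single[OF M'_ops M'_above \<mu> bn(2,3) this]
    show "F_row D M' \<mu> (dsingle (delta_wt M \<mu>) ?I i x) = \<theta> (dsingle (delta_wt M \<mu>) ?I i x)"
      unfolding ds at f_def bn(1) .
  qed
  have "corner (wt M' \<mu>) (wt_delta D M' \<mu>) (E_col D M' \<mu>) (F_row D M' \<mu>) 0"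
    unfolding D' at
  proof (rule corner_iso[where h = "\<lambda>x. x" and k = "\<lambda>x. x" and \<epsilon>' = "E_col D M' \<mu>" and \<theta>' = "F_row D M' \<mu>" and \<epsilon> = \<epsilon> and \<theta> = \<theta>,
        OF cor C(1,2) _ _ hom_id _ hom_id])
    show "E_col D M' \<mu> \<in> Hom Q ?\<Delta>" using E unfolding D' at .
    show "F_row D M' \<mu> \<in> Hom ?\<Delta> Q" using F unfolding D' at .
    show "bij_betw (\<lambda>x. x) (carrier Q) (carrier Q)" "bij_betw (\<lambda>x. x) (carrier ?\<Delta>) (carrier ?\<Delta>)" by (simp_all add: bij_betw_def)
    show "E_col D M' \<mu> x = \<epsilon> x" if "x \<in> carrier Q" for x by (rule Eeq[OF that])
    show "F_row D M' \<mu> x = \<theta> x" if "x \<in> carrier ?\<Delta>" for x by (rule Feq[OF that])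
  qed
  moreover have "X2_at M' \<mu>"
    unfolding X2_at_iff[OF M'_ops M'_above \<mu> M'_fin] D'
  proof
    fix y assume y: "y \<in> carrier ?\<Delta>"
    have ha: "hom_above (\<lambda>_ x. x) M M' \<mu>"
      unfolding hom_above_def compat_at_def
    proof (intro ballI impI conjI allI)
      fix \<nu> assume \<nu>: "\<nu> \<in> wl" "weight_lt \<mu> \<nu>"
      show "(\<lambda>x. x) \<in> Hom (wt M \<nu>) (wt M' \<nu>)" using ag[OF \<nu>(2)] hom_id by (simp add: agree_at_def)
    qed (use ag in \<open>simp_all add: agree_at_def\<close>)
    have "delta_map (\<lambda>_ x. x) \<mu> z = z" if z: "z \<in> carrier ?\<Delta>" for z
    proof -
      have "z \<in> extensional ?I" using z by (simp add: wt_delta_eq dsum_simps(1) PiE_iff)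
      then show ?thesis by (simp add: delta_map_def dsum_map_def extensional_restrict case_prod_unfold)
    qed
    then have "EF_map M \<mu> y = EF_map M' \<mu> y"
      using EF_map_nat[OF M fin M'_above M'_fin \<mu> ha y] y hom_closed[OF \<Phi> y] by simp
    moreover have "\<theta> y \<in> carrier Q" by (rule hom_closed[OF C(4) y])
    ultimately show "E_col D M' \<mu> (F_row D M' \<mu> y) = EF_map M' \<mu> y" using Eeq Feq[OF y] et[OF y] by simp
  qed
  ultimately have "good_at M' \<mu> 0" unfolding good_at_def using M'_ops M'_fin by blast
  then show ?thesis unfolding M'_def by blast
qed

text \<open>The weight space at one weight with its operators \<open>E\<close> and \<open>F\<close>, the unit of the recursion.\<close>

type_synonym ('w, 'r) level =
  "('r, (nat => 'r) set) module \<times> ('w => nat => (nat => 'r) set => (nat => 'r) set) \<times> ('w => nat => (nat => 'r) set => (nat => 'r) set)"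

text \<open>A free module of rank one at \<open>\<kappa>\<close> is extended downwards without adding generators; the weight
  spaces at weights not below \<open>\<kappa>\<close> are zero.\<close>

lemma good_exists:
  assumes \<kappa>: "\<kappa> \<in> wl"
  shows "\<exists>S :: ('v, 'a, (nat => 'a) set) xobj. (\<forall>\<mu>\<in>wl. good_at S \<mu> (if \<mu> = \<kappa> then 1 else 0)) \<and>
     quasi_bounded D (weights D S) \<and> (\<forall>\<mu>\<in>weights D S. weight_le D \<mu> \<kappa>)"
proof -
  let ?\<delta> = "\<lambda>\<mu>. if \<mu> = \<kappa> then 1 else 0 :: nat"
  define obj :: "('v => ('v, 'a) level) => ('v, 'a, (nat => 'a) set) xobj"
    where "obj f = \<lparr>wt = (\<lambda>\<mu>. if weight_le D \<mu> \<kappa> then fst (f \<mu>) else zero_mod),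
      opE = (\<lambda>\<mu>. if weight_le D \<mu> \<kappa> then fst (snd (f \<mu>)) else (\<lambda>_ _ _. undefined)),
      opF = (\<lambda>\<mu>. if weight_le D \<mu> \<kappa> then snd (snd (f \<mu>)) else (\<lambda>_ _ _. undefined))\<rparr>" for f
  define R where "R = {(\<nu>, \<mu>). weight_lt \<mu> \<nu> \<and> weight_le D \<nu> \<kappa>}"
  define P where "P f \<mu> r \<longleftrightarrow> (\<mu> \<in> wl \<and> weight_le D \<mu> \<kappa> --> good_at (obj (f(\<mu> := r))) \<mu> (?\<delta> \<mu>))" for f \<mu> r
  have wtz: "wt (obj f) \<nu> = zero_mod" if "\<not> weight_le D \<nu> \<kappa>" for f \<nu> using that by (simp add: obj_def)
  have not_le: "\<not> weight_le D (shift \<nu> \<alpha> n) \<kappa>" if "\<not> weight_le D \<nu> \<kappa>" "\<alpha> \<in> simple D" for \<nu> \<alpha> n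
    using that weight_le_trans[OF weight_le_shift[OF that(2)]] by blast
  have opsz: "ops_at (obj f) \<nu>" if z: "\<not> weight_le D \<nu> \<kappa>" for f \<nu>
    unfolding ops_at_def
  proof (intro conjI ballI allI impI)
    show "module A (wt (obj f) \<nu>)" unfolding wtz[OF z] by (rule module_zero_mod)
    fix \<alpha> and n :: nat assume a: "\<alpha> \<in> simple D" "0 < n"
    show "opE (obj f) \<nu> \<alpha> n \<in> Hom (wt (obj f) \<nu>) (wt (obj f) (shift \<nu> \<alpha> n))"
      "opF (obj f) \<nu> \<alpha> n \<in> Hom (wt (obj f) (shift \<nu> \<alpha> n)) (wt (obj f) \<nu>)"
      unfolding wtz[OF z] wtz[OF not_le[OF z a(1)]] using z by (simp_all add: obj_def mod_hom_def zero_mod_def)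
  qed
  have "\<exists>f. \<forall>\<mu>. P f \<mu> (f \<mu>)"
  proof (rule dependent_wf_choice)
    show "wf R"
    proof (rule wf_subset[OF wf_measure])
      show "R \<subseteq> measure (\<lambda>\<mu>. nat \<lfloor>height \<kappa> - height \<mu>\<rfloor>)"
      proof clarify
        fix \<nu> \<mu> assume "(\<nu>, \<mu>) \<in> R"
        then have lt: "weight_lt \<mu> \<nu>" and le: "weight_le D \<nu> \<kappa>" by (auto simp: R_def)
        obtain k :: nat where "height \<kappa> = height \<nu> + real k" using weight_le_height[OF le] by blast
        then have "nat \<lfloor>height \<kappa> - height \<nu>\<rfloor> < nat \<lfloor>height \<kappa> - height \<mu>\<rfloor>"
          using weight_lt_height[OF lt] by linarith
        then show "(\<nu>, \<mu>) \<in> measure (\<lambda>\<mu>. nat \<lfloor>height \<kappa> - height \<mu>\<rfloor>)" by (simp only: in_measure)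
      qed
    qed
  next
    fix f g :: "'v => ('v, 'a) level"
    fix \<mu> r assume fg: "\<And>\<nu>. (\<nu>, \<mu>) \<in> R ==> f \<nu> = g \<nu>"
    have "agree_at (obj (f(\<mu> := r))) (obj (g(\<mu> := r))) \<nu>" if "weight_le D \<mu> \<nu>" for \<nu>
    proof (cases "weight_le D \<nu> \<kappa> \<and> \<nu> \<noteq> \<mu>")
      case True
      then have "(\<nu>, \<mu>) \<in> R" using that by (auto simp: R_def weight_lt_def)
      from fg[OF this] show ?thesis using True by (simp add: agree_at_def obj_def)
    qed (auto simp: agree_at_def obj_def)
    from good_at_cong[OF this] show "P f \<mu> r = P g \<mu> r" by (simp add: P_def)
  next
    fix \<mu> and f :: "'v => ('v, 'a) level"
    assume IH: "\<And>\<nu>. (\<nu>, \<mu>) \<in> R ==> P f \<nu> (f \<nu>)"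
    show "\<exists>r. P f \<mu> r"
    proof (cases "\<mu> \<in> wl \<and> weight_le D \<mu> \<kappa>")
      case False
      then show ?thesis by (auto simp: P_def)
    next
      case True
      then have \<mu>: "\<mu> \<in> wl" and le: "weight_le D \<mu> \<kappa>" by auto
      show ?thesis
      proof (cases "\<mu> = \<kappa>")
        case True
        let ?F = "free_mod {0::nat}"
        obtain h :: "(nat => 'a) => (nat => 'a) set" where h: "inj_on h (carrier ?F)"
          using fin_gen_embeds[OF module_free_mod fin_gen_free_mod[of "{0::nat}"]] by auto
        obtain Q :: "('a, (nat => 'a) set) module" where Q: "module A Q" "h \<in> Hom ?F Q" "bij_betw h (carrier ?F) (carrier Q)"
          using module_transport[OF module_free_mod h] by blast
        define r where "r = (Q, (\<lambda>(\<alpha>::'v) (n::nat) (x::(nat => 'a) set). undefined :: (nat => 'a) set), (\<lambda>(\<alpha>::'v) (n::nat) (x::(nat => 'a) set). \<zero>\<^bsub>Q\<^esub>))"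
        let ?M = "obj (f(\<kappa> := r))"
        have at: "wt ?M \<kappa> = Q" "opE ?M \<kappa> = (\<lambda>_ _ _. undefined)" "opF ?M \<kappa> = (\<lambda>_ _ _. \<zero>\<^bsub>Q\<^esub>)"
          by (simp_all add: obj_def r_def)
        have gt: "\<not> weight_le D \<nu> \<kappa>" if "weight_lt \<kappa> \<nu>" for \<nu> using weight_lt_irrefl[OF that] .
        have z: "wt ?M (shift \<kappa> \<alpha> n) = zero_mod" if "\<alpha> \<in> simple D" "n > 0" for \<alpha> n
          by (rule wtz[OF gt[OF weight_lt_shift[OF that]]])
        have ops: "ops_at ?M \<kappa>"
          unfolding ops_at_def at
        proof (intro conjI ballI allI impI)
          show "module A Q" by (rule Q(1))
          fix \<alpha> and n :: nat assume a: "\<alpha> \<in> simple D" "0 < n"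
          show "(\<lambda>_. undefined) \<in> Hom Q (wt ?M (shift \<kappa> \<alpha> n))"
            unfolding z[OF a] by (simp add: mod_hom_def zero_mod_def)
          show "(\<lambda>_. \<zero>\<^bsub>Q\<^esub>) \<in> Hom (wt ?M (shift \<kappa> \<alpha> n)) Q" by (rule hom_const_zero[OF Q(1)])
        qed
        have "good_at ?M \<kappa> (card {0::nat})"
        proof (rule good_top[OF \<kappa> ops])
          show "ops_above ?M \<kappa>" unfolding ops_above_def using opsz gt by blast
          show "trivial (wt ?M (shift \<kappa> \<alpha> n))" if "\<alpha> \<in> simple D" "n > 0" for \<alpha> n
            unfolding z[OF that] by simp
          show "h \<in> Hom ?F (wt ?M \<kappa>)" unfolding at by (rule Q(2))
          show "bij_betw h (carrier ?F) (carrier (wt ?M \<kappa>))" unfolding at by (rule Q(3))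
        qed simp
        then have "P f \<mu> r" using True by (simp add: P_def)
        then show ?thesis by blast
      next
        case False
        let ?M = "obj f"
        have good: "good_at ?M \<nu> (?\<delta> \<nu>)" if \<nu>: "\<nu> \<in> wl" "weight_lt \<mu> \<nu>" "weight_le D \<nu> \<kappa>" for \<nu>
          using IH[of \<nu>] \<nu> by (simp add: P_def R_def)
        have above: "ops_above ?M \<mu>"
          unfolding ops_above_def using good_atD(1)[OF good] opsz by blast
        have fg: "fin_gen (wt ?M \<nu>) (carrier (wt ?M \<nu>))" if \<nu>: "\<nu> \<in> wl" "weight_lt \<mu> \<nu>" for \<nu>
        proof (cases "weight_le D \<nu> \<kappa>")
          case True
          then show ?thesis using cornerD(5)[OF good_atD(4)[OF good[OF \<nu>]]] by blast
        next
          case False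
          show ?thesis unfolding wtz[OF False] by (rule fin_gen_zero_mod)
        qed
        obtain N :: nat where N: "height \<kappa> = height \<mu> + real N" using weight_le_height[OF le] by blast
        have fin: "finite_above ?M \<mu>"
          unfolding finite_above_def
        proof (rule finite_subset)
          show "finite (simple D \<times> {..N})" using finite_simple by simp
          show "{(\<alpha>, n) \<in> delta_index D. \<not> trivial (wt ?M (shift \<mu> \<alpha> n))} \<subseteq> simple D \<times> {..N}"
          proof clarify
            fix \<alpha> and n :: nat
            assume a: "(\<alpha>, n) \<in> delta_index D" and nz: "\<not> trivial (wt ?M (shift \<mu> \<alpha> n))"
            have \<alpha>: "\<alpha> \<in> simple D" using a by simp
            have "weight_le D (shift \<mu> \<alpha> n) \<kappa>" using nz wtz[of "shift \<mu> \<alpha> n" f] by (cases "weight_le D (shift \<mu> \<alpha> n) \<kappa>") simp_all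
            then obtain k :: nat where "height \<kappa> = height (shift \<mu> \<alpha> n) + real k" using weight_le_height by blast
            then have "real n \<le> real N" using N height_shift[OF \<alpha>, of \<mu> n] by simp
            then show "\<alpha> \<in> simple D \<and> n \<in> {..N}" using \<alpha> by simp
          qed
        qed
        obtain Q e g where ext: "good_at (?M\<lparr>wt := (wt ?M)(\<mu> := Q), opE := (opE ?M)(\<mu> := e), opF := (opF ?M)(\<mu> := g)\<rparr>) \<mu> 0"
          using good_extend[OF \<mu> above fin fg] by blast
        have "obj (f(\<mu> := (Q, e, g))) = ?M\<lparr>wt := (wt ?M)(\<mu> := Q), opE := (opE ?M)(\<mu> := e), opF := (opF ?M)(\<mu> := g)\<rparr>"
          using le by (simp add: obj_def fun_eq_iff)
        then have "P f \<mu> (Q, e, g)" using ext False by (simp add: P_def)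
        then show ?thesis by blast
      qed
    qed
  qed
  then obtain f where f: "\<And>\<mu>. P f \<mu> (f \<mu>)" by blast
  let ?S = "obj f"
  have w: "weight_le D \<mu> \<kappa>" if "\<mu> \<in> weights D ?S" for \<mu>
    using that wtz[of \<mu> f] by (cases "weight_le D \<mu> \<kappa>") (simp_all add: weights_iff)
  have "finite {\<nu>\<in>weights D ?S. weight_le D \<mu> \<nu>}" for \<mu>
    by (rule finite_subset[OF _ finite_interval[of \<mu> \<kappa>]]) (use w in blast)
  then have qb: "quasi_bounded D (weights D ?S)" by (auto simp: quasi_bounded_def weights_iff)
  have good1: "good_at ?S \<mu> (?\<delta> \<mu>)" if "\<mu> \<in> wl" "weight_le D \<mu> \<kappa>" for \<mu>
    using f[of \<mu>] that by (simp add: P_def)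
  have good2: "good_at ?S \<mu> (card ({}::nat set))" if \<mu>: "\<mu> \<in> wl" and z: "\<not> weight_le D \<mu> \<kappa>" for \<mu>
  proof (rule good_top[OF \<mu> opsz[OF z]])
    show "ops_above ?S \<mu>"
      unfolding ops_above_def
    proof (intro ballI impI)
      fix \<nu> assume "\<nu> \<in> wl" "weight_lt \<mu> \<nu>"
      then show "ops_at ?S \<nu>" using opsz[of \<nu> f] z weight_le_trans[of \<mu> \<nu> \<kappa>] by (auto simp: weight_lt_def)
    qed
    show "trivial (wt ?S (shift \<mu> \<alpha> n))" if "\<alpha> \<in> simple D" "n > 0" for \<alpha> n
      unfolding wtz[OF not_le[OF z that(1)]] by simp
    show "(\<lambda>_. undefined) \<in> Hom (free_mod ({}::nat set)) (wt ?S \<mu>)"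
      unfolding wtz[OF z] by (simp add: mod_hom_def zero_mod_def)
    show "bij_betw (\<lambda>_. undefined) (carrier (free_mod ({}::nat set))) (carrier (wt ?S \<mu>))"
      unfolding wtz[OF z] by (simp add: free_mod_carrier bij_betw_def)
  qed simp
  have "good_at ?S \<mu> (?\<delta> \<mu>)" if \<mu>: "\<mu> \<in> wl" for \<mu>
  proof (cases "weight_le D \<mu> \<kappa>")
    case True
    then show ?thesis by (rule good1[OF \<mu>])
  next
    case False
    then have "\<mu> \<noteq> \<kappa>" by auto
    then show ?thesis using good2[OF \<mu> False] by simp
  qed
  then show ?thesis using qb w by blast
qed

end

section \<open>Direct sums of objects\<close>

context graded_category
begin

lemma X_dsum_simps:
  "wt (X_dsum J M) \<mu> = dsum_module J (\<lambda>i. wt (M i) \<mu>)"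
  "opE (X_dsum J M) \<mu> \<alpha> n = dsum_map J (\<lambda>i. opE (M i) \<mu> \<alpha> n)"
  "opF (X_dsum J M) \<mu> \<alpha> n = dsum_map J (\<lambda>i. opF (M i) \<mu> \<alpha> n)"
  by (simp_all add: X_dsum_def dsum_map_def fun_eq_iff)

lemma ops_at_dsum:
  assumes M: "\<And>i \<mu>. i \<in> J ==> \<mu> \<in> wl ==> ops_at (M i) \<mu>" and \<mu>: "\<mu> \<in> wl"
  shows "ops_at (X_dsum J M) \<mu>"
  unfolding ops_at_def X_dsum_simps
proof (intro conjI ballI allI impI)
  note mods = ops_atD(1)[OF M]
  show "module A (dsum_module J (\<lambda>i. wt (M i) \<mu>))" by (rule module_dsum) (rule mods[OF _ \<mu>])
  fix \<alpha> and n :: nat assume a: "\<alpha> \<in> simple D" "0 < n"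
  note s = wl_shift[OF \<mu> a(1), of n]
  show "dsum_map J (\<lambda>i. opE (M i) \<mu> \<alpha> n) \<in> Hom (dsum_module J (\<lambda>i. wt (M i) \<mu>)) (dsum_module J (\<lambda>i. wt (M i) (shift \<mu> \<alpha> n)))"
    by (rule dsum_map_hom) (use mods \<mu> s M a in \<open>auto simp: ops_at_def\<close>)
  show "dsum_map J (\<lambda>i. opF (M i) \<mu> \<alpha> n) \<in> Hom (dsum_module J (\<lambda>i. wt (M i) (shift \<mu> \<alpha> n))) (dsum_module J (\<lambda>i. wt (M i) \<mu>))"
    by (rule dsum_map_hom) (use mods \<mu> s M a in \<open>auto simp: ops_at_def\<close>)
qed

lemma proj_compat: "i \<in> J ==> compat_at (\<lambda>_ f. f i) (X_dsum J M) (M i) \<mu>"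
  by (simp add: compat_at_def X_dsum_simps dsum_map_def)

lemma proj_hom: "i \<in> J ==> (\<lambda>f. f i) \<in> Hom (wt (X_dsum J M) \<mu>) (wt (M i) \<mu>)"
  unfolding X_dsum_simps by (rule dproj_hom)

lemma weights_dsum:
  "weights D (X_dsum J M) \<subseteq> (\<Union>i\<in>J. weights D (M i))"
proof
  fix \<mu> assume "\<mu> \<in> weights D (X_dsum J M)"
  then have \<mu>: "\<mu> \<in> wl" and nz: "\<not> trivial (wt (X_dsum J M) \<mu>)" by (auto simp: weights_iff)
  show "\<mu> \<in> (\<Union>i\<in>J. weights D (M i))"
  proof (rule ccontr)
    assume "\<mu> \<notin> (\<Union>i\<in>J. weights D (M i))"
    then have z: "trivial (wt (M i) \<mu>)" if "i \<in> J" for i using that \<mu> by (auto simp: weights_iff)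
    have "trivial (wt (X_dsum J M) \<mu>)"
      unfolding X_dsum_simps dsum_simps(1,2)
    proof (intro equalityI subsetI)
      fix f assume f: "f \<in> {f \<in> \<Pi>\<^sub>E i\<in>J. carrier (wt (M i) \<mu>). finite {i \<in> J. f i \<noteq> \<zero>\<^bsub>wt (M i) \<mu>\<^esub>}}"
      have "f = (\<lambda>i\<in>J. \<zero>\<^bsub>wt (M i) \<mu>\<^esub>)"
      proof (rule PiE_ext[where k = J])
        show "f \<in> (\<Pi>\<^sub>E i\<in>J. carrier (wt (M i) \<mu>))" using f by simp
        show "(\<lambda>i\<in>J. \<zero>\<^bsub>wt (M i) \<mu>\<^esub>) \<in> (\<Pi>\<^sub>E i\<in>J. carrier (wt (M i) \<mu>))" using z by simp
        fix i assume i: "i \<in> J"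
        have "f i \<in> carrier (wt (M i) \<mu>)" using f i by auto
        then show "f i = (\<lambda>i\<in>J. \<zero>\<^bsub>wt (M i) \<mu>\<^esub>) i" using z[OF i] i by simp
      qed
      then show "f \<in> {\<lambda>i\<in>J. \<zero>\<^bsub>wt (M i) \<mu>\<^esub>}" by simp
    qed (use z in simp)
    then show False using nz by simp
  qed
qed

lemma quasi_bounded_subset:
  assumes W: "quasi_bounded D W" and V: "V \<subseteq> W"
  shows "quasi_bounded D V"
  unfolding quasi_bounded_def
proof (intro conjI ballI)
  show "V \<subseteq> wl" using W V unfolding quasi_bounded_def by blast
  fix \<mu> assume "\<mu> \<in> wl"
  then have "finite {\<nu> \<in> W. weight_le D \<mu> \<nu>}" using W by (simp add: quasi_bounded_def)
  moreover have "{\<nu> \<in> V. weight_le D \<mu> \<nu>} \<subseteq> {\<nu> \<in> W. weight_le D \<mu> \<nu>}" using V by blast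
  ultimately show "finite {\<nu> \<in> V. weight_le D \<mu> \<nu>}" by (rule rev_finite_subset)
qed

text \<open>The operators of a direct sum form, up to interchanging the sum over \<open>J\<close> with the sum over the
  weights above \<open>\<mu>\<close>, a direct sum of corners.\<close>

lemma good_dsum:
  assumes gM: "\<And>i \<mu>. i \<in> J ==> \<mu> \<in> wl ==> good_at (M i) \<mu> (c i \<mu>)"
    and qb: "quasi_bounded D (\<Union>i\<in>J. weights D (M i))"
    and \<mu>: "\<mu> \<in> wl" and K: "finite K" "K \<subseteq> J" "\<And>i. i \<in> J ==> \<mu> \<in> weights D (M i) ==> i \<in> K"
  shows "good_at (X_dsum J M) \<mu> (\<Sum>i\<in>K. c i \<mu>)"
proof -
  let ?X = "X_dsum J M" and ?I = "delta_index D"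
  have ops: "ops_at (M i) \<nu>" if "i \<in> J" "\<nu> \<in> wl" for i \<nu> using good_atD(1)[OF gM[OF that]] .
  have above: "ops_above (M i) \<mu>" if "i \<in> J" for i using ops[OF that] by (simp add: ops_above_def)
  note mods = ops_atD(1)[OF ops]
  have Xops: "ops_at ?X \<nu>" if "\<nu> \<in> wl" for \<nu> by (rule ops_at_dsum[OF ops that])
  have Xabove: "ops_above ?X \<mu>" using Xops by (simp add: ops_above_def)
  have Xfin: "finite_above ?X \<mu>"
    by (rule quasi_bounded_finite_above[OF quasi_bounded_subset[OF qb weights_dsum] \<mu>])
  note Xmod = ops_atD(1)[OF Xops[OF \<mu>]]
  note X\<Delta> = module_wt_delta[OF Xabove \<mu>] and XE = E_col_hom[OF Xops[OF \<mu>] Xfin] and XF = F_row_hom[OF Xops[OF \<mu>] Xabove \<mu>]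
  have pa: "hom_above (\<lambda>_ f. f i) ?X (M i) \<mu>" if "i \<in> J" for i
    unfolding hom_above_def by (intro ballI impI conjI proj_hom[OF that] proj_compat[OF that])
  note G = good_atD[OF gM[OF _ \<mu>]]
  let ?\<Delta> = "\<lambda>i. wt_delta D (M i) \<mu>"
  have \<Delta>: "module A (?\<Delta> i)" if "i \<in> J" for i by (rule module_wt_delta[OF above[OF that] \<mu>])
  have c0: "corner (dsum_module J (\<lambda>i. wt (M i) \<mu>)) (dsum_module J ?\<Delta>) (dsum_map J (\<lambda>i. E_col D (M i) \<mu>)) (dsum_map J (\<lambda>i. F_row D (M i) \<mu>)) (\<Sum>i\<in>K. c i \<mu>)"
  proof (rule corner_dsum[OF _ K(1,2)])
    show "corner (wt (M i) \<mu>) (?\<Delta> i) (E_col D (M i) \<mu>) (F_row D (M i) \<mu>) (c i \<mu>)" if "i \<in> J" for i by (rule G(4)[OF that])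
    show "trivial (wt (M i) \<mu>)" if "i \<in> J" "i \<notin> K" for i
      using K(3)[OF that(1)] that \<mu> by (auto simp: weights_iff)
  qed
  \<comment> \<open>the interchange of the two direct sums, with inverse \<open>k'\<close>\<close>
  define k where "k y = (\<lambda>a\<in>?I. \<lambda>i\<in>J. y i a)" for y :: "'b => 'v \<times> nat => 'c"
  have ycl: "y i (\<alpha>, n) \<in> carrier (wt (M i) (shift \<mu> \<alpha> n))" if "y \<in> carrier (dsum_module J ?\<Delta>)" "i \<in> J" "\<alpha> \<in> simple D" "n > 0" for y i \<alpha> n
  proof -
    have "y i \<in> carrier (?\<Delta> i)" by (rule dsum_component[OF that(1,2)])
    from dsum_component[OF this[unfolded wt_delta_eq], of "(\<alpha>, n)"] show ?thesis using that by simp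
  qed
  have kcl: "k y \<in> carrier (wt_delta D ?X \<mu>)" if y: "y \<in> carrier (dsum_module J ?\<Delta>)" for y
  proof (rule wt_delta_carrierI[OF Xfin])
    show "k y \<in> extensional ?I" by (simp add: k_def)
    fix \<alpha> and n :: nat assume a: "\<alpha> \<in> simple D" "n > 0"
    have i: "(\<alpha>, n) \<in> ?I" using a by simp
    have "finite {i \<in> J. y i \<noteq> \<zero>\<^bsub>?\<Delta> i\<^esub>}" using y by (simp add: dsum_simps(1))
    moreover have "{i \<in> J. y i (\<alpha>, n) \<noteq> \<zero>\<^bsub>wt (M i) (shift \<mu> \<alpha> n)\<^esub>} \<subseteq> {i \<in> J. y i \<noteq> \<zero>\<^bsub>?\<Delta> i\<^esub>}"
      using i by (auto simp: wt_delta_eq dsum_simps(2))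
    ultimately have "finite {i \<in> J. y i (\<alpha>, n) \<noteq> \<zero>\<^bsub>wt (M i) (shift \<mu> \<alpha> n)\<^esub>}" by (rule rev_finite_subset)
    then show "k y (\<alpha>, n) \<in> carrier (wt ?X (shift \<mu> \<alpha> n))"
      unfolding X_dsum_simps dsum_simps(1) using ycl[OF y _ a] i by (simp add: k_def cong: conj_cong)
  qed
  have khom: "k \<in> Hom (dsum_module J ?\<Delta>) (wt_delta D ?X \<mu>)"
  proof (rule mod_homI)
    show "k y \<in> carrier (wt_delta D ?X \<mu>)" if "y \<in> carrier (dsum_module J ?\<Delta>)" for y by (rule kcl[OF that])
    show "k (x \<oplus>\<^bsub>dsum_module J ?\<Delta>\<^esub> y) = k x \<oplus>\<^bsub>wt_delta D ?X \<mu>\<^esub> k y" for x y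
      unfolding k_def wt_delta_eq[of ?X] dsum_simps(3)
      by (rule restrict_ext) (auto simp: X_dsum_simps dsum_simps(3) wt_delta_eq restrict_def)
    show "k (a \<odot>\<^bsub>dsum_module J ?\<Delta>\<^esub> y) = a \<odot>\<^bsub>wt_delta D ?X \<mu>\<^esub> k y" for a y
      unfolding k_def wt_delta_eq[of ?X] dsum_simps(4)
      by (rule restrict_ext) (auto simp: X_dsum_simps dsum_simps(4) wt_delta_eq restrict_def)
  qed
  define k' where "k' z = (\<lambda>i\<in>J. \<lambda>a\<in>?I. z a i)" for z :: "'v \<times> nat => 'b => 'c"
  have zcl: "z (\<alpha>, n) \<in> carrier (dsum_module J (\<lambda>i. wt (M i) (shift \<mu> \<alpha> n)))" if "z \<in> carrier (wt_delta D ?X \<mu>)" "\<alpha> \<in> simple D" "n > 0" for z \<alpha> n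
    using dsum_component[OF that(1)[unfolded wt_delta_eq], of "(\<alpha>, n)"] that by (simp add: X_dsum_simps)
  have k'cl: "k' z \<in> carrier (dsum_module J ?\<Delta>)" if z: "z \<in> carrier (wt_delta D ?X \<mu>)" for z
    unfolding dsum_simps(1)
  proof (intro CollectI conjI)
    have comp: "(\<lambda>a\<in>?I. z a i) \<in> carrier (?\<Delta> i)" if i: "i \<in> J" for i
    proof (rule wt_delta_carrierI[OF G(2)[OF i]])
      fix \<alpha> and n :: nat assume a: "\<alpha> \<in> simple D" "n > 0"
      show "(\<lambda>a\<in>?I. z a i) (\<alpha>, n) \<in> carrier (wt (M i) (shift \<mu> \<alpha> n))"
        using dsum_component[OF zcl[OF z a] i] a by simp
    qed simp
    then show "k' z \<in> (\<Pi>\<^sub>E i\<in>J. carrier (?\<Delta> i))" by (simp add: k'_def)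
    let ?s = "{a \<in> ?I. z a \<noteq> \<zero>\<^bsub>delta_wt ?X \<mu> a\<^esub>}"
    have fs: "finite ?s" using z by (simp add: wt_delta_eq dsum_simps(1))
    have fi: "finite {i \<in> J. z a i \<noteq> \<zero>\<^bsub>delta_wt (M i) \<mu> a\<^esub>}" if "a \<in> ?I" for a
      using zcl[OF z, of "fst a" "snd a"] that by (cases a) (simp add: dsum_simps(1))
    have "{i \<in> J. k' z i \<noteq> \<zero>\<^bsub>?\<Delta> i\<^esub>} \<subseteq> (\<Union>a\<in>?s. {i \<in> J. z a i \<noteq> \<zero>\<^bsub>delta_wt (M i) \<mu> a\<^esub>})"
    proof clarify
      fix i assume i: "i \<in> J" and ne: "k' z i \<noteq> \<zero>\<^bsub>?\<Delta> i\<^esub>"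
      have "\<exists>a\<in>?I. z a i \<noteq> \<zero>\<^bsub>delta_wt (M i) \<mu> a\<^esub>"
      proof (rule ccontr)
        assume "\<not> (\<exists>a\<in>?I. z a i \<noteq> \<zero>\<^bsub>delta_wt (M i) \<mu> a\<^esub>)"
        then have "k' z i = \<zero>\<^bsub>?\<Delta> i\<^esub>" using i by (auto simp: k'_def wt_delta_eq dsum_simps(2) restrict_def)
        then show False using ne by simp
      qed
      then obtain a where a: "a \<in> ?I" "z a i \<noteq> \<zero>\<^bsub>delta_wt (M i) \<mu> a\<^esub>" by blast
      have "z a \<noteq> \<zero>\<^bsub>delta_wt ?X \<mu> a\<^esub>"
      proof
        assume "z a = \<zero>\<^bsub>delta_wt ?X \<mu> a\<^esub>"
        then have "z a i = \<zero>\<^bsub>delta_wt (M i) \<mu> a\<^esub>" using i by (cases a) (simp add: X_dsum_simps dsum_simps(2))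
        then show False using a(2) by simp
      qed
      then show "i \<in> (\<Union>a\<in>?s. {i \<in> J. z a i \<noteq> \<zero>\<^bsub>delta_wt (M i) \<mu> a\<^esub>})" using a i by blast
    qed
    then show "finite {i \<in> J. k' z i \<noteq> \<zero>\<^bsub>?\<Delta> i\<^esub>}"
      by (rule finite_subset) (use fs fi in blast)
  qed
  have kbij: "bij_betw k (carrier (dsum_module J ?\<Delta>)) (carrier (wt_delta D ?X \<mu>))"
  proof (rule bij_betw_byWitness[where f' = k'])
    show "\<forall>y\<in>carrier (dsum_module J ?\<Delta>). k' (k y) = y"
    proof
      fix y assume y: "y \<in> carrier (dsum_module J ?\<Delta>)"
      show "k' (k y) = y"
      proof (rule dsum_eqI[OF k'cl[OF kcl[OF y]] y])
        fix i assume i: "i \<in> J"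
        have "y i \<in> extensional ?I" using dsum_component[OF y i] by (simp add: wt_delta_eq dsum_simps(1) PiE_iff)
        then show "k' (k y) i = y i" using i by (auto simp: k_def k'_def extensional_def restrict_def)
      qed
    qed
    show "\<forall>z\<in>carrier (wt_delta D ?X \<mu>). k (k' z) = z"
    proof
      fix z assume z: "z \<in> carrier (wt_delta D ?X \<mu>)"
      show "k (k' z) = z"
      proof (rule dsum_eqI[where I = ?I and M = "delta_wt ?X \<mu>"])
        show "k (k' z) \<in> carrier (dsum_module ?I (delta_wt ?X \<mu>))" using kcl[OF k'cl[OF z]] by (simp only: wt_delta_eq)
        show "z \<in> carrier (dsum_module ?I (delta_wt ?X \<mu>))" using z by (simp only: wt_delta_eq)
        fix a assume a: "a \<in> ?I"
        have "z a \<in> extensional J" using zcl[OF z, of "fst a" "snd a"] a by (cases a) (simp add: dsum_simps(1) PiE_iff)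
        then show "k (k' z) a = z a" using a by (auto simp: k_def k'_def extensional_def restrict_def)
      qed
    qed
    show "k ` carrier (dsum_module J ?\<Delta>) \<subseteq> carrier (wt_delta D ?X \<mu>)" using kcl by blast
    show "k' ` carrier (wt_delta D ?X \<mu>) \<subseteq> carrier (dsum_module J ?\<Delta>)" using k'cl by blast
  qed
  have cor: "corner (wt ?X \<mu>) (wt_delta D ?X \<mu>) (E_col D ?X \<mu>) (F_row D ?X \<mu>) (\<Sum>i\<in>K. c i \<mu>)"
  proof (rule corner_iso[where h = "\<lambda>x. x" and k = k and \<epsilon>' = "E_col D ?X \<mu>" and \<theta>' = "F_row D ?X \<mu>"
        and \<epsilon> = "dsum_map J (\<lambda>i. E_col D (M i) \<mu>)" and \<theta> = "dsum_map J (\<lambda>i. F_row D (M i) \<mu>)", OF c0 Xmod X\<Delta> XE XF _ _ khom kbij])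
    show "(\<lambda>x. x) \<in> Hom (dsum_module J (\<lambda>i. wt (M i) \<mu>)) (wt ?X \<mu>)" unfolding X_dsum_simps by (rule hom_id)
    show "bij_betw (\<lambda>x. x) (carrier (dsum_module J (\<lambda>i. wt (M i) \<mu>))) (carrier (wt ?X \<mu>))" unfolding X_dsum_simps by (simp add: bij_betw_def)
    show "E_col D ?X \<mu> x = k (dsum_map J (\<lambda>i. E_col D (M i) \<mu>) x)" for x
      unfolding k_def E_col_def by (rule restrict_ext) (auto simp: X_dsum_simps dsum_map_def restrict_def)
    fix y assume y: "y \<in> carrier (dsum_module J ?\<Delta>)"
    note ky = kcl[OF y]
    have Fh: "dsum_map J (\<lambda>i. F_row D (M i) \<mu>) \<in> Hom (dsum_module J ?\<Delta>) (dsum_module J (\<lambda>i. wt (M i) \<mu>))"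
      by (rule dsum_map_hom[OF \<Delta> mods[OF _ \<mu>] F_row_hom[OF ops[OF _ \<mu>] above \<mu>]])
    show "F_row D ?X \<mu> (k y) = dsum_map J (\<lambda>i. F_row D (M i) \<mu>) y"
    proof (rule dsum_eqI[where I = J and M = "\<lambda>i. wt (M i) \<mu>"])
      show "F_row D ?X \<mu> (k y) \<in> carrier (dsum_module J (\<lambda>i. wt (M i) \<mu>))" using hom_closed[OF XF ky] by (simp only: X_dsum_simps)
      show "dsum_map J (\<lambda>i. F_row D (M i) \<mu>) y \<in> carrier (dsum_module J (\<lambda>i. wt (M i) \<mu>))" by (rule hom_closed[OF Fh y])
      fix i assume i: "i \<in> J"
      have "F_row D ?X \<mu> (k y) i = F_row D (M i) \<mu> (delta_map (\<lambda>_ f. f i) \<mu> (k y))"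
        by (rule compat_at_F_row[where f = "\<lambda>_ f. f i", OF Xops[OF \<mu>] Xabove ops[OF i \<mu>] above[OF i] \<mu> proj_hom[OF i] pa[OF i] proj_compat[OF i] ky])
      also have "delta_map (\<lambda>_ f. f i) \<mu> (k y) = y i"
      proof -
        have "y i \<in> extensional ?I" using dsum_component[OF y i] by (simp add: wt_delta_eq dsum_simps(1) PiE_iff)
        then show ?thesis using i by (auto simp: delta_map_def dsum_map_def k_def extensional_def restrict_def)
      qed
      finally show "F_row D ?X \<mu> (k y) i = dsum_map J (\<lambda>i. F_row D (M i) \<mu>) y i" using i by (simp add: dsum_map_def)
    qed
  qed
  have "X2_at ?X \<mu>"
    unfolding X2_at_iff[OF Xops[OF \<mu>] Xabove \<mu> Xfin]
  proof
    fix z assume z: "z \<in> carrier (wt_delta D ?X \<mu>)"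
    have Fz: "F_row D ?X \<mu> z \<in> carrier (wt ?X \<mu>)" by (rule hom_closed[OF XF z])
    have EFz: "E_col D ?X \<mu> (F_row D ?X \<mu> z) \<in> carrier (wt_delta D ?X \<mu>)" by (rule hom_closed[OF XE Fz])
    have Mz: "EF_map ?X \<mu> z \<in> carrier (wt_delta D ?X \<mu>)" by (rule hom_closed[OF EF_map_hom[OF Xabove \<mu> Xfin] z])
    have pr: "delta_map (\<lambda>_ f. f i) \<mu> (E_col D ?X \<mu> (F_row D ?X \<mu> z)) = delta_map (\<lambda>_ f. f i) \<mu> (EF_map ?X \<mu> z)" if i: "i \<in> J" for i
    proof -
      let ?p = "\<lambda>_ f. f i"
      have d: "delta_map ?p \<mu> z \<in> carrier (?\<Delta> i)" by (rule hom_closed[OF delta_map_hom[OF Xabove above[OF i] \<mu> pa[OF i]] z])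
      have "delta_map ?p \<mu> (E_col D ?X \<mu> (F_row D ?X \<mu> z)) = E_col D (M i) \<mu> (F_row D ?X \<mu> z i)"
        by (rule compat_at_E_col[where f = ?p, OF Xops[OF \<mu>] Xfin proj_compat[OF i] Fz, symmetric])
      also have "F_row D ?X \<mu> z i = F_row D (M i) \<mu> (delta_map ?p \<mu> z)"
        by (rule compat_at_F_row[where f = ?p, OF Xops[OF \<mu>] Xabove ops[OF i \<mu>] above[OF i] \<mu> proj_hom[OF i] pa[OF i] proj_compat[OF i] z])
      also have "E_col D (M i) \<mu> (F_row D (M i) \<mu> (delta_map ?p \<mu> z)) = EF_map (M i) \<mu> (delta_map ?p \<mu> z)"
        by (rule good_EF[OF gM[OF i \<mu>] above[OF i] \<mu> d])
      also have "\<dots> = delta_map ?p \<mu> (EF_map ?X \<mu> z)"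
        by (rule EF_map_nat[OF Xabove Xfin above[OF i] G(2)[OF i] \<mu> pa[OF i] z, symmetric])
      finally show ?thesis .
    qed
    show "E_col D ?X \<mu> (F_row D ?X \<mu> z) = EF_map ?X \<mu> z"
    proof (rule dsum_eqI[where I = ?I and M = "delta_wt ?X \<mu>"])
      show "E_col D ?X \<mu> (F_row D ?X \<mu> z) \<in> carrier (dsum_module ?I (delta_wt ?X \<mu>))" using EFz by (simp only: wt_delta_eq)
      show "EF_map ?X \<mu> z \<in> carrier (dsum_module ?I (delta_wt ?X \<mu>))" using Mz by (simp only: wt_delta_eq)
      fix a assume a: "a \<in> ?I"
      obtain \<alpha> n where an: "a = (\<alpha>, n)" "\<alpha> \<in> simple D" "n > 0" using a by (cases a) auto
      show "E_col D ?X \<mu> (F_row D ?X \<mu> z) a = EF_map ?X \<mu> z a"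
        unfolding an(1)
      proof (rule dsum_eqI[OF zcl[OF EFz an(2,3)] zcl[OF Mz an(2,3)]])
        fix i assume i: "i \<in> J"
        show "E_col D ?X \<mu> (F_row D ?X \<mu> z) (\<alpha>, n) i = EF_map ?X \<mu> z (\<alpha>, n) i"
          using fun_cong[OF pr[OF i], of "(\<alpha>, n)"] by (simp add: delta_map_apply[OF an(2,3)])
      qed
    qed
  qed
  then show ?thesis unfolding good_at_def using Xops[OF \<mu>] Xfin cor by blast
qed

lemma quasi_bounded_downset:
  assumes W: "quasi_bounded D W" shows "quasi_bounded D (downset W)"
  unfolding quasi_bounded_def
proof (intro conjI ballI)
  show "downset W \<subseteq> wl" by (auto simp: downset_def)
  fix \<mu> assume \<mu>: "\<mu> \<in> wl"
  have "{\<nu> \<in> downset W. weight_le D \<mu> \<nu>} \<subseteq> (\<Union>\<kappa>\<in>{\<kappa>\<in>W. weight_le D \<mu> \<kappa>}. {\<nu>. weight_le D \<mu> \<nu> \<and> weight_le D \<nu> \<kappa>})"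
    using weight_le_trans by (auto simp: downset_def)
  then show "finite {\<nu> \<in> downset W. weight_le D \<mu> \<nu>}"
    by (rule finite_subset) (use W \<mu> finite_interval in \<open>auto simp: quasi_bounded_def\<close>)
qed

lemma good_pos_weight:
  assumes g: "good_at M \<mu> c" and c: "c > 0" and \<mu>: "\<mu> \<in> wl"
  shows "\<mu> \<in> weights D M"
proof -
  note C = cornerD[OF good_atD(4)[OF g]]
  obtain I C' p b where ab: "adapted_basis (wt M \<mu>) (F_row D M \<mu> ` carrier (wt_delta D M \<mu>)) (mod_ker (wt M \<mu>) (wt_delta D M \<mu>) (E_col D M \<mu>)) (I::nat set) C' p b"
    and card: "card C' = c" using C(8) by (auto simp: has_adapted_basis_def)
  note B = adapted_basisD[OF ab]
  obtain i where "i \<in> C'" using card c by (cases "C' = {}") auto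
  then have i: "i \<in> I" using B(2) by blast
  have "b i \<noteq> \<zero>\<^bsub>wt M \<mu>\<^esub>"
  proof
    assume "b i = \<zero>\<^bsub>wt M \<mu>\<^esub>"
    then have "unit_vec I i = \<zero>\<^bsub>free_mod I\<^esub>" using hom_zero[OF B(3) C(1) module_free_mod] B(6)[OF i] by simp
    then show False using unit_vec_apply[OF i i] i by (simp add: dsum_simps(2))
  qed
  then have "\<not> trivial (wt M \<mu>)" using B(5)[OF i] by auto
  then show ?thesis using \<mu> by (simp add: weights_iff)
qed

text \<open>Each pair \<open>(\<mu>, k)\<close> stands for one of the \<open>c \<mu>\<close> generators of \<open>S\<close> at \<open>\<mu>\<close>, and contributes a copy of
  the object generated at \<open>\<mu>\<close>. Arbitrary subsets are allowed in order to split off single generators.\<close>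

lemma good_dsum_generators:
  assumes gS: "\<And>\<mu>. \<mu> \<in> wl ==> good_at S \<mu> (c \<mu>)" and qS: "quasi_bounded D (weights D S)"
    and G: "\<And>\<kappa> \<mu>. \<kappa> \<in> wl ==> \<mu> \<in> wl ==> good_at (G \<kappa>) \<mu> (if \<mu> = \<kappa> then 1 else 0)"
      "\<And>\<kappa> \<mu>. \<kappa> \<in> wl ==> \<mu> \<in> weights D (G \<kappa>) ==> weight_le D \<mu> \<kappa>"
    and J: "J \<subseteq> {(\<mu>, k). \<mu> \<in> wl \<and> k < c \<mu>}"
  shows "quasi_bounded D (weights D (X_dsum J (\<lambda>i. G (fst i))))"
    and "\<And>\<mu>. \<mu> \<in> wl ==> good_at (X_dsum J (\<lambda>i. G (fst i))) \<mu> (card {k. (\<mu>, k) \<in> J})"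
proof -
  let ?W = "weights D S"
  have JW: "fst i \<in> ?W" "fst i \<in> wl" if "i \<in> J" for i
  proof -
    obtain \<mu> k where i: "i = (\<mu>, k)" "\<mu> \<in> wl" "k < c \<mu>" using J \<open>i \<in> J\<close> by blast
    show "fst i \<in> ?W" using good_pos_weight[OF gS[OF i(2)] _ i(2)] i by simp
    show "fst i \<in> wl" using i by simp
  qed
  have sub: "(\<Union>i\<in>J. weights D (G (fst i))) \<subseteq> downset ?W"
  proof
    fix \<mu> assume "\<mu> \<in> (\<Union>i\<in>J. weights D (G (fst i)))"
    then obtain i where i: "i \<in> J" "\<mu> \<in> weights D (G (fst i))" by blast
    have "weight_le D \<mu> (fst i)" by (rule G(2)[OF JW(2)[OF i(1)] i(2)])
    moreover have "\<mu> \<in> wl" using i(2) by (simp only: weights_iff)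
    ultimately show "\<mu> \<in> downset ?W" unfolding downset_def using JW(1)[OF i(1)] by blast
  qed
  have qb: "quasi_bounded D (\<Union>i\<in>J. weights D (G (fst i)))"
    by (rule quasi_bounded_subset[OF quasi_bounded_downset[OF qS] sub])
  show "quasi_bounded D (weights D (X_dsum J (\<lambda>i. G (fst i))))"
    by (rule quasi_bounded_subset[OF qb weights_dsum])
  fix \<mu> assume \<mu>: "\<mu> \<in> wl"
  let ?U = "{\<kappa> \<in> ?W. weight_le D \<mu> \<kappa>}"
  let ?K = "{i \<in> J. fst i \<in> ?U}"
  have finU: "finite ?U" using qS \<mu> by (simp add: quasi_bounded_def)
  have "?K \<subseteq> Sigma ?U (\<lambda>\<kappa>. {..<c \<kappa>})" using J by auto
  then have finK: "finite ?K" by (rule finite_subset) (use finU in auto)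
  have "good_at (X_dsum J (\<lambda>i. G (fst i))) \<mu> (\<Sum>i\<in>?K. if \<mu> = fst i then 1 else 0)"
  proof (rule good_dsum[where c = "\<lambda>i \<mu>. if \<mu> = fst i then 1 else 0", OF _ qb \<mu> finK])
    show "good_at (G (fst i)) \<nu> (if \<nu> = fst i then 1 else 0)" if "i \<in> J" "\<nu> \<in> wl" for i \<nu>
      by (rule G(1)[OF JW(2)[OF that(1)] that(2)])
    show "?K \<subseteq> J" by blast
    show "i \<in> ?K" if "i \<in> J" "\<mu> \<in> weights D (G (fst i))" for i
      using that JW[OF that(1)] G(2) by blast
  qed
  also have "(\<Sum>i\<in>?K. if \<mu> = fst i then 1 else 0) = card {i \<in> ?K. \<mu> = fst i}"
    using finK by (simp add: sum.If_cases Int_def)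
  also have "{i \<in> ?K. \<mu> = fst i} = (\<lambda>k. (\<mu>, k)) ` {k. (\<mu>, k) \<in> J}"
    using JW by force
  also have "card \<dots> = card {k. (\<mu>, k) \<in> J}" by (rule card_image) (simp add: inj_on_def)
  finally show "good_at (X_dsum J (\<lambda>i. G (fst i))) \<mu> (card {k. (\<mu>, k) \<in> J})" .
qed

end

section \<open>Endomorphisms of modules of rank one\<close>

context local_noetherian_domain
begin

lemma rank_one_generator:
  fixes N :: "('a, 'm) module"
  assumes N: "module A N" and r: "free_of_rank A N 1"
  shows "\<exists>s\<in>carrier N. bij_betw (\<lambda>a. a \<odot>\<^bsub>N\<^esub> s) (carrier A) (carrier N)"
proof -
  interpret G: abelian_group N using N by (rule mod_abelian_group)
  obtain B where B0: "module_basis A N B" "card B = 1" using r by (auto simp: free_of_rank_def)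
  obtain s where "B = {s}" using B0(2) by (rule card_1_singletonE)
  then have B: "module_basis A N {s}" using B0(1) by simp
  then have s: "s \<in> carrier N" by (simp add: module_basis_def)
  have fs: "(\<Oplus>\<^bsub>N\<^esub>b\<in>{b\<in>{s}. c b \<noteq> \<zero>}. c b \<odot>\<^bsub>N\<^esub> b) = c s \<odot>\<^bsub>N\<^esub> s" if c: "c s \<in> carrier A" for c
  proof (cases "c s = \<zero>")
    case True
    then have e: "{b\<in>{s}. c b \<noteq> \<zero>} = {}" by auto
    show ?thesis unfolding e using True s N by simp
  next
    case False
    then have e: "{b\<in>{s}. c b \<noteq> \<zero>} = {s}" by auto
    show ?thesis unfolding e using c s N by simp
  qed
  have ex1: "\<exists>!c. c \<in> ({s} \<rightarrow>\<^sub>E carrier A) \<and> finite {b\<in>{s}. c b \<noteq> \<zero>} \<and> x = (\<Oplus>\<^bsub>N\<^esub>b\<in>{b\<in>{s}. c b \<noteq> \<zero>}. c b \<odot>\<^bsub>N\<^esub> b)"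
    if "x \<in> carrier N" for x
    using B that by (simp add: module_basis_def)
  have "bij_betw (\<lambda>a. a \<odot>\<^bsub>N\<^esub> s) (carrier A) (carrier N)"
  proof (rule bij_betw_imageI)
    show "inj_on (\<lambda>a. a \<odot>\<^bsub>N\<^esub> s) (carrier A)"
    proof (rule inj_onI)
      fix a b assume ab: "a \<in> carrier A" "b \<in> carrier A" and eq: "a \<odot>\<^bsub>N\<^esub> s = b \<odot>\<^bsub>N\<^esub> s"
      let ?c = "\<lambda>a. \<lambda>_\<in>{s}. a"
      have P: "?c d \<in> ({s} \<rightarrow>\<^sub>E carrier A) \<and> finite {b\<in>{s}. ?c d b \<noteq> \<zero>} \<and> a \<odot>\<^bsub>N\<^esub> s = (\<Oplus>\<^bsub>N\<^esub>b\<in>{b\<in>{s}. ?c d b \<noteq> \<zero>}. ?c d b \<odot>\<^bsub>N\<^esub> b)"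
        if d: "d \<in> carrier A" "a \<odot>\<^bsub>N\<^esub> s = d \<odot>\<^bsub>N\<^esub> s" for d
      proof (intro conjI)
        show "?c d \<in> ({s} \<rightarrow>\<^sub>E carrier A)" using d(1) by simp
        show "finite {b\<in>{s}. ?c d b \<noteq> \<zero>}" by (rule finite_subset[of _ "{s}"]) auto
        have "?c d s \<in> carrier A" using d(1) by simp
        from fs[of "?c d", OF this] show "a \<odot>\<^bsub>N\<^esub> s = (\<Oplus>\<^bsub>N\<^esub>b\<in>{b\<in>{s}. ?c d b \<noteq> \<zero>}. ?c d b \<odot>\<^bsub>N\<^esub> b)" using d(2) by simp
      qed
      have x: "a \<odot>\<^bsub>N\<^esub> s \<in> carrier N" using ab(1) s N by simp
      have "?c a = ?c b"
        using the1_equality[OF ex1[OF x], OF P[OF ab(1) refl]] the1_equality[OF ex1[OF x], OF P[OF ab(2) eq]] by (rule trans[OF sym])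
      from fun_cong[OF this, of s] show "a = b" by simp
    qed
    show "(\<lambda>a. a \<odot>\<^bsub>N\<^esub> s) ` carrier A = carrier N"
    proof (intro equalityI subsetI)
      fix x assume x: "x \<in> carrier N"
      obtain c where c: "c \<in> ({s} \<rightarrow>\<^sub>E carrier A)" "x = (\<Oplus>\<^bsub>N\<^esub>b\<in>{b\<in>{s}. c b \<noteq> \<zero>}. c b \<odot>\<^bsub>N\<^esub> b)" using ex1[OF x] by (blast dest: ex1_implies_ex)
      have cs: "c s \<in> carrier A" using c(1) by (rule PiE_mem) simp
      show "x \<in> (\<lambda>a. a \<odot>\<^bsub>N\<^esub> s) ` carrier A" unfolding c(2) fs[of c, OF cs] using cs by (rule imageI)
    qed (use s N in auto)
  qed
  then show ?thesis using s by blast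
qed

lemma rank_one_endo:
  fixes N :: "('a, 'm) module"
  assumes N: "module A N" and s: "s \<in> carrier N" "bij_betw (\<lambda>a. a \<odot>\<^bsub>N\<^esub> s) (carrier A) (carrier N)"
    and h: "h \<in> Hom N N"
  shows "\<exists>a\<in>carrier A. (\<forall>x\<in>carrier N. h x = a \<odot>\<^bsub>N\<^esub> x) \<and> (bij_betw h (carrier N) (carrier N) \<longleftrightarrow> a \<in> Units A)"
proof -
  have gen: "\<exists>b\<in>carrier A. x = b \<odot>\<^bsub>N\<^esub> s" if "x \<in> carrier N" for x
    using s(2) that by (auto simp: bij_betw_def)
  obtain a where a: "a \<in> carrier A" "h s = a \<odot>\<^bsub>N\<^esub> s" using gen[OF hom_closed[OF h s(1)]] by blast
  have ha: "h x = a \<odot>\<^bsub>N\<^esub> x" if x: "x \<in> carrier N" for x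
  proof -
    obtain b where b: "b \<in> carrier A" "x = b \<odot>\<^bsub>N\<^esub> s" using gen[OF x] by blast
    have "h x = b \<odot>\<^bsub>N\<^esub> (a \<odot>\<^bsub>N\<^esub> s)" unfolding b(2) using hom_smult[OF h b(1) s(1)] a(2) by simp
    also have "\<dots> = (a \<otimes> b) \<odot>\<^bsub>N\<^esub> s" using mod_smult_assoc[OF N b(1) a(1) s(1)] m_comm[OF a(1) b(1)] by simp
    also have "\<dots> = a \<odot>\<^bsub>N\<^esub> x" unfolding b(2) by (rule mod_smult_assoc[OF N a(1) b(1) s(1)])
    finally show ?thesis .
  qed
  have "bij_betw h (carrier N) (carrier N) \<longleftrightarrow> a \<in> Units A"
  proof
    assume bij: "bij_betw h (carrier N) (carrier N)"
    have "s \<in> h ` carrier N" using bij s(1) by (simp only: bij_betw_imp_surj_on)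
    then obtain x where x: "x \<in> carrier N" "h x = s" by blast
    obtain b where b: "b \<in> carrier A" "x = b \<odot>\<^bsub>N\<^esub> s" using gen[OF x(1)] by blast
    have "(a \<otimes> b) \<odot>\<^bsub>N\<^esub> s = \<one> \<odot>\<^bsub>N\<^esub> s"
      using ha[OF x(1)] x(2) b mod_smult_assoc[OF N a(1) b(1) s(1)] mod_one_smult[OF N s(1)] by simp
    then have ab: "a \<otimes> b = \<one>" using s(2) a(1) b(1) by (auto simp: bij_betw_def inj_on_def)
    then show "a \<in> Units A" using a(1) b(1) m_comm[OF a(1) b(1)] unfolding Units_def by auto
  next
    assume u: "a \<in> Units A"
    have i: "inv a \<in> carrier A" using u by simp
    show "bij_betw h (carrier N) (carrier N)"
    proof (rule bij_betw_byWitness[where f' = "\<lambda>x. inv a \<odot>\<^bsub>N\<^esub> x"])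
      show "\<forall>x\<in>carrier N. inv a \<odot>\<^bsub>N\<^esub> h x = x"
        using ha mod_smult_assoc[OF N i a(1), symmetric] u N by simp
      show "\<forall>x\<in>carrier N. h (inv a \<odot>\<^bsub>N\<^esub> x) = x"
        using ha mod_smult_assoc[OF N a(1) i, symmetric] mod_smult_closed[OF N i] u N by simp
      show "h ` carrier N \<subseteq> carrier N" using hom_closed[OF h] by blast
      show "(\<lambda>x. inv a \<odot>\<^bsub>N\<^esub> x) ` carrier N \<subseteq> carrier N" using mod_smult_closed[OF N i] by blast
    qed
  qed
  then show ?thesis using a(1) ha by blast
qed

lemma rank_one_scalar_unique:
  fixes N :: "('a, 'm) module"
  assumes N: "module A N" and s: "s \<in> carrier N" "bij_betw (\<lambda>a. a \<odot>\<^bsub>N\<^esub> s) (carrier A) (carrier N)"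
    and ab: "a \<in> carrier A" "b \<in> carrier A" "a \<odot>\<^bsub>N\<^esub> s = b \<odot>\<^bsub>N\<^esub> s"
  shows "a = b"
  using inj_onD[OF bij_betw_imp_inj_on[OF s(2)] ab(3,1,2)] .

text \<open>Endomorphisms of a module of rank one are scalars, so the non-invertible ones form an ideal.\<close>

lemma rank_one_nonbij_add:
  fixes N :: "('a, 'm) module"
  assumes N: "module A N" "free_of_rank A N 1" and g: "g \<in> Hom N N" and h: "h \<in> Hom N N"
    and b: "bij_betw (\<lambda>x. g x \<oplus>\<^bsub>N\<^esub> h x) (carrier N) (carrier N)"
  shows "bij_betw g (carrier N) (carrier N) \<or> bij_betw h (carrier N) (carrier N)"
proof -
  obtain s where s: "s \<in> carrier N" "bij_betw (\<lambda>a. a \<odot>\<^bsub>N\<^esub> s) (carrier A) (carrier N)" using rank_one_generator[OF N] by blast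
  obtain a where a: "a \<in> carrier A" "\<forall>x\<in>carrier N. g x = a \<odot>\<^bsub>N\<^esub> x" "bij_betw g (carrier N) (carrier N) \<longleftrightarrow> a \<in> Units A"
    using rank_one_endo[OF N(1) s g] by blast
  obtain c where c: "c \<in> carrier A" "\<forall>x\<in>carrier N. h x = c \<odot>\<^bsub>N\<^esub> x" "bij_betw h (carrier N) (carrier N) \<longleftrightarrow> c \<in> Units A"
    using rank_one_endo[OF N(1) s h] by blast
  obtain d where d: "d \<in> carrier A" "\<forall>x\<in>carrier N. g x \<oplus>\<^bsub>N\<^esub> h x = d \<odot>\<^bsub>N\<^esub> x" "d \<in> Units A"
    using rank_one_endo[OF N(1) s hom_plus[OF g h N(1) N(1)]] b by blast
  have "d \<odot>\<^bsub>N\<^esub> s = (a \<oplus> c) \<odot>\<^bsub>N\<^esub> s" using a c d s(1) mod_l_distr[OF N(1) a(1) c(1) s(1)] by simp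
  then have "d = a \<oplus> c" by (rule rank_one_scalar_unique[OF N(1) s d(1) a_closed[OF a(1) c(1)]])
  then show ?thesis using nonunit_add[of a c] a(1,3) c(1,3) d(3) by blast
qed

lemma rank_one_nonbij_comp:
  fixes N :: "('a, 'm) module"
  assumes N: "module A N" "free_of_rank A N 1" and g: "g \<in> Hom N N" and h: "h \<in> Hom N N"
    and b: "bij_betw (\<lambda>x. g (h x)) (carrier N) (carrier N)"
  shows "bij_betw h (carrier N) (carrier N)"
proof -
  obtain s where s: "s \<in> carrier N" "bij_betw (\<lambda>a. a \<odot>\<^bsub>N\<^esub> s) (carrier A) (carrier N)" using rank_one_generator[OF N] by blast
  obtain a where a: "a \<in> carrier A" "\<forall>x\<in>carrier N. g x = a \<odot>\<^bsub>N\<^esub> x"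
    using rank_one_endo[OF N(1) s g] by blast
  obtain c where c: "c \<in> carrier A" "\<forall>x\<in>carrier N. h x = c \<odot>\<^bsub>N\<^esub> x" "bij_betw h (carrier N) (carrier N) \<longleftrightarrow> c \<in> Units A"
    using rank_one_endo[OF N(1) s h] by blast
  obtain d where d: "d \<in> carrier A" "\<forall>x\<in>carrier N. g (h x) = d \<odot>\<^bsub>N\<^esub> x" "d \<in> Units A"
    using rank_one_endo[OF N(1) s hom_comp[OF h g]] b by blast
  have "g (h s) = a \<odot>\<^bsub>N\<^esub> (c \<odot>\<^bsub>N\<^esub> s)" using a c s(1) mod_smult_closed[OF N(1) c(1) s(1)] by simp
  then have "d \<odot>\<^bsub>N\<^esub> s = (a \<otimes> c) \<odot>\<^bsub>N\<^esub> s" using d s(1) mod_smult_assoc[OF N(1) a(1) c(1) s(1)] by simp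
  then have "d = a \<otimes> c" by (rule rank_one_scalar_unique[OF N(1) s d(1) m_closed[OF a(1) c(1)]])
  then show ?thesis using nonunit_mult[of c a] a(1) c(1,3) d(3) by blast
qed

lemma rank_one_zero_nonbij:
  fixes N :: "('a, 'm) module"
  assumes N: "module A N" "free_of_rank A N 1"
  shows "\<not> bij_betw (\<lambda>x. \<zero>\<^bsub>N\<^esub>) (carrier N) (carrier N)"
proof
  assume b: "bij_betw (\<lambda>x. \<zero>\<^bsub>N\<^esub>) (carrier N) (carrier N)"
  obtain s where s: "s \<in> carrier N" "bij_betw (\<lambda>a. a \<odot>\<^bsub>N\<^esub> s) (carrier A) (carrier N)" using rank_one_generator[OF N] by blast
  have "s = \<zero>\<^bsub>N\<^esub>" using b s(1) N(1) by (auto simp: bij_betw_def inj_on_def)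
  then have "\<one> \<odot>\<^bsub>N\<^esub> s = \<zero> \<odot>\<^bsub>N\<^esub> s" using N(1) s(1) by simp
  from rank_one_scalar_unique[OF N(1) s _ _ this] show False using one_not_zero by simp
qed

end

section \<open>Objects with one generator\<close>

context graded_category
begin

text \<open>With no weights above, the whole weight space is the kernel of \<open>E\<close>. An adapted basis has then no
  indices outside \<open>C\<close>, since the coordinate of a basis element at itself is \<open>1\<close>.\<close>

lemma good_top_rank:
  fixes M :: "('v, 'a, 'm) xobj"
  assumes g: "good_at M \<mu> c" and M: "ops_above M \<mu>" and \<mu>: "\<mu> \<in> wl"
    and z: "\<And>\<alpha> n. \<alpha> \<in> simple D ==> n > 0 ==> trivial (wt M (shift \<mu> \<alpha> n))"
  shows "free_of_rank A (wt M \<mu>) c"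
proof -
  let ?N = "wt M \<mu>" and ?\<Delta> = "wt_delta D M \<mu>"
  note C = cornerD[OF good_atD(4)[OF g]]
  have Dz: "trivial ?\<Delta>" by (rule wt_delta_zero[OF M \<mu> z])
  have K: "mod_ker ?N ?\<Delta> (E_col D M \<mu>) = carrier ?N" using hom_closed[OF C(3)] Dz by (auto simp: mod_ker_def)
  have U: "F_row D M \<mu> ` carrier ?\<Delta> = {\<zero>\<^bsub>?N\<^esub>}" unfolding Dz using hom_zero[OF C(4,2,1)] by simp
  obtain I C' p b where ab: "adapted_basis ?N {\<zero>\<^bsub>?N\<^esub>} (carrier ?N) (I::nat set) C' p b" and card: "card C' = c"
    using C(8) unfolding K U by (auto simp: has_adapted_basis_def)
  note B = adapted_basisD[OF ab]
  have "I \<subseteq> C'"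
  proof
    fix i assume i: "i \<in> I"
    show "i \<in> C'"
    proof (rule ccontr)
      assume "i \<notin> C'"
      from B(8)[OF B(5)[OF i] i this] have "\<one> \<notin> Units A" using B(6)[OF i] i by (simp add: unit_vec_apply)
      then show False by simp
    qed
  qed
  then have IC: "C' = I" using B(2) by blast
  let ?k = "lincomb ?N I b"
  have k: "?k \<in> Hom (free_mod I) ?N" by (rule lincomb_hom[OF C(1) B(5)])
  have pk: "p (?k y) = y" if y: "y \<in> carrier (free_mod I)" for y
    by (rule coordinates_lincomb[OF C(1) B(3,5,6) y])
  have inj: "inj_on p (carrier ?N)"
    by (rule hom_inj_onI[OF B(3) C(1) module_free_mod]) (use B(4) in blast)
  have "bij_betw ?k (carrier (free_mod I)) (carrier ?N)"
  proof (rule bij_betw_byWitness[where f' = p])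
    show "\<forall>y\<in>carrier (free_mod I). p (?k y) = y" using pk by blast
    show "\<forall>x\<in>carrier ?N. ?k (p x) = x"
    proof
      fix x assume x: "x \<in> carrier ?N"
      note px = hom_closed[OF B(3) x]
      show "?k (p x) = x" by (rule inj_onD[OF inj pk[OF px] hom_closed[OF k px] x])
    qed
    show "?k ` carrier (free_mod I) \<subseteq> carrier ?N" using hom_closed[OF k] by blast
    show "p ` carrier ?N \<subseteq> carrier (free_mod I)" using hom_closed[OF B(3)] by blast
  qed
  from free_of_rankI[OF C(1) B(1) one_not_zero k this] show ?thesis using card IC by simp
qed

lemma zero_above_top:
  assumes le: "\<And>\<mu>. \<mu> \<in> weights D M ==> weight_le D \<mu> \<kappa>" and \<nu>: "\<nu> \<in> wl" "\<not> weight_le D \<nu> \<kappa>"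
  shows "trivial (wt M \<nu>)"
proof (rule ccontr)
  assume "\<not> trivial (wt M \<nu>)"
  then have "\<nu> \<in> weights D M" unfolding weights_iff using \<nu>(1) by (rule conjI[rotated])
  from le[OF this] \<nu>(2) show False by contradiction
qed

lemma zero_hom_bij:
  assumes f: "f \<in> Hom M N" and M: "module A M" "trivial M" and N: "module A N" "trivial N"
  shows "bij_betw f (carrier M) (carrier N)"
  unfolding M(2) N(2) using hom_zero[OF f M(1) N(1)] by (simp add: bij_betw_def)

text \<open>Below \<open>\<kappa>\<close> all multiplicities vanish, so bijectivity propagates downwards from \<open>\<kappa>\<close>.\<close>

lemma good_endo_bij:
  assumes gS: "\<And>\<mu>. \<mu> \<in> wl ==> good_at S \<mu> (if \<mu> = \<kappa> then 1 else 0)"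
    and le: "\<And>\<mu>. \<mu> \<in> weights D S ==> weight_le D \<mu> \<kappa>"
    and fh: "\<And>\<mu>. \<mu> \<in> wl ==> f \<mu> \<in> Hom (wt S \<mu>) (wt S \<mu>)" and fc: "\<And>\<mu>. \<mu> \<in> wl ==> compat_at f S S \<mu>"
    and \<kappa>: "bij_betw (f \<kappa>) (carrier (wt S \<kappa>)) (carrier (wt S \<kappa>))" and \<mu>: "\<mu> \<in> wl"
  shows "bij_betw (f \<mu>) (carrier (wt S \<mu>)) (carrier (wt S \<mu>))"
  using \<mu>
proof (induction "nat \<lfloor>height \<kappa> - height \<mu>\<rfloor>" arbitrary: \<mu> rule: less_induct)
  case less
  note \<mu> = less.prems
  have ops: "ops_at S \<nu>" if "\<nu> \<in> wl" for \<nu> using good_atD(1)[OF gS[OF that]] .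
  have above: "ops_above S \<nu>" for \<nu> using ops by (simp add: ops_above_def)
  note mods = ops_atD(1)[OF ops]
  have off: "bij_betw (f \<nu>) (carrier (wt S \<nu>)) (carrier (wt S \<nu>))" if \<nu>: "\<nu> \<in> wl" "\<not> weight_le D \<nu> \<kappa>" for \<nu>
    by (rule zero_hom_bij[OF fh[OF \<nu>(1)] mods[OF \<nu>(1)] zero_above_top[OF le \<nu>] mods[OF \<nu>(1)] zero_above_top[OF le \<nu>]])
  consider "\<mu> = \<kappa>" | "\<not> weight_le D \<mu> \<kappa>" | "\<mu> \<noteq> \<kappa>" "weight_le D \<mu> \<kappa>" by blast
  then show ?case
  proof cases
    case 1
    then show ?thesis using \<kappa> by simp
  next
    case 2
    show ?thesis by (rule off[OF \<mu> 2])
  next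
    case 3
    have g: "good_at S \<mu> 0" using gS[OF \<mu>] 3(1) by simp
    have fa: "hom_above f S S \<mu>" unfolding hom_above_def by (intro ballI impI conjI fh fc)
    have fb: "bij_betw (f \<nu>) (carrier (wt S \<nu>)) (carrier (wt S \<nu>))" if \<nu>: "\<nu> \<in> wl" "weight_lt \<mu> \<nu>" for \<nu>
    proof (cases "weight_le D \<nu> \<kappa>")
      case True
      obtain k :: nat where "height \<kappa> = height \<nu> + real k" using weight_le_height[OF True] by blast
      then have "nat \<lfloor>height \<kappa> - height \<nu>\<rfloor> < nat \<lfloor>height \<kappa> - height \<mu>\<rfloor>"
        using weight_lt_height[OF \<nu>(2)] by linarith
      from less.hyps[OF this \<nu>(1)] show ?thesis .
    next
      case False
      show ?thesis by (rule off[OF \<nu>(1) False])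
    qed
    have db: "bij_betw (delta_map f \<mu>) (carrier (wt_delta D S \<mu>)) (carrier (wt_delta D S \<mu>))"
      by (rule delta_map_bij[OF above above \<mu> fa]) (rule fb)
    show ?thesis
    proof (rule corner_hom_bij[where g = "delta_map f \<mu>", OF good_atD(4)[OF g] good_atD(4)[OF g] delta_map_hom[OF above above \<mu> fa] db fh[OF \<mu>]])
      show "E_col D S \<mu> (f \<mu> x) = delta_map f \<mu> (E_col D S \<mu> x)" if "x \<in> carrier (wt S \<mu>)" for x
        by (rule compat_at_E_col[OF ops[OF \<mu>] good_atD(2)[OF g] fc[OF \<mu>] that])
      show "f \<mu> (F_row D S \<mu> y) = F_row D S \<mu> (delta_map f \<mu> y)" if "y \<in> carrier (wt_delta D S \<mu>)" for y
        by (rule compat_at_F_row[OF ops[OF \<mu>] above ops[OF \<mu>] above \<mu> fh[OF \<mu>] fa fc[OF \<mu>] that])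
    qed
  qed
qed

lemma single_compat:
  assumes M: "\<And>i \<mu>. i \<in> J ==> \<mu> \<in> wl ==> ops_at (M i) \<mu>" and i: "i \<in> J" and \<mu>: "\<mu> \<in> wl"
  shows "compat_at (\<lambda>\<mu>. dsingle (\<lambda>i. wt (M i) \<mu>) J i) (M i) (X_dsum J M) \<mu>"
  unfolding compat_at_def X_dsum_simps
proof (intro ballI allI impI conjI)
  fix \<alpha> and n :: nat assume a: "\<alpha> \<in> simple D" "0 < n"
  note s = wl_shift[OF \<mu> a(1), of n]
  note mods = ops_atD(1)[OF M]
  have E: "opE (M j) \<mu> \<alpha> n \<in> Hom (wt (M j) \<mu>) (wt (M j) (shift \<mu> \<alpha> n))"
    and F: "opF (M j) \<mu> \<alpha> n \<in> Hom (wt (M j) (shift \<mu> \<alpha> n)) (wt (M j) \<mu>)" if "j \<in> J" for j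
    using M[OF that \<mu>] a by (auto simp: ops_at_def)
  show "dsingle (\<lambda>i. wt (M i) (shift \<mu> \<alpha> n)) J i (opE (M i) \<mu> \<alpha> n x)
      = dsum_map J (\<lambda>i. opE (M i) \<mu> \<alpha> n) (dsingle (\<lambda>i. wt (M i) \<mu>) J i x)" for x
    by (rule dsum_map_single[where g = "\<lambda>i. opE (M i) \<mu> \<alpha> n", OF mods[OF _ \<mu>] mods[OF _ s] E i, symmetric])
  show "dsingle (\<lambda>i. wt (M i) \<mu>) J i (opF (M i) \<mu> \<alpha> n x)
      = dsum_map J (\<lambda>i. opF (M i) \<mu> \<alpha> n) (dsingle (\<lambda>i. wt (M i) (shift \<mu> \<alpha> n)) J i x)" for x
    by (rule dsum_map_single[where g = "\<lambda>i. opF (M i) \<mu> \<alpha> n", OF mods[OF _ s] mods[OF _ \<mu>] F i, symmetric])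
qed

lemma compat_comp:
  assumes f: "\<And>\<mu>. \<mu> \<in> wl ==> f \<mu> \<in> Hom (wt M \<mu>) (wt N \<mu>)" "compat_at f M N \<mu>"
    and g: "compat_at g N P \<mu>" and M: "ops_at M \<mu>" and \<mu>: "\<mu> \<in> wl"
  shows "compat_at (\<lambda>\<mu> x. g \<mu> (f \<mu> x)) M P \<mu>"
  unfolding compat_at_def
proof (intro ballI allI impI conjI)
  fix \<alpha> and n :: nat assume a: "\<alpha> \<in> simple D" "0 < n"
  show "g (shift \<mu> \<alpha> n) (f (shift \<mu> \<alpha> n) (opE M \<mu> \<alpha> n x)) = opE P \<mu> \<alpha> n (g \<mu> (f \<mu> x))" if x: "x \<in> carrier (wt M \<mu>)" for x
    using f(2) g a x hom_closed[OF f(1)[OF \<mu>] x] by (simp add: compat_at_def)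
  show "g \<mu> (f \<mu> (opF M \<mu> \<alpha> n x)) = opF P \<mu> \<alpha> n (g (shift \<mu> \<alpha> n) (f (shift \<mu> \<alpha> n) x))" if x: "x \<in> carrier (wt M (shift \<mu> \<alpha> n))" for x
    using f(2) g a x hom_closed[OF f(1)[OF wl_shift[OF \<mu> a(1)]] x] by (simp add: compat_at_def)
qed

text \<open>The two idempotents of a decomposition add up to the identity. At \<open>\<kappa>\<close> they are scalars of a local
  ring, so one of them is bijective there, hence everywhere, and the other summand vanishes.\<close>

lemma good_indecomposable:
  fixes S :: "('v, 'a, 'm) xobj"
  assumes gS: "\<And>\<mu>. \<mu> \<in> wl ==> good_at S \<mu> (if \<mu> = \<kappa> then 1 else 0)"
    and le: "\<And>\<mu>. \<mu> \<in> weights D S ==> weight_le D \<mu> \<kappa>" and \<kappa>: "\<kappa> \<in> wl" and rank: "free_of_rank A (wt S \<kappa>) 1"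
    and N: "\<And>b \<mu>. \<mu> \<in> wl ==> ops_at (N b) \<mu>"
    and iso: "X_iso A D S (X_dsum (UNIV :: bool set) N)"
  shows "\<exists>b. zero_object D (N b)"
proof -
  let ?X = "X_dsum (UNIV :: bool set) N"
  obtain f g where f: "f \<in> X_hom A D S ?X" and g: "g \<in> X_hom A D ?X S"
    and gf: "\<And>\<mu> x. \<mu> \<in> wl ==> x \<in> carrier (wt S \<mu>) ==> g \<mu> (f \<mu> x) = x"
    and fg: "\<And>\<mu> y. \<mu> \<in> wl ==> y \<in> carrier (wt ?X \<mu>) ==> f \<mu> (g \<mu> y) = y"
    using X_isoD[OF iso] by blast
  note fh = X_homD(1)[OF f] and fc = X_homD(2)[OF f] and gh = X_homD(1)[OF g] and gc = X_homD(2)[OF g]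
  have oS: "ops_at S \<mu>" if "\<mu> \<in> wl" for \<mu> using good_atD(1)[OF gS[OF that]] .
  have oX: "ops_at ?X \<mu>" if "\<mu> \<in> wl" for \<mu> by (rule ops_at_dsum[OF N that])
  have mS: "module A (wt S \<mu>)" and mX: "module A (wt ?X \<mu>)" and mN: "module A (wt (N b) \<mu>)" if "\<mu> \<in> wl" for \<mu> b
    using oS[OF that] oX[OF that] N[OF that] by (simp_all add: ops_at_def)
  let ?i = "\<lambda>b \<mu>. dsingle (\<lambda>b. wt (N b) \<mu>) UNIV b"
  define p where "p b \<mu> x = f \<mu> x b" for b \<mu> x
  define e where "e b \<mu> x = g \<mu> (?i b \<mu> (p b \<mu> x))" for b \<mu> x
  have ih: "?i b \<mu> \<in> Hom (wt (N b) \<mu>) (wt ?X \<mu>)" if "\<mu> \<in> wl" for b \<mu>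
    unfolding X_dsum_simps by (rule dsingle_hom[where M = "\<lambda>b. wt (N b) \<mu>"]) (use mN[OF that] in simp_all)
  have ph: "p b \<mu> \<in> Hom (wt S \<mu>) (wt (N b) \<mu>)" if "\<mu> \<in> wl" for b \<mu>
    unfolding p_def by (rule hom_comp[OF fh[OF that] proj_hom]) simp
  have pc: "compat_at (p b) S (N b) \<mu>" if "\<mu> \<in> wl" for b \<mu>
    unfolding p_def by (rule compat_comp[where f = f and g = "\<lambda>_ y. y b", OF fh fc[OF that] proj_compat oS[OF that] that]) simp_all
  have qh: "(\<lambda>x. ?i b \<mu> (p b \<mu> x)) \<in> Hom (wt S \<mu>) (wt ?X \<mu>)" if "\<mu> \<in> wl" for b \<mu>
    by (rule hom_comp[OF ph[OF that] ih[OF that]])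
  have qc: "compat_at (\<lambda>\<mu> x. ?i b \<mu> (p b \<mu> x)) S ?X \<mu>" if "\<mu> \<in> wl" for b \<mu>
    by (rule compat_comp[where f = "p b" and g = "?i b", OF ph pc[OF that] single_compat[where M = N, OF N UNIV_I that] oS[OF that] that])
  have eh: "e b \<mu> \<in> Hom (wt S \<mu>) (wt S \<mu>)" if "\<mu> \<in> wl" for b \<mu>
    unfolding e_def by (rule hom_comp[OF qh[OF that] gh[OF that]])
  have ec: "compat_at (e b) S S \<mu>" if "\<mu> \<in> wl" for b \<mu>
    unfolding e_def by (rule compat_comp[where f = "\<lambda>\<mu> x. ?i b \<mu> (p b \<mu> x)" and g = g, OF qh qc[OF that] gc[OF that] oS[OF that] that])
  have sum: "e True \<mu> x \<oplus>\<^bsub>wt S \<mu>\<^esub> e False \<mu> x = x" if \<mu>: "\<mu> \<in> wl" and x: "x \<in> carrier (wt S \<mu>)" for \<mu> x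
  proof -
    let ?q = "\<lambda>b. ?i b \<mu> (p b \<mu> x)"
    have q: "?q b \<in> carrier (wt ?X \<mu>)" for b by (rule hom_closed[OF qh[OF \<mu>] x])
    have "?q True \<oplus>\<^bsub>wt ?X \<mu>\<^esub> ?q False = f \<mu> x"
    proof (rule dsum_eqI[where I = UNIV and M = "\<lambda>b. wt (N b) \<mu>"])
      show "?q True \<oplus>\<^bsub>wt ?X \<mu>\<^esub> ?q False \<in> carrier (dsum_module UNIV (\<lambda>b. wt (N b) \<mu>))"
        using mod_add_closed[OF mX[OF \<mu>] q q] by (simp only: X_dsum_simps)
      show "f \<mu> x \<in> carrier (dsum_module UNIV (\<lambda>b. wt (N b) \<mu>))"
        using hom_closed[OF fh[OF \<mu>] x] by (simp only: X_dsum_simps)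
      fix b
      have "p b \<mu> x \<in> carrier (wt (N b) \<mu>)" by (rule hom_closed[OF ph[OF \<mu>] x])
      then show "(?q True \<oplus>\<^bsub>wt ?X \<mu>\<^esub> ?q False) b = f \<mu> x b"
        using mN[OF \<mu>] by (cases b) (simp_all add: X_dsum_simps dsum_simps(3) dsingle_def p_def)
    qed
    then have "g \<mu> (?q True \<oplus>\<^bsub>wt ?X \<mu>\<^esub> ?q False) = x" using gf[OF \<mu> x] by simp
    then show ?thesis unfolding e_def hom_add[OF gh[OF \<mu>] q q] .
  qed
  have "bij_betw (\<lambda>x. x) (carrier (wt S \<kappa>)) (carrier (wt S \<kappa>))" by (simp add: bij_betw_def)
  then have "bij_betw (\<lambda>x. e True \<kappa> x \<oplus>\<^bsub>wt S \<kappa>\<^esub> e False \<kappa> x) (carrier (wt S \<kappa>)) (carrier (wt S \<kappa>))"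
    by (subst bij_betw_cong[where g = "\<lambda>x. x"]) (use sum[OF \<kappa>] in simp_all)
  from rank_one_nonbij_add[OF mS[OF \<kappa>] rank eh[OF \<kappa>] eh[OF \<kappa>] this]
  obtain b where b: "bij_betw (e b \<kappa>) (carrier (wt S \<kappa>)) (carrier (wt S \<kappa>))" by blast
  have eb: "bij_betw (e b \<mu>) (carrier (wt S \<mu>)) (carrier (wt S \<mu>))" if "\<mu> \<in> wl" for \<mu>
    by (rule good_endo_bij[where f = "e b", OF gS le eh ec b that])
  have "trivial (wt (N (\<not> b)) \<mu>)" if \<mu>: "\<mu> \<in> wl" for \<mu>
  proof (intro equalityI subsetI)
    fix y assume y: "y \<in> carrier (wt (N (\<not> b)) \<mu>)"
    let ?y = "?i (\<not> b) \<mu> y"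
    have yc: "?y \<in> carrier (wt ?X \<mu>)" by (rule hom_closed[OF ih[OF \<mu>] y])
    let ?x = "g \<mu> ?y"
    have x: "?x \<in> carrier (wt S \<mu>)" by (rule hom_closed[OF gh[OF \<mu>] yc])
    have p0: "p b \<mu> ?x = \<zero>\<^bsub>wt (N b) \<mu>\<^esub>" unfolding p_def fg[OF \<mu> yc] by (simp add: dsingle_def)
    have "e b \<mu> ?x = \<zero>\<^bsub>wt S \<mu>\<^esub>"
      unfolding e_def p0 hom_zero[OF ih[OF \<mu>] mN[OF \<mu>] mX[OF \<mu>]] by (rule hom_zero[OF gh[OF \<mu>] mX[OF \<mu>] mS[OF \<mu>]])
    then have "e b \<mu> ?x = e b \<mu> \<zero>\<^bsub>wt S \<mu>\<^esub>" using hom_zero[OF eh[OF \<mu>] mS[OF \<mu>] mS[OF \<mu>]] by simp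
    then have "?x = \<zero>\<^bsub>wt S \<mu>\<^esub>"
      by (rule inj_onD[OF bij_betw_imp_inj_on[OF eb[OF \<mu>]] _ x mod_zero_closed[OF mS[OF \<mu>]]])
    then have "?y = \<zero>\<^bsub>wt ?X \<mu>\<^esub>" using fg[OF \<mu> yc] hom_zero[OF fh[OF \<mu>] mS[OF \<mu>] mX[OF \<mu>]] by simp
    from fun_cong[OF this, of "\<not> b"] have "y = \<zero>\<^bsub>wt (N (\<not> b)) \<mu>\<^esub>" by (simp add: X_dsum_simps dsum_simps(2) dsingle_def)
    then show "y \<in> {\<zero>\<^bsub>wt (N (\<not> b)) \<mu>\<^esub>}" by simp
  qed (use mN[OF \<mu>] in simp)
  then have "zero_object D (N (\<not> b))" by (simp add: zero_object_def weights_def)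
  then show ?thesis by blast
qed

lemma good_Smax_property:
  fixes S :: "('v, 'a, 'm) xobj"
  assumes gS: "\<And>\<mu>. \<mu> \<in> wl ==> good_at S \<mu> (if \<mu> = \<kappa> then 1 else 0)" and qb: "quasi_bounded D (weights D S)"
    and le: "\<And>\<mu>. \<mu> \<in> weights D S ==> weight_le D \<mu> \<kappa>" and \<kappa>: "\<kappa> \<in> wl"
  shows "Smax_property A \<phi> D \<kappa> S"
proof -
  have max: "maximal_object A \<phi> D S" by (rule good_imp_maximal_object[OF qb]) (use gS in blast)
  then have X: "X_object A \<phi> D S" by (simp add: maximal_object_def)
  have g1: "good_at S \<kappa> 1" using gS[OF \<kappa>] by simp
  have above: "ops_above S \<kappa>" using good_atD(1)[OF gS] by (simp add: ops_above_def)
  have z: "trivial (wt S (shift \<kappa> \<alpha> n))" if "\<alpha> \<in> simple D" "n > 0" for \<alpha> n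
    by (rule zero_above_top[OF le wl_shift[OF \<kappa> that(1)] weight_lt_irrefl[OF weight_lt_shift[OF that]]])
  have rank: "free_of_rank A (wt S \<kappa>) 1" by (rule good_top_rank[OF g1 above \<kappa> z])
  have "\<kappa> \<in> weights D S" by (rule good_pos_weight[OF g1 _ \<kappa>]) simp
  then have nz: "\<not> zero_object D S" by (auto simp: zero_object_def)
  have "zero_object D N1 \<or> zero_object D N2"
    if N: "X_object A \<phi> D N1" "X_object A \<phi> D N2" and iso: "X_iso A D S (X_dsum UNIV (\<lambda>b. if b then N1 else N2))"
    for N1 N2 :: "('v, 'a, 'm) xobj"
  proof -
    have "ops_at (if b then N1 else N2) \<mu>" if "\<mu> \<in> wl" for b \<mu>
      using N that by (simp add: X_object_def graded_with_ops_iff)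
    from good_indecomposable[OF gS le \<kappa> rank this iso] obtain b where "zero_object D (if b then N1 else N2)" by blast
    then show ?thesis by (cases b) simp_all
  qed
  then have "indecomposable A \<phi> D S" unfolding indecomposable_def using X nz by blast
  then show ?thesis unfolding Smax_property_def using X rank le max by blast
qed

end

context graded_category
begin

section \<open>Uniqueness of indecomposable maximal objects\<close>

lemma free_rank_good:
  fixes S :: "('v, 'a, 'm) xobj"
  assumes ops: "\<And>\<mu>. \<mu> \<in> wl ==> ops_at S \<mu>" and le: "\<And>\<mu>. \<mu> \<in> weights D S ==> weight_le D \<mu> \<kappa>" and \<kappa>: "\<kappa> \<in> wl"
    and rank: "free_of_rank A (wt S \<kappa>) n"
  shows "good_at S \<kappa> n"
proof -
  note N = ops_atD(1)[OF ops[OF \<kappa>]]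
  obtain B where B: "module_basis A (wt S \<kappa>) B" "finite B" "card B = n" using rank by (auto simp: free_of_rank_def)
  have k: "B \<subseteq> carrier (wt S \<kappa>)" "bij_betw (lincomb (wt S \<kappa>) B (\<lambda>b. b)) (carrier (free_mod B)) (carrier (wt S \<kappa>))"
    using B(1) unfolding module_basis_iff[OF N] by simp_all
  have above: "ops_above S \<kappa>" using ops by (simp add: ops_above_def)
  have z: "trivial (wt S (shift \<kappa> \<alpha> n))" if "\<alpha> \<in> simple D" "n > 0" for \<alpha> n
    by (rule zero_above_top[OF le wl_shift[OF \<kappa> that(1)] weight_lt_irrefl[OF weight_lt_shift[OF that]]])
  have hom: "lincomb (wt S \<kappa>) B (\<lambda>b. b) \<in> Hom (free_mod B) (wt S \<kappa>)"
    by (rule lincomb_hom[OF N]) (use k(1) in blast)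
  from good_top[OF \<kappa> ops[OF \<kappa>] above z B(2) hom k(2)] show ?thesis using B(3) by simp
qed

lemma quasi_bounded_Un: "quasi_bounded D V ==> quasi_bounded D W ==> quasi_bounded D (V \<union> W)"
proof -
  assume VW: "quasi_bounded D V" "quasi_bounded D W"
  have "{\<nu> \<in> V \<union> W. weight_le D \<mu> \<nu>} = {\<nu> \<in> V. weight_le D \<mu> \<nu>} \<union> {\<nu> \<in> W. weight_le D \<mu> \<nu>}" for \<mu> by blast
  then show ?thesis using VW by (simp add: quasi_bounded_def)
qed

text \<open>Both sides have the same multiplicities.\<close>

lemma generator_decomposition:
  fixes S :: "('v, 'a, 'm) xobj" and G :: "'v => ('v, 'a, 'n) xobj"
  assumes gS: "\<And>\<mu>. \<mu> \<in> wl ==> good_at S \<mu> (c \<mu>)" and qS: "quasi_bounded D (weights D S)"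
    and G: "\<And>\<kappa> \<mu>. \<kappa> \<in> wl ==> \<mu> \<in> wl ==> good_at (G \<kappa>) \<mu> (if \<mu> = \<kappa> then 1 else 0)"
      "\<And>\<kappa> \<mu>. \<kappa> \<in> wl ==> \<mu> \<in> weights D (G \<kappa>) ==> weight_le D \<mu> \<kappa>"
  shows "X_iso A D S (X_dsum {(\<mu>, k). \<mu> \<in> wl \<and> k < c \<mu>} (\<lambda>i. G (fst i)))"
proof (rule iso_exists[where k = c, OF qS _ gS])
  let ?J = "{(\<mu>, k). \<mu> \<in> wl \<and> k < c \<mu>}"
  show "quasi_bounded D (weights D (X_dsum ?J (\<lambda>i. G (fst i))))"
    by (rule good_dsum_generators(1)[where S = S and c = c and G = G, OF gS qS G subset_refl])
  fix \<mu> assume \<mu>: "\<mu> \<in> wl"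
  have "{k. (\<mu>, k) \<in> ?J} = {..<c \<mu>}" using \<mu> by auto
  then have "card {k. (\<mu>, k) \<in> ?J} = c \<mu>" by simp
  moreover have "good_at (X_dsum ?J (\<lambda>i. G (fst i))) \<mu> (card {k. (\<mu>, k) \<in> ?J})"
    by (rule good_dsum_generators(2)[where S = S and c = c and G = G, OF gS qS G subset_refl \<mu>])
  ultimately show "good_at (X_dsum ?J (\<lambda>i. G (fst i))) \<mu> (c \<mu>)" by simp
qed

lemma zero_extension:
  fixes M :: "'i => ('a, 'n) module"
  assumes M: "\<And>i. i \<in> J ==> module A (M i)" and I: "I \<subseteq> J"
  shows "\<And>y. y \<in> carrier (dsum_module I M) ==> (\<lambda>i\<in>J. if i \<in> I then y i else \<zero>\<^bsub>M i\<^esub>) \<in> carrier (dsum_module J M)"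
    and "inj_on (\<lambda>y. \<lambda>i\<in>J. if i \<in> I then y i else \<zero>\<^bsub>M i\<^esub>) (carrier (dsum_module I M))"
proof -
  let ?h = "\<lambda>y. \<lambda>i\<in>J. if i \<in> I then y i else \<zero>\<^bsub>M i\<^esub>"
  show "?h y \<in> carrier (dsum_module J M)" if y: "y \<in> carrier (dsum_module I M)" for y
    unfolding dsum_simps(1)
  proof (intro CollectI conjI)
    show "?h y \<in> (\<Pi>\<^sub>E i\<in>J. carrier (M i))" using dsum_component[OF y] M by auto
    have "finite {i \<in> I. y i \<noteq> \<zero>\<^bsub>M i\<^esub>}" using y by (simp add: dsum_simps(1))
    moreover have "{i \<in> J. ?h y i \<noteq> \<zero>\<^bsub>M i\<^esub>} \<subseteq> {i \<in> I. y i \<noteq> \<zero>\<^bsub>M i\<^esub>}" by auto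
    ultimately show "finite {i \<in> J. ?h y i \<noteq> \<zero>\<^bsub>M i\<^esub>}" by (rule rev_finite_subset)
  qed
  show "inj_on ?h (carrier (dsum_module I M))"
  proof (rule inj_onI)
    fix y z assume y: "y \<in> carrier (dsum_module I M)" and z: "z \<in> carrier (dsum_module I M)" and eq: "?h y = ?h z"
    show "y = z"
    proof (rule dsum_eqI[OF y z])
      fix i assume i: "i \<in> I"
      then show "y i = z i" using fun_cong[OF eq, of i] I by auto
    qed
  qed
qed

text \<open>The multiplicity at \<open>\<kappa>\<close> may be taken to be the rank \<open>1\<close>. Were there another generator at \<open>\<mu>\<close>, one
  could compare \<open>S\<close> with the sum of the objects generated by its individual generators. Separating
  the generator at \<open>\<kappa>\<close> from the others would split \<open>S\<close> into two objects, with the weights \<open>\<kappa>\<close> and \<open>\<mu>\<close>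
  respectively, so \<open>S\<close> would be decomposable.\<close>

lemma Smax_good:
  fixes S :: "('v, 'a, 'm) xobj"
  assumes S: "Smax_property A \<phi> D \<kappa> S" and \<kappa>: "\<kappa> \<in> wl" and \<mu>: "\<mu> \<in> wl"
  shows "good_at S \<mu> (if \<mu> = \<kappa> then 1 else 0)"
proof -
  have max: "maximal_object A \<phi> D S" and ind: "indecomposable A \<phi> D S" and rank: "free_of_rank A (wt S \<kappa>) 1"
    and le: "\<And>\<mu>. \<mu> \<in> weights D S ==> weight_le D \<mu> \<kappa>"
    using S by (auto simp: Smax_property_def)
  have qS: "quasi_bounded D (weights D S)" using S by (simp add: Smax_property_def X_object_def axiom_X1_def)
  obtain c0 where c0: "\<And>\<mu>. \<mu> \<in> wl ==> good_at S \<mu> (c0 \<mu>)"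
    using maximal_object_imp_good[OF max] by metis
  have g1: "good_at S \<kappa> 1" by (rule free_rank_good[OF good_atD(1)[OF c0] le \<kappa> rank])
  \<comment> \<open>the value chosen for \<open>c0 \<kappa>\<close> is arbitrary among the possible ones and is replaced by \<open>1\<close>\<close>
  define c where "c = c0(\<kappa> := 1)"
  have c\<kappa>: "c \<kappa> = 1" by (simp add: c_def)
  have gS: "good_at S \<nu> (c \<nu>)" if "\<nu> \<in> wl" for \<nu> using g1 c0[OF that] by (simp add: c_def)
  have "c \<mu> = 0" if ne: "\<mu> \<noteq> \<kappa>"
  proof (rule ccontr)
    assume c\<mu>: "c \<mu> \<noteq> 0"
    have "\<forall>\<kappa>\<in>wl. \<exists>S :: ('v, 'a, (nat => 'a) set) xobj. (\<forall>\<mu>\<in>wl. good_at S \<mu> (if \<mu> = \<kappa> then 1 else 0)) \<and>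
       quasi_bounded D (weights D S) \<and> (\<forall>\<mu>\<in>weights D S. weight_le D \<mu> \<kappa>)"
      using good_exists by (rule ballI)
    from bchoice[OF this] obtain G :: "'v => ('v, 'a, (nat => 'a) set) xobj" where
      G0: "\<forall>\<kappa>\<in>wl. (\<forall>\<mu>\<in>wl. good_at (G \<kappa>) \<mu> (if \<mu> = \<kappa> then 1 else 0)) \<and>
       quasi_bounded D (weights D (G \<kappa>)) \<and> (\<forall>\<mu>\<in>weights D (G \<kappa>). weight_le D \<mu> \<kappa>)" ..
    have G: "good_at (G \<kappa>) \<mu> (if \<mu> = \<kappa> then 1 else 0)" if "\<kappa> \<in> wl" "\<mu> \<in> wl" for \<kappa> \<mu> using G0 that by blast
    have G': "weight_le D \<mu> \<kappa>" if "\<kappa> \<in> wl" "\<mu> \<in> weights D (G \<kappa>)" for \<kappa> \<mu> using G0 that by blast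
    let ?J = "{(\<mu>, k). \<mu> \<in> wl \<and> k < c \<mu>}" and ?T = "\<lambda>J. X_dsum J (\<lambda>i. G (fst i))"
    define J where "J b = (if b then {(\<kappa>, 0)} else ?J - {(\<kappa>, 0)})" for b :: bool
    have JJ: "J b \<subseteq> ?J" for b using \<kappa> c\<kappa> by (auto simp: J_def)
    note T = good_dsum_generators[where S = S and c = c and G = G, OF gS qS G G' JJ]
    obtain g where g: "g \<in> X_hom A D (?T ?J) S" and ginj: "\<And>\<nu>. \<nu> \<in> wl ==> inj_on (g \<nu>) (carrier (wt (?T ?J) \<nu>))"
    proof -
      obtain f g where fg: "g \<in> X_hom A D (?T ?J) S" "\<forall>\<nu>\<in>wl. \<forall>y\<in>carrier (wt (?T ?J) \<nu>). f \<nu> (g \<nu> y) = y"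
        using X_isoD[OF generator_decomposition[where G = G, OF gS qS G G']] by blast
      have "inj_on (g \<nu>) (carrier (wt (?T ?J) \<nu>))" if "\<nu> \<in> wl" for \<nu>
        by (rule inj_on_inverseI[where g = "f \<nu>"]) (use fg(2) that in blast)
      then show ?thesis by (rule that[OF fg(1)])
    qed
    have mG: "module A (wt (G \<kappa>) \<nu>)" if "\<kappa> \<in> wl" "\<nu> \<in> wl" for \<kappa> \<nu> using good_atD(1)[OF G[OF that]] by (simp add: ops_at_def)
    have "\<exists>N :: ('v, 'a, 'm) xobj. (\<forall>\<nu>\<in>wl. good_at N \<nu> (card {k. (\<nu>, k) \<in> J b})) \<and> weights D N = weights D (?T (J b))" for b
    proof (rule good_transport[OF T(2)])
      fix \<nu> assume \<nu>: "\<nu> \<in> wl"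
      let ?M = "\<lambda>i. wt (G (fst i)) \<nu>"
      \<comment> \<open>extension by zero embeds the partial sums into the sum isomorphic to \<open>S\<close>\<close>
      let ?h = "\<lambda>y. \<lambda>i\<in>?J. if i \<in> J b then y i else \<zero>\<^bsub>?M i\<^esub>"
      have mods: "module A (?M i)" if "i \<in> ?J" for i using mG[OF _ \<nu>] that by auto
      note ze = zero_extension[where M = ?M, OF mods JJ[of b]]
      have "inj_on (g \<nu> \<circ> ?h) (carrier (dsum_module (J b) ?M))"
      proof (rule comp_inj_on[OF ze(2)])
        show "inj_on (g \<nu>) (?h ` carrier (dsum_module (J b) ?M))"
          by (rule inj_on_subset[OF ginj[OF \<nu>]]) (use ze(1) in \<open>auto simp: X_dsum_simps\<close>)
      qed
      then show "inj_on (g \<nu> \<circ> ?h) (carrier (wt (?T (J b)) \<nu>))" by (simp only: X_dsum_simps)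
    qed
    then have "\<forall>b. \<exists>N :: ('v, 'a, 'm) xobj. (\<forall>\<nu>\<in>wl. good_at N \<nu> (card {k. (\<nu>, k) \<in> J b})) \<and> weights D N = weights D (?T (J b))" ..
    from choice[OF this] obtain N :: "bool => ('v, 'a, 'm) xobj" where
      N0: "\<forall>b. (\<forall>\<nu>\<in>wl. good_at (N b) \<nu> (card {k. (\<nu>, k) \<in> J b})) \<and> weights D (N b) = weights D (?T (J b))" ..
    have N: "good_at (N b) \<nu> (card {k. (\<nu>, k) \<in> J b})" if "\<nu> \<in> wl" for b \<nu> using N0 that by blast
    have qN: "quasi_bounded D (weights D (N b))" for b using N0 T(1)[of b] by simp
    let ?X = "X_dsum (UNIV :: bool set) N"
    have "(\<Union>b\<in>UNIV. weights D (N b)) = weights D (N True) \<union> weights D (N False)" by (auto simp: UNIV_bool)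
    then have qU: "quasi_bounded D (\<Union>b\<in>UNIV. weights D (N b))" using quasi_bounded_Un[OF qN qN] by simp
    have sum: "(\<Sum>b\<in>UNIV. card {k. (\<nu>, k) \<in> J b}) = c \<nu>" if \<nu>: "\<nu> \<in> wl" for \<nu>
    proof -
      have "{k. (\<nu>, k) \<in> J True} \<union> {k. (\<nu>, k) \<in> J False} = {..<c \<nu>}" using \<nu> c\<kappa> by (auto simp: J_def)
      moreover have "card ({k. (\<nu>, k) \<in> J True} \<union> {k. (\<nu>, k) \<in> J False}) = card {k. (\<nu>, k) \<in> J True} + card {k. (\<nu>, k) \<in> J False}"
      proof (rule card_Un_disjoint)
        show "finite {k. (\<nu>, k) \<in> J True}" by (rule finite_subset[of _ "{0}"]) (auto simp: J_def)
        show "finite {k. (\<nu>, k) \<in> J False}" by (rule finite_subset[of _ "{..<c \<nu>}"]) (auto simp: J_def)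
      qed (auto simp: J_def)
      ultimately show ?thesis by (simp add: UNIV_bool)
    qed
    have gX: "good_at ?X \<nu> (c \<nu>)" if \<nu>: "\<nu> \<in> wl" for \<nu>
      using good_dsum[where J = UNIV and M = N and c = "\<lambda>b \<nu>. card {k. (\<nu>, k) \<in> J b}" and K = UNIV, OF N qU \<nu>] sum[OF \<nu>] by simp
    have "X_iso A D S ?X"
      by (rule iso_exists[where k = c, OF qS quasi_bounded_subset[OF qU weights_dsum] gS gX])
    moreover have "N = (\<lambda>b. if b then N True else N False)" by (simp add: fun_eq_iff)
    ultimately have "X_iso A D S (X_dsum UNIV (\<lambda>b. if b then N True else N False))" by simp
    moreover have "X_object A \<phi> D (N b)" for b
    proof -
      have "maximal_object A \<phi> D (N b)" by (rule good_imp_maximal_object[OF qN]) (use N in blast)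
      then show ?thesis by (simp add: maximal_object_def)
    qed
    ultimately have "zero_object D (N True) \<or> zero_object D (N False)" using ind unfolding indecomposable_def by blast
    moreover have "\<kappa> \<in> weights D (N True)"
      by (rule good_pos_weight[OF N[OF \<kappa>] _ \<kappa>]) (simp add: J_def)
    moreover have "\<mu> \<in> weights D (N False)"
    proof (rule good_pos_weight[OF N[OF \<mu>] _ \<mu>])
      have "{k. (\<mu>, k) \<in> J False} = {..<c \<mu>}" using \<mu> ne by (auto simp: J_def)
      then show "card {k. (\<mu>, k) \<in> J False} > 0" using c\<mu> by simp
    qed
    ultimately show False by (auto simp: zero_object_def)
  qed
  then show ?thesis using gS[OF \<mu>] c\<kappa> by (cases "\<mu> = \<kappa>") simp_all
qed

lemma Smax_exists: "\<kappa> \<in> wl ==> \<exists>S :: ('v, 'a, (nat => 'a) set) xobj. Smax_property A \<phi> D \<kappa> S"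
proof -
  assume \<kappa>: "\<kappa> \<in> wl"
  obtain S :: "('v, 'a, (nat => 'a) set) xobj" where S: "\<forall>\<mu>\<in>wl. good_at S \<mu> (if \<mu> = \<kappa> then 1 else 0)"
     "quasi_bounded D (weights D S)" "\<forall>\<mu>\<in>weights D S. weight_le D \<mu> \<kappa>" using good_exists[OF \<kappa>] by blast
  have "Smax_property A \<phi> D \<kappa> S" by (rule good_Smax_property[OF _ S(2) _ \<kappa>]) (use S(1,3) in blast)+
  then show ?thesis by blast
qed

lemma S_max: "\<kappa> \<in> wl ==> Smax_property A \<phi> D \<kappa> (S_max A \<phi> D \<kappa>)"
  unfolding S_max_def by (rule someI_ex[OF Smax_exists])

lemma Smax_quasi_bounded: "Smax_property A \<phi> D \<kappa> S ==> quasi_bounded D (weights D S)"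
  by (simp add: Smax_property_def X_object_def axiom_X1_def)

lemma Smax_unique:
  fixes S :: "('v, 'a, 'm) xobj" and T :: "('v, 'a, 'n) xobj"
  assumes \<kappa>: "\<kappa> \<in> wl" and S: "Smax_property A \<phi> D \<kappa> S" and T: "Smax_property A \<phi> D \<kappa> T"
  shows "X_iso A D S T"
  by (rule iso_exists[where k = "\<lambda>\<mu>. if \<mu> = \<kappa> then 1 else 0", OF Smax_quasi_bounded[OF S] Smax_quasi_bounded[OF T]
      Smax_good[OF S \<kappa>] Smax_good[OF T \<kappa>]])

lemma maximal_decomposition:
  fixes S :: "('v, 'a, 'm) xobj"
  assumes S: "maximal_object A \<phi> D S"
  shows "\<exists>(J :: ('v \<times> nat) set) l. l ` J \<subseteq> wl \<and> X_iso A D S (X_dsum J (\<lambda>i. S_max A \<phi> D (l i)))"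
proof -
  have qS: "quasi_bounded D (weights D S)" using S by (simp add: maximal_object_def X_object_def axiom_X1_def)
  obtain c where c: "\<And>\<mu>. \<mu> \<in> wl ==> good_at S \<mu> (c \<mu>)"
    using maximal_object_imp_good[OF S] by metis
  have le: "weight_le D \<mu> \<kappa>" if "\<kappa> \<in> wl" "\<mu> \<in> weights D (S_max A \<phi> D \<kappa>)" for \<kappa> \<mu>
    using S_max[OF that(1)] that(2) by (simp add: Smax_property_def)
  have "X_iso A D S (X_dsum {(\<mu>, k). \<mu> \<in> wl \<and> k < c \<mu>} (\<lambda>i. S_max A \<phi> D (fst i)))"
    by (rule generator_decomposition[where G = "S_max A \<phi> D", OF c qS Smax_good[OF S_max] le])
  moreover have "fst ` {(\<mu>, k). \<mu> \<in> wl \<and> k < c \<mu>} \<subseteq> wl" by auto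
  ultimately show ?thesis by blast
qed

section \<open>Endomorphism rings\<close>

lemma X_hom_eqI:
  assumes f: "f \<in> X_hom A D M N" and g: "g \<in> X_hom A D M N"
    and eq: "\<And>\<mu> x. \<mu> \<in> wl ==> x \<in> carrier (wt M \<mu>) ==> f \<mu> x = g \<mu> x"
  shows "f = g"
proof (rule PiE_ext[where k = wl])
  show f': "f \<in> (\<Pi>\<^sub>E \<mu>\<in>wl. Hom (wt M \<mu>) (wt N \<mu>) \<inter> extensional (carrier (wt M \<mu>)))" using f by (simp add: X_hom_def)
  show g': "g \<in> (\<Pi>\<^sub>E \<mu>\<in>wl. Hom (wt M \<mu>) (wt N \<mu>) \<inter> extensional (carrier (wt M \<mu>)))" using g by (simp add: X_hom_def)
  fix \<mu> assume \<mu>: "\<mu> \<in> wl"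
  show "f \<mu> = g \<mu>"
    by (rule extensionalityI[where A = "carrier (wt M \<mu>)"]) (use PiE_mem[OF f' \<mu>] PiE_mem[OF g' \<mu>] eq[OF \<mu>] in auto)
qed

lemma End_ring_simps:
  "carrier (End_ring A D M) = X_hom A D M M"
  "\<mu> \<in> wl ==> x \<in> carrier (wt M \<mu>) ==> (f \<otimes>\<^bsub>End_ring A D M\<^esub> g) \<mu> x = f \<mu> (g \<mu> x)"
  "\<mu> \<in> wl ==> x \<in> carrier (wt M \<mu>) ==> (f \<oplus>\<^bsub>End_ring A D M\<^esub> g) \<mu> x = f \<mu> x \<oplus>\<^bsub>wt M \<mu>\<^esub> g \<mu> x"
  "\<mu> \<in> wl ==> x \<in> carrier (wt M \<mu>) ==> \<one>\<^bsub>End_ring A D M\<^esub> \<mu> x = x"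
  "\<mu> \<in> wl ==> x \<in> carrier (wt M \<mu>) ==> \<zero>\<^bsub>End_ring A D M\<^esub> \<mu> x = \<zero>\<^bsub>wt M \<mu>\<^esub>"
  by (simp_all add: End_ring_def X_comp_def X_id_def compose_def)

lemma ring_End_ring:
  fixes M :: "('v, 'a, 'm) xobj"
  assumes M: "\<And>\<mu>. \<mu> \<in> wl ==> ops_at M \<mu>"
  shows "ring (End_ring A D M)"
proof -
  let ?R = "End_ring A D M"
  note mods = ops_atD(1)[OF M]
  have E: "opE M \<mu> \<alpha> n \<in> Hom (wt M \<mu>) (wt M (shift \<mu> \<alpha> n))"
    and F: "opF M \<mu> \<alpha> n \<in> Hom (wt M (shift \<mu> \<alpha> n)) (wt M \<mu>)" if "\<mu> \<in> wl" "\<alpha> \<in> simple D" "n > 0" for \<mu> \<alpha> n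
    using M[OF that(1)] that(2,3) by (auto simp: ops_at_def)
  have cl: "f \<mu> x \<in> carrier (wt M \<mu>)" if "f \<in> X_hom A D M M" "\<mu> \<in> wl" "x \<in> carrier (wt M \<mu>)" for f \<mu> x
    by (rule hom_closed[OF X_homD(1)[OF that(1,2)] that(3)])
  have add_hom: "f \<mu> (x \<oplus>\<^bsub>wt M \<mu>\<^esub> y) = f \<mu> x \<oplus>\<^bsub>wt M \<mu>\<^esub> f \<mu> y"
    if "f \<in> X_hom A D M M" "\<mu> \<in> wl" "x \<in> carrier (wt M \<mu>)" "y \<in> carrier (wt M \<mu>)" for f \<mu> x y
    by (rule hom_add[OF X_homD(1)[OF that(1,2)] that(3,4)])
  have add: "f \<oplus>\<^bsub>?R\<^esub> g \<in> X_hom A D M M" if f: "f \<in> X_hom A D M M" and g: "g \<in> X_hom A D M M" for f g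
  proof -
    have "(\<lambda>\<mu>\<in>wl. \<lambda>x\<in>carrier (wt M \<mu>). f \<mu> x \<oplus>\<^bsub>wt M \<mu>\<^esub> g \<mu> x) \<in> X_hom A D M M"
    proof (rule X_homI[OF M])
      fix \<mu> assume \<mu>: "\<mu> \<in> wl"
      show "(\<lambda>x. f \<mu> x \<oplus>\<^bsub>wt M \<mu>\<^esub> g \<mu> x) \<in> Hom (wt M \<mu>) (wt M \<mu>)"
        by (rule hom_plus[OF X_homD(1)[OF f \<mu>] X_homD(1)[OF g \<mu>] mods[OF \<mu>] mods[OF \<mu>]])
      show "compat_at (\<lambda>\<mu> x. f \<mu> x \<oplus>\<^bsub>wt M \<mu>\<^esub> g \<mu> x) M M \<mu>"
        unfolding compat_at_def
      proof (intro ballI allI impI conjI)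
        fix \<alpha> and n :: nat assume a: "\<alpha> \<in> simple D" "0 < n"
        note s = wl_shift[OF \<mu> a(1), of n]
        show "f (shift \<mu> \<alpha> n) (opE M \<mu> \<alpha> n x) \<oplus>\<^bsub>wt M (shift \<mu> \<alpha> n)\<^esub> g (shift \<mu> \<alpha> n) (opE M \<mu> \<alpha> n x)
          = opE M \<mu> \<alpha> n (f \<mu> x \<oplus>\<^bsub>wt M \<mu>\<^esub> g \<mu> x)" if x: "x \<in> carrier (wt M \<mu>)" for x
          using X_homD(2)[OF f \<mu>] X_homD(2)[OF g \<mu>] a x hom_add[OF E[OF \<mu> a] cl[OF f \<mu> x] cl[OF g \<mu> x]] by (simp add: compat_at_def)
        show "f \<mu> (opF M \<mu> \<alpha> n x) \<oplus>\<^bsub>wt M \<mu>\<^esub> g \<mu> (opF M \<mu> \<alpha> n x)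
          = opF M \<mu> \<alpha> n (f (shift \<mu> \<alpha> n) x \<oplus>\<^bsub>wt M (shift \<mu> \<alpha> n)\<^esub> g (shift \<mu> \<alpha> n) x)" if x: "x \<in> carrier (wt M (shift \<mu> \<alpha> n))" for x
          using X_homD(2)[OF f \<mu>] X_homD(2)[OF g \<mu>] a x hom_add[OF F[OF \<mu> a] cl[OF f s x] cl[OF g s x]] by (simp add: compat_at_def)
      qed
    qed
    then show ?thesis by (simp add: End_ring_def)
  qed
  have comp: "f \<otimes>\<^bsub>?R\<^esub> g \<in> X_hom A D M M" if f: "f \<in> X_hom A D M M" and g: "g \<in> X_hom A D M M" for f g
  proof -
    have "(\<lambda>\<mu>\<in>wl. \<lambda>x\<in>carrier (wt M \<mu>). f \<mu> (g \<mu> x)) \<in> X_hom A D M M"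
      by (rule X_homI[where f = "\<lambda>\<mu> x. f \<mu> (g \<mu> x)", OF M hom_comp[OF X_homD(1)[OF g] X_homD(1)[OF f]]
          compat_comp[where f = g and g = f, OF X_homD(1)[OF g] X_homD(2)[OF g] X_homD(2)[OF f] M]])
    then show ?thesis by (simp add: End_ring_def X_comp_def compose_def)
  qed
  have one: "\<one>\<^bsub>?R\<^esub> \<in> X_hom A D M M"
  proof -
    have "(\<lambda>\<mu>\<in>wl. \<lambda>x\<in>carrier (wt M \<mu>). x) \<in> X_hom A D M M"
      by (rule X_homI[where f = "\<lambda>\<mu> x. x", OF M hom_id]) (simp_all add: compat_at_def)
    then show ?thesis by (simp add: End_ring_def X_id_def)
  qed
  have scale: "(\<lambda>\<mu>\<in>wl. \<lambda>x\<in>carrier (wt M \<mu>). a \<odot>\<^bsub>wt M \<mu>\<^esub> f \<mu> x) \<in> X_hom A D M M" if a: "a \<in> carrier A" and f: "f \<in> X_hom A D M M" for a f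
  proof (rule X_homI[OF M])
    fix \<mu> assume \<mu>: "\<mu> \<in> wl"
    show "(\<lambda>x. a \<odot>\<^bsub>wt M \<mu>\<^esub> f \<mu> x) \<in> Hom (wt M \<mu>) (wt M \<mu>)"
      by (rule hom_scale[OF a X_homD(1)[OF f \<mu>] mods[OF \<mu>] mods[OF \<mu>]])
    show "compat_at (\<lambda>\<mu> x. a \<odot>\<^bsub>wt M \<mu>\<^esub> f \<mu> x) M M \<mu>"
      unfolding compat_at_def
    proof (intro ballI allI impI conjI)
      fix \<alpha> and n :: nat assume an: "\<alpha> \<in> simple D" "0 < n"
      note s = wl_shift[OF \<mu> an(1), of n]
      show "a \<odot>\<^bsub>wt M (shift \<mu> \<alpha> n)\<^esub> f (shift \<mu> \<alpha> n) (opE M \<mu> \<alpha> n x) = opE M \<mu> \<alpha> n (a \<odot>\<^bsub>wt M \<mu>\<^esub> f \<mu> x)" if x: "x \<in> carrier (wt M \<mu>)" for x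
        using X_homD(2)[OF f \<mu>] an x hom_smult[OF E[OF \<mu> an] a cl[OF f \<mu> x]] by (simp add: compat_at_def)
      show "a \<odot>\<^bsub>wt M \<mu>\<^esub> f \<mu> (opF M \<mu> \<alpha> n x) = opF M \<mu> \<alpha> n (a \<odot>\<^bsub>wt M (shift \<mu> \<alpha> n)\<^esub> f (shift \<mu> \<alpha> n) x)" if x: "x \<in> carrier (wt M (shift \<mu> \<alpha> n))" for x
        using X_homD(2)[OF f \<mu>] an x hom_smult[OF F[OF \<mu> an] a cl[OF f s x]] by (simp add: compat_at_def)
    qed
  qed
  have zero: "\<zero>\<^bsub>?R\<^esub> \<in> X_hom A D M M"
  proof -
    have "(\<lambda>\<mu>\<in>wl. \<lambda>x\<in>carrier (wt M \<mu>). \<zero>\<^bsub>wt M \<mu>\<^esub>) = (\<lambda>\<mu>\<in>wl. \<lambda>x\<in>carrier (wt M \<mu>). \<zero> \<odot>\<^bsub>wt M \<mu>\<^esub> \<one>\<^bsub>?R\<^esub> \<mu> x)"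
      by (intro restrict_ext) (simp add: End_ring_simps mods)
    then show ?thesis using scale[OF zero_closed one] by (simp add: End_ring_def)
  qed
  have ab: "abelian_group ?R"
  proof (rule abelian_groupI, unfold End_ring_simps(1))
    show "f \<oplus>\<^bsub>?R\<^esub> g \<in> X_hom A D M M" if "f \<in> X_hom A D M M" "g \<in> X_hom A D M M" for f g by (rule add[OF that])
    show "\<zero>\<^bsub>?R\<^esub> \<in> X_hom A D M M" by (rule zero)
    fix f assume f: "f \<in> X_hom A D M M"
    show "\<zero>\<^bsub>?R\<^esub> \<oplus>\<^bsub>?R\<^esub> f = f"
      by (rule X_hom_eqI[OF add[OF zero f] f]) (simp add: End_ring_simps mods cl[OF f])
    let ?n = "\<lambda>\<mu>\<in>wl. \<lambda>x\<in>carrier (wt M \<mu>). (\<ominus> \<one>) \<odot>\<^bsub>wt M \<mu>\<^esub> f \<mu> x"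
    have n: "?n \<in> X_hom A D M M" by (rule scale[OF _ f]) simp
    have "?n \<oplus>\<^bsub>?R\<^esub> f = \<zero>\<^bsub>?R\<^esub>"
      by (rule X_hom_eqI[OF add[OF n f] zero]) (simp add: End_ring_simps mods cl[OF f] mod_neg_eq_smult[symmetric])
    then show "\<exists>g\<in>X_hom A D M M. g \<oplus>\<^bsub>?R\<^esub> f = \<zero>\<^bsub>?R\<^esub>" using n by blast
    fix g assume g: "g \<in> X_hom A D M M"
    show "f \<oplus>\<^bsub>?R\<^esub> g = g \<oplus>\<^bsub>?R\<^esub> f"
    proof (rule X_hom_eqI[OF add[OF f g] add[OF g f]])
      fix \<mu> x assume m: "\<mu> \<in> wl" "x \<in> carrier (wt M \<mu>)"
      show "(f \<oplus>\<^bsub>?R\<^esub> g) \<mu> x = (g \<oplus>\<^bsub>?R\<^esub> f) \<mu> x"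
        unfolding End_ring_simps(3)[OF m] by (rule mod_add_comm[OF mods[OF m(1)] cl[OF f m] cl[OF g m]])
    qed
    fix h assume h: "h \<in> X_hom A D M M"
    show "f \<oplus>\<^bsub>?R\<^esub> g \<oplus>\<^bsub>?R\<^esub> h = f \<oplus>\<^bsub>?R\<^esub> (g \<oplus>\<^bsub>?R\<^esub> h)"
    proof (rule X_hom_eqI[OF add[OF add[OF f g] h] add[OF f add[OF g h]]])
      fix \<mu> x assume m: "\<mu> \<in> wl" "x \<in> carrier (wt M \<mu>)"
      show "(f \<oplus>\<^bsub>?R\<^esub> g \<oplus>\<^bsub>?R\<^esub> h) \<mu> x = (f \<oplus>\<^bsub>?R\<^esub> (g \<oplus>\<^bsub>?R\<^esub> h)) \<mu> x"
        unfolding End_ring_simps(3)[OF m] by (rule mod_add_assoc[OF mods[OF m(1)] cl[OF f m] cl[OF g m] cl[OF h m]])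
    qed
  qed
  have mon: "monoid ?R"
  proof (rule monoidI, unfold End_ring_simps(1))
    show "f \<otimes>\<^bsub>?R\<^esub> g \<in> X_hom A D M M" if "f \<in> X_hom A D M M" "g \<in> X_hom A D M M" for f g by (rule comp[OF that])
    show "\<one>\<^bsub>?R\<^esub> \<in> X_hom A D M M" by (rule one)
    fix f assume f: "f \<in> X_hom A D M M"
    show "\<one>\<^bsub>?R\<^esub> \<otimes>\<^bsub>?R\<^esub> f = f" by (rule X_hom_eqI[OF comp[OF one f] f]) (simp add: End_ring_simps cl[OF f])
    show "f \<otimes>\<^bsub>?R\<^esub> \<one>\<^bsub>?R\<^esub> = f" by (rule X_hom_eqI[OF comp[OF f one] f]) (simp add: End_ring_simps)
    fix g h assume g: "g \<in> X_hom A D M M" and h: "h \<in> X_hom A D M M"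
    show "f \<otimes>\<^bsub>?R\<^esub> g \<otimes>\<^bsub>?R\<^esub> h = f \<otimes>\<^bsub>?R\<^esub> (g \<otimes>\<^bsub>?R\<^esub> h)"
      by (rule X_hom_eqI[OF comp[OF comp[OF f g] h] comp[OF f comp[OF g h]]]) (simp add: End_ring_simps cl[OF h])
  qed
  show ?thesis
  proof (rule ringI[OF ab mon], unfold End_ring_simps(1))
    fix f g h assume f: "f \<in> X_hom A D M M" and g: "g \<in> X_hom A D M M" and h: "h \<in> X_hom A D M M"
    show "(f \<oplus>\<^bsub>?R\<^esub> g) \<otimes>\<^bsub>?R\<^esub> h = f \<otimes>\<^bsub>?R\<^esub> h \<oplus>\<^bsub>?R\<^esub> g \<otimes>\<^bsub>?R\<^esub> h"
      by (rule X_hom_eqI[OF comp[OF add[OF f g] h] add[OF comp[OF f h] comp[OF g h]]]) (simp add: End_ring_simps cl[OF h])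
    show "h \<otimes>\<^bsub>?R\<^esub> (f \<oplus>\<^bsub>?R\<^esub> g) = h \<otimes>\<^bsub>?R\<^esub> f \<oplus>\<^bsub>?R\<^esub> h \<otimes>\<^bsub>?R\<^esub> g"
      by (rule X_hom_eqI[OF comp[OF h add[OF f g]] add[OF comp[OF h f] comp[OF h g]]])
        (simp add: End_ring_simps cl[OF f] cl[OF g] add_hom[OF h])
  qed
qed

text \<open>An endomorphism that is bijective at \<open>\<kappa>\<close> is invertible. Those that are not form a left ideal by the
  corresponding fact for scalars, and it contains every proper left ideal.\<close>

lemma local_ring_End:
  fixes S :: "('v, 'a, 'm) xobj"
  assumes gS: "\<And>\<mu>. \<mu> \<in> wl ==> good_at S \<mu> (if \<mu> = \<kappa> then 1 else 0)"
    and le: "\<And>\<mu>. \<mu> \<in> weights D S ==> weight_le D \<mu> \<kappa>" and \<kappa>: "\<kappa> \<in> wl" and rank: "free_of_rank A (wt S \<kappa>) 1"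
  shows "local_ring (End_ring A D S)"
proof -
  let ?R = "End_ring A D S" and ?N = "wt S \<kappa>"
  have ops: "ops_at S \<mu>" if "\<mu> \<in> wl" for \<mu> using good_atD(1)[OF gS[OF that]] .
  have N: "module A ?N" using ops[OF \<kappa>] by (simp add: ops_at_def)
  interpret R: ring ?R by (rule ring_End_ring[OF ops])
  note hom = X_homD(1)[OF _ \<kappa>]
  define I where "I = {f \<in> carrier ?R. \<not> bij_betw (f \<kappa>) (carrier ?N) (carrier ?N)}"
  have inv: "\<exists>g\<in>carrier ?R. g \<otimes>\<^bsub>?R\<^esub> f = \<one>\<^bsub>?R\<^esub>" if f: "f \<in> carrier ?R" "f \<notin> I" for f
  proof -
    have fX: "f \<in> X_hom A D S S" using f(1) by (simp add: End_ring_simps)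
    have "bij_betw (f \<kappa>) (carrier ?N) (carrier ?N)" using f by (simp add: I_def)
    from good_endo_bij[where f = f, OF gS le X_homD(1)[OF fX] X_homD(2)[OF fX] this]
    have "iso_at f S S \<mu>" if "\<mu> \<in> wl" for \<mu> using X_homD[OF fX that] that by (simp add: iso_at_def)
    from X_hom_inverse[OF ops ops this] obtain f' g where f': "f' \<in> X_hom A D S S" "\<forall>\<mu>\<in>wl. \<forall>x\<in>carrier (wt S \<mu>). f' \<mu> x = f \<mu> x"
      and g: "g \<in> X_hom A D S S" "X_comp D S g f' = X_id D S" by blast
    have "f' = f" by (rule X_hom_eqI[OF f'(1) fX]) (use f'(2) in blast)
    then show ?thesis using g by (intro bexI[of _ g]) (simp_all add: End_ring_def)
  qed
  have mult: "f \<otimes>\<^bsub>?R\<^esub> g \<in> I" if f: "f \<in> carrier ?R" and g: "g \<in> I" for f g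
  proof -
    have gc: "g \<in> carrier ?R" and gn: "\<not> bij_betw (g \<kappa>) (carrier ?N) (carrier ?N)" using g by (auto simp: I_def)
    have "\<not> bij_betw ((f \<otimes>\<^bsub>?R\<^esub> g) \<kappa>) (carrier ?N) (carrier ?N)"
    proof
      assume "bij_betw ((f \<otimes>\<^bsub>?R\<^esub> g) \<kappa>) (carrier ?N) (carrier ?N)"
      then have "bij_betw (\<lambda>x. f \<kappa> (g \<kappa> x)) (carrier ?N) (carrier ?N)"
        by (subst (asm) bij_betw_cong[where g = "\<lambda>x. f \<kappa> (g \<kappa> x)"]) (simp_all add: End_ring_simps(2)[OF \<kappa>])
      then show False using rank_one_nonbij_comp[OF N rank hom hom] f gc gn by (simp add: End_ring_simps(1))
    qed
    then show ?thesis using R.m_closed[OF f gc] by (simp add: I_def)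
  qed
  have add: "f \<oplus>\<^bsub>?R\<^esub> g \<in> I" if f: "f \<in> I" and g: "g \<in> I" for f g
  proof -
    have fc: "f \<in> carrier ?R" "\<not> bij_betw (f \<kappa>) (carrier ?N) (carrier ?N)"
      and gc: "g \<in> carrier ?R" "\<not> bij_betw (g \<kappa>) (carrier ?N) (carrier ?N)" using f g by (auto simp: I_def)
    have "\<not> bij_betw ((f \<oplus>\<^bsub>?R\<^esub> g) \<kappa>) (carrier ?N) (carrier ?N)"
    proof
      assume "bij_betw ((f \<oplus>\<^bsub>?R\<^esub> g) \<kappa>) (carrier ?N) (carrier ?N)"
      then have "bij_betw (\<lambda>x. f \<kappa> x \<oplus>\<^bsub>?N\<^esub> g \<kappa> x) (carrier ?N) (carrier ?N)"
        by (subst (asm) bij_betw_cong[where g = "\<lambda>x. f \<kappa> x \<oplus>\<^bsub>?N\<^esub> g \<kappa> x"]) (simp_all add: End_ring_simps(3)[OF \<kappa>])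
      moreover have "f \<in> X_hom A D S S" "g \<in> X_hom A D S S" using fc(1) gc(1) by (simp_all add: End_ring_simps(1))
      ultimately show False using rank_one_nonbij_add[OF N rank hom hom, of f g] fc(2) gc(2) by blast
    qed
    then show ?thesis using R.a_closed[OF fc(1) gc(1)] by (simp add: I_def)
  qed
  have zero: "\<zero>\<^bsub>?R\<^esub> \<in> I"
  proof -
    have "\<not> bij_betw (\<zero>\<^bsub>?R\<^esub> \<kappa>) (carrier ?N) (carrier ?N)"
      by (subst bij_betw_cong[where g = "\<lambda>x. \<zero>\<^bsub>?N\<^esub>"]) (simp_all add: End_ring_simps(5)[OF \<kappa>] rank_one_zero_nonbij[OF N rank])
    then show ?thesis by (simp add: I_def)
  qed
  have one: "\<one>\<^bsub>?R\<^esub> \<notin> I"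
  proof -
    have "bij_betw (\<one>\<^bsub>?R\<^esub> \<kappa>) (carrier ?N) (carrier ?N)"
      by (subst bij_betw_cong[where g = "\<lambda>x. x"]) (simp_all add: End_ring_simps(4)[OF \<kappa>] bij_betw_def)
    then show ?thesis by (simp add: I_def)
  qed
  have Ic: "I \<subseteq> carrier ?R" by (auto simp: I_def)
  have neg: "\<ominus>\<^bsub>?R\<^esub> f \<in> I" if f: "f \<in> I" for f
  proof -
    have "(\<ominus>\<^bsub>?R\<^esub> \<one>\<^bsub>?R\<^esub>) \<otimes>\<^bsub>?R\<^esub> f \<in> I" by (rule mult[OF _ f]) simp
    then show ?thesis using f Ic by (simp add: R.l_minus subset_iff)
  qed
  have "subgroup I (add_monoid ?R)"
    by (rule group.subgroupI[OF R.a_group]) (use Ic zero neg add in \<open>auto simp: a_inv_def\<close>)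
  then have lI: "left_ideal I ?R" using mult by (simp add: left_ideal_def additive_subgroup_def)
  have top: "J \<subseteq> I" if J: "left_ideal J ?R" "J \<noteq> carrier ?R" for J
  proof
    fix f assume f: "f \<in> J"
    have Jc: "J \<subseteq> carrier ?R" using J(1) by (simp add: left_ideal_def additive_subgroup.a_subset)
    have Jm: "g \<otimes>\<^bsub>?R\<^esub> h \<in> J" if "g \<in> carrier ?R" "h \<in> J" for g h using J(1) that by (simp add: left_ideal_def)
    show "f \<in> I"
    proof (rule ccontr)
      assume "f \<notin> I"
      then obtain g where "g \<in> carrier ?R" "g \<otimes>\<^bsub>?R\<^esub> f = \<one>\<^bsub>?R\<^esub>" using inv[of f] f Jc by blast
      then have 1: "\<one>\<^bsub>?R\<^esub> \<in> J" using Jm[OF _ f, of g] by simp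
      have "h \<in> J" if "h \<in> carrier ?R" for h using Jm[OF that 1] that by simp
      then show False using J(2) Jc by blast
    qed
  qed
  have IR: "I \<noteq> carrier ?R" using one by auto
  have "maximal_left_ideal I ?R" unfolding maximal_left_ideal_def using lI IR top by blast
  moreover have "J = I" if J: "maximal_left_ideal J ?R" for J
    using J top[of J] lI IR unfolding maximal_left_ideal_def by blast
  ultimately show ?thesis unfolding local_ring_def using R.ring_axioms by blast
qed

end

theorem proposition7p2:
  fixes A :: "'a ring" and \<phi> :: "laurent \<Rightarrow> 'a" and D :: "'v::real_vector root_data"
  assumes "ground_data D"
    and "noetherian_domain A"
    and "\<phi> \<in> ring_hom ring_of_type_algebra A"
    and "local_ring A"
  shows "(\<forall>\<nu>\<in>weight_lattice D.
            (\<exists>S :: ('v, 'a, (nat \<Rightarrow> 'a) set) xobj. Smax_property A \<phi> D \<nu> S) \<and>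
            (\<forall>(S :: ('v, 'a, 'm) xobj) (T :: ('v, 'a, 'n) xobj).
               Smax_property A \<phi> D \<nu> S \<longrightarrow> Smax_property A \<phi> D \<nu> T \<longrightarrow> X_iso A D S T)) \<and>
         (\<forall>\<nu>\<in>weight_lattice D. local_ring (End_ring A D (S_max A \<phi> D \<nu>))) \<and>
         (\<forall>S :: ('v, 'a, 'm) xobj. maximal_object A \<phi> D S \<longrightarrow>
            (\<exists>(J :: ('v \<times> nat) set) l. l ` J \<subseteq> weight_lattice D \<and>
               X_iso A D S (X_dsum J (\<lambda>i. S_max A \<phi> D (l i)))))"
proof -
  interpret noetherian_domain A by (rule assms(2))
  interpret graded_category A \<phi> D
    by unfold_locales (use assms in auto)
  have "local_ring (End_ring A D (S_max A \<phi> D \<nu>))" if \<nu>: "\<nu> \<in> weight_lattice D" for \<nu>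
  proof (rule local_ring_End[OF Smax_good[OF S_max[OF \<nu>] \<nu>] _ \<nu>])
    show "free_of_rank A (wt (S_max A \<phi> D \<nu>) \<nu>) 1"
      and "\<And>\<mu>. \<mu> \<in> weights D (S_max A \<phi> D \<nu>) \<Longrightarrow> weight_le D \<mu> \<nu>"
      using S_max[OF \<nu>] by (simp_all add: Smax_property_def)
  qed
  then show ?thesis using Smax_exists Smax_unique maximal_decomposition by blast
qed

end
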